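(* Let $T^m\cong\mathbb{R}^m/2\pi\mathbb{Z}^m$ act on the right by isometries on a closed, oriented Riemannian manifold $M$ of dimension $2n$, let $E=E^+\oplus E^-$ be a graded $T^m$-equivariant Hermitian vector bundle over $M$ of total rank $r$, let $D^+:\Gamma(M,E^+)\to\Gamma(M,E^-)$ be a first order, $T^m$-equivariant, transversally elliptic differential operator, and let $D=(D^+,(D^+)^* )$ on $\Gamma(M,E)$. Let $Z:E\to E$ be a bundle map such that: (1) $Z$ maps $E^{\pm}$ to $E^{\mp}$, is smooth, self-adjoint and $T^m$-equivariant, and is nonsingular away from a finite number of points of $M$; (2) for each irreducible representation $\sigma$ of $T^m$, the restriction of $DZ+ZD$ to $\Gamma(M,E)^{\sigma}$ is a bundle map; (3) in a small neighborhood $U_{\overline{x}}$ of each singular point $\overline{x}$ of $Z$, $E^{\pm}$ has the structure of a $T^m$-equivariant Clifford bundle with equivariant Clifford connection $\nabla$, and $D$ is an equivariant Dirac operator there; (4) on $U_{\overline{x}}$, $Z=c(iV)$, where $c$ is Clifford multiplication and $V$ is the vector field induced by some element $\mathbf{v}_{\overline{x}}$ of the Lie algebra of $T^m$ such that the closure of $\{\exp(t\mathbf{v}_{\overline{x}}):t\in\mathbb{R}\}$ is the entire torus $T^m$. Let $\rho$ be an irreducible unitary representation of $T^m$, let $\overline{x}$ be a singular point of $Z$, and let $K^\rho_{\overline{x}}$ be the model operator and $\mathbf{b},\mathbf{k}_l,\kappa_l,\mathbf{a}_j,\varepsilon_{jl}$ the local data at $\overline{x}$ defined in the context. Then the spectrum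 of $K^\rho_{\overline{x}}$ is the set of real numbers of the form $$\lambda=2\sum_{l=1}^n\kappa_l\left(|m_l|+m_l+2d_l+1+\varepsilon_{jl}\right),$$ where the multiplicity of the eigenvalue $\lambda$ is the number of pairs $(\mathbf{m},\mathbf{d})\in\mathbb{Z}^n\times(\mathbb{Z}_{\ge0})^n$ such that there exists $j\in\{1,\dots,r\}$ such that $$\sum_{h=1}^n m_h\mathbf{k}_h=\mathbf{a}_j+\mathbf{b}\quad\text{and}\quad 2\sum_{l=1}^n\kappa_l\left(|m_l|+m_l+2d_l+1+\varepsilon_{jl}\right)=\lambda.$$
   Context: Group actions. $T^m$ acts on $M$ on the right, and equivariance of $E$ gives lifted maps $F_g:E_x\to E_{xg}$. The induced action on sections is $(\psi_g u)(x)=F_{g^{-1}}(u(xg))$; $\Gamma(\cdot,\cdot)^\rho$ denotes sections of type $\rho$ (the sum of irreducible subspaces equivalent to $\rho$). A differential operator is transversally elliptic if its principal symbol is invertible on all nonzero covectors that annihilate the tangent spaces of the group orbits. The restriction of an operator $B$ to $\Gamma(M,E)^\rho$ "is a bundle map" if there is a smooth bundle endomorphism $B^\rho$ of $E$ with $Bu=B^\rho u$ for all $u\in\Gamma(M,E)^\rho$. Clifford convention: $c(v)^2=-|v|^2$, $c$ is extended complex linearly (so $c(iV)=i\,c(V)$), vectors and covectors are identified by the metric, and $c(\alpha\wedge\beta)=c(\alpha)c(\beta)$ for orthogonal covectors. Local data at a singular point $\overline{x}$ of $Z$ (such a point is fixed by $T^m$). Choose coordinates $\theta=(\theta_1,\dots,\theta_m)\in(\mathbb{R}/2\pi\mathbb{Z})^m$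 on $T^m$ (depending on $\overline{x}$) such that $\exp(t\mathbf{v}_{\overline{x}})=t\boldsymbol{\tau}=(t\tau_1,\dots,t\tau_m)$ with all $\tau_p>0$ (the $\tau_p$ are then linearly independent over $\mathbb{Q}$). - $\mathbf{b}\in\mathbb{Z}^m$ is defined by $\rho(\theta)=e^{i\mathbf{b}\cdot\theta}$ in these coordinates. - Choose orthonormal coordinates $(x_1,y_1,\dots,x_n,y_n)$ on $T_{\overline{x}}M$, $z_l=x_l+iy_l$, such that $\theta$ acts by $(z_1,\dots,z_n)\theta=(e^{i\mathbf{k}_1\cdot\theta}z_1,\dots,e^{i\mathbf{k}_n\cdot\theta}z_n)$ with $\mathbf{k}_l\in\mathbb{Z}^m$ and $\kappa_l:=\mathbf{k}_l\cdot\boldsymbol{\tau}>0$ for each $l$ (achieved by interchanging $x_l$ and $y_l$ if necessary). - Choose a unitary basis of $E_{\overline{x}}=E_{\overline{x}}^+\oplus E_{\overline{x}}^-$, with coordinates $(w_1,\dots,w_r)$, in which the action $F_\theta(w_1,\dots,w_r)=(e^{i\mathbf{a}_1\cdot\theta}w_1,\dots,e^{i\mathbf{a}_r\cdot\theta}w_r)$, $\mathbf{a}_j\in\mathbb{Z}^m$, the grading operator, and the mutually commuting involutions $i\,c(d\mathrm{vol}_l)$, $d\mathrm{vol}_l=dx_l\wedge dy_l$, are all diagonal. - $\varepsilon_{jl}\in\{-1,1\}$ is the eigenvalue of $i\,c(d\mathrm{vol}_l)$ on the $j$-th coordinate line of $E_{\overline{x}}$. Model operator. Let $A=D^2$, $B=DZ+ZD$,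 $C=Z^2$ (so $\frac1s(D+sZ)^2=\frac1sA+B+sC$; near $\overline{x}$, $C=|V|^2$). In geodesic normal coordinates centered at $\overline{x}$ (identifying $T_{\overline{x}}M=\mathbb{R}^{2n}$), the model operator $$K^\rho_{\overline{x}}=\widetilde A+\widetilde B^\rho+\widetilde C:\Gamma(\mathbb{R}^{2n},E_{\overline{x}})^\rho\to\Gamma(\mathbb{R}^{2n},E_{\overline{x}})^\rho$$ has $\widetilde A$ = principal part of $A$ at $\overline{x}$ (the constant-coefficient second order operator obtained by freezing the top-order coefficients at $\overline{x}$), $\widetilde B^\rho=B^\rho(\overline{x})$ where $B^\rho$ is the bundle map giving $B|_{\Gamma(M,E)^\rho}$, and $\widetilde C$ = quadratic part of $C$ at $\overline{x}$. Type $\rho$ is with respect to the linearized action on $\mathbb{R}^{2n}\times E_{\overline{x}}$ (the action on $T_{\overline x}M$ and $F_\theta$ on $E_{\overline{x}}$); the operator is considered as a self-adjoint operator in $L^2$.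
   Formalization: The multiplicity of λ is taken as the number of triples (m,d,j) satisfying both equations, not of pairs (m,d) for which some j exists; the pair count is false when several j realize the same pair, e.g. for a Dirac operator on the 2-sphere twisted by a trivial C^2. *)

theory Defs
  imports "HOL-Analysis.Analysis"
begin

section \<open>Smooth maps between open subsets of Euclidean spaces\<close>

text \<open>All these notions are applied to open sets only.\<close>

definition pd :: "('a::real_normed_vector \<Rightarrow> 'b::real_normed_vector) \<Rightarrow> 'a \<Rightarrow> 'a \<Rightarrow> 'b" where
  "pd f v = (\<lambda>x. frechet_derivative f (at x) v)"

fun C_on :: "nat \<Rightarrow> 'a::real_normed_vector set \<Rightarrow> ('a \<Rightarrow> 'b::real_normed_vector) \<Rightarrow> bool" where
  "C_on 0 S f = continuous_on S f"
| "C_on (Suc k) S f = (f differentiable_on S \<and> (\<forall>v. C_on k S (pd f v)))"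

definition smooth_on :: "'a::real_normed_vector set \<Rightarrow> ('a \<Rightarrow> 'b::real_normed_vector) \<Rightarrow> bool" where
  "smooth_on S f \<longleftrightarrow> (\<forall>k. C_on k S f)"


section \<open>Hermitian linear algebra\<close>

definition cinner :: "complex ^ 'r::finite \<Rightarrow> complex ^ 'r \<Rightarrow> complex" where
  "cinner a b = (\<Sum>j\<in>UNIV. a $ j * cnj (b $ j))"

definition cadj :: "complex ^ 'r::finite ^ 'r \<Rightarrow> complex ^ 'r ^ 'r" where
  "cadj A = (\<chi> i j. cnj (A $ j $ i))"

definition unitary :: "complex ^ 'r::finite ^ 'r \<Rightarrow> bool" where
  "unitary A \<longleftrightarrow> A ** cadj A = mat 1 \<and> cadj A ** A = mat 1"


section \<open>Closed oriented Riemannian manifolds\<close>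

text \<open>
  A manifold is the whole type \<open>'m\<close> together with an atlas of charts \<open>(U, \<phi>)\<close>, where \<open>\<phi>\<close> is
  relevant on \<open>U\<close> only.  The tangent space at \<open>x\<close> is \<open>real ^ 'd\<close>: a tangent vector is given by its
  components in the chosen chart \<open>chart_at M x\<close>.  A Riemannian metric is a bilinear form on each
  of these tangent spaces.
\<close>

type_synonym ('m, 'd) chart = "'m set \<times> ('m \<Rightarrow> real ^ 'd)"

record ('m, 'd) rmanifold =
  atlas :: "('m set \<times> ('m \<Rightarrow> real ^ ('d::finite))) set"
  metric :: "'m \<Rightarrow> real ^ ('d::finite) \<Rightarrow> real ^ ('d::finite) \<Rightarrow> real"

definition cinv :: "('m, 'd::finite) chart \<Rightarrow> real ^ 'd \<Rightarrow> 'm" where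
  "cinv c = inv_into (fst c) (snd c)"

definition chart_at :: "('m, 'd::finite, 'z) rmanifold_scheme \<Rightarrow> 'm \<Rightarrow> ('m, 'd) chart" where
  "chart_at M x = (SOME c. c \<in> atlas M \<and> x \<in> fst c)"

definition chart :: "('m::topological_space, 'd::finite) chart \<Rightarrow> bool" where
  "chart c \<longleftrightarrow> open (fst c) \<and> open (snd c ` fst c) \<and>
     homeomorphism (fst c) (snd c ` fst c) (snd c) (cinv c)"

definition smooth_transition :: "('m, 'd::finite) chart \<Rightarrow> ('m, 'd) chart \<Rightarrow> bool" where
  "smooth_transition c c' \<longleftrightarrow> smooth_on (snd c ` (fst c \<inter> fst c')) (snd c' \<circ> cinv c)"

definition oriented_transition :: "('m, 'd::finite) chart \<Rightarrow> ('m, 'd) chart \<Rightarrow> bool" where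
  "oriented_transition c c' \<longleftrightarrow> (\<forall>y \<in> snd c ` (fst c \<inter> fst c').
     det (matrix (frechet_derivative (snd c' \<circ> cinv c) (at y))) > 0)"

text \<open>A chart of the smooth structure; it may reverse the orientation.\<close>

definition smooth_chart :: "('m::topological_space, 'd::finite, 'z) rmanifold_scheme \<Rightarrow> ('m, 'd) chart \<Rightarrow> bool" where
  "smooth_chart M c \<longleftrightarrow> chart c \<and> (\<forall>c' \<in> atlas M. smooth_transition c c' \<and> smooth_transition c' c)"

text \<open>\<open>dvec M c x a\<close> is the tangent vector at \<open>x\<close> that has components \<open>a\<close> in the chart \<open>c\<close>, and
  \<open>mdiff M f x v\<close> is \<open>df\<^sub>x(v)\<close>.\<close>

definition dvec :: "('m, 'd::finite, 'z) rmanifold_scheme \<Rightarrow> ('m, 'd) chart \<Rightarrow> 'm \<Rightarrow> real ^ 'd \<Rightarrow> real ^ 'd" where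
  "dvec M c x a = frechet_derivative (snd (chart_at M x) \<circ> cinv c) (at (snd c x)) a"

definition mdiff :: "('m, 'd::finite, 'z) rmanifold_scheme \<Rightarrow> ('m \<Rightarrow> 'b::real_normed_vector) \<Rightarrow> 'm \<Rightarrow> real ^ 'd \<Rightarrow> 'b" where
  "mdiff M f x v = frechet_derivative (f \<circ> cinv (chart_at M x)) (at (snd (chart_at M x) x)) v"

definition tmap :: "('m, 'd::finite, 'z) rmanifold_scheme \<Rightarrow> ('m \<Rightarrow> 'm) \<Rightarrow> 'm \<Rightarrow> real ^ 'd \<Rightarrow> real ^ 'd" where
  "tmap M h x v = mdiff M (snd (chart_at M (h x)) \<circ> h) x v"

definition gmat :: "('m, 'd::finite, 'z) rmanifold_scheme \<Rightarrow> ('m, 'd) chart \<Rightarrow> real ^ 'd \<Rightarrow> real ^ 'd ^ 'd" where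
  "gmat M c y = (\<chi> i j. metric M (cinv c y)
     (dvec M c (cinv c y) (axis i 1)) (dvec M c (cinv c y) (axis j 1)))"

definition closed_oriented_riemannian :: "('m::t2_space, 'd::finite, 'z) rmanifold_scheme \<Rightarrow> bool" where
  "closed_oriented_riemannian M \<longleftrightarrow>
     compact (UNIV :: 'm set) \<and>
     (\<Union>c \<in> atlas M. fst c) = UNIV \<and>
     (\<forall>c \<in> atlas M. chart c) \<and>
     (\<forall>c \<in> atlas M. \<forall>c' \<in> atlas M. smooth_transition c c' \<and> oriented_transition c c') \<and>
     (\<forall>x. bilinear (metric M x) \<and> (\<forall>v w. metric M x v w = metric M x w v) \<and>
          (\<forall>v. v \<noteq> 0 \<longrightarrow> metric M x v v > 0)) \<and>
     (\<forall>c \<in> atlas M. smooth_on (snd c ` fst c) (gmat M c))"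

definition riemannian_volume :: "('m::topological_space, 'd::finite, 'z) rmanifold_scheme \<Rightarrow> 'm measure \<Rightarrow> bool" where
  "riemannian_volume M vol \<longleftrightarrow> sets vol = sets borel \<and>
     (\<forall>c \<in> atlas M. \<forall>S \<in> sets borel. S \<subseteq> fst c \<longrightarrow>
        emeasure vol S =
          (\<integral>\<^sup>+ y. ennreal (sqrt (det (gmat M c y))) * indicator (snd c ` S) y \<partial>lborel))"

definition smooth_fun_on :: "('m, 'd::finite, 'z) rmanifold_scheme \<Rightarrow> 'm set \<Rightarrow> ('m \<Rightarrow> 'b::real_normed_vector) \<Rightarrow> bool" where
  "smooth_fun_on M S f \<longleftrightarrow> (\<forall>c \<in> atlas M. smooth_on (snd c ` (fst c \<inter> S)) (f \<circ> cinv c))"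

definition smooth_vfield_on :: "('m, 'd::finite, 'z) rmanifold_scheme \<Rightarrow> 'm set \<Rightarrow> ('m \<Rightarrow> real ^ 'd) \<Rightarrow> bool" where
  "smooth_vfield_on M S X \<longleftrightarrow> (\<forall>c \<in> atlas M.
     smooth_on (snd c ` (fst c \<inter> S)) (\<lambda>y. mdiff M (snd c) (cinv c y) (X (cinv c y))))"

definition levi_civita_on :: "('m, 'd::finite, 'z) rmanifold_scheme \<Rightarrow> 'm set \<Rightarrow>
    ('m \<Rightarrow> real ^ 'd \<Rightarrow> ('m \<Rightarrow> real ^ 'd) \<Rightarrow> real ^ 'd) \<Rightarrow> bool" where
  "levi_civita_on M S lc \<longleftrightarrow>
     (\<forall>x \<in> S. \<forall>Y. smooth_vfield_on M S Y \<longrightarrow> linear (\<lambda>v. lc x v Y)) \<and>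
     (\<forall>x \<in> S. \<forall>v Y Y'. smooth_vfield_on M S Y \<and> smooth_vfield_on M S Y' \<longrightarrow>
        lc x v (\<lambda>y. Y y + Y' y) = lc x v Y + lc x v Y') \<and>
     (\<forall>x \<in> S. \<forall>v f Y. smooth_fun_on M S f \<and> smooth_vfield_on M S Y \<longrightarrow>
        lc x v (\<lambda>y. f y *\<^sub>R Y y) = mdiff M f x v *\<^sub>R Y x + f x *\<^sub>R lc x v Y) \<and>
     (\<forall>X Y. smooth_vfield_on M S X \<and> smooth_vfield_on M S Y \<longrightarrow>
        smooth_vfield_on M S (\<lambda>x. lc x (X x) Y)) \<and>
     (\<forall>x \<in> S. \<forall>v Y Y'. smooth_vfield_on M S Y \<and> smooth_vfield_on M S Y' \<longrightarrow>
        mdiff M (\<lambda>y. metric M y (Y y) (Y' y)) x v =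
          metric M x (lc x v Y) (Y' x) + metric M x (Y x) (lc x v Y')) \<and>
     \<comment> \<open>torsion-free; the bracket is expressed through its action on functions\<close>
     (\<forall>x \<in> S. \<forall>X Y. \<forall>f :: 'm \<Rightarrow> real.
        smooth_vfield_on M S X \<and> smooth_vfield_on M S Y \<and> smooth_fun_on M S f \<longrightarrow>
        mdiff M f x (lc x (X x) Y - lc x (Y x) X) =
          mdiff M (\<lambda>y. mdiff M f y (Y y)) x (X x) - mdiff M (\<lambda>y. mdiff M f y (X y)) x (Y x))"

text \<open>Geodesic normal coordinates centred at \<open>x\<close>: orthonormal at \<open>x\<close>, star-shaped, and the rays
  \<open>t \<mapsto> t y\<close> satisfy the geodesic equation.  \<open>christoffel M c y l i j\<close> is
  \<open>\<Gamma>\<^sub>l\<^sub>i\<^sub>j\<close> with all indices lowered.\<close>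

definition christoffel :: "('m, 'd::finite, 'z) rmanifold_scheme \<Rightarrow> ('m, 'd) chart \<Rightarrow> real ^ 'd \<Rightarrow> 'd \<Rightarrow> 'd \<Rightarrow> 'd \<Rightarrow> real" where
  "christoffel M c y l i j =
     (pd (\<lambda>y. gmat M c y $ j $ l) (axis i 1) y + pd (\<lambda>y. gmat M c y $ i $ l) (axis j 1) y
      - pd (\<lambda>y. gmat M c y $ i $ j) (axis l 1) y) / 2"

definition normal_chart :: "('m::topological_space, 'd::finite, 'z) rmanifold_scheme \<Rightarrow> 'm \<Rightarrow> ('m, 'd) chart \<Rightarrow> bool" where
  "normal_chart M x c \<longleftrightarrow>
     smooth_chart M c \<and> x \<in> fst c \<and> snd c x = 0 \<and> gmat M c 0 = mat 1 \<and>
     (\<forall>y \<in> snd c ` fst c. \<forall>t \<in> {0..1}. t *\<^sub>R y \<in> snd c ` fst c \<and>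
        (\<forall>l. (\<Sum>i\<in>UNIV. \<Sum>j\<in>UNIV. christoffel M c (t *\<^sub>R y) l i j * y $ i * y $ j) = 0))"


section \<open>The torus\<close>

text \<open>The torus is \<open>real ^ 'p\<close> modulo \<open>lattice\<close>; its Lie algebra is \<open>real ^ 'p\<close> and \<open>exp\<close> is the
  quotient map.  Other coordinates \<open>\<theta>\<close> on the torus are given by a linear automorphism that
  preserves the lattice.\<close>

definition lattice :: "(real ^ 'p::finite) set" where
  "lattice = {\<theta>. \<forall>p. \<exists>z::int. \<theta> $ p = 2 * pi * of_int z}"

definition torus_coords :: "(real ^ 'p::finite \<Rightarrow> real ^ 'p) \<Rightarrow> bool" where
  "torus_coords L \<longleftrightarrow> linear L \<and> L ` lattice = lattice"

definition dense_one_parameter :: "real ^ 'p::finite \<Rightarrow> bool" where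
  "dense_one_parameter v \<longleftrightarrow> closure {t *\<^sub>R v + h | t h. h \<in> lattice} = UNIV"

text \<open>The torus is abelian, so its irreducible unitary representations are one-dimensional and are
  identified with their characters.\<close>

definition torus_irrep :: "(real ^ 'p::finite \<Rightarrow> complex) \<Rightarrow> bool" where
  "torus_irrep \<rho> \<longleftrightarrow> continuous_on UNIV \<rho> \<and> (\<forall>\<theta>. cmod (\<rho> \<theta>) = 1) \<and>
     (\<forall>\<theta> \<eta>. \<rho> (\<theta> + \<eta>) = \<rho> \<theta> * \<rho> \<eta>) \<and> (\<forall>\<theta> \<in> lattice. \<rho> \<theta> = 1)"

definition idot :: "int ^ 'p::finite \<Rightarrow> real ^ 'p \<Rightarrow> real" where
  "idot k \<theta> = (\<Sum>p\<in>UNIV. of_int (k $ p) * \<theta> $ p)"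


section \<open>Graded equivariant Hermitian bundles\<close>

text \<open>
  Each fibre \<open>E\<^sub>x\<close> is the Hermitian space \<open>complex ^ 'r\<close>.  These identifications of the
  fibres with \<open>complex ^ 'r\<close> are pointwise choices without any continuity in \<open>x\<close>, so no triviality
  of the bundle is implied: the smooth structure is given by the local unitary trivializations
  \<open>(W, \<Phi>)\<close>, \<open>\<Phi> x : E\<^sub>x \<rightarrow> complex ^ 'r\<close> for \<open>x \<in> W\<close>.
  \<open>ract M x \<theta>\<close> is \<open>x\<theta>\<close> and \<open>lift M \<theta> x\<close> is \<open>F\<^sub>\<theta> : E\<^sub>x \<rightarrow> E\<^sub>x\<^sub>\<theta>\<close>.
\<close>

type_synonym ('m, 'r) triv = "'m set \<times> ('m \<Rightarrow> complex ^ 'r ^ 'r)"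
type_synonym ('m, 'r) endo = "'m \<Rightarrow> complex ^ 'r ^ 'r"
type_synonym ('m, 'r) sec = "'m \<Rightarrow> complex ^ 'r"

record ('m, 'd, 'p, 'r) tbundle = "('m, 'd::finite) rmanifold" +
  ract :: "'m \<Rightarrow> real ^ ('p::finite) \<Rightarrow> 'm"
  trivs :: "('m set \<times> ('m \<Rightarrow> complex ^ ('r::finite) ^ ('r::finite))) set"
  grading :: "'m \<Rightarrow> complex ^ ('r::finite) ^ ('r::finite)"
  lift :: "real ^ ('p::finite) \<Rightarrow> 'm \<Rightarrow> complex ^ ('r::finite) ^ ('r::finite)"

definition smooth_section_on :: "('m, 'd::finite, 'p::finite, 'r::finite, 'z) tbundle_scheme \<Rightarrow> 'm set \<Rightarrow> ('m, 'r) sec \<Rightarrow> bool" where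
  "smooth_section_on M S u \<longleftrightarrow> (\<forall>c \<in> atlas M. \<forall>t \<in> trivs M.
     smooth_on (snd c ` (fst c \<inter> fst t \<inter> S)) (\<lambda>y. snd t (cinv c y) *v u (cinv c y)))"

definition smooth_endo_on :: "('m, 'd::finite, 'p::finite, 'r::finite, 'z) tbundle_scheme \<Rightarrow> 'm set \<Rightarrow> ('m, 'r) endo \<Rightarrow> bool" where
  "smooth_endo_on M S A \<longleftrightarrow> (\<forall>c \<in> atlas M. \<forall>t \<in> trivs M.
     smooth_on (snd c ` (fst c \<inter> fst t \<inter> S))
       (\<lambda>y. snd t (cinv c y) ** A (cinv c y) ** cadj (snd t (cinv c y))))"

definition hermitian_bundle :: "('m::topological_space, 'd::finite, 'p::finite, 'r::finite, 'z) tbundle_scheme \<Rightarrow> bool" where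
  "hermitian_bundle M \<longleftrightarrow>
     (\<Union>t \<in> trivs M. fst t) = UNIV \<and>
     (\<forall>t \<in> trivs M. open (fst t) \<and> (\<forall>x \<in> fst t. unitary (snd t x))) \<and>
     (\<forall>t \<in> trivs M. \<forall>t' \<in> trivs M.
        smooth_fun_on M (fst t \<inter> fst t') (\<lambda>x. snd t' x ** cadj (snd t x)))"

definition equivariant_endo :: "('m, 'd::finite, 'p::finite, 'r::finite, 'z) tbundle_scheme \<Rightarrow> ('m, 'r) endo \<Rightarrow> bool" where
  "equivariant_endo M A \<longleftrightarrow> (\<forall>\<theta> x. A (ract M x \<theta>) ** lift M \<theta> x = lift M \<theta> x ** A x)"

text \<open>\<open>E\<^sup>\<plusminus>\<close> are the \<open>\<plusminus>1\<close>-eigenbundles of the grading.\<close>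

definition graded :: "('m, 'd::finite, 'p::finite, 'r::finite, 'z) tbundle_scheme \<Rightarrow> bool" where
  "graded M \<longleftrightarrow> smooth_endo_on M UNIV (grading M) \<and>
     (\<forall>x. cadj (grading M x) = grading M x \<and> grading M x ** grading M x = mat 1)"

definition fibre :: "('m, 'd::finite, 'p::finite, 'r::finite, 'z) tbundle_scheme \<Rightarrow> complex \<Rightarrow> 'm \<Rightarrow> (complex ^ 'r) set" where
  "fibre M s x = {w. grading M x *v w = s *s w}"

definition odd_at :: "('m, 'd::finite, 'p::finite, 'r::finite, 'z) tbundle_scheme \<Rightarrow> 'm \<Rightarrow> complex ^ 'r ^ 'r \<Rightarrow> bool" where
  "odd_at M x A \<longleftrightarrow> (\<forall>w \<in> fibre M 1 x. A *v w \<in> fibre M (-1) x) \<and>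
                     (\<forall>w \<in> fibre M (-1) x. A *v w \<in> fibre M 1 x)"

definition isometric_action :: "('m::topological_space, 'd::finite, 'p::finite, 'r::finite, 'z) tbundle_scheme \<Rightarrow> bool" where
  "isometric_action M \<longleftrightarrow>
     (\<forall>x \<theta> \<eta>. ract M x (\<theta> + \<eta>) = ract M (ract M x \<theta>) \<eta>) \<and>
     (\<forall>x. \<forall>\<theta> \<in> lattice. ract M x \<theta> = x) \<and>
     continuous_on UNIV (\<lambda>(x, \<theta>). ract M x \<theta>) \<and>
     (\<forall>c \<in> atlas M. \<forall>c' \<in> atlas M.
        smooth_on {(y, \<theta>). y \<in> snd c ` fst c \<and> ract M (cinv c y) \<theta> \<in> fst c'}
          (\<lambda>(y, \<theta>). snd c' (ract M (cinv c y) \<theta>))) \<and>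
     (\<forall>\<theta> x v w. metric M (ract M x \<theta>) (tmap M (\<lambda>x. ract M x \<theta>) x v) (tmap M (\<lambda>x. ract M x \<theta>) x w)
                 = metric M x v w)"

definition equivariant_bundle :: "('m, 'd::finite, 'p::finite, 'r::finite, 'z) tbundle_scheme \<Rightarrow> bool" where
  "equivariant_bundle M \<longleftrightarrow>
     (\<forall>\<theta> x. unitary (lift M \<theta> x)) \<and>
     (\<forall>\<theta> \<eta> x. lift M (\<theta> + \<eta>) x = lift M \<eta> (ract M x \<theta>) ** lift M \<theta> x) \<and>
     (\<forall>\<theta> \<in> lattice. \<forall>x. lift M \<theta> x = mat 1) \<and>
     (\<forall>c \<in> atlas M. \<forall>t \<in> trivs M. \<forall>t' \<in> trivs M.
        smooth_on {(y, \<theta>). y \<in> snd c ` (fst c \<inter> fst t) \<and> ract M (cinv c y) \<theta> \<in> fst t'}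
          (\<lambda>(y, \<theta>). snd t' (ract M (cinv c y) \<theta>) ** lift M \<theta> (cinv c y) ** cadj (snd t (cinv c y)))) \<and>
     equivariant_endo M (grading M)"

definition sections :: "('m, 'd::finite, 'p::finite, 'r::finite, 'z) tbundle_scheme \<Rightarrow> ('m, 'r) sec set" where
  "sections M = {u. smooth_section_on M UNIV u}"

definition graded_sections :: "('m, 'd::finite, 'p::finite, 'r::finite, 'z) tbundle_scheme \<Rightarrow> complex \<Rightarrow> ('m, 'r) sec set" where
  "graded_sections M s = {u \<in> sections M. \<forall>x. u x \<in> fibre M s x}"

text \<open>The induced action \<open>\<psi>\<^sub>\<theta>\<close> on sections, and the sections of type \<open>\<sigma>\<close>: since \<open>\<sigma>\<close> is
  one-dimensional, the irreducible subspaces equivalent to \<open>\<sigma>\<close> are the lines on which \<open>\<psi>\<^sub>\<theta>\<close> acts by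
  \<open>\<sigma>(\<theta>)\<close>, and the sum of these lines is the following set.\<close>

definition sec_act :: "('m, 'd::finite, 'p::finite, 'r::finite, 'z) tbundle_scheme \<Rightarrow> real ^ 'p \<Rightarrow> ('m, 'r) sec \<Rightarrow> ('m, 'r) sec" where
  "sec_act M \<theta> u = (\<lambda>x. lift M (- \<theta>) (ract M x \<theta>) *v u (ract M x \<theta>))"

definition type_sections :: "('m, 'd::finite, 'p::finite, 'r::finite, 'z) tbundle_scheme \<Rightarrow> (real ^ 'p \<Rightarrow> complex) \<Rightarrow> ('m, 'r) sec set" where
  "type_sections M \<sigma> = {u \<in> sections M. \<forall>\<theta>. sec_act M \<theta> u = (\<lambda>x. \<sigma> \<theta> *s u x)}"

definition restricts_to_bundle_map :: "('m, 'd::finite, 'p::finite, 'r::finite, 'z) tbundle_scheme \<Rightarrow>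
    (('m, 'r) sec \<Rightarrow> ('m, 'r) sec) \<Rightarrow> (real ^ 'p \<Rightarrow> complex) \<Rightarrow> ('m, 'r) endo \<Rightarrow> bool" where
  "restricts_to_bundle_map M T \<sigma> A \<longleftrightarrow> smooth_endo_on M UNIV A \<and>
     (\<forall>u \<in> type_sections M \<sigma>. T u = (\<lambda>x. A x *v u x))"

definition orbit_field :: "('m, 'd::finite, 'p::finite, 'r::finite, 'z) tbundle_scheme \<Rightarrow> real ^ 'p \<Rightarrow> 'm \<Rightarrow> real ^ 'd" where
  "orbit_field M v x = vector_derivative (\<lambda>t. snd (chart_at M x) (ract M x (t *\<^sub>R v))) (at 0)"


section \<open>Differential operators\<close>

definition local_rep :: "('m, 'd::finite) chart \<Rightarrow> ('m, 'r::finite) triv \<Rightarrow> ('m, 'r) sec \<Rightarrow> real ^ 'd \<Rightarrow> complex ^ 'r" where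
  "local_rep c t u = (\<lambda>y. snd t (cinv c y) *v u (cinv c y))"

definition local_coeffs1 :: "('m, 'd::finite) chart \<Rightarrow> ('m, 'r::finite) triv \<Rightarrow> ('m, 'r) sec set \<Rightarrow>
    (('m, 'r) sec \<Rightarrow> ('m, 'r) sec) \<Rightarrow> ('d \<Rightarrow> real ^ 'd \<Rightarrow> complex ^ 'r ^ 'r) \<Rightarrow>
    (real ^ 'd \<Rightarrow> complex ^ 'r ^ 'r) \<Rightarrow> bool" where
  "local_coeffs1 c t \<D> T a1 a0 \<longleftrightarrow>
     (\<forall>i. smooth_on (snd c ` (fst c \<inter> fst t)) (a1 i)) \<and>
     smooth_on (snd c ` (fst c \<inter> fst t)) a0 \<and>
     (\<forall>u \<in> \<D>. \<forall>y \<in> snd c ` (fst c \<inter> fst t).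
        local_rep c t (T u) y =
          (\<Sum>i\<in>UNIV. a1 i y *v pd (local_rep c t u) (axis i 1) y) + a0 y *v local_rep c t u y)"

definition local_coeffs2 :: "('m, 'd::finite) chart \<Rightarrow> ('m, 'r::finite) triv \<Rightarrow> ('m, 'r) sec set \<Rightarrow>
    (('m, 'r) sec \<Rightarrow> ('m, 'r) sec) \<Rightarrow> ('d \<Rightarrow> 'd \<Rightarrow> real ^ 'd \<Rightarrow> complex ^ 'r ^ 'r) \<Rightarrow>
    ('d \<Rightarrow> real ^ 'd \<Rightarrow> complex ^ 'r ^ 'r) \<Rightarrow> (real ^ 'd \<Rightarrow> complex ^ 'r ^ 'r) \<Rightarrow> bool" where
  "local_coeffs2 c t \<D> T a2 a1 a0 \<longleftrightarrow>
     (\<forall>i j. smooth_on (snd c ` (fst c \<inter> fst t)) (a2 i j)) \<and>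
     (\<forall>i. smooth_on (snd c ` (fst c \<inter> fst t)) (a1 i)) \<and>
     smooth_on (snd c ` (fst c \<inter> fst t)) a0 \<and>
     (\<forall>u \<in> \<D>. \<forall>y \<in> snd c ` (fst c \<inter> fst t).
        local_rep c t (T u) y =
          (\<Sum>i\<in>UNIV. \<Sum>j\<in>UNIV. a2 i j y *v pd (pd (local_rep c t u) (axis j 1)) (axis i 1) y)
          + (\<Sum>i\<in>UNIV. a1 i y *v pd (local_rep c t u) (axis i 1) y) + a0 y *v local_rep c t u y)"

definition first_order_op :: "('m, 'd::finite, 'p::finite, 'r::finite, 'z) tbundle_scheme \<Rightarrow>
    (('m, 'r) sec \<Rightarrow> ('m, 'r) sec) \<Rightarrow> bool" where
  "first_order_op M Dp \<longleftrightarrow>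
     (\<forall>u \<in> graded_sections M 1. Dp u \<in> graded_sections M (-1)) \<and>
     (\<forall>c \<in> atlas M. \<forall>t \<in> trivs M. \<exists>a1 a0. local_coeffs1 c t (graded_sections M 1) Dp a1 a0)"

definition equivariant_op :: "('m, 'd::finite, 'p::finite, 'r::finite, 'z) tbundle_scheme \<Rightarrow>
    (('m, 'r) sec \<Rightarrow> ('m, 'r) sec) \<Rightarrow> bool" where
  "equivariant_op M Dp \<longleftrightarrow> (\<forall>\<theta>. \<forall>u \<in> graded_sections M 1. Dp (sec_act M \<theta> u) = sec_act M \<theta> (Dp u))"

text \<open>In a chart, \<open>\<xi>\<close> is the covector \<open>\<Sum>\<^sub>i \<xi>\<^sub>i dx\<^sub>i\<close>; the principal symbol
  \<open>\<Sum>\<^sub>i \<xi>\<^sub>i a\<^sub>i : E\<^sup>+ \<rightarrow> E\<^sup>-\<close> is taken without a factor \<open>i\<close>, which does not affect invertibility.\<close>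

definition transversally_elliptic :: "('m, 'd::finite, 'p::finite, 'r::finite, 'z) tbundle_scheme \<Rightarrow>
    (('m, 'r) sec \<Rightarrow> ('m, 'r) sec) \<Rightarrow> bool" where
  "transversally_elliptic M Dp \<longleftrightarrow>
     (\<forall>c \<in> atlas M. \<forall>t \<in> trivs M. \<forall>a1 a0. local_coeffs1 c t (graded_sections M 1) Dp a1 a0 \<longrightarrow>
        (\<forall>x \<in> fst c \<inter> fst t. \<forall>\<xi>. \<xi> \<noteq> 0 \<and>
           (\<forall>v. \<xi> \<bullet> vector_derivative (\<lambda>s. snd c (ract M x (s *\<^sub>R v))) (at 0) = 0) \<longrightarrow>
           bij_betw (\<lambda>w. (\<Sum>i\<in>UNIV. \<xi> $ i *\<^sub>R a1 i (snd c x)) *v w)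
             ((*v) (snd t x) ` fibre M 1 x) ((*v) (snd t x) ` fibre M (-1) x)))"

definition formal_adjoint :: "('m, 'd::finite, 'p::finite, 'r::finite, 'z) tbundle_scheme \<Rightarrow> 'm measure \<Rightarrow>
    (('m, 'r) sec \<Rightarrow> ('m, 'r) sec) \<Rightarrow> (('m, 'r) sec \<Rightarrow> ('m, 'r) sec) \<Rightarrow> bool" where
  "formal_adjoint M vol Dp Dm \<longleftrightarrow>
     (\<forall>w \<in> graded_sections M (-1). Dm w \<in> graded_sections M 1) \<and>
     (\<forall>u \<in> graded_sections M 1. \<forall>w \<in> graded_sections M (-1).
        (LINT x|vol. cinner (Dp u x) (w x)) = (LINT x|vol. cinner (u x) (Dm w x)))"

text \<open>\<open>D = (D\<^sup>+, (D\<^sup>+)\<^sup>*)\<close>, applied to the components \<open>(u \<plusminus> \<gamma>u)/2\<close> of \<open>u\<close>.\<close>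

definition full_op :: "('m, 'd::finite, 'p::finite, 'r::finite, 'z) tbundle_scheme \<Rightarrow>
    (('m, 'r) sec \<Rightarrow> ('m, 'r) sec) \<Rightarrow> (('m, 'r) sec \<Rightarrow> ('m, 'r) sec) \<Rightarrow>
    ('m, 'r) sec \<Rightarrow> ('m, 'r) sec" where
  "full_op M Dp Dm u = (\<lambda>x.
     Dp (\<lambda>y. (1/2) *\<^sub>R (u y + grading M y *v u y)) x + Dm (\<lambda>y. (1/2) *\<^sub>R (u y - grading M y *v u y)) x)"

definition anticomm :: "(('m, 'r::finite) sec \<Rightarrow> ('m, 'r) sec) \<Rightarrow> ('m, 'r) endo \<Rightarrow>
    ('m, 'r) sec \<Rightarrow> ('m, 'r) sec" where
  "anticomm D Z u = (\<lambda>x. D (\<lambda>y. Z y *v u y) x + Z x *v D u x)"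


section \<open>Clifford bundles and Dirac operators near a point\<close>

text \<open>Everything lives on an invariant open set \<open>S\<close>; \<open>c x v\<close> is Clifford multiplication by the
  tangent vector \<open>v\<close> at \<open>x\<close>, \<open>nab x v u\<close> is \<open>(\<nabla>\<^sub>v u)(x)\<close> for a smooth section \<open>u\<close> over \<open>S\<close>.\<close>

definition clifford_structure_on :: "('m::topological_space, 'd::finite, 'p::finite, 'r::finite, 'z) tbundle_scheme \<Rightarrow> 'm set \<Rightarrow>
    ('m \<Rightarrow> real ^ 'd \<Rightarrow> complex ^ 'r ^ 'r) \<Rightarrow> bool" where
  "clifford_structure_on M S c \<longleftrightarrow>
     (\<forall>x \<in> S. linear (c x) \<and>
        (\<forall>v. c x v ** c x v = - mat (of_real (metric M x v v)) \<and>
             cadj (c x v) = - c x v \<and> odd_at M x (c x v))) \<and>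
     (\<forall>X. smooth_vfield_on M S X \<longrightarrow> smooth_endo_on M S (\<lambda>x. c x (X x))) \<and>
     (\<forall>x \<in> S. \<forall>\<theta> v. c (ract M x \<theta>) (tmap M (\<lambda>x. ract M x \<theta>) x v) ** lift M \<theta> x = lift M \<theta> x ** c x v)"

definition clifford_connection_on :: "('m::topological_space, 'd::finite, 'p::finite, 'r::finite, 'z) tbundle_scheme \<Rightarrow> 'm set \<Rightarrow>
    ('m \<Rightarrow> real ^ 'd \<Rightarrow> complex ^ 'r ^ 'r) \<Rightarrow>
    ('m \<Rightarrow> real ^ 'd \<Rightarrow> ('m, 'r) sec \<Rightarrow> complex ^ 'r) \<Rightarrow> bool" where
  "clifford_connection_on M S c nab \<longleftrightarrow>
     \<comment> \<open>a connection\<close>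
     (\<forall>x \<in> S. \<forall>u. smooth_section_on M S u \<longrightarrow> linear (\<lambda>v. nab x v u)) \<and>
     (\<forall>x \<in> S. \<forall>v u u'. smooth_section_on M S u \<and> smooth_section_on M S u' \<longrightarrow>
        nab x v (\<lambda>y. u y + u' y) = nab x v u + nab x v u') \<and>
     (\<forall>x \<in> S. \<forall>v f u. smooth_fun_on M S f \<and> smooth_section_on M S u \<longrightarrow>
        nab x v (\<lambda>y. f y *s u y) = mdiff M f x v *s u x + f x *s nab x v u) \<and>
     (\<forall>X u. smooth_vfield_on M S X \<and> smooth_section_on M S u \<longrightarrow>
        smooth_section_on M S (\<lambda>x. nab x (X x) u)) \<and>
     \<comment> \<open>Hermitian, compatible with the grading, equivariant\<close>
     (\<forall>x \<in> S. \<forall>v u u'. smooth_section_on M S u \<and> smooth_section_on M S u' \<longrightarrow>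
        mdiff M (\<lambda>y. cinner (u y) (u' y)) x v = cinner (nab x v u) (u' x) + cinner (u x) (nab x v u')) \<and>
     (\<forall>x \<in> S. \<forall>v u. smooth_section_on M S u \<longrightarrow>
        nab x v (\<lambda>y. grading M y *v u y) = grading M x *v nab x v u) \<and>
     (\<forall>x \<in> S. \<forall>v u \<theta>. smooth_section_on M S u \<longrightarrow>
        nab x v (sec_act M \<theta> u) =
          lift M (- \<theta>) (ract M x \<theta>) *v nab (ract M x \<theta>) (tmap M (\<lambda>x. ract M x \<theta>) x v) u) \<and>
     \<comment> \<open>compatible with Clifford multiplication\<close>
     (\<exists>lc. levi_civita_on M S lc \<and>
        (\<forall>x \<in> S. \<forall>v Y u. smooth_vfield_on M S Y \<and> smooth_section_on M S u \<longrightarrow>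
           nab x v (\<lambda>y. c y (Y y) *v u y) = c x (lc x v Y) *v u x + c x (Y x) *v nab x v u))"

definition dirac_operator_on :: "('m, 'd::finite, 'p::finite, 'r::finite, 'z) tbundle_scheme \<Rightarrow> 'm set \<Rightarrow>
    ('m \<Rightarrow> real ^ 'd \<Rightarrow> complex ^ 'r ^ 'r) \<Rightarrow> ('m \<Rightarrow> real ^ 'd \<Rightarrow> ('m, 'r) sec \<Rightarrow> complex ^ 'r) \<Rightarrow>
    (('m, 'r) sec \<Rightarrow> ('m, 'r) sec) \<Rightarrow> bool" where
  "dirac_operator_on M S c nab D \<longleftrightarrow>
     (\<forall>u \<in> sections M. \<forall>x \<in> S. \<forall>e :: 'd \<Rightarrow> real ^ 'd.
        (\<forall>i j. metric M x (e i) (e j) = (if i = j then 1 else 0)) \<longrightarrow>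
        D u x = (\<Sum>i\<in>UNIV. c x (e i) *v nab x (e i) u))"

definition dirac_near :: "('m::topological_space, 'd::finite, 'p::finite, 'r::finite, 'z) tbundle_scheme \<Rightarrow>
    (('m, 'r) sec \<Rightarrow> ('m, 'r) sec) \<Rightarrow> 'm \<Rightarrow> 'm set \<Rightarrow>
    ('m \<Rightarrow> real ^ 'd \<Rightarrow> complex ^ 'r ^ 'r) \<Rightarrow> ('m \<Rightarrow> real ^ 'd \<Rightarrow> ('m, 'r) sec \<Rightarrow> complex ^ 'r) \<Rightarrow> bool" where
  "dirac_near M D x S c nab \<longleftrightarrow>
     open S \<and> x \<in> S \<and> (\<forall>y \<in> S. \<forall>\<theta>. ract M y \<theta> \<in> S) \<and>
     clifford_structure_on M S c \<and> clifford_connection_on M S c nab \<and> dirac_operator_on M S c nab D"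

definition singular_points :: "('m, 'r::finite) endo \<Rightarrow> 'm set" where
  "singular_points Z = {x. \<not> invertible (Z x)}"


section \<open>The model operator\<close>

text \<open>The model space is \<open>real ^ ('n + 'n)\<close> with \<open>x\<^sub>l\<close>, \<open>y\<^sub>l\<close> the components \<open>Inl l\<close>, \<open>Inr l\<close>.
  In \<open>rot k \<theta>\<close> the argument \<open>\<theta>\<close> is expressed in the torus coordinates to which \<open>k\<close> refers.\<close>

definition zc :: "real ^ ('n::finite + 'n) \<Rightarrow> 'n \<Rightarrow> complex" where
  "zc v l = Complex (v $ Inl l) (v $ Inr l)"

definition rot :: "('n::finite \<Rightarrow> int ^ 'p::finite) \<Rightarrow> real ^ 'p \<Rightarrow> real ^ ('n + 'n) \<Rightarrow> real ^ ('n + 'n)" where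
  "rot k \<theta> v = (\<chi> i. case i of Inl l \<Rightarrow> Re (cis (idot (k l) \<theta>) * zc v l)
                              | Inr l \<Rightarrow> Im (cis (idot (k l) \<theta>) * zc v l))"

text \<open>\<open>K = \<tilde>A + B\<^sup>\<rho>(x) + \<tilde>C\<close> in the coordinates \<open>c\<close> (a normal chart at \<open>x\<close>, so \<open>snd c x = 0\<close>).
  The top order coefficients of \<open>A = D\<^sup>2\<close> and the Taylor polynomial of \<open>C = Z\<^sup>2\<close> are read off in a
  trivialization \<open>t\<close> around \<open>x\<close> and transported back to \<open>E\<^sub>x\<close> by \<open>snd t x\<close>; the result does not
  depend on \<open>t\<close>, because the principal symbol is invariant and \<open>C\<close> vanishes to second order at \<open>x\<close>.
  \<open>B\<^sup>\<rho>\<close> is determined by \<open>D\<close>, \<open>Z\<close> and \<open>\<rho>\<close> near \<open>x\<close> on the values taken by sections of type \<open>\<rho>\<close>,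
  hence so is the restriction of \<open>K\<close> to type \<open>\<rho>\<close>.\<close>

definition model_operator :: "('m, 'd::finite, 'p::finite, 'r::finite, 'z) tbundle_scheme \<Rightarrow>
    (('m, 'r) sec \<Rightarrow> ('m, 'r) sec) \<Rightarrow> ('m, 'r) endo \<Rightarrow> (real ^ 'p \<Rightarrow> complex) \<Rightarrow> 'm \<Rightarrow>
    ('m, 'd) chart \<Rightarrow> ((real ^ 'd \<Rightarrow> complex ^ 'r) \<Rightarrow> real ^ 'd \<Rightarrow> complex ^ 'r) \<Rightarrow> bool" where
  "model_operator M D Z \<rho> x c K \<longleftrightarrow>
     (\<exists>t \<in> trivs M. \<exists>a2 a1 a0 B. x \<in> fst t \<and>
        local_coeffs2 c t (sections M) (\<lambda>u. D (D u)) a2 a1 a0 \<and>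
        restricts_to_bundle_map M (anticomm D Z) \<rho> B \<and>
        K = (\<lambda>u y.
          (\<Sum>i\<in>UNIV. \<Sum>j\<in>UNIV.
             (cadj (snd t x) ** a2 i j 0 ** snd t x) *v pd (pd u (axis j 1)) (axis i 1) y)
          + B x *v u y
          + (cadj (snd t x)
             ** ((1/2) *\<^sub>R pd (pd (\<lambda>y. snd t (cinv c y) ** (Z (cinv c y) ** Z (cinv c y))
                                      ** cadj (snd t (cinv c y))) y) y 0)
             ** snd t x) *v u y))"


section \<open>Spectrum of an operator in a space of square integrable functions\<close>

text \<open>Elements of \<open>L\<^sup>2\<close> are represented by functions, equality being equality almost everywhere; an
  unbounded operator is given by its graph, a set of pairs that is closed under equality almost
  everywhere.\<close>

definition L2_fun :: "(real ^ 'd::finite \<Rightarrow> complex ^ 'r::finite) set" where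
  "L2_fun = {u \<in> borel_measurable borel. integrable lborel (\<lambda>x. (norm (u x))\<^sup>2)}"

definition L2_nrm :: "(real ^ 'd::finite \<Rightarrow> complex ^ 'r::finite) \<Rightarrow> real" where
  "L2_nrm u = sqrt (LINT x|lborel. (norm (u x))\<^sup>2)"

text \<open>The action of \<open>\<theta>\<close> on the base of the model space is \<open>R \<theta>\<close>, on the fibre it is \<open>F \<theta>\<close>.\<close>

definition L2_type :: "(real ^ 'p::finite \<Rightarrow> real ^ 'd::finite \<Rightarrow> real ^ 'd) \<Rightarrow> (real ^ 'p \<Rightarrow> complex ^ 'r::finite ^ 'r) \<Rightarrow>
    (real ^ 'p \<Rightarrow> complex) \<Rightarrow> (real ^ 'd \<Rightarrow> complex ^ 'r) set" where
  "L2_type R F \<rho> = {u \<in> L2_fun. \<forall>\<theta>. AE x in lborel. F (- \<theta>) *v u (R \<theta> x) = \<rho> \<theta> *s u x}"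

definition test_sections :: "(real ^ 'p::finite \<Rightarrow> real ^ 'd::finite \<Rightarrow> real ^ 'd) \<Rightarrow> (real ^ 'p \<Rightarrow> complex ^ 'r::finite ^ 'r) \<Rightarrow>
    (real ^ 'p \<Rightarrow> complex) \<Rightarrow> (real ^ 'd \<Rightarrow> complex ^ 'r) set" where
  "test_sections R F \<rho> = {u. smooth_on UNIV u \<and> bounded {x. u x \<noteq> 0} \<and>
     (\<forall>\<theta> x. F (- \<theta>) *v u (R \<theta> x) = \<rho> \<theta> *s u x)}"

text \<open>The model operator is essentially self-adjoint on compactly supported smooth sections of type
  \<open>\<rho>\<close>; considered as a self-adjoint operator it is the closure from this domain.\<close>

definition L2_closure :: "(real ^ 'd::finite \<Rightarrow> complex ^ 'r::finite) set \<Rightarrow>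
    ((real ^ 'd \<Rightarrow> complex ^ 'r) \<Rightarrow> real ^ 'd \<Rightarrow> complex ^ 'r) \<Rightarrow>
    ((real ^ 'd \<Rightarrow> complex ^ 'r) \<times> (real ^ 'd \<Rightarrow> complex ^ 'r)) set" where
  "L2_closure \<D> K = {(u, f). u \<in> L2_fun \<and> f \<in> L2_fun \<and>
     (\<exists>s :: nat \<Rightarrow> real ^ 'd \<Rightarrow> complex ^ 'r. (\<forall>n. s n \<in> \<D>) \<and>
        (\<lambda>n. L2_nrm (\<lambda>x. s n x - u x)) \<longlonglongrightarrow> 0 \<and> (\<lambda>n. L2_nrm (\<lambda>x. K (s n) x - f x)) \<longlonglongrightarrow> 0)}"

definition resolvent_point :: "(real ^ 'd::finite \<Rightarrow> complex ^ 'r::finite) set \<Rightarrow>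
    ((real ^ 'd \<Rightarrow> complex ^ 'r) \<times> (real ^ 'd \<Rightarrow> complex ^ 'r)) set \<Rightarrow> complex \<Rightarrow> bool" where
  "resolvent_point H T \<zeta> \<longleftrightarrow> (\<exists>C. \<forall>f \<in> H. \<exists>u. (u, \<lambda>x. \<zeta> *s u x + f x) \<in> T \<and> L2_nrm u \<le> C * L2_nrm f \<and>
     (\<forall>u'. (u', \<lambda>x. \<zeta> *s u' x + f x) \<in> T \<longrightarrow> (AE x in lborel. u' x = u x)))"

definition L2_spectrum :: "(real ^ 'd::finite \<Rightarrow> complex ^ 'r::finite) set \<Rightarrow>
    ((real ^ 'd \<Rightarrow> complex ^ 'r) \<times> (real ^ 'd \<Rightarrow> complex ^ 'r)) set \<Rightarrow> complex set" where
  "L2_spectrum H T = {\<zeta>. \<not> resolvent_point H T \<zeta>}"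

text \<open>The eigenspace for \<open>\<zeta>\<close> has a basis with \<open>N\<close> elements.\<close>

definition has_multiplicity :: "((real ^ 'd::finite \<Rightarrow> complex ^ 'r::finite) \<times> (real ^ 'd \<Rightarrow> complex ^ 'r)) set \<Rightarrow>
    complex \<Rightarrow> nat \<Rightarrow> bool" where
  "has_multiplicity T \<zeta> N \<longleftrightarrow> (\<exists>e :: nat \<Rightarrow> real ^ 'd \<Rightarrow> complex ^ 'r.
     (\<forall>i<N. (e i, \<lambda>x. \<zeta> *s e i x) \<in> T) \<and>
     (\<forall>u. (u, \<lambda>x. \<zeta> *s u x) \<in> T \<longrightarrow>
        (\<exists>!a :: nat \<Rightarrow> complex. (\<forall>i\<ge>N. a i = 0) \<and> (AE x in lborel. u x = (\<Sum>i<N. a i *s e i x)))))"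

end

theory Submission
 imports Defs "HOL-Probability.Distributions"
begin

text \<open>
  Near the fixed point \<open>xb\<close> the field \<open>V\<close> is the infinitesimal rotation \<open>z\<^sub>l \<mapsto> i \<kappa>\<^sub>l z\<^sub>l\<close> to first order.
  Since \<open>Z = c(iV)\<close>, the model operator is the oscillator \<open>- \<Delta> + \<Sum> \<kappa>\<^sub>l\<^sup>2 |z\<^sub>l|\<^sup>2\<close> plus the constant
  endomorphism \<open>B(xb)\<close>.

  To find \<open>B(xb) f\<^sub>j\<close>, average over the torus to get an equivariant section \<open>\<sigma>\<close> with \<open>\<sigma>(xb) = f\<^sub>j\<close> and
  equivariant functions \<open>\<zeta>\<^sub>h\<close> with differential \<open>dz\<^sub>h\<close> at \<open>xb\<close>, and let \<open>\<phi>\<close> be the product of the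
  \<open>m\<^sub>h\<close>-th powers of the \<open>\<zeta>\<^sub>h\<close>, with \<open>\<zeta>\<^sub>h\<close> conjugated if \<open>m\<^sub>h < 0\<close>.  Then \<open>\<phi> \<sigma>\<close> has type \<open>\<rho>\<close> if
  \<open>\<Sum> m\<^sub>h k\<^sub>h = a\<^sub>j + b\<close>, and \<open>(DZ + ZD)(\<phi> \<sigma>) = \<phi> (DZ + ZD) \<sigma> - 2i (V\<phi>) \<sigma>\<close> with
  \<open>V\<phi> = i ((a\<^sub>j + b) \<cdot> \<tau>) \<phi>\<close>.  Dividing by \<open>\<phi>\<close> and letting \<open>x \<rightarrow> xb\<close> gives
  \<open>B(xb) f\<^sub>j = (2 \<Sum> \<kappa>\<^sub>l \<epsilon>\<^sub>j\<^sub>l + 2 (a\<^sub>j + b) \<cdot> \<tau>) f\<^sub>j\<close>, where \<open>(a\<^sub>j + b) \<cdot> \<tau> = \<Sum> m\<^sub>l \<kappa>\<^sub>l\<close>.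

  The oscillator has the eigenfunctions Gaussian times complex Hermite polynomial of bidegree
  \<open>(\<alpha>, \<beta>)\<close>, with eigenvalue \<open>2 \<Sum> \<kappa>\<^sub>l (\<alpha>\<^sub>l + \<beta>\<^sub>l + 1)\<close> and weight \<open>\<alpha> - \<beta>\<close>; they are complete because the
  Fourier transform is injective.  With \<open>m = \<alpha> - \<beta>\<close> and \<open>d = min \<alpha> \<beta>\<close> one has \<open>\<alpha> + \<beta> = |m| + 2 d\<close>.\<close>

section \<open>Calculus of smooth maps\<close>

text \<open>Hypothesis (2) only asserts that \<open>B\<close> exists, and the sections of type
  \<rho> may all vanish at \<open>xb\<close>, so \<open>B xb\<close> cannot be read off by
  evaluating there; this forces the division by \<phi>. Even so, \<open>B xb\<close> is pinned down
  only on those \<open>f j\<close> for which the equation for m is solvable. For every other j the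
  j-th component of each test section vanishes identically, because all its expansion coefficients
  do, so the undetermined part of \<open>B xb\<close> never acts.

  For admissible functions the constant 2 (a_j + b) . \<tau> equals 2 \<Sum> (\<alpha>_l -
  \<beta>_l) \<kappa>_l and removes \<beta> from the eigenvalue. Discreteness is rescued by the
  weight equation: a bound on the eigenvalue bounds \<alpha>, and the fixed number (a_j + b) .
  \<tau> then bounds \<beta>.

  The spectrum is read off from an orthonormal basis of the whole space of square integrable
  functions that is compatible with types: the closure of \<open>K\<close> acts diagonally on
  coefficients, and its resolvent is a square summable series.\<close>

lemma pd_eq_of_has_derivative: "(f has_derivative f') (at x) ==> pd f v x = f' v"
 unfolding pd_def by (metis frechet_derivative_at)

lemma pd_works: "f differentiable (at x) ==> (f has_derivative (\<lambda>v. pd f v x)) (at x)"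
 unfolding pd_def by (metis frechet_derivative_works)

lemma pd_cong_open:
 assumes "open S" "x \<in> S" "\<And>y. y \<in> S ==> f y = g y"
 shows "pd f v x = pd g v x"
proof -
 have "(f has_derivative F) (at x) \<longleftrightarrow> (g has_derivative F) (at x)" for F
  using has_derivative_transform_within_open[OF _ assms(1,2), of f F UNIV g]
   has_derivative_transform_within_open[OF _ assms(1,2), of g F UNIV f] assms(3) by auto
 then show ?thesis unfolding pd_def frechet_derivative_def by simp
qed

lemma differentiable_on_openD: "f differentiable_on S ==> open S ==> x \<in> S ==> f differentiable (at x)"
 by (metis at_within_open differentiable_on_def)

lemma differentiable_on_of_has_derivative:
 assumes "\<And>x. x \<in> S ==> (f has_derivative f' x) (at x)"
 shows "f differentiable_on S"
 unfolding differentiable_on_def differentiable_def using assms has_derivative_at_withinI by blast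

lemma differentiable_on_cong_open:
 assumes "f differentiable_on S" "open S" "\<And>y. y \<in> S ==> f y = g y"
 shows "g differentiable_on S"
 using assms unfolding differentiable_on_def differentiable_def
 by (metis has_derivative_transform)

lemma C_on_continuous: "C_on k S f ==> continuous_on S f"
 by (cases k) (auto intro: differentiable_imp_continuous_on)

lemma C_on_Suc_imp: "C_on (Suc k) S f ==> C_on k S f"
proof (induction k arbitrary: f)
 case 0
 then show ?case by (simp add: differentiable_imp_continuous_on)
next
 case (Suc k)
 then show ?case by (metis C_on.simps(2))
qed

lemma C_on_cong:
 assumes "open S" "\<And>y. y \<in> S ==> f y = g y" "C_on k S f"
 shows "C_on k S g"
 using assms(2,3)
proof (induction k arbitrary: f g)
 case 0
 then show ?case by (simp cong: continuous_on_cong)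
next
 case (Suc k)
 have "pd f v y = pd g v y" if "y \<in> S" for v y
  by (rule pd_cong_open[OF \<open>open S\<close> that Suc.prems(1)])
 then have "C_on k S (pd g v)" for v
  using Suc.IH[of "pd f v" "pd g v"] Suc.prems(2) by simp
 moreover have "g differentiable_on S"
  using Suc.prems differentiable_on_cong_open[OF _ \<open>open S\<close>, of f g] by simp
 ultimately show ?case by simp
qed

lemma C_on_subset: "C_on k S f ==> T \<subseteq> S ==> C_on k T f"
 by (induction k arbitrary: f) (auto intro: continuous_on_subset differentiable_on_subset)

text \<open>Regularity on a manifold is verified near each point, in charts and trivializations that
  depend on the point; such local verifications are glued here.\<close>

lemma C_on_local:
 assumes "open S" "\<And>x. x \<in> S ==> \<exists>T. open T \<and> x \<in> T \<and> C_on k (S \<inter> T) f"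
 shows "C_on k S f"
 using assms(2)
proof (induction k arbitrary: f)
 case 0
 show ?case unfolding C_on.simps continuous_on_eq_continuous_at[OF \<open>open S\<close>]
 proof
  fix x assume "x \<in> S"
  with 0 obtain T where "open T" "x \<in> T" "continuous_on (S \<inter> T) f" by force
  then show "isCont f x" using \<open>open S\<close> \<open>x \<in> S\<close>
   by (metis IntI continuous_on_eq_continuous_at open_Int)
 qed
next
 case (Suc k)
 have "f differentiable_on S" unfolding differentiable_on_def
 proof
  fix x assume "x \<in> S"
  with Suc.prems obtain T where "open T" "x \<in> T" "f differentiable_on (S \<inter> T)" by force
  then show "f differentiable (at x within S)" using \<open>open S\<close> \<open>x \<in> S\<close>
   by (metis IntI at_within_open differentiable_on_def open_Int)
 qed
 moreover have "C_on k S (pd f v)" for v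
  using Suc.prems by (intro Suc.IH) fastforce
 ultimately show ?case by simp
qed

lemma C_on_const: "C_on k S (\<lambda>x. c)"
proof (induction k arbitrary: c)
 case (Suc k)
 have "pd (\<lambda>x. c) v = (\<lambda>x. 0)" for v :: 'a by (auto intro!: pd_eq_of_has_derivative)
 then show ?case using Suc by (simp only: C_on.simps) auto
qed simp

lemma C_on_add: "open S ==> C_on k S f ==> C_on k S g ==> C_on k S (\<lambda>x. f x + g x)"
proof (induction k arbitrary: f g)
 case 0
 then show ?case by (simp add: continuous_on_add)
next
 case (Suc k)
 have "pd (\<lambda>x. f x + g x) v x = pd f v x + pd g v x" if "x \<in> S" for v x
  using Suc.prems that
  by (intro pd_eq_of_has_derivative has_derivative_add pd_works differentiable_on_openD) auto
 then have "C_on k S (pd (\<lambda>x. f x + g x) v)" for v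
  using Suc C_on_cong[OF \<open>open S\<close>, of "\<lambda>x. pd f v x + pd g v x"] by simp
 then show ?case using Suc.prems by (simp add: differentiable_on_add)
qed

lemma C_on_bounded_linear: "bounded_linear h ==> open S ==> C_on k S f ==> C_on k S (\<lambda>x. h (f x))"
proof (induction k arbitrary: f)
 case 0
 then show ?case by (simp add: bounded_linear.continuous_on)
next
 case (Suc k)
 have d: "((\<lambda>x. h (f x)) has_derivative (\<lambda>v. h (pd f v x))) (at x)" if "x \<in> S" for x
  using Suc.prems that
  by (intro bounded_linear.has_derivative[OF \<open>bounded_linear h\<close>] pd_works differentiable_on_openD) auto
 have "C_on k S (pd (\<lambda>x. h (f x)) v)" for v
 proof (rule C_on_cong[OF \<open>open S\<close>])
  show "C_on k S (\<lambda>x. h (pd f v x))" using Suc by simp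
 qed (rule pd_eq_of_has_derivative[OF d, symmetric])
 moreover have "(\<lambda>x. h (f x)) differentiable_on S"
  by (rule differentiable_on_of_has_derivative[OF d])
 ultimately show ?case by simp
qed

lemma C_on_bounded_bilinear:
 assumes "bounded_bilinear h" "open S" "C_on k S f" "C_on k S g"
 shows "C_on k S (\<lambda>x. h (f x) (g x))"
 using assms(3,4)
proof (induction k arbitrary: f g)
 case 0
 then show ?case using bounded_bilinear.continuous_on[OF assms(1)] by simp
next
 case (Suc k)
 have d: "((\<lambda>x. h (f x) (g x)) has_derivative (\<lambda>v. h (f x) (pd g v x) + h (pd f v x) (g x))) (at x)"
  if "x \<in> S" for x
  using Suc.prems that \<open>open S\<close>
  by (intro bounded_bilinear.FDERIV[OF assms(1)] pd_works differentiable_on_openD) auto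
 have "C_on k S (pd (\<lambda>x. h (f x) (g x)) v)" for v
 proof (rule C_on_cong[OF \<open>open S\<close>])
  show "C_on k S (\<lambda>x. h (f x) (pd g v x) + h (pd f v x) (g x))"
   using Suc.prems Suc.prems[THEN C_on_Suc_imp] by (intro C_on_add[OF \<open>open S\<close>] Suc.IH) simp_all
 qed (rule pd_eq_of_has_derivative[OF d, symmetric])
 moreover have "(\<lambda>x. h (f x) (g x)) differentiable_on S"
  by (rule differentiable_on_of_has_derivative[OF d])
 ultimately show ?case by simp
qed

lemma C_on_sum: "open S ==> (\<And>i. i \<in> I ==> C_on k S (f i)) ==> C_on k S (\<lambda>x. \<Sum>i\<in>I. f i x)"
 by (induction I rule: infinite_finite_induct) (auto intro: C_on_add C_on_const)

text \<open>The induction needs the derivative of the composite as a sum of products of maps that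
  are again of class k. In the chain rule \<open>pd g (pd f v x) (f x)\<close> the direction varies
  with x; expanding it in \<open>Basis\<close> freezes the directions.\<close>

lemma C_on_compose:
 fixes f :: "'a::real_normed_vector => 'b::euclidean_space" and g :: "'b => 'c::real_normed_vector"
 assumes "open S" "open T" "\<And>x. x \<in> S ==> f x \<in> T" "C_on k S f" "C_on k T g"
 shows "C_on k S (\<lambda>x. g (f x))"
 using assms(4,5)
proof (induction k arbitrary: g)
 case 0
 then show ?case using assms(3) by (auto intro: continuous_on_compose2)
next
 case (Suc k)
 have d: "((\<lambda>x. g (f x)) has_derivative (\<lambda>v. pd g (pd f v x) (f x))) (at x)" if "x \<in> S" for x
 proof -
  have "(f has_derivative (\<lambda>v. pd f v x)) (at x)"
   using Suc.prems(1) that \<open>open S\<close> by (auto intro: pd_works differentiable_on_openD)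
  moreover have "(g has_derivative (\<lambda>v. pd g v (f x))) (at (f x))"
   using Suc.prems(2) assms(3)[OF that] \<open>open T\<close> by (auto intro: pd_works differentiable_on_openD)
  ultimately show ?thesis using has_derivative_compose by blast
 qed
 have e: "pd (\<lambda>x. g (f x)) v x = (\<Sum>b\<in>Basis. (pd f v x \<bullet> b) *\<^sub>R pd g b (f x))" if "x \<in> S" for v x
 proof -
  have lin: "linear (\<lambda>v. pd g v (f x))"
   using Suc.prems(2) assms(3)[OF that] \<open>open T\<close>
   by (auto intro!: has_derivative_linear pd_works differentiable_on_openD)
  have "pd (\<lambda>x. g (f x)) v x = pd g (pd f v x) (f x)"
   using d[OF that] pd_eq_of_has_derivative by blast
  also have "\<dots> = pd g (\<Sum>b\<in>Basis. (pd f v x \<bullet> b) *\<^sub>R b) (f x)" by (simp add: euclidean_representation)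
  also have "\<dots> = (\<Sum>b\<in>Basis. (pd f v x \<bullet> b) *\<^sub>R pd g b (f x))"
   by (simp add: linear_sum[OF lin] linear_scale[OF lin])
  finally show ?thesis .
 qed
 have "C_on k S (pd (\<lambda>x. g (f x)) v)" for v
 proof (rule C_on_cong[OF \<open>open S\<close> e[symmetric]])
  show "C_on k S (\<lambda>x. \<Sum>b\<in>Basis. (pd f v x \<bullet> b) *\<^sub>R pd g b (f x))"
   using Suc.prems Suc.prems[THEN C_on_Suc_imp]
   by (intro C_on_sum C_on_bounded_bilinear[OF bounded_bilinear_scaleR] \<open>open S\<close> Suc.IH
     C_on_bounded_linear[OF bounded_linear_inner_left]) simp_all
 qed auto
 moreover have "(\<lambda>x. g (f x)) differentiable_on S"
  by (rule differentiable_on_of_has_derivative[OF d])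
 ultimately show ?case by simp
qed

lemma smooth_on_iff: "smooth_on S f \<longleftrightarrow> f differentiable_on S \<and> (\<forall>v. smooth_on S (pd f v))"
 unfolding smooth_on_def by (metis C_on.simps(2) C_on_Suc_imp)

text \<open>A family closed under directional derivatives is smooth as soon as its members are
  differentiable. It is applied to \<open>flat\<close>, to multiples of \<open>cis\<close> and to
  the span of the oscillator functions, where explicit higher derivatives would be unwieldy.\<close>

lemma smooth_on_coinduct:
 assumes "P f" "\<And>f. P f ==> f differentiable_on S \<and> (\<forall>v. P (pd f v))"
 shows "smooth_on S f"
proof -
 have "P f ==> C_on k S f" for k f
  using assms(2) by (induction k arbitrary: f) (auto intro: differentiable_imp_continuous_on)
 then show ?thesis using assms(1) by (simp add: smooth_on_def)
qed

lemma smooth_on_pd: "smooth_on S f ==> smooth_on S (pd f v)"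
 using smooth_on_iff by blast

lemma smooth_on_continuous: "smooth_on S f ==> continuous_on S f"
 unfolding smooth_on_def using C_on_continuous by blast

lemma smooth_on_differentiable: "smooth_on S f ==> open S ==> x \<in> S ==> f differentiable (at x)"
 using smooth_on_iff differentiable_on_openD by blast

lemma smooth_on_has_derivative:
 "smooth_on S f ==> open S ==> x \<in> S ==> (f has_derivative (\<lambda>v. pd f v x)) (at x)"
 using smooth_on_differentiable pd_works by blast

lemma smooth_on_cong: "smooth_on S f ==> open S ==> (\<And>y. y \<in> S ==> f y = g y) ==> smooth_on S g"
 unfolding smooth_on_def using C_on_cong by blast

lemma smooth_on_subset: "smooth_on S f ==> T \<subseteq> S ==> smooth_on T f"
 unfolding smooth_on_def using C_on_subset by blast

lemma smooth_on_local:
 assumes "open S" "\<And>x. x \<in> S ==> \<exists>T. open T \<and> x \<in> T \<and> smooth_on (S \<inter> T) f"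
 shows "smooth_on S f"
 unfolding smooth_on_def
proof
 fix k show "C_on k S f"
  by (rule C_on_local[OF assms(1)]) (use assms(2) smooth_on_def in blast)
qed

lemma smooth_on_const: "smooth_on S (\<lambda>x. c)"
 by (simp add: smooth_on_def C_on_const)

lemma smooth_on_add: "open S ==> smooth_on S f ==> smooth_on S g ==> smooth_on S (\<lambda>x. f x + g x)"
 by (simp add: smooth_on_def C_on_add)

lemma smooth_on_bounded_linear:
 "bounded_linear h ==> open S ==> smooth_on S f ==> smooth_on S (\<lambda>x. h (f x))"
 by (simp add: smooth_on_def C_on_bounded_linear)

lemma smooth_on_minus: "open S ==> smooth_on S f ==> smooth_on S (\<lambda>x. - f x)"
 by (rule smooth_on_bounded_linear[OF bounded_linear_minus[OF bounded_linear_ident]])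

lemma smooth_on_diff: "open S ==> smooth_on S f ==> smooth_on S g ==> smooth_on S (\<lambda>x. f x - g x)"
 using smooth_on_add[of S f "\<lambda>x. - g x"] smooth_on_minus by fastforce

lemma smooth_on_bounded_bilinear:
 "bounded_bilinear h ==> open S ==> smooth_on S f ==> smooth_on S g ==> smooth_on S (\<lambda>x. h (f x) (g x))"
 by (simp add: smooth_on_def C_on_bounded_bilinear)

lemmas smooth_on_mult = smooth_on_bounded_bilinear[OF bounded_bilinear_mult]
lemmas smooth_on_scaleR = smooth_on_bounded_bilinear[OF bounded_bilinear_scaleR]

lemma smooth_on_compose:
 fixes f :: "'a::real_normed_vector => 'b::euclidean_space" and g :: "'b => 'c::real_normed_vector"
 assumes "open S" "open T" "\<And>x. x \<in> S ==> f x \<in> T" "smooth_on S f" "smooth_on T g"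
 shows "smooth_on S (\<lambda>x. g (f x))"
 using assms C_on_compose unfolding smooth_on_def by metis

lemma smooth_on_ident: "smooth_on S (\<lambda>x. x)"
proof -
 have "smooth_on UNIV (\<lambda>x::'a. x)"
  unfolding smooth_on_iff[of _ "\<lambda>x. x"]
 proof (intro conjI allI)
  fix v :: 'a
  have "pd (\<lambda>x::'a. x) v = (\<lambda>x. v)" by (auto intro!: pd_eq_of_has_derivative has_derivative_ident)
  then show "smooth_on UNIV (pd (\<lambda>x::'a. x) v)" by (simp add: smooth_on_const)
 qed (simp add: differentiable_on_ident[unfolded id_def])
 then show ?thesis using smooth_on_subset by blast
qed

lemma smooth_on_linear: "bounded_linear h ==> smooth_on S h"
 using smooth_on_bounded_linear[of h UNIV "\<lambda>x. x"] smooth_on_ident smooth_on_subset by blast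

lemma smooth_on_power:
 fixes f :: "'a::real_normed_vector => 'b::{real_normed_algebra,comm_ring_1}"
 shows "open S ==> smooth_on S f ==> smooth_on S (\<lambda>x. f x ^ n)"
 by (induction n) (auto intro: smooth_on_mult smooth_on_const)

lemma smooth_on_Pair: "open S ==> smooth_on S f ==> smooth_on S g ==> smooth_on S (\<lambda>x. (f x, g x))"
proof -
 assume a: "open S" "smooth_on S f" "smooth_on S g"
 have "bounded_linear (\<lambda>x. (x, 0))" "bounded_linear (\<lambda>x. (0, x))"
  by (intro bounded_linear_Pair bounded_linear_ident bounded_linear_zero)+
 then have "smooth_on S (\<lambda>x. (f x, 0) + (0, g x))"
  using a by (intro smooth_on_add smooth_on_bounded_linear[where h="\<lambda>x. (x, 0)"]
    smooth_on_bounded_linear[where h="\<lambda>x. (0, x)"]) auto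
 then show ?thesis by simp
qed

lemma pd_linear: "smooth_on S f ==> open S ==> x \<in> S ==> linear (\<lambda>v. pd f v x)"
 using smooth_on_has_derivative has_derivative_linear by blast

lemma pd_add:
 assumes "f differentiable at x" "g differentiable at x"
 shows "pd (\<lambda>x. f x + g x) v x = pd f v x + pd g v x"
 by (rule pd_eq_of_has_derivative) (rule has_derivative_add[OF pd_works[OF assms(1)] pd_works[OF assms(2)]])

lemma pd_bounded_linear:
 assumes "bounded_linear h" "f differentiable at x"
 shows "pd (\<lambda>x. h (f x)) v x = h (pd f v x)"
 by (rule pd_eq_of_has_derivative) (rule bounded_linear.has_derivative[OF assms(1) pd_works[OF assms(2)]])

lemma pd_bounded_bilinear:
 assumes "bounded_bilinear h" "f differentiable at x" "g differentiable at x"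
 shows "pd (\<lambda>x. h (f x) (g x)) v x = h (f x) (pd g v x) + h (pd f v x) (g x)"
 by (rule pd_eq_of_has_derivative)
  (rule bounded_bilinear.FDERIV[OF assms(1) pd_works[OF assms(2)] pd_works[OF assms(3)]])

lemmas pd_mult = pd_bounded_bilinear[OF bounded_bilinear_mult]

lemma pd_compose:
 assumes "f differentiable at x" "g differentiable at (f x)"
 shows "pd (\<lambda>x. g (f x)) v x = pd g (pd f v x) (f x)"
 by (rule pd_eq_of_has_derivative) (rule has_derivative_compose[OF pd_works[OF assms(1)] pd_works[OF assms(2)]])

section \<open>A smooth cutoff built from exp (- 1 / t)\<close>

lemma has_real_derivative_exp_inverse:
 assumes "t > 0"
 shows "((\<lambda>t::real. poly p (1 / t) * exp (- 1 / t)) has_real_derivative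
  poly ([:0, 0, 1:] * (p - pderiv p)) (1 / t) * exp (- 1 / t)) (at t)"
 using assms by (auto intro!: derivative_eq_intros simp: field_simps power2_eq_square)

lemma tendsto_poly_exp_minus: "((\<lambda>x::real. poly p x * exp (- x)) \<longlongrightarrow> 0) at_top"
proof -
 have "((\<lambda>x::real. \<Sum>i\<le>degree p. coeff p i * (x ^ i / exp x)) \<longlongrightarrow> (\<Sum>i\<le>degree p. coeff p i * 0)) at_top"
  by (intro tendsto_intros tendsto_power_div_exp_0)
 then show ?thesis
  by (simp add: poly_altdef sum_divide_distrib sum_distrib_right exp_minus divide_inverse mult.assoc)
qed

text \<open>Carrying an arbitrary polynomial p makes the family closed under differentiation: in the
  variable s = 1 / t the derivative replaces p by s^2 (p - p'), and at t = 0 every member has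
  derivative 0.\<close>

definition flat :: "real poly => real => real" where
 "flat p t = (if t \<le> 0 then 0 else poly p (1 / t) * exp (- 1 / t))"

lemma flat_has_derivative:
 "(flat p has_real_derivative flat ([:0, 0, 1:] * (p - pderiv p)) t) (at t)"
proof -
 consider "t > 0" | "t < 0" | "t = 0" by linarith
 then show ?thesis
 proof cases
  case 1
  then have "(flat p has_real_derivative poly ([:0, 0, 1:] * (p - pderiv p)) (1 / t) * exp (- 1 / t)) (at t)"
   using has_field_derivative_transform_within_open[OF has_real_derivative_exp_inverse[of t p], of "{0<..}" "flat p"]
   by (auto simp: flat_def)
  then show ?thesis using 1 by (simp add: flat_def)
 next
  case 2
  have "((\<lambda>_. 0) has_real_derivative 0) (at t)" by simp
  then have "(flat p has_real_derivative 0) (at t)"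
   using has_field_derivative_transform_within_open[of "\<lambda>_. 0" 0 t "{..<0}" "flat p"] 2
   by (auto simp: flat_def)
  then show ?thesis using 2 by (simp add: flat_def)
 next
  case 3
  have "filterlim (\<lambda>h::real. 1 / h) at_top (at_right 0)"
   using filterlim_inverse_at_top_right by (simp add: inverse_eq_divide)
  \<comment> \<open>For h > 0 the difference quotient at 0 is s p(s) e^(-s) with s = 1 / h, which
    explains the extra factor \<open>[:0, 1:]\<close>.\<close>
  from filterlim_compose[OF tendsto_poly_exp_minus[of "[:0, 1:] * p"] this]
  have "((\<lambda>h. poly ([:0, 1:] * p) (1 / h) * exp (- (1 / h))) \<longlongrightarrow> 0) (at_right 0)" .
  then have r: "((\<lambda>h. flat p h / h) \<longlongrightarrow> 0) (at_right 0)"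
   by (rule Lim_transform_eventually) (auto simp: eventually_at_right_field flat_def intro!: exI[of _ 1])
  have l: "((\<lambda>h. flat p h / h) \<longlongrightarrow> 0) (at_left 0)"
   by (rule tendsto_eventually) (auto simp: eventually_at_left_field flat_def intro!: exI[of _ "-1"])
  have "(flat p has_real_derivative 0) (at 0)"
   unfolding has_field_derivative_iff using filterlim_split_at[OF l r] by (simp add: flat_def)
  then show ?thesis using 3 by (simp add: flat_def)
 qed
qed

text \<open>There is no plateau: for t > 0 this is exp (1 - 1 / t), which takes the value 1 only at
  t = 1. Later arguments rely on that value at the centre of a ball, on the support, and on bounds
  for t \<le> 1.\<close>

definition cutoff :: "real => real" where
 "cutoff t = exp 1 * flat 1 t"

lemma cutoff_1: "cutoff 1 = 1"
 by (simp add: cutoff_def flat_def flip: exp_add)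

lemma cutoff_nonpos: "t \<le> 0 ==> cutoff t = 0"
 by (simp add: cutoff_def flat_def)

lemma smooth_on_cutoff: "smooth_on UNIV cutoff"
proof -
 have "smooth_on UNIV (flat 1)"
 proof (rule smooth_on_coinduct[where P="\<lambda>f. \<exists>p c. f = (\<lambda>x. c * flat p x)"])
  show "\<exists>p c. flat 1 = (\<lambda>x. c * flat p x)" by (rule exI[of _ 1], rule exI[of _ 1]) auto
  fix f :: "real => real" assume "\<exists>p c. f = (\<lambda>x. c * flat p x)"
  then obtain p c where c: "f = (\<lambda>x. c * flat p x)" by auto
  have d: "(f has_derivative (\<lambda>v. (v * c) * flat ([:0, 0, 1:] * (p - pderiv p)) x)) (at x)" for x
   using DERIV_cmult[OF flat_has_derivative[of p x], of c]
   unfolding c has_field_derivative_def by (rule has_derivative_eq_rhs) (auto simp: mult_ac)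
  have "f differentiable_on UNIV" by (rule differentiable_on_of_has_derivative[OF d])
  moreover have "pd f v = (\<lambda>x. (v * c) * flat ([:0, 0, 1:] * (p - pderiv p)) x)" for v
   by (rule ext) (rule pd_eq_of_has_derivative[OF d])
  ultimately show "f differentiable_on UNIV \<and> (\<forall>v. \<exists>p c. pd f v = (\<lambda>x. c * flat p x))" by metis
 qed
 then show ?thesis unfolding cutoff_def by (intro smooth_on_mult smooth_on_const) auto
qed

section \<open>Symmetry of second derivatives\<close>

lemma second_difference_tendsto:
 fixes g :: "'a::real_normed_vector => real"
 assumes "open S" "x \<in> S" "C_on 2 S g"
 shows "((\<lambda>t. (g (x + t *\<^sub>R u + t *\<^sub>R v) - g (x + t *\<^sub>R u) - g (x + t *\<^sub>R v) + g x) / t\<^sup>2)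
  \<longlongrightarrow> pd (pd g u) v x) (at_right 0)"
proof (rule tendstoI)
 fix \<epsilon> :: real assume "\<epsilon> > 0"
 have dg: "g differentiable_on S" and dgu: "pd g u differentiable_on S"
  and cont: "continuous_on S (pd (pd g u) v)"
  using assms(3) by (auto simp: numeral_2_eq_2)
 obtain e where e: "e > 0" "ball x e \<subseteq> S" using assms openE by blast
 have "isCont (pd (pd g u) v) x" using cont assms(1,2) by (simp add: continuous_on_eq_continuous_at)
 then obtain d where d: "d > 0" "\<And>y. dist y x < d ==> dist (pd (pd g u) v y) (pd (pd g u) v x) < \<epsilon>"
  using \<open>\<epsilon> > 0\<close> unfolding continuous_at_eps_delta by metis
 \<comment> \<open>N bounds the extent of the parallelogram spanned by u and v; the summand 1 keeps
   it positive when both vanish.\<close>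
 define N where "N = norm u + norm v + 1"
 have N: "N > 0" unfolding N_def by (smt (verit) norm_ge_zero)
 define \<delta> where "\<delta> = min e d / N"
 have "\<delta> > 0" using e d N by (simp add: \<delta>_def)
 have near: "dist (x + s *\<^sub>R u + r *\<^sub>R v) x < min e d" if "0 \<le> s" "s \<le> t" "0 \<le> r" "r \<le> t" "0 < t" "t < \<delta>" for s r t
 proof -
  have "dist (x + s *\<^sub>R u + r *\<^sub>R v) x = norm (s *\<^sub>R u + r *\<^sub>R v)" by (simp add: dist_norm)
  also have "\<dots> \<le> s * norm u + r * norm v" using norm_triangle_ineq[of "s *\<^sub>R u" "r *\<^sub>R v"] that by simp
  also have "\<dots> \<le> t * norm u + t * norm v" using that by (intro add_mono mult_right_mono) auto
  also have "\<dots> < t * N" using that by (simp add: N_def algebra_simps)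
  also have "\<dots> < min e d" using that N by (simp add: \<delta>_def pos_less_divide_eq)
  finally show ?thesis .
 qed
 have inS: "x + s *\<^sub>R u + r *\<^sub>R v \<in> S" if "0 \<le> s" "s \<le> t" "0 \<le> r" "r \<le> t" "0 < t" "t < \<delta>" for s r t
  using near[OF that] e(2) by (auto simp: dist_commute)
 have main: "dist ((g (x + t *\<^sub>R u + t *\<^sub>R v) - g (x + t *\<^sub>R u) - g (x + t *\<^sub>R v) + g x) / t\<^sup>2) (pd (pd g u) v x) < \<epsilon>"
  if t: "0 < t" "t < \<delta>" for t
 proof -
  \<comment> \<open>The second difference is symmetric in u and v, but the way to its limit is not:
    one mean value step in direction u followed by one in direction v produces
    \<open>pd (pd g u) v\<close>.\<close>
  define \<phi> where "\<phi> s = g (x + s *\<^sub>R u + t *\<^sub>R v) - g (x + s *\<^sub>R u)" for s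
  have D1: "((\<lambda>s. g (x + s *\<^sub>R u + r *\<^sub>R v)) has_real_derivative pd g u (x + s *\<^sub>R u + r *\<^sub>R v)) (at s)"
   if "0 \<le> s" "s \<le> t" "0 \<le> r" "r \<le> t" for s r
  proof -
   have g': "(g has_derivative (\<lambda>w. pd g w (x + s *\<^sub>R u + r *\<^sub>R v))) (at (x + s *\<^sub>R u + r *\<^sub>R v))"
    using inS[OF that t] dg assms(1) by (intro pd_works differentiable_on_openD)
   have l: "linear (\<lambda>w. pd g w (x + s *\<^sub>R u + r *\<^sub>R v))" by (rule has_derivative_linear[OF g'])
   have "((\<lambda>s. x + s *\<^sub>R u + r *\<^sub>R v) has_derivative (\<lambda>h. h *\<^sub>R u)) (at s)"
    by (auto intro!: derivative_eq_intros)
   from has_derivative_compose[OF this g'] show ?thesis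
    unfolding has_field_derivative_def
    by (rule has_derivative_eq_rhs) (auto simp: linear_scale[OF l])
  qed
  have D2: "((\<lambda>r. pd g u (x + s *\<^sub>R u + r *\<^sub>R v)) has_real_derivative pd (pd g u) v (x + s *\<^sub>R u + r *\<^sub>R v)) (at r)"
   if "0 \<le> s" "s \<le> t" "0 \<le> r" "r \<le> t" for s r
  proof -
   have g': "(pd g u has_derivative (\<lambda>w. pd (pd g u) w (x + s *\<^sub>R u + r *\<^sub>R v))) (at (x + s *\<^sub>R u + r *\<^sub>R v))"
    using inS[OF that t] dgu assms(1) by (intro pd_works differentiable_on_openD)
   have l: "linear (\<lambda>w. pd (pd g u) w (x + s *\<^sub>R u + r *\<^sub>R v))" by (rule has_derivative_linear[OF g'])
   have "((\<lambda>r. x + s *\<^sub>R u + r *\<^sub>R v) has_derivative (\<lambda>h. h *\<^sub>R v)) (at r)"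
    by (auto intro!: derivative_eq_intros)
   from has_derivative_compose[OF this g'] show ?thesis
    unfolding has_field_derivative_def
    by (rule has_derivative_eq_rhs) (auto simp: linear_scale[OF l])
  qed
  have "(\<phi> has_real_derivative pd g u (x + s *\<^sub>R u + t *\<^sub>R v) - pd g u (x + s *\<^sub>R u)) (at s)"
   if "0 \<le> s" "s \<le> t" for s
   unfolding \<phi>_def using D1[of s t] D1[of s 0] that t by (auto intro!: derivative_intros)
  then obtain \<xi> where \<xi>: "0 < \<xi>" "\<xi> < t"
   "\<phi> t - \<phi> 0 = (t - 0) * (pd g u (x + \<xi> *\<^sub>R u + t *\<^sub>R v) - pd g u (x + \<xi> *\<^sub>R u))"
   using MVT2[OF \<open>0 < t\<close>, of \<phi> "\<lambda>s. pd g u (x + s *\<^sub>R u + t *\<^sub>R v) - pd g u (x + s *\<^sub>R u)"] by metis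
  obtain \<eta> where \<eta>: "0 < \<eta>" "\<eta> < t"
   "pd g u (x + \<xi> *\<^sub>R u + t *\<^sub>R v) - pd g u (x + \<xi> *\<^sub>R u + 0 *\<^sub>R v) = (t - 0) * pd (pd g u) v (x + \<xi> *\<^sub>R u + \<eta> *\<^sub>R v)"
   using MVT2[OF \<open>0 < t\<close>, of "\<lambda>r. pd g u (x + \<xi> *\<^sub>R u + r *\<^sub>R v)"
     "\<lambda>r. pd (pd g u) v (x + \<xi> *\<^sub>R u + r *\<^sub>R v)"] D2[of \<xi>] \<xi> by (metis less_imp_le)
  have "\<phi> t - \<phi> 0 = t\<^sup>2 * pd (pd g u) v (x + \<xi> *\<^sub>R u + \<eta> *\<^sub>R v)"
   using \<xi>(3) \<eta>(3) by (simp add: power2_eq_square)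
  then have "(g (x + t *\<^sub>R u + t *\<^sub>R v) - g (x + t *\<^sub>R u) - g (x + t *\<^sub>R v) + g x) / t\<^sup>2
    = pd (pd g u) v (x + \<xi> *\<^sub>R u + \<eta> *\<^sub>R v)"
   using t by (simp add: \<phi>_def field_simps)
  then show ?thesis using d(2) near[of \<xi> t \<eta>] \<xi> \<eta> t by simp
 qed
 then show "\<forall>\<^sub>F t in at_right 0. dist ((g (x + t *\<^sub>R u + t *\<^sub>R v) - g (x + t *\<^sub>R u) - g (x + t *\<^sub>R v) + g x) / t\<^sup>2) (pd (pd g u) v x) < \<epsilon>"
  unfolding eventually_at_right_field using \<open>\<delta> > 0\<close> by blast
qed

text \<open>The mean value theorem concerns real functions, hence the passage to components; there
  the two mixed derivatives are limits of one and the same second difference.\<close>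

lemma pd_commute:
 fixes f :: "'a::real_normed_vector => 'b::euclidean_space"
 assumes "open S" "x \<in> S" "smooth_on S f"
 shows "pd (pd f u) v x = pd (pd f v) u x"
proof (rule euclidean_eqI)
 fix b :: 'b
 define g where "g y = f y \<bullet> b" for y
 have bl: "bounded_linear (\<lambda>z. z \<bullet> b)" by (rule bounded_linear_inner_left)
 have sg: "smooth_on S g" unfolding g_def by (rule smooth_on_bounded_linear[OF bl assms(1,3)])
 have g1: "pd f w y \<bullet> b = pd g w y" if "y \<in> S" for w y
  unfolding g_def by (rule pd_bounded_linear[OF bl, symmetric]) (rule smooth_on_differentiable[OF assms(3,1) that])
 have g2: "pd (pd f w) z x \<bullet> b = pd (pd g w) z x" for w z
 proof -
  have "pd (pd f w) z x \<bullet> b = pd (\<lambda>y. pd f w y \<bullet> b) z x"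
   by (rule pd_bounded_linear[OF bl, symmetric])
    (rule smooth_on_differentiable[OF smooth_on_pd[OF assms(3)] assms(1,2)])
  also have "\<dots> = pd (pd g w) z x" by (rule pd_cong_open[OF assms(1,2) g1])
  finally show ?thesis .
 qed
 have c: "C_on 2 S g" using sg by (simp add: smooth_on_def del: C_on.simps)
 have "((\<lambda>t. (g (x + t *\<^sub>R u + t *\<^sub>R v) - g (x + t *\<^sub>R u) - g (x + t *\<^sub>R v) + g x) / t\<^sup>2)
  \<longlongrightarrow> pd (pd g v) u x) (at_right 0)"
  by (rule Lim_transform_eventually[OF second_difference_tendsto[OF assms(1,2) c, of v u]])
   (simp add: algebra_simps)
 then have "pd (pd g u) v x = pd (pd g v) u x"
  using second_difference_tendsto[OF assms(1,2) c, of u v] tendsto_unique trivial_limit_at_right_real by blast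
 then show "pd (pd f u) v x \<bullet> b = pd (pd f v) u x \<bullet> b" by (simp add: g2)
qed

section \<open>Gaussian bounds and integration by parts\<close>

abbreviation meas :: "('a::topological_space => 'b::topological_space) set" where
 "meas \<equiv> borel_measurable borel"

lemma integrable_gaussian_real:
 assumes "c > 0"
 shows "integrable lborel (\<lambda>x::real. exp (- c * x\<^sup>2))"
proof -
 have "has_bochner_integral lborel (\<lambda>x::real. exp (- x\<^sup>2)) (2 * (sqrt pi / 2))"
  using has_bochner_integral_even_function[OF gaussian_moment_0] by simp
 then have "integrable lborel (\<lambda>x::real. exp (- x\<^sup>2))" by (simp add: has_bochner_integral_iff)
 from lborel_integrable_real_affine[OF this, of "sqrt c" 0] show ?thesis
  using assms by (simp add: power_mult_distrib)
qed

lemma integrable_gaussian: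
 assumes "c > 0"
 shows "integrable lborel (\<lambda>x::'a::euclidean_space. exp (- c * (norm x)\<^sup>2))"
proof (rule integrableI_nonneg)
 have "exp (- c * (norm x)\<^sup>2) = (\<Prod>b\<in>Basis. exp (- c * (x \<bullet> b)\<^sup>2))" for x :: 'a
  unfolding power2_norm_eq_inner euclidean_inner[of x x] sum_distrib_left
  by (simp add: power2_eq_square exp_sum)
 then have "(\<integral>\<^sup>+(x::'a). ennreal (exp (- c * (norm x)\<^sup>2)) \<partial>lborel)
   = (\<integral>\<^sup>+(x::'a). (\<Prod>b\<in>Basis. ennreal (exp (- c * (x \<bullet> b)\<^sup>2))) \<partial>lborel)"
  by (simp add: prod_ennreal)
 also have "\<dots> = (\<Prod>b\<in>(Basis::'a set). (\<integral>\<^sup>+x. ennreal (exp (- c * x\<^sup>2)) \<partial>lborel))"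
  by (subst nn_integral_lborel_prod[where f="\<lambda>b x. ennreal (exp (- c * x\<^sup>2))"]) auto
 also have "\<dots> < \<infinity>"
  using integrable_gaussian_real[OF assms]
  by (simp add: integrable_iff_bounded power_less_top_ennreal)
 finally show "(\<integral>\<^sup>+(x::'a). ennreal (exp (- c * (norm x)\<^sup>2)) \<partial>lborel) < \<infinity>" .
qed auto

text \<open>The rate c is existentially quantified so that it may shrink: the class then absorbs
  polynomial and exponential factors and takes the place of the rapidly decreasing
  functions.\<close>

definition gauss_bounded :: "('a::real_normed_vector => 'b::real_normed_vector) => bool" where
 "gauss_bounded f \<longleftrightarrow> (\<exists>C c. c > 0 \<and> (\<forall>x. norm (f x) \<le> C * exp (- c * (norm x)\<^sup>2)))"

lemma gauss_boundedE:
 assumes "gauss_bounded f"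
 obtains C c where "C > 0" "c > 0" "\<And>x. norm (f x) \<le> C * exp (- c * (norm x)\<^sup>2)"
proof -
 obtain C c where c: "c > 0" "\<And>x. norm (f x) \<le> C * exp (- c * (norm x)\<^sup>2)"
  using assms by (auto simp: gauss_bounded_def)
 have "norm (f x) \<le> (\<bar>C\<bar> + 1) * exp (- c * (norm x)\<^sup>2)" for x
 proof -
  have "C * exp (- c * (norm x)\<^sup>2) \<le> (\<bar>C\<bar> + 1) * exp (- c * (norm x)\<^sup>2)"
   by (rule mult_right_mono) auto
  with c(2)[of x] show ?thesis by linarith
 qed
 with c(1) that[of "\<bar>C\<bar> + 1" c] show ?thesis by (simp add: add_nonneg_pos)
qed

lemma gauss_bounded_integrable:
 fixes f :: "'a::euclidean_space => 'b::{banach, second_countable_topology}"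
 assumes "gauss_bounded f" "f \<in> meas"
 shows "integrable lborel f"
proof -
 obtain C c where c: "C > 0" "c > 0" "\<And>x. norm (f x) \<le> C * exp (- c * (norm x)\<^sup>2)"
  using gauss_boundedE[OF assms(1)] by blast
 show ?thesis
  by (rule Bochner_Integration.integrable_bound[where f="\<lambda>x. C * exp (- c * (norm x)\<^sup>2)"])
   (use c assms integrable_gaussian in \<open>auto intro!: AE_I2 simp: abs_mult\<close>)
qed

lemma gauss_bounded_mono:
 assumes "gauss_bounded f" "\<And>x. norm (g x) \<le> A * norm (f x)"
 shows "gauss_bounded g"
proof -
 obtain C c where c: "C > 0" "c > 0" "\<And>x. norm (f x) \<le> C * exp (- c * (norm x)\<^sup>2)"
  using gauss_boundedE[OF assms(1)] by blast
 have "norm (g x) \<le> (\<bar>A\<bar> * C) * exp (- c * (norm x)\<^sup>2)" for x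
 proof -
  have "A * norm (f x) \<le> \<bar>A\<bar> * (C * exp (- c * (norm x)\<^sup>2))" using c by (intro mult_mono) auto
  with assms(2)[of x] show ?thesis by simp
 qed
 with c(2) show ?thesis unfolding gauss_bounded_def by blast
qed

lemma gauss_bounded_add:
 assumes "gauss_bounded f" "gauss_bounded g"
 shows "gauss_bounded (\<lambda>x. f x + g x)"
proof -
 obtain C c where c: "C > 0" "c > 0" "\<And>x. norm (f x) \<le> C * exp (- c * (norm x)\<^sup>2)"
  using gauss_boundedE[OF assms(1)] by blast
 obtain D d where d: "D > 0" "d > 0" "\<And>x. norm (g x) \<le> D * exp (- d * (norm x)\<^sup>2)"
  using gauss_boundedE[OF assms(2)] by blast
 have "norm (f x + g x) \<le> (C + D) * exp (- (min c d) * (norm x)\<^sup>2)" for x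
 proof -
  have "exp (- c * (norm x)\<^sup>2) \<le> exp (- (min c d) * (norm x)\<^sup>2)"
   "exp (- d * (norm x)\<^sup>2) \<le> exp (- (min c d) * (norm x)\<^sup>2)"
   by (auto intro!: mult_right_mono)
  then have "C * exp (- c * (norm x)\<^sup>2) \<le> C * exp (- (min c d) * (norm x)\<^sup>2)"
   "D * exp (- d * (norm x)\<^sup>2) \<le> D * exp (- (min c d) * (norm x)\<^sup>2)" using c d by auto
  then show ?thesis using c(3)[of x] d(3)[of x] norm_triangle_ineq[of "f x" "g x"]
   unfolding distrib_right by linarith
 qed
 moreover have "min c d > 0" using c d by simp
 ultimately show ?thesis unfolding gauss_bounded_def by blast
qed

text \<open>Half of the Gaussian rate pays for the growth: completing the square gives B |x| \<le>
  B^2 / (2 c) + (c / 2) |x|^2.\<close>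

lemma gauss_bounded_exp_growth:
 assumes "gauss_bounded f" "\<And>x. norm (g x) \<le> A * exp (B * norm x) * norm (f x)"
 shows "gauss_bounded g"
proof -
 obtain C c where c: "C > 0" "c > 0" "\<And>x. norm (f x) \<le> C * exp (- c * (norm x)\<^sup>2)"
  using gauss_boundedE[OF assms(1)] by blast
 have "norm (g x) \<le> (\<bar>A\<bar> * exp (B\<^sup>2 / (2 * c)) * C) * exp (- (c / 2) * (norm x)\<^sup>2)" for x
 proof -
  have "0 \<le> (B / sqrt (2 * c) - sqrt (c / 2) * norm x)\<^sup>2" by simp
  then have "B * norm x \<le> B\<^sup>2 / (2 * c) + (c / 2) * (norm x)\<^sup>2"
  proof -
   have "(B / sqrt (2 * c) - sqrt (c / 2) * norm x)\<^sup>2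
     = B\<^sup>2 / (2 * c) + (c / 2) * (norm x)\<^sup>2 - 2 * (B * (sqrt (c / 2) / sqrt (2 * c)) * norm x)"
    using c(2) by (simp add: power2_diff power_mult_distrib power_divide)
   also have "sqrt (c / 2) / sqrt (2 * c) = 1 / 2"
    using c(2) by (simp add: real_sqrt_divide real_sqrt_mult)
   finally show ?thesis using \<open>0 \<le> (B / sqrt (2 * c) - sqrt (c / 2) * norm x)\<^sup>2\<close> by simp
  qed
  then have "exp (B * norm x) \<le> exp (B\<^sup>2 / (2 * c)) * exp ((c / 2) * (norm x)\<^sup>2)"
   by (simp flip: exp_add)
  then have "A * exp (B * norm x) * norm (f x)
    \<le> \<bar>A\<bar> * (exp (B\<^sup>2 / (2 * c)) * exp ((c / 2) * (norm x)\<^sup>2)) * (C * exp (- c * (norm x)\<^sup>2))"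
   using c by (intro mult_mono) auto
  also have "\<dots> = (\<bar>A\<bar> * exp (B\<^sup>2 / (2 * c)) * C) * exp ((c / 2) * (norm x)\<^sup>2 + (- c * (norm x)\<^sup>2))"
   by (simp only: exp_add mult_ac)
  also have "(c / 2) * (norm x)\<^sup>2 + (- c * (norm x)\<^sup>2) = - (c / 2) * (norm x)\<^sup>2" by (simp add: field_simps)
  finally show ?thesis using assms(2)[of x] by linarith
 qed
 with c(2) show ?thesis unfolding gauss_bounded_def by (meson half_gt_zero)
qed

lemma one_plus_le_exp_pow: "(1 + norm x) ^ k \<le> exp (real k * norm x)"
proof -
 have "(1 + norm x) ^ k \<le> exp (norm x) ^ k" using exp_ge_add_one_self[of "norm x"] by (intro power_mono) auto
 then show ?thesis by (simp add: exp_of_nat_mult)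
qed

lemma gauss_bounded_poly_growth:
 assumes "gauss_bounded f" "\<And>x. norm (g x) \<le> A * (1 + norm x) ^ k * norm (f x)"
 shows "gauss_bounded g"
proof (rule gauss_bounded_exp_growth[OF assms(1), of g "\<bar>A\<bar>" "real k"])
 fix x
 have "A * (1 + norm x) ^ k * norm (f x) \<le> \<bar>A\<bar> * exp (real k * norm x) * norm (f x)"
  by (intro mult_mono one_plus_le_exp_pow) auto
 with assms(2)[of x] show "norm (g x) \<le> \<bar>A\<bar> * exp (real k * norm x) * norm (f x)" by linarith
qed

lemma gauss_bounded_mult:
 fixes f g :: "'a::real_normed_vector => 'b::real_normed_algebra"
 assumes "gauss_bounded f" "gauss_bounded g"
 shows "gauss_bounded (\<lambda>x. f x * g x)"
proof -
 obtain D d where d: "D > 0" "d > 0" "\<And>x. norm (g x) \<le> D * exp (- d * (norm x)\<^sup>2)"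
  using gauss_boundedE[OF assms(2)] by blast
 have "norm (g x) \<le> D" for x
 proof -
  have "D * exp (- d * (norm x)\<^sup>2) \<le> D * 1" using d by (intro mult_left_mono) auto
  with d(3)[of x] show ?thesis by simp
 qed
 then have "norm (f x * g x) \<le> D * norm (f x)" for x
  using norm_mult_ineq[of "f x" "g x"] by (metis mult.commute mult_right_mono norm_ge_zero order_trans)
 then show ?thesis by (rule gauss_bounded_mono[OF assms(1)])
qed

text \<open>By translation invariance every difference quotient of w has integral 0; the mean value
  inequality bounds the quotients by g, and dominated convergence passes the value 0 on to the
  derivative.\<close>

lemma integral_pd_eq_0:
 fixes w :: "'a::euclidean_space => 'b::{banach, second_countable_topology}"
 assumes w: "integrable lborel w" and d: "\<And>x. w differentiable (at x)"
  and m: "pd w v \<in> meas"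
  and g: "integrable lborel g" "\<And>x t. 0 \<le> t ==> t \<le> 1 ==> norm (pd w v (x + t *\<^sub>R v)) \<le> g x"
 shows "(LINT x|lborel. pd w v x) = 0"
proof -
 define q where "q n x = (1 / inverse (real (Suc n))) *\<^sub>R (w (x + inverse (real (Suc n)) *\<^sub>R v) - w x)" for n x
 have wm[measurable]: "w \<in> meas" using w by auto
 have shift: "integrable lborel (\<lambda>x. w (x + c))" "(LINT x|lborel. w (x + c)) = (LINT x|lborel. w x)" for c :: 'a
  using integrable_distr_eq[of "(+) c" lborel borel w] integral_distr[of "(+) c" lborel borel w] w
  by (simp_all add: lborel_distr_plus add.commute)
 have q0: "(LINT x|lborel. q n x) = 0" for n
  unfolding q_def using shift[of "inverse (real (Suc n)) *\<^sub>R v"] w by simp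
 have D: "((\<lambda>t. w (x + t *\<^sub>R v)) has_vector_derivative pd w v (x + t *\<^sub>R v)) (at t)" for x t
 proof -
  have w': "(w has_derivative (\<lambda>u. pd w u (x + t *\<^sub>R v))) (at (x + t *\<^sub>R v))" by (rule pd_works[OF d])
  have "((\<lambda>t. x + t *\<^sub>R v) has_derivative (\<lambda>h. h *\<^sub>R v)) (at t)" by (auto intro!: derivative_eq_intros)
  from has_derivative_compose[OF this w'] show ?thesis
   unfolding has_vector_derivative_def
   by (rule has_derivative_eq_rhs) (auto simp: linear_scale[OF has_derivative_linear[OF w']])
 qed
 have bd: "norm (q n x) \<le> g x" for n x
 proof -
  define t where "t = inverse (real (Suc n))"
  have t: "0 < t" "t \<le> 1" by (auto simp: t_def field_simps)
  have "norm (w (x + t *\<^sub>R v) - w (x + 0 *\<^sub>R v)) \<le> g x * norm (t - 0)"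
  proof (rule differentiable_bound[of "{0..t}" "\<lambda>t. w (x + t *\<^sub>R v)" "\<lambda>s h. h *\<^sub>R pd w v (x + s *\<^sub>R v)"])
   fix s assume s: "s \<in> {0..t}"
   show "((\<lambda>t. w (x + t *\<^sub>R v)) has_derivative (\<lambda>h. h *\<^sub>R pd w v (x + s *\<^sub>R v))) (at s within {0..t})"
    using D[where t=s] unfolding has_vector_derivative_def by (rule has_derivative_at_withinI)
   show "onorm (\<lambda>h. h *\<^sub>R pd w v (x + s *\<^sub>R v)) \<le> g x"
   proof (rule onorm_bound)
    show "0 \<le> g x" using g(2)[of 0 x] norm_ge_zero order_trans by (metis less_eq_real_def zero_less_one order_refl)
    show "norm (h *\<^sub>R pd w v (x + s *\<^sub>R v)) \<le> g x * norm h" for h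
     using g(2)[of s x] s t mult_right_mono[of "norm (pd w v (x + s *\<^sub>R v))" "g x" "\<bar>h\<bar>"]
     by (simp add: mult.commute)
   qed
  qed (use t in auto)
  then have "norm (w (x + t *\<^sub>R v) - w x) \<le> g x * t" using t by simp
  then show ?thesis using t unfolding q_def t_def[symmetric]
   by (simp add: pos_divide_le_eq mult.commute del: scaleR_right_diff_distrib)
 qed
 have lim: "(\<lambda>n. q n x) \<longlonglongrightarrow> pd w v x" for x
 proof -
  have "((\<lambda>t. w (x + t *\<^sub>R v)) has_vector_derivative pd w v x) (at 0)" using D[of x 0] by simp
  then have "((\<lambda>y. (w (x + y *\<^sub>R v) - w x) /\<^sub>R \<bar>y\<bar> - (y / \<bar>y\<bar>) *\<^sub>R pd w v x) \<longlongrightarrow> 0) (at 0)"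
   unfolding has_vector_derivative_def has_derivative_def by (simp add: scaleR_diff_right divide_inverse mult.commute)
  then have "((\<lambda>y. (w (x + y *\<^sub>R v) - w x) /\<^sub>R \<bar>y\<bar> - (y / \<bar>y\<bar>) *\<^sub>R pd w v x) \<longlongrightarrow> 0) (at_right 0)"
   by (rule filterlim_mono) (auto intro: at_le)
  moreover have "filterlim (\<lambda>n. inverse (real (Suc n))) (at_right 0) sequentially"
   unfolding filterlim_at using LIMSEQ_inverse_real_of_nat by auto
  ultimately have "(\<lambda>n. (w (x + inverse (real (Suc n)) *\<^sub>R v) - w x) /\<^sub>R \<bar>inverse (real (Suc n))\<bar>
    - (inverse (real (Suc n)) / \<bar>inverse (real (Suc n))\<bar>) *\<^sub>R pd w v x) \<longlonglongrightarrow> 0"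
   by (rule filterlim_compose)
  then have "(\<lambda>n. q n x - pd w v x) \<longlonglongrightarrow> 0" by (simp add: q_def divide_inverse del: of_nat_Suc)
  then show ?thesis by (simp add: LIM_zero_iff)
 qed
 have "(\<lambda>n. LINT x|lborel. q n x) \<longlonglongrightarrow> (LINT x|lborel. pd w v x)"
 proof (rule integral_dominated_convergence[where w=g])
  show "\<And>i. AE x in lborel. norm (q i x) \<le> g x" using bd by auto
  show "AE x in lborel. (\<lambda>i. q i x) \<longlonglongrightarrow> pd w v x" using lim by auto
  show "\<And>i. q i \<in> borel_measurable lborel" unfolding q_def by measurable
 qed (use m g in auto)
 then show ?thesis unfolding q0 by (simp add: LIMSEQ_const_iff)
qed

lemma integral_pd_eq_0_gauss:
 fixes w :: "'a::euclidean_space => 'b::{banach, second_countable_topology}"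
 assumes w: "gauss_bounded w" and d: "\<And>x. w differentiable (at x)"
  and g: "gauss_bounded (pd w v)" and m: "pd w v \<in> meas"
 shows "(LINT x|lborel. pd w v x) = 0"
proof -
 obtain C c where c: "C > 0" "c > 0" "\<And>x. norm (pd w v x) \<le> C * exp (- c * (norm x)\<^sup>2)"
  using gauss_boundedE[OF g] by blast
 \<comment> \<open>From |x|^2 \<le> 2 |x + t v|^2 + 2 |v|^2: half the rate together with the factor
   exp (c |v|^2) dominates the derivative along the whole segment from x to x + v.\<close>
 define G where "G x = C * exp (c * (norm v)\<^sup>2) * exp (- (c / 2) * (norm x)\<^sup>2)" for x :: 'a
 have wc: "continuous_on UNIV w"
  using d by (intro differentiable_imp_continuous_on) (auto simp: differentiable_on_def)
 show ?thesis
 proof (rule integral_pd_eq_0[OF _ d m, where g=G])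
  show "integrable lborel w"
   by (rule gauss_bounded_integrable[OF w]) (use wc borel_measurable_continuous_onI in blast)
  show "integrable lborel G"
   unfolding G_def using integrable_gaussian[of "c / 2"] c by (auto intro!: integrable_mult_right)
  fix x :: 'a and t :: real assume t: "0 \<le> t" "t \<le> 1"
  have "norm x \<le> norm (x + t *\<^sub>R v) + norm v"
  proof -
   have "norm x \<le> norm (x + t *\<^sub>R v) + norm (t *\<^sub>R v)" by (metis add_diff_cancel_right' norm_triangle_sub norm_triangle_ineq4)
   also have "norm (t *\<^sub>R v) \<le> norm v" using t by (simp add: mult_left_le_one_le)
   finally show ?thesis by simp
  qed
  then have "(norm x)\<^sup>2 \<le> (norm (x + t *\<^sub>R v) + norm v)\<^sup>2" by (intro power_mono) auto
  also have "\<dots> \<le> 2 * (norm (x + t *\<^sub>R v))\<^sup>2 + 2 * (norm v)\<^sup>2"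
   using sum_squares_bound[of "norm (x + t *\<^sub>R v)" "norm v"] by (simp add: power2_sum)
  finally have "- c * (norm (x + t *\<^sub>R v))\<^sup>2 \<le> c * (norm v)\<^sup>2 + - (c / 2) * (norm x)\<^sup>2"
   using mult_left_mono[OF _ less_imp_le[OF c(2)], of "(norm x)\<^sup>2" "2 * (norm (x + t *\<^sub>R v))\<^sup>2 + 2 * (norm v)\<^sup>2"]
   by (simp add: distrib_left)
  then have "C * exp (- c * (norm (x + t *\<^sub>R v))\<^sup>2) \<le> G x"
   unfolding G_def using c(1) by (simp flip: exp_add)
  then show "norm (pd w v (x + t *\<^sub>R v)) \<le> G x" using c(3)[of "x + t *\<^sub>R v"] by linarith
 qed
qed

text \<open>Puts compactly supported test functions into the same class as the oscillator functions,
  so that one integration by parts covers both.\<close>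

lemma gauss_bounded_bounded_support:
 fixes f :: "'a::euclidean_space => 'b::real_normed_vector"
 assumes "continuous_on UNIV f" "bounded {x. f x \<noteq> 0}"
 shows "gauss_bounded f"
proof -
 obtain R where R: "\<And>x. f x \<noteq> 0 ==> norm x \<le> R" using assms(2) by (auto simp: bounded_iff)
 have mc: "norm x \<le> R \<longleftrightarrow> x \<in> cball 0 R" for x :: 'a by simp
 have "compact (f ` cball 0 R)"
  using assms(1) by (intro compact_continuous_image) (auto intro: continuous_on_subset)
 then obtain B where B: "\<And>x. norm x \<le> R ==> norm (f x) \<le> B"
  using compact_imp_bounded[of "f ` cball 0 R"] unfolding bounded_iff mc by blast
 have "norm (f x) \<le> (\<bar>B\<bar> * exp (R\<^sup>2)) * exp (- 1 * (norm x)\<^sup>2)" for x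
 proof (cases "f x = 0")
  case False
  then have x: "norm x \<le> R" by (rule R)
  then have "(norm x)\<^sup>2 \<le> R\<^sup>2" by (intro power_mono) auto
  then have "1 \<le> exp (R\<^sup>2) * exp (- 1 * (norm x)\<^sup>2)" by (simp flip: exp_add)
  then have "\<bar>B\<bar> * 1 \<le> \<bar>B\<bar> * (exp (R\<^sup>2) * exp (- 1 * (norm x)\<^sup>2))" by (intro mult_left_mono) auto
  with B[OF x] show ?thesis by (simp add: mult.assoc)
 qed simp
 then show ?thesis unfolding gauss_bounded_def by (meson zero_less_one)
qed

section \<open>Injectivity of the Fourier transform\<close>

text \<open>Only the linear span is generated, so a linear functional is tested on cosines and sines
  alone; closure under products, which Stone-Weierstrass demands, comes from the product-to-sum
  formulas.\<close>

inductive_set trig :: "('a::euclidean_space => real) set" where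
 trig_cos: "(\<lambda>x. cos (\<xi> \<bullet> x)) \<in> trig"
| trig_sin: "(\<lambda>x. sin (\<xi> \<bullet> x)) \<in> trig"
| trig_add: "f \<in> trig ==> g \<in> trig ==> (\<lambda>x. f x + g x) \<in> trig"
| trig_scale: "f \<in> trig ==> (\<lambda>x. c * f x) \<in> trig"

lemma trig_const: "(\<lambda>x. c) \<in> trig"
 using trig_scale[OF trig_cos[of 0], of c] by simp

lemma trig_mult:
 assumes "f \<in> trig" "g \<in> trig"
 shows "(\<lambda>x. f x * g x) \<in> trig"
 using assms(1)
proof induction
 case (trig_cos \<xi>)
 show ?case using assms(2)
 proof induction
  case (trig_cos \<eta>)
  have "(\<lambda>x. cos (\<xi> \<bullet> x) * cos (\<eta> \<bullet> x)) = (\<lambda>x. (1/2) * (cos ((\<xi> - \<eta>) \<bullet> x) + cos ((\<xi> + \<eta>) \<bullet> x)))"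
   by (auto simp: cos_times_cos inner_diff_left inner_add_left)
  then show ?case by (simp only:) (intro trig.intros)
 next
  case (trig_sin \<eta>)
  have "(\<lambda>x. cos (\<xi> \<bullet> x) * sin (\<eta> \<bullet> x)) = (\<lambda>x. (1/2) * (sin ((\<xi> + \<eta>) \<bullet> x) + (-1) * sin ((\<xi> - \<eta>) \<bullet> x)))"
   by (auto simp: cos_times_sin inner_diff_left inner_add_left)
  then show ?case by (simp only:) (intro trig.intros)
 next
  case (trig_add f g)
  from trig.trig_add[OF trig_add.IH] show ?case by (simp add: algebra_simps)
 next
  case (trig_scale f c)
  from trig.trig_scale[OF trig_scale.IH, of c] show ?case by (simp add: algebra_simps)
 qed
next
 case (trig_sin \<xi>)
 show ?case using assms(2)
 proof induction
  case (trig_cos \<eta>)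
  have "(\<lambda>x. sin (\<xi> \<bullet> x) * cos (\<eta> \<bullet> x)) = (\<lambda>x. (1/2) * (sin ((\<xi> + \<eta>) \<bullet> x) + sin ((\<xi> - \<eta>) \<bullet> x)))"
   by (auto simp: sin_times_cos inner_diff_left inner_add_left)
  then show ?case by (simp only:) (intro trig.intros)
 next
  case (trig_sin \<eta>)
  have "(\<lambda>x. sin (\<xi> \<bullet> x) * sin (\<eta> \<bullet> x)) = (\<lambda>x. (1/2) * (cos ((\<xi> - \<eta>) \<bullet> x) + (-1) * cos ((\<xi> + \<eta>) \<bullet> x)))"
   by (auto simp: sin_times_sin inner_diff_left inner_add_left)
  then show ?case by (simp only:) (intro trig.intros)
 next
  case (trig_add f g)
  from trig.trig_add[OF trig_add.IH] show ?case by (simp add: algebra_simps)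
 next
  case (trig_scale f c)
  from trig.trig_scale[OF trig_scale.IH, of c] show ?case by (simp add: algebra_simps)
 qed
next
 case (trig_add f1 f2)
 from trig.trig_add[OF trig_add.IH] show ?case by (simp add: algebra_simps)
next
 case (trig_scale f c)
 from trig.trig_scale[OF trig_scale.IH, of c] show ?case by (simp add: algebra_simps)
qed

lemma trig_continuous: "f \<in> trig ==> continuous_on S f"
 by (induction rule: trig.induct) (auto intro!: continuous_intros)

lemma trig_bounded: "f \<in> trig ==> \<exists>M. \<forall>x. \<bar>f x\<bar> \<le> M"
proof (induction rule: trig.induct)
 case (trig_cos \<xi>)
 show ?case by (rule exI[of _ 1]) auto
next
 case (trig_sin \<xi>)
 show ?case by (rule exI[of _ 1]) auto
next
 case (trig_add f g)
 then obtain M N where "\<And>x. \<bar>f x\<bar> \<le> M" "\<And>x. \<bar>g x\<bar> \<le> N" by blast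
 then have "\<bar>f x + g x\<bar> \<le> M + N" for x by (meson abs_triangle_ineq add_mono order_trans)
 then show ?case by blast
next
 case (trig_scale f c)
 then obtain M where "\<And>x. \<bar>f x\<bar> \<le> M" by blast
 then have "\<bar>c * f x\<bar> \<le> \<bar>c\<bar> * M" for x by (simp add: abs_mult mult_left_mono)
 then show ?case by blast
qed

text \<open>Lets a trigonometric polynomial be truncated by means of a polynomial without leaving
  the span.\<close>

lemma trig_polynomial: "real_polynomial_function p ==> f \<in> trig ==> (\<lambda>x. p (f x)) \<in> trig"
proof (induction p rule: real_polynomial_function.induct)
 case (linear h)
 have "h s = h 1 * s" for s :: real
  using linear_scale[OF bounded_linear.linear[OF linear(1)], of s 1] by simp
 then have "(\<lambda>x. h (f x)) = (\<lambda>x. h 1 * f x)" by blast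
 then show ?case using trig_scale[OF linear(2), of "h 1"] by simp
qed (simp_all add: trig_const trig_add trig_mult)

lemma function_ring_on_trig: "compact S ==> function_ring_on trig S"
proof unfold_locales
 fix x y :: 'a assume "x \<noteq> y"
 \<comment> \<open>The length is chosen so that \<xi> . (x - y) = pi: the shifted cosine f is 1 at y
   and -1 at x.\<close>
 define \<xi> where "\<xi> = (pi / ((x - y) \<bullet> (x - y))) *\<^sub>R (x - y)"
 define f where "f z = cos (\<xi> \<bullet> z) * cos (\<xi> \<bullet> y) + sin (\<xi> \<bullet> z) * sin (\<xi> \<bullet> y)" for z
 have f: "f z = cos (\<xi> \<bullet> (z - y))" for z by (simp add: f_def cos_diff inner_diff_right)
 have "\<xi> \<bullet> (x - y) = pi" using \<open>x \<noteq> y\<close> by (simp add: \<xi>_def)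
 then have "f x \<noteq> f y" by (simp add: f)
 moreover have "f \<in> trig" unfolding f_def by (intro trig_add trig_mult trig_const trig_cos trig_sin)
 ultimately show "\<exists>f\<in>trig. f x \<noteq> f y" by blast
qed (assumption | rule trig_const | erule trig_continuous | (rule trig_add trig_mult; assumption))+

lemma integrable_mult_trig:
 fixes h :: "'a::euclidean_space => real"
 assumes "integrable lborel h" "continuous_on UNIV f" "\<And>x. \<bar>f x\<bar> \<le> M"
 shows "integrable lborel (\<lambda>x. h x * f x)"
proof (rule Bochner_Integration.integrable_bound[where f="\<lambda>x. M * h x"])
 have [measurable]: "h \<in> meas" "f \<in> meas"
  using assms(1) borel_measurable_continuous_onI[OF assms(2)] by auto
 show "(\<lambda>x. h x * f x) \<in> borel_measurable lborel" by measurable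
 have "\<bar>h x * f x\<bar> \<le> \<bar>M * h x\<bar>" for x
 proof -
  have "\<bar>h x\<bar> * \<bar>f x\<bar> \<le> \<bar>h x\<bar> * \<bar>M\<bar>" using assms(3)[of x] by (intro mult_left_mono) auto
  then show ?thesis by (simp add: abs_mult mult.commute)
 qed
 then show "AE x in lborel. norm (h x * f x) \<le> norm (M * h x)" by simp
qed (use assms in auto)

text \<open>A trigonometric polynomial that approximates \<open>f\<close> on a large ball is made globally bounded by
 composing it with a polynomial that approximates the truncation \<open>max (- B) \<circ> min B\<close>.\<close>

lemma integral_continuous_eq_0:
 fixes h :: "'a::euclidean_space => real"
 assumes h: "integrable lborel h" and 0: "\<And>f. f \<in> trig ==> (LINT x|lborel. h x * f x) = 0"
  and f: "continuous_on UNIV f" "\<And>x. \<bar>f x\<bar> \<le> B"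
 shows "(LINT x|lborel. h x * f x) = 0"
proof -
 have [measurable]: "h \<in> meas" "f \<in> meas"
  using h borel_measurable_continuous_onI[OF f(1)] by auto
 have B: "B \<ge> 0" using f(2)[of 0] by linarith
 define A where "A = (LINT x|lborel. \<bar>h x\<bar>)"
 have A: "A \<ge> 0" by (simp add: A_def)
 define tail where "tail n = (LINT x|lborel. \<bar>h x\<bar> * indicator (- cball 0 (real n)) x)" for n
 have "(\<lambda>n. tail n) \<longlonglongrightarrow> (LINT x::'a|lborel. 0)"
  unfolding tail_def
 proof (rule integral_dominated_convergence[where w="\<lambda>x. \<bar>h x\<bar>"])
  have "(\<lambda>n. \<bar>h x\<bar> * indicator (- cball 0 (real n)) x) \<longlonglongrightarrow> 0" for x
  proof (rule tendsto_eventually)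
   obtain N where "norm x \<le> real N" using real_arch_simple by blast
   then show "\<forall>\<^sub>F n in sequentially. \<bar>h x\<bar> * indicator (- cball 0 (real n)) x = 0"
    unfolding eventually_sequentially by (intro exI[of _ N]) (auto simp: indicator_def)
  qed
  then show "AE x in lborel. (\<lambda>n. \<bar>h x\<bar> * indicator (- cball 0 (real n)) x) \<longlonglongrightarrow> 0" by simp
 qed (use h in \<open>auto simp: indicator_def\<close>)
 then have tail: "tail \<longlonglongrightarrow> 0" by simp
 \<comment> \<open>On the ball the error is at most 2 \<epsilon>, which contributes 2 \<epsilon> A;
   outside, the additional error is at most 2 B + 1 on a set where |h| has integral below
   \<epsilon>.\<close>
 have main: "\<bar>LINT x|lborel. h x * f x\<bar> \<le> \<epsilon> * (2 * A + 2 * B + 1)" if \<epsilon>: "0 < \<epsilon>" "\<epsilon> < 1" for \<epsilon>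
 proof -
  obtain n where n: "tail n < \<epsilon>"
   using order_tendstoD(2)[OF tail \<epsilon>(1)] by (meson eventually_sequentially order_refl)
  define K where "K = cball (0::'a) (real n)"
  interpret R: function_ring_on trig K by (rule function_ring_on_trig) (simp add: K_def)
  obtain T where T: "T \<in> trig" "\<And>x. x \<in> K ==> \<bar>f x - T x\<bar> < \<epsilon>"
   using R.Stone_Weierstrass_basic[of f \<epsilon>] continuous_on_subset[OF f(1)] \<epsilon>(1) by auto
  obtain M where M: "\<And>x. \<bar>T x\<bar> \<le> M" using trig_bounded[OF T(1)] by blast
  define clip where "clip s = max (- B) (min B s)" for s :: real
  have "continuous_on {- M..M} clip" unfolding clip_def by (intro continuous_intros)
  then obtain p where p: "real_polynomial_function p" "\<And>s. s \<in> {- M..M} ==> \<bar>clip s - p s\<bar> < \<epsilon>"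
   using Stone_Weierstrass_real_polynomial_function[of "{- M..M}" clip \<epsilon>] \<epsilon>(1) compact_Icc by blast
  define g where "g x = p (T x)" for x
  have gt: "g \<in> trig" unfolding g_def by (rule trig_polynomial[OF p(1) T(1)])
  have clipT: "\<bar>clip (T x) - g x\<bar> < \<epsilon>" for x unfolding g_def using p(2)[of "T x"] M[of x] by (simp add: abs_le_iff)
  have bd: "\<bar>f x - g x\<bar> \<le> 2 * \<epsilon> + (2 * B + 1) * indicator (- cball 0 (real n)) x" for x
  proof (cases "x \<in> K")
   case True
   have "\<bar>f x - clip (T x)\<bar> \<le> \<bar>f x - T x\<bar>" using f(2)[of x] by (auto simp: clip_def abs_le_iff)
   then have "\<bar>f x - g x\<bar> \<le> 2 * \<epsilon>" using T(2)[OF True] clipT[of x] by linarith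
   then show ?thesis using True by (simp add: K_def indicator_def)
  next
   case False
   have "\<bar>clip (T x)\<bar> \<le> B" using B by (auto simp: clip_def)
   then have "\<bar>f x - g x\<bar> \<le> 2 * B + 1" using f(2)[of x] clipT[of x] \<epsilon> by linarith
   then show ?thesis using False \<epsilon> by (simp add: K_def indicator_def)
  qed
  obtain G where G: "\<And>x. \<bar>g x\<bar> \<le> G" using trig_bounded[OF gt] by blast
  have ig: "integrable lborel (\<lambda>x. h x * g x)"
   by (rule integrable_mult_trig[OF h trig_continuous[OF gt] G])
  have if': "integrable lborel (\<lambda>x. h x * f x)" by (rule integrable_mult_trig[OF h f])
  have it: "integrable lborel (\<lambda>x. \<bar>h x\<bar> * indicator (- cball 0 (real n)) x)"
   by (rule Bochner_Integration.integrable_bound[OF h]) (auto simp: indicator_def)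
  have "(LINT x|lborel. h x * f x) = (LINT x|lborel. h x * (f x - g x))"
   using 0[OF gt] ig if' by (simp add: right_diff_distrib)
  also have "\<bar>\<dots>\<bar> \<le> (LINT x|lborel. \<bar>h x * (f x - g x)\<bar>)" by (rule integral_abs_bound)
  also have "\<dots> \<le> (LINT x|lborel. 2 * \<epsilon> * \<bar>h x\<bar> + (2 * B + 1) * (\<bar>h x\<bar> * indicator (- cball 0 (real n)) x))"
  proof (rule integral_mono)
   show "integrable lborel (\<lambda>x. \<bar>h x * (f x - g x)\<bar>)" using ig if' by (auto simp: right_diff_distrib)
   show "integrable lborel (\<lambda>x. 2 * \<epsilon> * \<bar>h x\<bar> + (2 * B + 1) * (\<bar>h x\<bar> * indicator (- cball 0 (real n)) x))"
    using h it by auto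
   show "\<bar>h x * (f x - g x)\<bar> \<le> 2 * \<epsilon> * \<bar>h x\<bar> + (2 * B + 1) * (\<bar>h x\<bar> * indicator (- cball 0 (real n)) x)" for x
    using mult_left_mono[OF bd[of x], of "\<bar>h x\<bar>"] unfolding abs_mult by (simp add: distrib_left mult_ac)
  qed
  also have "\<dots> = 2 * \<epsilon> * A + (2 * B + 1) * tail n"
   using h it by (simp add: A_def tail_def)
  also have "\<dots> \<le> 2 * \<epsilon> * A + (2 * B + 1) * \<epsilon>" using n B by (simp add: mult_left_mono)
  finally show ?thesis by (simp add: algebra_simps)
 qed
 have "\<bar>LINT x|lborel. h x * f x\<bar> \<le> 0"
 proof (rule field_le_epsilon)
  fix e :: real assume e: "e > 0"
  define Q where "Q = 2 * A + 2 * B + 1"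
  have Q: "Q > 0" using A B by (simp add: Q_def)
  define \<epsilon> where "\<epsilon> = min (e / Q) (1 / 2)"
  have "0 < \<epsilon>" "\<epsilon> < 1" "\<epsilon> \<le> e / Q" using e Q by (auto simp: \<epsilon>_def)
  moreover from this(3) have "\<epsilon> * Q \<le> e" using Q by (simp only: pos_le_divide_eq)
  ultimately show "\<bar>LINT x|lborel. h x * f x\<bar> \<le> 0 + e" using main[of \<epsilon>] by (simp add: Q_def)
 qed
 then show ?thesis by simp
qed

text \<open>Continuous functions decreasing to the indicator of a closed set show that h has
  integral 0 over closed sets. These are stable under intersection and generate the Borel sets, so h
  has integral 0 over every Borel set.\<close>

lemma AE_eq_0_of_trig:
 fixes h :: "'a::euclidean_space => real"
 assumes h: "integrable lborel h" and 0: "\<And>f. f \<in> trig ==> (LINT x|lborel. h x * f x) = 0"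
 shows "AE x in lborel. h x = 0"
proof (rule sigma_finite_measure.density_zero[OF sigma_finite_lborel h])
 have [measurable]: "h \<in> meas" using h by auto
 have iA: "integrable lborel (\<lambda>x. indicator A x * h x)" if "A \<in> sets borel" for A
  using that by (intro Bochner_Integration.integrable_bound[OF h]) (auto simp: indicator_def)
 have cl: "(LINT x|lborel. indicator C x * h x) = 0" if C: "closed C" for C :: "'a set"
 proof (cases "C = {}")
  case False
  define f where "f n x = max 0 (1 - real n * infdist x C)" for n x
  have "(\<lambda>n. LINT x|lborel. h x * f n x) \<longlonglongrightarrow> (LINT x|lborel. h x * indicator C x)"
  proof (rule integral_dominated_convergence[where w="\<lambda>x. \<bar>h x\<bar>"])
   have "(\<lambda>n. f n x) \<longlonglongrightarrow> indicator C x" for x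
   proof (cases "x \<in> C")
    case True
    then show ?thesis by (simp add: f_def)
   next
    case xC: False
    then have p: "infdist x C > 0"
     using C False in_closed_iff_infdist_zero[of C x] infdist_nonneg[of x C] by linarith
    obtain N where N: "1 \<le> real N * infdist x C" using reals_Archimedean3[OF p] less_imp_le by metis
    have "f n x = 0" if "n \<ge> N" for n
    proof -
     have "real N * infdist x C \<le> real n * infdist x C" using that p by (intro mult_right_mono) auto
     then show ?thesis using N by (simp add: f_def)
    qed
    then show ?thesis using xC by (intro tendsto_eventually) (auto simp: eventually_sequentially indicator_def)
   qed
   then show "AE x in lborel. (\<lambda>n. h x * f n x) \<longlonglongrightarrow> h x * indicator C x" by (auto intro!: tendsto_intros)
   have "\<bar>f n x\<bar> \<le> 1" for n x using infdist_nonneg[of x C] by (auto simp: f_def)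
   then show "\<And>n. AE x in lborel. norm (h x * f n x) \<le> \<bar>h x\<bar>" by (simp add: abs_mult mult_left_le)
   show "\<And>n. (\<lambda>x. h x * f n x) \<in> borel_measurable lborel"
   proof -
    fix n
    have "continuous_on UNIV (f n)" unfolding f_def by (intro continuous_intros)
    then show "(\<lambda>x. h x * f n x) \<in> borel_measurable lborel"
     using borel_measurable_continuous_onI[of "f n"] by auto
   qed
   show "(\<lambda>x. h x * indicator C x) \<in> borel_measurable lborel" using C by auto
  qed (use h in auto)
  moreover have "(LINT x|lborel. h x * f n x) = 0" for n
  proof (rule integral_continuous_eq_0[OF h 0])
   show "continuous_on UNIV (f n)" unfolding f_def by (intro continuous_intros)
   show "\<bar>f n x\<bar> \<le> 1" for x using infdist_nonneg[of x C] by (auto simp: f_def)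
  qed
  ultimately show ?thesis by (simp add: LIMSEQ_const_iff mult.commute)
 qed simp
 fix A :: "'a set" assume "A \<in> sets lborel"
 then have A: "A \<in> sigma_sets UNIV (Collect closed)" by (simp add: borel_eq_closed)
 have "Int_stable (Collect closed :: 'a set set)" by (auto simp: Int_stable_def)
 moreover have "(Collect closed :: 'a set set) \<subseteq> Pow UNIV" by simp
 ultimately have "(LINT x|lborel. indicator A x * h x) = 0" using A
 proof (induction rule: sigma_sets_induct_disjoint)
  case (basic A)
  then show ?case using cl by simp
 next
  case (compl A)
  then have A: "A \<in> sets borel" by (simp add: borel_eq_closed)
  have "indicator (UNIV - A) x * h x = indicator UNIV x * h x - indicator A x * h x" for x by (simp add: indicator_def)
  then show ?case using compl cl[of UNIV] iA[OF A] h by simp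
 next
  case (union A)
  then have A: "A i \<in> sets borel" for i by (auto simp: borel_eq_closed)
  have "set_lebesgue_integral lborel (\<Union>i. A i) h = (\<Sum>i. set_lebesgue_integral lborel (A i) h)"
  proof (rule lebesgue_integral_countable_add)
   show "set_integrable lborel (\<Union>i. A i) h" using iA[of "\<Union>i. A i"] A by (auto simp: set_integrable_def)
  qed (use A union in \<open>auto simp: disjoint_family_on_def\<close>)
  then show ?case using union by (simp add: set_lebesgue_integral_def)
 qed simp
 then show "set_lebesgue_integral lborel A h = 0" by (simp add: set_lebesgue_integral_def)
qed

text \<open>The values at \<xi> and -\<xi> combine to cosine and sine integrals; the real case then
  applies to the real and the imaginary part of h separately.\<close>

lemma AE_eq_0_of_fourier:
 fixes h :: "'a::euclidean_space => complex"
 assumes h: "integrable lborel h" and 0: "\<And>\<xi>. (LINT x|lborel. h x * exp (\<i> * of_real (\<xi> \<bullet> x))) = 0"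
 shows "AE x in lborel. h x = 0"
proof -
 have ic: "integrable lborel (\<lambda>x. h x * exp (\<i> * of_real (\<xi> \<bullet> x)))" for \<xi>
  by (rule Bochner_Integration.integrable_bound[OF h]) (use h in \<open>auto simp: norm_mult\<close>)
 have cos: "(LINT x|lborel. h x * of_real (cos (\<xi> \<bullet> x))) = 0" for \<xi>
 proof -
  have "h x * of_real (cos (\<xi> \<bullet> x)) = (1/2) * (h x * exp (\<i> * of_real (\<xi> \<bullet> x)) + h x * exp (\<i> * of_real ((- \<xi>) \<bullet> x)))" for x
   by (simp add: cos_exp_eq cos_of_real[symmetric] algebra_simps)
  then show ?thesis using 0[of \<xi>] 0[of "- \<xi>"] ic[of \<xi>] ic[of "- \<xi>"] by (simp only:) simp
 qed
 have sin: "(LINT x|lborel. h x * of_real (sin (\<xi> \<bullet> x))) = 0" for \<xi>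
 proof -
  have "h x * of_real (sin (\<xi> \<bullet> x)) = (1/(2*\<i>)) * (h x * exp (\<i> * of_real (\<xi> \<bullet> x)) - h x * exp (\<i> * of_real ((- \<xi>) \<bullet> x)))" for x
   by (simp add: sin_exp_eq sin_of_real[symmetric] algebra_simps diff_divide_distrib)
  then show ?thesis using 0[of \<xi>] 0[of "- \<xi>"] ic[of \<xi>] ic[of "- \<xi>"] by (simp only:) simp
 qed
 have im: "integrable lborel (\<lambda>x. h x * of_real (f x))" if "f \<in> trig" for f
 proof -
  obtain M where M: "\<And>x. \<bar>f x\<bar> \<le> M" using trig_bounded[OF \<open>f \<in> trig\<close>] by blast
  have M': "norm (h x * of_real (f x)) \<le> norm (of_real M * h x)" for x
   using mult_right_mono[OF order_trans[OF M abs_ge_self], of "norm (h x)" x]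
   by (simp add: norm_mult mult.commute)
  have [measurable]: "h \<in> meas" "f \<in> meas"
   using h borel_measurable_continuous_onI[OF trig_continuous[OF that]] by auto
  show ?thesis
  proof (rule Bochner_Integration.integrable_bound)
   show "integrable lborel (\<lambda>x. of_real M * h x)" using h by simp
   show "AE x in lborel. norm (h x * of_real (f x)) \<le> norm (of_real M * h x)" using M' by simp
  qed measurable
 qed
 have z: "(LINT x|lborel. h x * of_real (f x)) = 0" if "f \<in> trig" for f
  using that
 proof induction
  case (trig_add f g)
  then show ?case using im by (simp add: distrib_left)
 next
  case (trig_scale f c)
  have "h x * complex_of_real (c * f x) = of_real c * (h x * of_real (f x))" for x by simp
  then show ?case using trig_scale by (simp only:) simp
 qed (use sin cos in auto)
 have "AE x in lborel. Re (h x) = 0"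
 proof (rule AE_eq_0_of_trig)
  fix f :: "'a => real" assume "f \<in> trig"
  from integral_Re[OF im[OF this]] show "(LINT x|lborel. Re (h x) * f x) = 0" by (simp add: z[OF \<open>f \<in> trig\<close>])
 qed (use h in simp)
 moreover have "AE x in lborel. Im (h x) = 0"
 proof (rule AE_eq_0_of_trig)
  fix f :: "'a => real" assume "f \<in> trig"
  from integral_Im[OF im[OF this]] show "(LINT x|lborel. Im (h x) * f x) = 0" by (simp add: z[OF \<open>f \<in> trig\<close>])
 qed (use h in simp)
 ultimately show ?thesis by eventually_elim (simp add: complex_eq_iff)
qed

section \<open>The Hilbert space of square integrable functions\<close>

lemma norm_vec_power2: "(norm (a :: complex ^ 'r::finite))\<^sup>2 = (\<Sum>j\<in>UNIV. (cmod (a $ j))\<^sup>2)"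
 by (simp add: norm_vec_def L2_set_def sum_nonneg)

lemma cinner_self: "cinner a a = of_real ((norm a)\<^sup>2)"
 by (simp add: cinner_def norm_vec_power2 complex_norm_square flip: of_real_power)

lemma cinner_cnj: "cnj (cinner a b) = cinner b a"
 by (simp add: cinner_def mult.commute)

lemma cinner_add_left: "cinner (a + b) c = cinner a c + cinner b c"
 by (simp add: cinner_def distrib_right sum.distrib)

lemma cinner_add_right: "cinner c (a + b) = cinner c a + cinner c b"
 by (simp add: cinner_def distrib_left sum.distrib)

lemma cinner_scale_left: "cinner (z *s a) b = z * cinner a b"
 by (simp add: cinner_def sum_distrib_left mult.assoc)

lemma cinner_scale_right: "cinner a (z *s b) = cnj z * cinner a b"
 by (simp add: cinner_def sum_distrib_left mult.left_commute)

lemma cinner_scaleR_left: "cinner (z *\<^sub>R a) b = z *\<^sub>R cinner a b"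
 by (simp add: cinner_def scaleR_sum_right)

lemma cinner_scaleR_right: "cinner a (z *\<^sub>R b) = z *\<^sub>R cinner a b"
 by (simp add: cinner_def scaleR_sum_right)

lemma cinner_0: "cinner 0 a = 0" "cinner a 0 = 0"
 by (simp_all add: cinner_def)

lemma cinner_minus_left: "cinner (- a) b = - cinner a b"
 by (simp add: cinner_def sum_negf)

lemma cinner_diff_left: "cinner (a - b) c = cinner a c - cinner b c"
 by (simp add: cinner_def left_diff_distrib sum_subtractf)

lemma cinner_sum_left: "cinner (\<Sum>i\<in>I. f i) c = (\<Sum>i\<in>I. cinner (f i) c)"
 by (induction I rule: infinite_finite_induct) (auto simp: cinner_0 cinner_add_left)

lemma norm_cinner_le: "cmod (cinner a b) \<le> norm a * norm b"
proof -
 have "cmod (cinner a b) \<le> (\<Sum>j\<in>UNIV. \<bar>cmod (a $ j)\<bar> * \<bar>cmod (b $ j)\<bar>)"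
  unfolding cinner_def by (rule order_trans[OF norm_sum]) (simp add: norm_mult)
 also have "\<dots> \<le> L2_set (\<lambda>j. cmod (a $ j)) UNIV * L2_set (\<lambda>j. cmod (b $ j)) UNIV" by (rule L2_set_mult_ineq)
 finally show ?thesis by (simp add: norm_vec_def)
qed

lemma norm_vscale: "norm (z *s a) = cmod z * norm (a :: complex ^ 'r::finite)"
proof -
 have "(norm (z *s a))\<^sup>2 = (cmod z * norm a)\<^sup>2"
  by (simp add: norm_vec_power2 norm_mult power_mult_distrib sum_distrib_left)
 then show ?thesis by simp
qed

lemma bounded_bilinear_cinner: "bounded_bilinear cinner"
 by (rule bounded_bilinear.intro)
  (auto simp: cinner_add_left cinner_add_right cinner_scaleR_left cinner_scaleR_right intro!: exI[of _ 1] norm_cinner_le)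

lemma bounded_bilinear_vscale: "bounded_bilinear (\<lambda>z (a :: complex ^ 'r::finite). z *s a)"
 by (rule bounded_bilinear.intro)
  (auto simp: vec_eq_iff distrib_left distrib_right norm_vscale intro!: exI[of _ 1])

lemma borel_measurable_cinner[measurable]:
 "f \<in> borel_measurable M ==> g \<in> borel_measurable M ==> (\<lambda>x. cinner (f x) (g x)) \<in> borel_measurable M"
 by (rule borel_measurable_continuous_Pair[where H=cinner])
  (auto intro!: bounded_bilinear.continuous_on[OF bounded_bilinear_cinner] continuous_intros)

lemma borel_measurable_vscale[measurable]:
 fixes g :: "'a => complex ^ 'r::finite"
 shows "f \<in> borel_measurable M ==> g \<in> borel_measurable M ==> (\<lambda>x. f x *s g x) \<in> borel_measurable M"
 by (rule borel_measurable_continuous_Pair[where H="(*s)"])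
  (auto intro!: bounded_bilinear.continuous_on[OF bounded_bilinear_vscale] continuous_intros)

lemma integrable_of_norm_le:
 fixes f :: "'a::euclidean_space => 'b::{banach, second_countable_topology}"
 assumes "integrable lborel g" "f \<in> meas" "\<And>x. norm (f x) \<le> g x"
 shows "integrable lborel f"
 by (rule Bochner_Integration.integrable_bound[OF assms(1)])
  (simp_all add: assms(2) order_trans[OF assms(3) abs_ge_self])

section \<open>The inner product of square integrable functions\<close>

definition L2_inner :: "(real ^ 'd::finite => complex ^ 'r::finite) => (real ^ 'd => complex ^ 'r) => complex" where
 "L2_inner u w = (LINT x|lborel. cinner (u x) (w x))"

abbreviation L2_lim :: "(nat => real ^ 'd::finite => complex ^ 'r::finite) => (real ^ 'd => complex ^ 'r) => bool" where
 "L2_lim s u \<equiv> (\<lambda>n. L2_nrm (\<lambda>x. s n x - u x)) \<longlonglongrightarrow> 0"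

lemma L2_funD: "u \<in> L2_fun ==> u \<in> meas" "u \<in> L2_fun ==> integrable lborel (\<lambda>x. (norm (u x))\<^sup>2)"
 by (auto simp: L2_fun_def)

lemma norm_mult_norm_le: "norm a * norm b \<le> (norm a)\<^sup>2 + (norm b)\<^sup>2"
proof -
 have "norm a * norm b \<le> 2 * norm a * norm b" by simp
 then show ?thesis using sum_squares_bound[of "norm a" "norm b"] by linarith
qed

lemma L2_fun_bound:
 assumes "u \<in> L2_fun" "w \<in> meas" "\<And>x. norm (w x) \<le> C * norm (u x)"
 shows "w \<in> L2_fun"
proof -
 have "(norm (w x))\<^sup>2 \<le> C\<^sup>2 * (norm (u x))\<^sup>2" for x
  using power_mono[OF assms(3)[of x] norm_ge_zero, of 2] by (simp add: power_mult_distrib)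
 then have "integrable lborel (\<lambda>x. (norm (w x))\<^sup>2)"
  by (intro integrable_of_norm_le[OF integrable_mult_right[OF L2_funD(2)[OF assms(1)], of "C\<^sup>2"]])
   (use assms(2) in simp_all)
 with assms(2) show ?thesis by (simp add: L2_fun_def)
qed

lemma L2_fun_scale: "u \<in> L2_fun ==> (\<lambda>x. z *s u x) \<in> L2_fun"
 by (rule L2_fun_bound[where C="cmod z"]) (auto simp: norm_vscale dest: L2_funD)

lemma L2_fun_minus: "u \<in> L2_fun ==> (\<lambda>x. - u x) \<in> L2_fun"
 by (rule L2_fun_bound[where C=1]) (auto dest: L2_funD)

lemma L2_fun_0: "(\<lambda>x. 0) \<in> L2_fun"
 by (simp add: L2_fun_def)

lemma L2_fun_add:
 assumes "u \<in> L2_fun" "w \<in> L2_fun"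
 shows "(\<lambda>x. u x + w x) \<in> L2_fun"
proof -
 have "(norm (u x + w x))\<^sup>2 \<le> 2 * (norm (u x))\<^sup>2 + 2 * (norm (w x))\<^sup>2" for x
 proof -
  have "(norm (u x + w x))\<^sup>2 \<le> (norm (u x) + norm (w x))\<^sup>2" by (intro power_mono norm_triangle_ineq) auto
  also have "\<dots> \<le> 2 * (norm (u x))\<^sup>2 + 2 * (norm (w x))\<^sup>2"
   using sum_squares_bound[of "norm (u x)" "norm (w x)"] by (simp add: power2_sum)
  finally show ?thesis .
 qed
 note le = this
 have [measurable]: "u \<in> meas" "w \<in> meas"
  using assms[THEN L2_funD(1)] by auto
 have "integrable lborel (\<lambda>x. (norm (u x + w x))\<^sup>2)"
 proof (rule integrable_of_norm_le)
  show "integrable lborel (\<lambda>x. 2 * (norm (u x))\<^sup>2 + 2 * (norm (w x))\<^sup>2)"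
   by (intro Bochner_Integration.integrable_add integrable_mult_right L2_funD(2) assms)
 qed (use le in \<open>measurable, simp\<close>)
 then show ?thesis using assms[THEN L2_funD(1)] by (simp add: L2_fun_def)
qed

lemma L2_fun_diff: "u \<in> L2_fun ==> w \<in> L2_fun ==> (\<lambda>x. u x - w x) \<in> L2_fun"
 using L2_fun_add[of u "\<lambda>x. - w x"] L2_fun_minus[of w] by simp

lemma L2_fun_sum: "(\<And>i. i \<in> I ==> f i \<in> L2_fun) ==> (\<lambda>x. \<Sum>i\<in>I. f i x) \<in> L2_fun"
 by (induction I rule: infinite_finite_induct) (auto simp: L2_fun_0 intro: L2_fun_add)

lemma integrable_norm_mult_norm:
 assumes "u \<in> L2_fun" "w \<in> L2_fun"
 shows "integrable lborel (\<lambda>x. norm (u x) * norm (w x))"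
proof (rule integrable_of_norm_le)
 have [measurable]: "u \<in> meas" "w \<in> meas"
  using assms[THEN L2_funD(1)] by auto
 show "integrable lborel (\<lambda>x. (norm (u x))\<^sup>2 + (norm (w x))\<^sup>2)"
  by (intro Bochner_Integration.integrable_add L2_funD(2) assms)
 show "norm (norm (u x) * norm (w x)) \<le> (norm (u x))\<^sup>2 + (norm (w x))\<^sup>2" for x by (simp add: norm_mult_norm_le)
 show "(\<lambda>x. norm (u x) * norm (w x)) \<in> meas" by measurable
qed

lemma integrable_cinner:
 assumes "u \<in> L2_fun" "w \<in> L2_fun"
 shows "integrable lborel (\<lambda>x. cinner (u x) (w x))"
 by (rule integrable_of_norm_le[OF integrable_norm_mult_norm[OF assms] _ norm_cinner_le])
  (use assms[THEN L2_funD(1)] in measurable)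

lemma L2_nrm_nonneg: "L2_nrm u \<ge> 0"
 by (simp add: L2_nrm_def)

lemma L2_nrm_power2: "(L2_nrm u)\<^sup>2 = (LINT x|lborel. (norm (u x))\<^sup>2)"
 by (simp add: L2_nrm_def)

lemma L2_inner_self: "L2_inner u u = of_real ((L2_nrm u)\<^sup>2)"
 by (simp add: L2_inner_def cinner_self L2_nrm_power2 del: of_real_power)

lemma L2_inner_cnj: "cnj (L2_inner u w) = L2_inner w u"
 by (simp add: L2_inner_def cinner_cnj flip: Bochner_Integration.integral_cnj)

lemma L2_inner_add_left:
 "u \<in> L2_fun ==> u' \<in> L2_fun ==> w \<in> L2_fun ==> L2_inner (\<lambda>x. u x + u' x) w = L2_inner u w + L2_inner u' w"
 by (simp add: L2_inner_def cinner_add_left integrable_cinner)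

lemma L2_inner_diff_left:
 "u \<in> L2_fun ==> u' \<in> L2_fun ==> w \<in> L2_fun ==> L2_inner (\<lambda>x. u x - u' x) w = L2_inner u w - L2_inner u' w"
 by (simp add: L2_inner_def cinner_diff_left integrable_cinner)

lemma L2_inner_scale_left: "L2_inner (\<lambda>x. z *s u x) w = z * L2_inner u w"
 by (simp add: L2_inner_def cinner_scale_left)

lemma L2_inner_scale_right: "L2_inner u (\<lambda>x. z *s w x) = cnj z * L2_inner u w"
 by (simp add: L2_inner_def cinner_scale_right)

lemma L2_inner_0: "L2_inner (\<lambda>x. 0) w = 0" "L2_inner w (\<lambda>x. 0) = 0"
 by (simp_all add: L2_inner_def cinner_0)

lemma L2_inner_sum_left:
 "(\<And>i. i \<in> I ==> f i \<in> L2_fun) ==> w \<in> L2_fun ==>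
  L2_inner (\<lambda>x. \<Sum>i\<in>I. f i x) w = (\<Sum>i\<in>I. L2_inner (f i) w)"
 by (induction I rule: infinite_finite_induct) (auto simp: L2_inner_0 L2_inner_add_left L2_fun_sum)

lemma ennreal_L2_nrm_power2:
 assumes "u \<in> L2_fun"
 shows "ennreal ((L2_nrm u)\<^sup>2) = (\<integral>\<^sup>+x. ennreal ((norm (u x))\<^sup>2) \<partial>lborel)"
 unfolding L2_nrm_power2 by (rule nn_integral_eq_integral[symmetric]) (use L2_funD(2)[OF assms] in auto)

lemma L2_inner_le:
 assumes u: "u \<in> L2_fun" and w: "w \<in> L2_fun"
 shows "cmod (L2_inner u w) \<le> L2_nrm u * L2_nrm w"
proof (rule power2_le_imp_le)
 have [measurable]: "u \<in> meas" "w \<in> meas"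
  using assms[THEN L2_funD(1)] by auto
 note uw = integrable_norm_mult_norm[OF u w]
 let ?I = "LINT x|lborel. norm (u x) * norm (w x)"
 have "cmod (L2_inner u w) \<le> (LINT x|lborel. cmod (cinner (u x) (w x)))"
  unfolding L2_inner_def by (rule integral_norm_bound)
 also have "\<dots> \<le> ?I"
  using integrable_cinner[OF u w] uw norm_cinner_le by (intro integral_mono) auto
 finally have 1: "(cmod (L2_inner u w))\<^sup>2 \<le> ?I\<^sup>2" by (intro power_mono) auto
 have "ennreal (?I\<^sup>2) = (\<integral>\<^sup>+x. ennreal (norm (u x)) * ennreal (norm (w x)) \<partial>lborel)\<^sup>2"
  using nn_integral_eq_integral[OF uw] by (simp add: ennreal_mult flip: ennreal_power)
 also have "\<dots> \<le> (\<integral>\<^sup>+x. (ennreal (norm (u x)))\<^sup>2 \<partial>lborel) * (\<integral>\<^sup>+x. (ennreal (norm (w x)))\<^sup>2 \<partial>lborel)"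
  by (rule Cauchy_Schwarz_nn_integral) measurable
 also have "\<dots> = ennreal ((L2_nrm u * L2_nrm w)\<^sup>2)"
  by (simp add: ennreal_power ennreal_L2_nrm_power2[symmetric] assms ennreal_mult power_mult_distrib)
 finally have "?I\<^sup>2 \<le> (L2_nrm u * L2_nrm w)\<^sup>2" by simp
 with 1 show "(cmod (L2_inner u w))\<^sup>2 \<le> (L2_nrm u * L2_nrm w)\<^sup>2" by linarith
qed (simp add: L2_nrm_nonneg)

lemma L2_nrm_scale: "L2_nrm (\<lambda>x. z *s u x) = cmod z * L2_nrm u"
 by (simp add: L2_nrm_def norm_vscale power_mult_distrib real_sqrt_mult)

lemma L2_nrm_diff_commute: "L2_nrm (\<lambda>x. u x - w x) = L2_nrm (\<lambda>x. w x - u x)"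
 by (simp add: L2_nrm_def norm_minus_commute)

lemma L2_nrm_triangle:
 assumes u: "u \<in> L2_fun" and w: "w \<in> L2_fun"
 shows "L2_nrm (\<lambda>x. u x + w x) \<le> L2_nrm u + L2_nrm w"
proof -
 have "(norm (u x + w x))\<^sup>2 = (norm (u x))\<^sup>2 + (norm (w x))\<^sup>2 + 2 * Re (cinner (u x) (w x))" for x
 proof -
  have "complex_of_real ((norm (u x + w x))\<^sup>2) = cinner (u x) (u x) + cinner (w x) (w x) + (cinner (u x) (w x) + cnj (cinner (u x) (w x)))"
   unfolding cinner_self[symmetric] cinner_cnj by (simp add: cinner_add_left cinner_add_right)
  then have "complex_of_real ((norm (u x + w x))\<^sup>2) = of_real ((norm (u x))\<^sup>2 + (norm (w x))\<^sup>2 + 2 * Re (cinner (u x) (w x)))"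
   by (simp add: cinner_self complex_add_cnj)
  then show ?thesis by (simp only: of_real_eq_iff)
 qed
 then have "(L2_nrm (\<lambda>x. u x + w x))\<^sup>2 = (L2_nrm u)\<^sup>2 + (L2_nrm w)\<^sup>2 + 2 * Re (L2_inner u w)"
  using integrable_cinner[OF u w] assms[THEN L2_funD(2)] by (simp add: L2_nrm_power2 L2_inner_def integral_Re)
 also have "Re (L2_inner u w) \<le> L2_nrm u * L2_nrm w"
  using L2_inner_le[OF u w] complex_Re_le_cmod order_trans by blast
 finally have "(L2_nrm (\<lambda>x. u x + w x))\<^sup>2 \<le> (L2_nrm u + L2_nrm w)\<^sup>2" by (simp add: power2_sum)
 then show ?thesis using L2_nrm_nonneg by (meson add_nonneg_nonneg power2_le_imp_le)
qed

lemma L2_nrm_triangle_diff: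
 assumes "u \<in> L2_fun" "w \<in> L2_fun" "z \<in> L2_fun"
 shows "L2_nrm (\<lambda>x. u x - z x) \<le> L2_nrm (\<lambda>x. u x - w x) + L2_nrm (\<lambda>x. w x - z x)"
 using L2_nrm_triangle[OF L2_fun_diff[OF assms(1,2)] L2_fun_diff[OF assms(2,3)]] by simp

lemma L2_nrm_eq_0_iff:
 assumes "u \<in> L2_fun"
 shows "L2_nrm u = 0 \<longleftrightarrow> (AE x in lborel. u x = 0)"
 unfolding L2_nrm_def using integral_nonneg_eq_0_iff_AE[OF L2_funD(2)[OF assms]] by simp

lemma L2_nrm_cong_AE:
 assumes "u \<in> meas" "w \<in> meas" "AE x in lborel. u x = w x"
 shows "L2_nrm u = L2_nrm w"
 unfolding L2_nrm_def using assms by (intro arg_cong[where f=sqrt] integral_cong_AE) auto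

lemma L2_inner_cong_AE:
 assumes "u \<in> meas" "w \<in> meas" "z \<in> meas" "AE x in lborel. u x = w x"
 shows "L2_inner u z = L2_inner w z"
 unfolding L2_inner_def using assms by (intro integral_cong_AE) auto

lemma L2_inner_tendsto:
 assumes "\<And>n. s n \<in> L2_fun" "u \<in> L2_fun" "w \<in> L2_fun" "L2_lim s u"
 shows "(\<lambda>n. L2_inner (s n) w) \<longlonglongrightarrow> L2_inner u w"
proof (rule Lim_null[THEN iffD2])
 show "(\<lambda>n. L2_inner (s n) w - L2_inner u w) \<longlonglongrightarrow> 0"
 proof (rule Lim_null_comparison)
  show "\<forall>\<^sub>F n in sequentially. norm (L2_inner (s n) w - L2_inner u w) \<le> L2_nrm (\<lambda>x. s n x - u x) * L2_nrm w"
   using L2_inner_le[OF L2_fun_diff[OF assms(1,2)] assms(3)] assms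
   by (intro always_eventually allI) (simp add: L2_inner_diff_left)
  show "(\<lambda>n. L2_nrm (\<lambda>x. s n x - u x) * L2_nrm w) \<longlonglongrightarrow> 0" using tendsto_mult_right[OF assms(4), of "L2_nrm w"] by simp
 qed
qed

text \<open>The weights 4^k sit between two geometric scales: \<Sum> 4^k |d_k|^2 still has integral
  at most \<Sum> 2^(-k), yet boundedness of 4^k |d_k(x)|^2 at a point x already forces |d_k(x)| to
  decay like 2^(-k).\<close>

lemma L2_AE_convergent:
 assumes d: "\<And>k. d k \<in> L2_fun" and b: "\<And>k. (L2_nrm (d k))\<^sup>2 \<le> (1 / 8) ^ k"
 shows "AE x in lborel. summable (\<lambda>k. d k x)"
proof -
 have [measurable]: "d k \<in> meas" for k using d by (rule L2_funD)
 have "(\<integral>\<^sup>+x. (\<Sum>k. ennreal (4 ^ k * (norm (d k x))\<^sup>2)) \<partial>lborel) = (\<Sum>k. \<integral>\<^sup>+x. ennreal (4 ^ k * (norm (d k x))\<^sup>2) \<partial>lborel)"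
  by (rule nn_integral_suminf) measurable
 also have "\<dots> \<le> (\<Sum>k. ennreal ((1 / 2) ^ k))"
 proof (rule suminf_le)
  fix k
  have "(\<integral>\<^sup>+x. ennreal (4 ^ k * (norm (d k x))\<^sup>2) \<partial>lborel) = ennreal (4 ^ k) * (\<integral>\<^sup>+x. ennreal ((norm (d k x))\<^sup>2) \<partial>lborel)"
   by (simp add: ennreal_mult nn_integral_cmult)
  also have "\<dots> = ennreal (4 ^ k * (L2_nrm (d k))\<^sup>2)"
   by (simp add: ennreal_L2_nrm_power2[OF d, symmetric] ennreal_mult)
  also have "\<dots> \<le> ennreal (4 ^ k * (1 / 8) ^ k)" by (intro ennreal_leI mult_left_mono b) auto
  also have "(4::real) ^ k * (1 / 8) ^ k = (1 / 2) ^ k" by (simp flip: power_mult_distrib)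
  finally show "(\<integral>\<^sup>+x. ennreal (4 ^ k * (norm (d k x))\<^sup>2) \<partial>lborel) \<le> ennreal ((1 / 2) ^ k)" .
 qed auto
 also have "\<dots> = ennreal (\<Sum>k. (1 / 2) ^ k)" by (rule suminf_ennreal2) auto
 also have "\<dots> < \<infinity>" by simp
 finally have "AE x in lborel. (\<Sum>k. ennreal (4 ^ k * (norm (d k x))\<^sup>2)) \<noteq> \<infinity>"
  by (intro nn_integral_PInf_AE) auto
 then show ?thesis
 proof eventually_elim
  fix x assume "(\<Sum>k. ennreal (4 ^ k * (norm (d k x))\<^sup>2)) \<noteq> \<infinity>"
  then have "summable (\<lambda>k. 4 ^ k * (norm (d k x))\<^sup>2)" by (intro summable_suminf_not_top) auto
  then have "bounded (range (\<lambda>k. 4 ^ k * (norm (d k x))\<^sup>2))"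
   using summable_LIMSEQ_zero convergent_imp_bounded by blast
  then obtain B where B0: "\<forall>y\<in>range (\<lambda>k. 4 ^ k * (norm (d k x))\<^sup>2). norm y \<le> B"
   unfolding bounded_iff by blast
  have B: "4 ^ k * (norm (d k x))\<^sup>2 \<le> B" for k
   using bspec[OF B0 rangeI, of k] by simp
  have "norm (d k x) \<le> sqrt B * (1 / 2) ^ k" for k
  proof -
   have "(2 ^ k * norm (d k x))\<^sup>2 \<le> B"
   proof -
    have "((2::real) ^ k)\<^sup>2 = 4 ^ k" by (simp add: power2_eq_square flip: power_mult_distrib)
    then show ?thesis using B[of k] by (simp add: power_mult_distrib)
   qed
   then have "2 ^ k * norm (d k x) \<le> sqrt B" by (rule real_le_rsqrt)
   then show ?thesis by (simp add: power_one_over field_simps)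
  qed
  note le = this
  have "summable (\<lambda>k. sqrt B * (1 / 2) ^ k)" by (intro summable_mult summable_geometric) simp
  then show "summable (\<lambda>k. d k x)" by (rule summable_comparison_test'[where N=0]) (rule le)
 qed
qed

text \<open>Riesz-Fischer: a rapidly Cauchy subsequence converges almost everywhere, and Fatou's
  lemma bounds the distance of the whole sequence to that limit.\<close>

theorem L2_complete:
 assumes s: "\<And>n. s n \<in> L2_fun"
  and c: "\<And>e. e > 0 ==> \<exists>N. \<forall>m\<ge>N. \<forall>n\<ge>N. L2_nrm (\<lambda>x. s m x - s n x) < e"
 shows "\<exists>u\<in>L2_fun. L2_lim s u"
proof -
 have [measurable]: "s k \<in> meas" for k using s by (rule L2_funD)
 have "\<forall>k. \<exists>N. \<forall>m\<ge>N. \<forall>n\<ge>N. L2_nrm (\<lambda>x. s m x - s n x) < sqrt ((1 / 8) ^ k)"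
  using c by simp
 then obtain N where N: "\<And>k m n. m \<ge> N k ==> n \<ge> N k ==> L2_nrm (\<lambda>x. s m x - s n x) < sqrt ((1 / 8) ^ k)"
  by metis
 \<comment> \<open>Summing the thresholds makes both \<open>r k\<close> and \<open>r (Suc k)\<close>
   at least \<open>N k\<close>; the added k makes r tend to infinity.\<close>
 define r where "r k = (\<Sum>i\<le>k. N i) + k" for k
 have rN: "r k \<ge> N k" for k unfolding r_def by (rule trans_le_add1) (rule member_le_sum, auto)
 have r1: "r (Suc k) \<ge> N k" for k using rN[of k] by (simp add: r_def)
 define d where "d k x = s (r (Suc k)) x - s (r k) x" for k x
 have "AE x in lborel. summable (\<lambda>k. d k x)"
 proof (rule L2_AE_convergent)
  show "d k \<in> L2_fun" for k unfolding d_def using s by (intro L2_fun_diff)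
  show "(L2_nrm (d k))\<^sup>2 \<le> (1 / 8) ^ k" for k
  proof -
   have "L2_nrm (d k) \<le> sqrt ((1 / 8) ^ k)" unfolding d_def using N[OF r1 rN, of k] by simp
   from power_mono[OF this L2_nrm_nonneg, of 2] show ?thesis by simp
  qed
 qed
 then have conv: "AE x in lborel. convergent (\<lambda>k. s (r k) x)"
 proof eventually_elim
  fix x assume "summable (\<lambda>k. d k x)"
  then have "convergent (\<lambda>n. \<Sum>k<n. d k x)" by (simp add: summable_iff_convergent)
  moreover have "(\<Sum>k<n. d k x) = s (r n) x - s (r 0) x" for n
   unfolding d_def using sum_lessThan_telescope[of "\<lambda>k. s (r k) x" n] by simp
  ultimately have "convergent (\<lambda>n. s (r n) x - s (r 0) x)" by simp
  then have "convergent (\<lambda>n. (s (r n) x - s (r 0) x) + s (r 0) x)" by (intro convergent_add convergent_const)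
  then show "convergent (\<lambda>k. s (r k) x)" by simp
 qed
 define u where "u x = lim (\<lambda>k. s (r k) x)" for x
 have um[measurable]: "u \<in> meas" unfolding u_def by measurable
 \<comment> \<open>Fatou's lemma along the subsequence from K on, where every integral is at most
   e^2.\<close>
 have key: "(\<integral>\<^sup>+x. ennreal ((norm (s n x - u x))\<^sup>2) \<partial>lborel) \<le> ennreal (e\<^sup>2)"
  if e: "\<And>m. m \<ge> K ==> L2_nrm (\<lambda>x. s n x - s m x) \<le> e" for n e K
 proof -
  have "(\<integral>\<^sup>+x. ennreal ((norm (s n x - u x))\<^sup>2) \<partial>lborel)
    = (\<integral>\<^sup>+x. liminf (\<lambda>k. ennreal ((norm (s n x - s (r (K + k)) x))\<^sup>2)) \<partial>lborel)"
  proof (rule nn_integral_cong_AE, use conv in eventually_elim)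
   fix x assume "convergent (\<lambda>k. s (r k) x)"
   then have "(\<lambda>k. s (r k) x) \<longlonglongrightarrow> u x" by (simp add: u_def convergent_LIMSEQ_iff)
   from LIMSEQ_ignore_initial_segment[OF this, of K]
   have "(\<lambda>k. ennreal ((norm (s n x - s (r (K + k)) x))\<^sup>2)) \<longlonglongrightarrow> ennreal ((norm (s n x - u x))\<^sup>2)"
    by (auto intro!: tendsto_intros simp: add.commute)
   from lim_imp_Liminf[OF sequentially_bot this]
   show "ennreal ((norm (s n x - u x))\<^sup>2) = liminf (\<lambda>k. ennreal ((norm (s n x - s (r (K + k)) x))\<^sup>2))"
    by (rule sym)
  qed
  also have "\<dots> \<le> liminf (\<lambda>k. \<integral>\<^sup>+x. ennreal ((norm (s n x - s (r (K + k)) x))\<^sup>2) \<partial>lborel)"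
   by (rule nn_integral_liminf) measurable
  also have "\<dots> \<le> ennreal (e\<^sup>2)"
  proof -
   have rK: "r (K + k) \<ge> K" for k by (simp add: r_def)
   have "(\<integral>\<^sup>+x. ennreal ((norm (s n x - s (r (K + k)) x))\<^sup>2) \<partial>lborel) \<le> ennreal (e\<^sup>2)" for k
    unfolding ennreal_L2_nrm_power2[OF L2_fun_diff[OF s s], symmetric]
    by (intro ennreal_leI power_mono e[OF rK] L2_nrm_nonneg)
   then show ?thesis by (intro Liminf_le) auto
  qed
  finally show ?thesis .
 qed
 have su: "(\<lambda>x. s n x - u x) \<in> L2_fun \<and> L2_nrm (\<lambda>x. s n x - u x) \<le> e"
  if e: "\<And>m. m \<ge> K ==> L2_nrm (\<lambda>x. s n x - s m x) \<le> e" for n e K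
 proof -
  have e0: "e \<ge> 0" using e[of K] L2_nrm_nonneg order_trans by blast
  have f: "(\<lambda>x. s n x - u x) \<in> L2_fun"
  proof -
   have "(\<integral>\<^sup>+x. ennreal ((norm (s n x - u x))\<^sup>2) \<partial>lborel) < \<infinity>"
    using le_less_trans[OF key[OF e] ennreal_less_top] by simp
   then have "integrable lborel (\<lambda>x. (norm (s n x - u x))\<^sup>2)"
    by (intro integrableI_nonneg) simp_all
   then show ?thesis by (simp add: L2_fun_def)
  qed
  have "ennreal ((L2_nrm (\<lambda>x. s n x - u x))\<^sup>2) \<le> ennreal (e\<^sup>2)"
   unfolding ennreal_L2_nrm_power2[OF f] by (rule key) (rule e)
  then have "(L2_nrm (\<lambda>x. s n x - u x))\<^sup>2 \<le> e\<^sup>2" by simp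
  then show ?thesis using f e0 power2_le_imp_le by blast
 qed
 have lim: "\<exists>K. \<forall>n\<ge>K. (\<lambda>x. s n x - u x) \<in> L2_fun \<and> L2_nrm (\<lambda>x. s n x - u x) \<le> e" if e0: "e > 0" for e
 proof -
  obtain K where "\<And>m n. m \<ge> K ==> n \<ge> K ==> L2_nrm (\<lambda>x. s m x - s n x) < e" using c[OF e0] by blast
  then have "(\<lambda>x. s n x - u x) \<in> L2_fun \<and> L2_nrm (\<lambda>x. s n x - u x) \<le> e" if "n \<ge> K" for n
   using su[of K n e] that by (meson less_imp_le)
  then show ?thesis by blast
 qed
 obtain K where "(\<lambda>x. s K x - u x) \<in> L2_fun" using lim[of 1] by auto
 from L2_fun_diff[OF s[of K] this] have "u \<in> L2_fun" by simp
 moreover have "L2_lim s u"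
 proof (rule LIMSEQ_I)
  fix e :: real assume "e > 0"
  then obtain K where K: "\<forall>n\<ge>K. L2_nrm (\<lambda>x. s n x - u x) \<le> e / 2" using lim[of "e / 2"] by auto
  have "norm (L2_nrm (\<lambda>x. s n x - u x) - 0) < e" if "n \<ge> K" for n
   using K that \<open>e > 0\<close> L2_nrm_nonneg[of "\<lambda>x. s n x - u x"] by fastforce
  then show "\<exists>K. \<forall>n\<ge>K. norm (L2_nrm (\<lambda>x. s n x - u x) - 0) < e"
   by blast
 qed
 ultimately show ?thesis by blast
qed

section \<open>Closures of operators with an orthonormal basis of eigenfunctions\<close>

text \<open>\<open>E\<close> is a basis of the whole space, and \<open>adm\<close> marks the indices
  that belong to the subspace \<open>H\<close>. In the application the \<open>E n\<close> are not
  compactly supported and hence lie outside the domain, so the eigenvalue equation enters twice: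
  \<open>E_closure\<close> puts \<open>E n\<close> into the closure, and \<open>K_E\<close> is the
  symmetry of \<open>K\<close> tested against \<open>E n\<close>.\<close>

locale L2_eigenbasis =
 fixes \<D> :: "(real ^ 'd::finite => complex ^ 'r::finite) set"
  and K :: "(real ^ 'd => complex ^ 'r) => real ^ 'd => complex ^ 'r"
  and H :: "(real ^ 'd => complex ^ 'r) set"
  and E :: "nat => real ^ 'd => complex ^ 'r"
  and lam :: "nat => real" and adm :: "nat => bool"
 assumes dom: "\<And>s. s \<in> \<D> ==> s \<in> L2_fun" "\<And>s. s \<in> \<D> ==> K s \<in> L2_fun"
  and dom_0: "(\<lambda>x. 0) \<in> \<D>"
  and dom_add: "\<And>s t. s \<in> \<D> ==> t \<in> \<D> ==> (\<lambda>x. s x + t x) \<in> \<D>"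
  and dom_scale: "\<And>s z. s \<in> \<D> ==> (\<lambda>x. z *s s x) \<in> \<D>"
  and K_add: "\<And>s t. s \<in> \<D> ==> t \<in> \<D> ==> K (\<lambda>x. s x + t x) = (\<lambda>x. K s x + K t x)"
  and K_scale: "\<And>s z. s \<in> \<D> ==> K (\<lambda>x. z *s s x) = (\<lambda>x. z *s K s x)"
  and E_L2: "\<And>n. E n \<in> L2_fun"
  and E_orth: "\<And>m n. L2_inner (E m) (E n) = (if m = n then 1 else 0)"
  and E_complete: "\<And>u. u \<in> L2_fun ==> (\<And>n. L2_inner u (E n) = 0) ==> L2_nrm u = 0"
  and E_closure: "\<And>n. adm n ==> (E n, \<lambda>x. of_real (lam n) *s E n x) \<in> L2_closure \<D> K"
  and K_E: "\<And>s n. s \<in> \<D> ==> adm n ==> L2_inner (K s) (E n) = of_real (lam n) * L2_inner s (E n)"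
  and dom_adm: "\<And>s n. s \<in> \<D> ==> \<not> adm n ==> L2_inner s (E n) = 0"
  and H: "\<And>f. f \<in> H ==> f \<in> L2_fun" "\<And>f n. f \<in> H ==> \<not> adm n ==> L2_inner f (E n) = 0"
  and H_0: "(\<lambda>x. 0) \<in> H"
  and fin: "\<And>R. finite {n. adm n \<and> lam n \<le> R}"
begin

abbreviation "T \<equiv> L2_closure \<D> K"

lemma T_L2: "(u, f) \<in> T ==> u \<in> L2_fun" "(u, f) \<in> T ==> f \<in> L2_fun"
 by (auto simp: L2_closure_def)

lemma T_approx:
 assumes "(u, f) \<in> T" "e > 0"
 shows "\<exists>s\<in>\<D>. L2_nrm (\<lambda>x. s x - u x) < e \<and> L2_nrm (\<lambda>x. K s x - f x) < e"
proof -
 obtain s where s: "\<And>n. s n \<in> \<D>" "L2_lim s u"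
  "L2_lim (\<lambda>n. K (s n)) f"
  using assms by (auto simp: L2_closure_def)
 from order_tendstoD(2)[OF s(2) assms(2)] order_tendstoD(2)[OF s(3) assms(2)]
 have "\<forall>\<^sub>F n in sequentially. L2_nrm (\<lambda>x. s n x - u x) < e \<and> L2_nrm (\<lambda>x. K (s n) x - f x) < e"
  by (rule eventually_conj)
 then show ?thesis using s(1) by (auto simp: eventually_sequentially)
qed

text \<open>Diagonal argument: the n-th pair is replaced by a domain element that is within 1 / (n +
  1) of it in both entries.\<close>

lemma T_closed:
 assumes t: "\<And>n. (u n, f n) \<in> T" and L: "u' \<in> L2_fun" "f' \<in> L2_fun"
  and c: "L2_lim u u'" "L2_lim f f'"
 shows "(u', f') \<in> T"
proof -
 define P where "P n s \<longleftrightarrow> s \<in> \<D> \<and> L2_nrm (\<lambda>x. s x - u n x) < inverse (real (Suc n)) \<and>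
  L2_nrm (\<lambda>x. K s x - f n x) < inverse (real (Suc n))" for n s
 have "\<exists>s. P n s" for n
  using T_approx[OF t[of n], of "inverse (real (Suc n))"] by (auto simp: P_def simp del: of_nat_Suc)
 then obtain s where "\<And>n. P n (s n)" by metis
 then have s: "\<And>n. s n \<in> \<D>"
  "\<And>n. L2_nrm (\<lambda>x. s n x - u n x) < inverse (real (Suc n))"
  "\<And>n. L2_nrm (\<lambda>x. K (s n) x - f n x) < inverse (real (Suc n))" unfolding P_def by auto
 have close: "L2_lim p g" if "\<And>n. p n \<in> L2_fun" "\<And>n. q n \<in> L2_fun" "g \<in> L2_fun" "L2_lim q g"
   "\<And>n. L2_nrm (\<lambda>x. p n x - q n x) < inverse (real (Suc n))" for p q and g :: "real ^ 'd => complex ^ 'r"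
 proof (rule Lim_null_comparison)
  show "(\<lambda>n. inverse (real (Suc n)) + L2_nrm (\<lambda>x. q n x - g x)) \<longlonglongrightarrow> 0"
   using tendsto_add[OF LIMSEQ_inverse_real_of_nat that(4)] by simp
  have "L2_nrm (\<lambda>x. p n x - g x) \<le> inverse (real (Suc n)) + L2_nrm (\<lambda>x. q n x - g x)" for n
   using L2_nrm_triangle_diff[OF that(1)[of n] that(2)[of n] that(3)] that(5)[of n] by linarith
  then show "\<forall>\<^sub>F n in sequentially. norm (L2_nrm (\<lambda>x. p n x - g x)) \<le> inverse (real (Suc n)) + L2_nrm (\<lambda>x. q n x - g x)"
   by (simp add: L2_nrm_nonneg)
 qed
 note close[OF dom(1)[OF s(1)] T_L2(1)[OF t] L(1) c(1) s(2)] close[OF dom(2)[OF s(1)] T_L2(2)[OF t] L(2) c(2) s(3)]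
 then show ?thesis using L s(1) unfolding L2_closure_def by blast
qed

lemma T_0: "(\<lambda>x. 0, \<lambda>x. 0) \<in> T"
proof -
 have "K (\<lambda>x. 0) = (\<lambda>x. 0)" using K_scale[OF dom_0, of 0] by simp
 moreover have "L2_nrm (\<lambda>x :: real ^ 'd. 0 :: complex ^ 'r) = 0" by (simp add: L2_nrm_def)
 ultimately show ?thesis using dom_0 unfolding L2_closure_def
  by (auto simp: L2_fun_0 intro!: exI[of _ "\<lambda>n x. 0"])
qed

lemma T_add:
 assumes "(u, f) \<in> T" "(u', f') \<in> T"
 shows "(\<lambda>x. u x + u' x, \<lambda>x. f x + f' x) \<in> T"
proof -
 obtain s where s: "\<And>n. s n \<in> \<D>" "L2_lim s u"
  "L2_lim (\<lambda>n. K (s n)) f" and L: "u \<in> L2_fun" "f \<in> L2_fun"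
  using assms(1) by (auto simp: L2_closure_def)
 obtain t where t: "\<And>n. t n \<in> \<D>" "L2_lim t u'"
  "L2_lim (\<lambda>n. K (t n)) f'" and L': "u' \<in> L2_fun" "f' \<in> L2_fun"
  using assms(2) by (auto simp: L2_closure_def)
 have null: "(\<lambda>n. L2_nrm (\<lambda>x. (p n x + q n x) - (g x + g' x))) \<longlonglongrightarrow> 0"
  if "\<And>n. p n \<in> L2_fun" "\<And>n. q n \<in> L2_fun" "g \<in> L2_fun" "g' \<in> L2_fun"
   "L2_lim p g" "L2_lim q g'" for p q and g g' :: "real ^ 'd => complex ^ 'r"
 proof (rule Lim_null_comparison)
  show "(\<lambda>n. L2_nrm (\<lambda>x. p n x - g x) + L2_nrm (\<lambda>x. q n x - g' x)) \<longlonglongrightarrow> 0"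
   using tendsto_add[OF that(5,6)] by simp
  have "L2_nrm (\<lambda>x. (p n x + q n x) - (g x + g' x)) \<le> L2_nrm (\<lambda>x. p n x - g x) + L2_nrm (\<lambda>x. q n x - g' x)" for n
   using L2_nrm_triangle[OF L2_fun_diff[OF that(1)[of n] that(3)] L2_fun_diff[OF that(2)[of n] that(4)]]
   by (simp add: algebra_simps)
  then show "\<forall>\<^sub>F n in sequentially. norm (L2_nrm (\<lambda>x. (p n x + q n x) - (g x + g' x))) \<le> L2_nrm (\<lambda>x. p n x - g x) + L2_nrm (\<lambda>x. q n x - g' x)"
   by (simp add: L2_nrm_nonneg)
 qed
 have "(\<lambda>n. L2_nrm (\<lambda>x. K (\<lambda>x. s n x + t n x) x - (f x + f' x))) \<longlonglongrightarrow> 0"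
  unfolding K_add[OF s(1) t(1)] by (rule null) (use s t L L' dom in auto)
 moreover have "(\<lambda>n. L2_nrm (\<lambda>x. (s n x + t n x) - (u x + u' x))) \<longlonglongrightarrow> 0"
  by (rule null) (use s t L L' dom in auto)
 ultimately show ?thesis unfolding L2_closure_def
  using dom_add[OF s(1) t(1)] L L' by (auto intro!: L2_fun_add exI[of _ "\<lambda>n x. s n x + t n x"])
qed

lemma T_scale:
 assumes "(u, f) \<in> T"
 shows "(\<lambda>x. z *s u x, \<lambda>x. z *s f x) \<in> T"
proof -
 obtain s where s: "\<And>n. s n \<in> \<D>" "L2_lim s u"
  "L2_lim (\<lambda>n. K (s n)) f" and L: "u \<in> L2_fun" "f \<in> L2_fun"
  using assms(1) by (auto simp: L2_closure_def)
 have "(\<lambda>n. L2_nrm (\<lambda>x. z *s s n x - z *s u x)) \<longlonglongrightarrow> 0"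
  using tendsto_mult_left[OF s(2), of "cmod z"] by (simp add: vector_sub_rdistrib[symmetric] L2_nrm_scale flip: vector_ssub_ldistrib)
 moreover have "(\<lambda>n. L2_nrm (\<lambda>x. K (\<lambda>x. z *s s n x) x - z *s f x)) \<longlonglongrightarrow> 0"
  unfolding K_scale[OF s(1)]
  using tendsto_mult_left[OF s(3), of "cmod z"] by (simp add: L2_nrm_scale flip: vector_ssub_ldistrib)
 ultimately show ?thesis unfolding L2_closure_def
  using dom_scale[OF s(1)] L by (auto intro!: L2_fun_scale exI[of _ "\<lambda>n x. z *s s n x"])
qed

lemma T_sum:
 assumes "\<And>i. i \<in> I ==> (u i, f i) \<in> T"
 shows "(\<lambda>x. \<Sum>i\<in>I. u i x, \<lambda>x. \<Sum>i\<in>I. f i x) \<in> T"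
 using assms by (induction I rule: infinite_finite_induct) (auto intro: T_0 T_add)

text \<open>Coefficients depend continuously on the function, so the relations that hold on the
  domain survive the closure.\<close>

lemma T_inner:
 assumes "(u, f) \<in> T"
 shows "adm n ==> L2_inner f (E n) = of_real (lam n) * L2_inner u (E n)"
  and "\<not> adm n ==> L2_inner u (E n) = 0"
proof -
 obtain s where s: "\<And>n. s n \<in> \<D>" "L2_lim s u"
  "L2_lim (\<lambda>n. K (s n)) f" and L: "u \<in> L2_fun" "f \<in> L2_fun"
  using assms(1) by (auto simp: L2_closure_def)
 have a: "(\<lambda>k. L2_inner (s k) (E n)) \<longlonglongrightarrow> L2_inner u (E n)"
  by (rule L2_inner_tendsto[OF dom(1)[OF s(1)] L(1) E_L2 s(2)])
 have b: "(\<lambda>k. L2_inner (K (s k)) (E n)) \<longlonglongrightarrow> L2_inner f (E n)"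
  by (rule L2_inner_tendsto[OF dom(2)[OF s(1)] L(2) E_L2 s(3)])
 {
  assume "adm n"
  then have "(\<lambda>k. L2_inner (K (s k)) (E n)) \<longlonglongrightarrow> of_real (lam n) * L2_inner u (E n)"
   using tendsto_mult_left[OF a, of "of_real (lam n)"] by (simp add: K_E[OF s(1)])
  then show "L2_inner f (E n) = of_real (lam n) * L2_inner u (E n)" using b LIMSEQ_unique by blast
 next
  assume "\<not> adm n"
  then show "L2_inner u (E n) = 0" using a by (simp add: dom_adm[OF s(1)] LIMSEQ_const_iff)
 }
qed

lemma E_sum_L2: "(\<lambda>x. \<Sum>n\<in>I. c n *s E n x) \<in> L2_fun"
 by (intro L2_fun_sum L2_fun_scale E_L2)

lemma E_sum_inner: "finite I ==> L2_inner (\<lambda>x. \<Sum>n\<in>I. c n *s E n x) (E m) = (if m \<in> I then c m else 0)"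
 by (subst L2_inner_sum_left) (auto simp: L2_fun_scale E_L2 L2_inner_scale_left E_orth if_distrib sum.delta cong: if_cong)

lemma E_sum_nrm:
 assumes "finite I"
 shows "(L2_nrm (\<lambda>x. \<Sum>n\<in>I. c n *s E n x))\<^sup>2 = (\<Sum>n\<in>I. (cmod (c n))\<^sup>2)"
proof -
 let ?S = "\<lambda>x. \<Sum>n\<in>I. c n *s E n x"
 have r: "L2_inner (E n) ?S = cnj (c n)" if "n \<in> I" for n
  using E_sum_inner[OF assms, of c n] that L2_inner_cnj[of ?S "E n"] by simp
 have "complex_of_real ((L2_nrm ?S)\<^sup>2) = (\<Sum>n\<in>I. c n * L2_inner (E n) ?S)"
  unfolding L2_inner_self[symmetric]
  by (subst L2_inner_sum_left) (auto simp: L2_fun_scale E_L2 E_sum_L2 L2_inner_scale_left)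
 also have "\<dots> = (\<Sum>n\<in>I. c n * cnj (c n))" using r by (intro sum.cong) auto
 also have "\<dots> = complex_of_real (\<Sum>n\<in>I. (cmod (c n))\<^sup>2)" by (simp only: of_real_sum complex_norm_square)
 finally show ?thesis by (simp only: of_real_eq_iff)
qed

text \<open>The partial sum S satisfies |S|^2 = <S, f> \<le> |S| |f|, hence |S| \<le> |f|.\<close>

lemma bessel:
 assumes "f \<in> L2_fun"
 shows "(\<Sum>n<N. (cmod (L2_inner f (E n)))\<^sup>2) \<le> (L2_nrm f)\<^sup>2"
proof -
 define S where "S x = (\<Sum>n\<in>{..<N}. L2_inner f (E n) *s E n x)" for x
 have S: "S \<in> L2_fun" unfolding S_def by (rule E_sum_L2)
 have nS: "(L2_nrm S)\<^sup>2 = (\<Sum>n<N. (cmod (L2_inner f (E n)))\<^sup>2)"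
  unfolding S_def by (rule E_sum_nrm) simp
 have "L2_inner S f = (\<Sum>n<N. L2_inner f (E n) * L2_inner (E n) f)"
  unfolding S_def by (subst L2_inner_sum_left) (auto simp: L2_fun_scale E_L2 assms L2_inner_scale_left)
 also have "\<dots> = complex_of_real ((L2_nrm S)\<^sup>2)"
  unfolding nS of_real_sum complex_norm_square by (simp add: L2_inner_cnj)
 finally have "(L2_nrm S)\<^sup>2 = cmod (L2_inner S f)" by (simp add: norm_power L2_nrm_nonneg)
 also have "\<dots> \<le> L2_nrm S * L2_nrm f" by (rule L2_inner_le[OF S assms])
 finally have "L2_nrm S \<le> L2_nrm f"
  using L2_nrm_nonneg[of S] L2_nrm_nonneg[of f] by (cases "L2_nrm S = 0") (auto simp: power2_eq_square)
 then show ?thesis unfolding nS[symmetric] by (intro power_mono L2_nrm_nonneg)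
qed

text \<open>Completeness realizes square summable coefficients by a function. The resolvent
  construction uses this twice: for the solution u, and to see that f is the sum of its own
  series.\<close>

lemma E_series:
 assumes c: "summable (\<lambda>n. (cmod (c n))\<^sup>2)"
 shows "\<exists>u\<in>L2_fun. (\<lambda>N. L2_nrm (\<lambda>x. (\<Sum>n<N. c n *s E n x) - u x)) \<longlonglongrightarrow> 0 \<and>
  (\<forall>n. L2_inner u (E n) = c n) \<and> (L2_nrm u)\<^sup>2 \<le> (\<Sum>n. (cmod (c n))\<^sup>2)"
proof -
 define S where "S N x = (\<Sum>n<N. c n *s E n x)" for N x
 have S: "S N \<in> L2_fun" for N unfolding S_def by (rule E_sum_L2)
 have diff: "(L2_nrm (\<lambda>x. S n x - S m x))\<^sup>2 = (\<Sum>i\<in>{m..<n}. (cmod (c i))\<^sup>2)" if "m \<le> n" for m n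
 proof -
  have "S n x - S m x = (\<Sum>i\<in>{m..<n}. c i *s E i x)" for x
   using sum.atLeastLessThan_concat[of 0 m n "\<lambda>i. c i *s E i x"] that by (simp add: S_def lessThan_atLeast0 algebra_simps)
  then show ?thesis by (simp add: E_sum_nrm)
 qed
 have "\<exists>N. \<forall>m\<ge>N. \<forall>n\<ge>N. L2_nrm (\<lambda>x. S m x - S n x) < e" if e: "e > 0" for e
 proof -
  obtain N where N: "\<And>m n. m \<ge> N ==> norm (\<Sum>i\<in>{m..<n}. (cmod (c i))\<^sup>2) < e\<^sup>2"
   using c e unfolding summable_Cauchy by (metis zero_less_power)
  have le: "L2_nrm (\<lambda>x. S n x - S m x) < e" if "m \<ge> N" "m \<le> n" for m n
  proof -
   have "(L2_nrm (\<lambda>x. S n x - S m x))\<^sup>2 < e\<^sup>2" using N[OF that(1), of n] diff[OF that(2)] by simp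
   then show ?thesis using e by (meson less_imp_le power2_less_imp_less)
  qed
  have "L2_nrm (\<lambda>x. S m x - S n x) < e" if "m \<ge> N" "n \<ge> N" for m n
   using le[of m n] le[of n m] that L2_nrm_diff_commute[of "S m" "S n"] by (metis nle_le)
  then show ?thesis by blast
 qed
 from L2_complete[OF S this] obtain u where u: "u \<in> L2_fun" "(\<lambda>n. L2_nrm (\<lambda>x. S n x - u x)) \<longlonglongrightarrow> 0" by blast
 have "L2_inner u (E n) = c n" for n
 proof -
  have "(\<lambda>N. L2_inner (S N) (E n)) \<longlonglongrightarrow> L2_inner u (E n)" by (rule L2_inner_tendsto[OF S u(1) E_L2 u(2)])
  moreover have "(\<lambda>N. L2_inner (S N) (E n)) \<longlonglongrightarrow> c n"
   unfolding S_def by (rule tendsto_eventually)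
    (auto simp: E_sum_inner eventually_sequentially intro!: exI[of _ "Suc n"])
  ultimately show ?thesis by (rule LIMSEQ_unique)
 qed
 moreover have "(L2_nrm u)\<^sup>2 \<le> (\<Sum>n. (cmod (c n))\<^sup>2)"
 proof -
  let ?q = "\<Sum>n. (cmod (c n))\<^sup>2"
  have q: "0 \<le> ?q" by (rule suminf_nonneg[OF c]) simp
  have SN: "L2_nrm (S N) \<le> sqrt ?q" for N
   unfolding S_def by (rule real_le_rsqrt) (simp add: E_sum_nrm sum_le_suminf[OF c])
  have "L2_nrm u \<le> L2_nrm (\<lambda>x. S N x - u x) + sqrt ?q" for N
   using L2_nrm_triangle_diff[OF u(1) S[of N] L2_fun_0] SN[of N] L2_nrm_diff_commute[of u "S N"] by simp
  moreover have "(\<lambda>N. L2_nrm (\<lambda>x. S N x - u x) + sqrt ?q) \<longlonglongrightarrow> 0 + sqrt ?q"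
   by (intro tendsto_add u(2) tendsto_const)
  ultimately have "L2_nrm u \<le> 0 + sqrt ?q" by (intro LIMSEQ_le_const) auto
  then have "(L2_nrm u)\<^sup>2 \<le> (sqrt ?q)\<^sup>2" by (intro power_mono L2_nrm_nonneg) simp
  then show ?thesis using q by simp
 qed
 ultimately show ?thesis using u unfolding S_def by blast
qed

text \<open>Only finitely many admissible values are at most Re \<zeta> + 1; they give a positive
  minimal distance, and all the others exceed the real part of \<zeta> by more than 1.\<close>

lemma resolvent_gap:
 assumes "\<And>n. adm n ==> of_real (lam n) \<noteq> \<zeta>"
 shows "\<exists>\<delta>>0. \<forall>n. adm n \<longrightarrow> \<delta> \<le> cmod (of_real (lam n) - \<zeta>)"
proof -
 define F where "F = {n. adm n \<and> lam n \<le> Re \<zeta> + 1}"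
 define \<delta> where "\<delta> = Min (insert 1 ((\<lambda>n. cmod (of_real (lam n) - \<zeta>)) ` F))"
 have F: "finite F" unfolding F_def by (rule fin)
 then have "\<delta> > 0" unfolding \<delta>_def using assms by (subst Min_gr_iff) (auto simp: F_def)
 moreover have "\<delta> \<le> cmod (of_real (lam n) - \<zeta>)" if n: "adm n" for n
 proof (cases "n \<in> F")
  case True
  then show ?thesis unfolding \<delta>_def using F by (intro Min_le) auto
 next
  case False
  then have "1 \<le> Re (of_real (lam n) - \<zeta>)" using n by (auto simp: F_def)
  also have "\<dots> \<le> cmod (of_real (lam n) - \<zeta>)" by (rule complex_Re_le_cmod)
  finally show ?thesis using F by (auto simp: \<delta>_def intro: order_trans[OF Min_le])
 qed
 ultimately show ?thesis by blast
qed

lemma AE_unique: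
 assumes "(u, \<lambda>x. \<zeta> *s u x + f x) \<in> T" "(u', \<lambda>x. \<zeta> *s u' x + f x) \<in> T" "\<And>n. adm n ==> of_real (lam n) \<noteq> \<zeta>"
 shows "AE x in lborel. u' x = u x"
proof -
 define w where "w x = u' x + (-1) *s u x" for x
 have "(w, \<lambda>x. (\<zeta> *s u' x + f x) + (-1) *s (\<zeta> *s u x + f x)) \<in> T"
  unfolding w_def by (rule T_add[OF assms(2) T_scale[OF assms(1)]])
 moreover have "(\<lambda>x. (\<zeta> *s u' x + f x) + (-1) *s (\<zeta> *s u x + f x)) = (\<lambda>x. \<zeta> *s w x)"
  by (auto simp: w_def vec_eq_iff algebra_simps)
 ultimately have w: "(w, \<lambda>x. \<zeta> *s w x) \<in> T" by simp
 have "L2_inner w (E n) = 0" for n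
 proof (cases "adm n")
  case True
  from T_inner(1)[OF w this] have "(of_real (lam n) - \<zeta>) * L2_inner w (E n) = 0"
   by (auto simp: L2_inner_scale_left left_diff_distrib)
  then show ?thesis using assms(3)[OF True] unfolding mult_eq_0_iff eq_iff_diff_eq_0[symmetric] by blast
 qed (rule T_inner(2)[OF w])
 from E_complete[OF T_L2(1)[OF w] this] have "AE x in lborel. w x = 0"
  by (simp add: L2_nrm_eq_0_iff[OF T_L2(1)[OF w]])
 then show ?thesis by eventually_elim (simp add: w_def vec_eq_iff)
qed

lemma resolvent_pointI:
 assumes ne: "\<And>n. adm n ==> of_real (lam n) \<noteq> \<zeta>"
 shows "resolvent_point H T \<zeta>"
proof -
 obtain \<delta> where \<delta>: "\<delta> > 0" "\<And>n. adm n ==> \<delta> \<le> cmod (of_real (lam n) - \<zeta>)" using resolvent_gap[OF ne] by blast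
 have "\<exists>u. (u, \<lambda>x. \<zeta> *s u x + f x) \<in> T \<and> L2_nrm u \<le> (1 / \<delta>) * L2_nrm f" if f: "f \<in> H" for f
 proof -
  have fL: "f \<in> L2_fun" by (rule H(1)[OF f])
  define c where "c n = L2_inner f (E n)" for n
  \<comment> \<open>In coefficients the equation K u = \<zeta> u + f reads (lam_n - \<zeta>) b_n =
    c_n. Off \<open>adm\<close> the right-hand side vanishes because f lies in
    \<open>H\<close>.\<close>
  define b where "b n = (if adm n then c n / (of_real (lam n) - \<zeta>) else 0)" for n
  have c0: "c n = 0" if "\<not> adm n" for n using H(2)[OF f that] by (simp add: c_def)
  have cs: "summable (\<lambda>n. (cmod (c n))\<^sup>2)"
   unfolding c_def by (rule summableI_nonneg_bounded[OF _ bessel[OF fL]]) simp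
  have bc: "(cmod (b n))\<^sup>2 \<le> (1 / \<delta>)\<^sup>2 * (cmod (c n))\<^sup>2" for n
  proof (cases "adm n")
   case True
   have "cmod (b n) \<le> (1 / \<delta>) * cmod (c n)"
    using True \<delta> by (simp add: b_def norm_divide frac_le)
   then have "(cmod (b n))\<^sup>2 \<le> ((1 / \<delta>) * cmod (c n))\<^sup>2" by (intro power_mono) auto
   then show ?thesis by (simp only: power_mult_distrib)
  qed (simp add: b_def)
  have bs: "summable (\<lambda>n. (cmod (b n))\<^sup>2)"
   by (rule summable_comparison_test'[OF summable_mult[OF cs, of "(1 / \<delta>)\<^sup>2"], of 0]) (use bc in simp)
  obtain u where u: "u \<in> L2_fun" "(\<lambda>N. L2_nrm (\<lambda>x. (\<Sum>n<N. b n *s E n x) - u x)) \<longlonglongrightarrow> 0"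
   "(L2_nrm u)\<^sup>2 \<le> (\<Sum>n. (cmod (b n))\<^sup>2)" using E_series[OF bs] by blast
  obtain g where g: "g \<in> L2_fun" "(\<lambda>N. L2_nrm (\<lambda>x. (\<Sum>n<N. c n *s E n x) - g x)) \<longlonglongrightarrow> 0"
   "\<And>n. L2_inner g (E n) = c n" using E_series[OF cs] by blast
  \<comment> \<open>g is the sum of the series of f and has the same coefficients, so completeness
    of the basis identifies the two.\<close>
  have "L2_nrm (\<lambda>x. g x - f x) = 0"
   by (rule E_complete) (use g fL in \<open>auto simp: L2_fun_diff L2_inner_diff_left E_L2 c_def\<close>)
  then have gf: "AE x in lborel. g x - f x = 0"
   using L2_nrm_eq_0_iff[OF L2_fun_diff[OF g(1) fL]] by simp
  have "L2_nrm (\<lambda>x. (\<Sum>n<N. c n *s E n x) - f x) = L2_nrm (\<lambda>x. (\<Sum>n<N. c n *s E n x) - g x)" for N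
  proof (rule L2_nrm_cong_AE)
   show "AE x in lborel. (\<Sum>n<N. c n *s E n x) - f x = (\<Sum>n<N. c n *s E n x) - g x"
    using gf by eventually_elim simp
  qed (intro L2_funD(1) L2_fun_diff E_sum_L2 fL g(1))+
  then have fs: "(\<lambda>N. L2_nrm (\<lambda>x. (\<Sum>n<N. c n *s E n x) - f x)) \<longlonglongrightarrow> 0" using g(2) by simp
  \<comment> \<open>The partial sums belong to T since T is linear and contains the admissible
    eigenpairs; closedness of T then gives the limit.\<close>
  have TN: "(\<lambda>x. \<Sum>n<N. b n *s E n x, \<lambda>x. \<Sum>n<N. (\<zeta> * b n + c n) *s E n x) \<in> T" for N
  proof (rule T_sum)
   fix n
   show "(\<lambda>x. b n *s E n x, \<lambda>x. (\<zeta> * b n + c n) *s E n x) \<in> T"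
   proof (cases "adm n")
    case True
    have "\<zeta> * b n + c n = b n * of_real (lam n)" using ne[OF True] True by (simp add: b_def field_simps)
    then show ?thesis using T_scale[OF E_closure[OF True], of "b n"] by simp
   next
    case False
    then show ?thesis using T_0 by (simp add: b_def c0)
   qed
  qed
  have "(u, \<lambda>x. \<zeta> *s u x + f x) \<in> T"
  proof (rule T_closed[OF TN u(1) _ u(2)])
   show L: "(\<lambda>x. \<zeta> *s u x + f x) \<in> L2_fun" by (intro L2_fun_add L2_fun_scale u(1) fL)
   show "(\<lambda>N. L2_nrm (\<lambda>x. (\<Sum>n<N. (\<zeta> * b n + c n) *s E n x) - (\<zeta> *s u x + f x))) \<longlonglongrightarrow> 0"
   proof (rule Lim_null_comparison)
    show "(\<lambda>N. cmod \<zeta> * L2_nrm (\<lambda>x. (\<Sum>n<N. b n *s E n x) - u x) + L2_nrm (\<lambda>x. (\<Sum>n<N. c n *s E n x) - f x)) \<longlonglongrightarrow> 0"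
     using tendsto_add[OF tendsto_mult_left[OF u(2), of "cmod \<zeta>"] fs] by simp
    have "L2_nrm (\<lambda>x. (\<Sum>n<N. (\<zeta> * b n + c n) *s E n x) - (\<zeta> *s u x + f x))
     \<le> cmod \<zeta> * L2_nrm (\<lambda>x. (\<Sum>n<N. b n *s E n x) - u x) + L2_nrm (\<lambda>x. (\<Sum>n<N. c n *s E n x) - f x)" for N
    proof -
     have "(\<Sum>n<N. (\<zeta> * b n + c n) *s E n x) - (\<zeta> *s u x + f x)
      = \<zeta> *s ((\<Sum>n<N. b n *s E n x) - u x) + ((\<Sum>n<N. c n *s E n x) - f x)" for x
      by (simp add: vec_eq_iff sum.distrib sum_distrib_left algebra_simps)
     then show ?thesis
      using L2_nrm_triangle[OF L2_fun_scale[OF L2_fun_diff[OF E_sum_L2[of b "{..<N}"] u(1)], of \<zeta>] L2_fun_diff[OF E_sum_L2[of c "{..<N}"] fL]]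
      by (simp only: L2_nrm_scale)
    qed
    then show "\<forall>\<^sub>F N in sequentially. norm (L2_nrm (\<lambda>x. (\<Sum>n<N. (\<zeta> * b n + c n) *s E n x) - (\<zeta> *s u x + f x)))
     \<le> cmod \<zeta> * L2_nrm (\<lambda>x. (\<Sum>n<N. b n *s E n x) - u x) + L2_nrm (\<lambda>x. (\<Sum>n<N. c n *s E n x) - f x)"
     by (simp add: L2_nrm_nonneg)
   qed
  qed
  moreover have "L2_nrm u \<le> (1 / \<delta>) * L2_nrm f"
  proof (rule power2_le_imp_le)
   have "(\<Sum>n. (cmod (b n))\<^sup>2) \<le> (\<Sum>n. (1 / \<delta>)\<^sup>2 * (cmod (c n))\<^sup>2)"
    by (rule suminf_le[OF bc bs summable_mult[OF cs]])
   also have "\<dots> = (1 / \<delta>)\<^sup>2 * (\<Sum>n. (cmod (c n))\<^sup>2)" by (rule suminf_mult[OF cs])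
   also have "\<dots> \<le> (1 / \<delta>)\<^sup>2 * (L2_nrm f)\<^sup>2"
    by (intro mult_left_mono suminf_le_const[OF cs]) (use bessel[OF fL] in \<open>auto simp: c_def\<close>)
   finally show "(L2_nrm u)\<^sup>2 \<le> ((1 / \<delta>) * L2_nrm f)\<^sup>2" using u(3) unfolding power_mult_distrib by linarith
   show "0 \<le> (1 / \<delta>) * L2_nrm f" using \<delta>(1) L2_nrm_nonneg[of f] by simp
  qed
  ultimately show ?thesis by blast
 qed
 note ex = this
 show ?thesis unfolding resolvent_point_def
 proof (rule exI[of _ "1 / \<delta>"], rule ballI)
  fix f assume "f \<in> H"
  from ex[OF this] obtain u where u: "(u, \<lambda>x. \<zeta> *s u x + f x) \<in> T" "L2_nrm u \<le> (1 / \<delta>) * L2_nrm f" by blast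
  have "(u, \<lambda>x. \<zeta> *s u x + f x) \<in> T \<and> L2_nrm u \<le> (1 / \<delta>) * L2_nrm f \<and>
    (\<forall>u'. (u', \<lambda>x. \<zeta> *s u' x + f x) \<in> T \<longrightarrow> (AE x in lborel. u' x = u x))"
   using u AE_unique[OF u(1) _ ne] by simp
  then show "\<exists>u. (u, \<lambda>x. \<zeta> *s u x + f x) \<in> T \<and> L2_nrm u \<le> (1 / \<delta>) * L2_nrm f \<and>
    (\<forall>u'. (u', \<lambda>x. \<zeta> *s u' x + f x) \<in> T \<longrightarrow> (AE x in lborel. u' x = u x))" by (rule exI[of _ u])
 qed
qed

lemma E_not_AE_0: "\<not> (AE x in lborel. E n x = 0)"
proof
 assume "AE x in lborel. E n x = 0"
 then have "L2_nrm (E n) = 0" using L2_nrm_eq_0_iff[OF E_L2] by blast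
 then show False using E_orth[of n n] L2_inner_self[of "E n"] by simp
qed

theorem spectrum: "L2_spectrum H T = {of_real (lam n) | n. adm n}"
proof (intro equalityI subsetI)
 fix \<zeta> assume "\<zeta> \<in> L2_spectrum H T"
 then have "\<not> resolvent_point H T \<zeta>" by (simp add: L2_spectrum_def)
 then show "\<zeta> \<in> {of_real (lam n) | n. adm n}" using resolvent_pointI[of \<zeta>] by auto
next
 fix \<zeta> assume "\<zeta> \<in> {complex_of_real (lam n) | n. adm n}"
 then obtain n where n: "adm n" "\<zeta> = of_real (lam n)" by blast
 have "\<not> resolvent_point H T \<zeta>"
 proof
  assume "resolvent_point H T \<zeta>"
  then obtain C where "\<forall>f\<in>H. \<exists>u. (u, \<lambda>x. \<zeta> *s u x + f x) \<in> T \<and> L2_nrm u \<le> C * L2_nrm f \<and>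
   (\<forall>u'. (u', \<lambda>x. \<zeta> *s u' x + f x) \<in> T \<longrightarrow> (AE x in lborel. u' x = u x))"
   unfolding resolvent_point_def by (rule exE)
  \<comment> \<open>Uniqueness already fails for f = 0: adding \<open>E n\<close> to a solution
    gives a different one.\<close>
  from bspec[OF this H_0] obtain u where u: "(u, \<lambda>x. \<zeta> *s u x + 0) \<in> T"
   "\<And>u'. (u', \<lambda>x. \<zeta> *s u' x + 0) \<in> T ==> AE x in lborel. u' x = u x"
   by auto
  have "(\<lambda>x. u x + E n x, \<lambda>x. (\<zeta> *s u x + 0) + of_real (lam n) *s E n x) \<in> T"
   by (rule T_add[OF u(1) E_closure[OF n(1)]])
  moreover have "(\<lambda>x. (\<zeta> *s u x + 0) + of_real (lam n) *s E n x) = (\<lambda>x. \<zeta> *s (u x + E n x) + 0)"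
   by (simp add: n(2) vector_add_ldistrib)
  ultimately have "AE x in lborel. u x + E n x = u x" using u(2)[of "\<lambda>x. u x + E n x"] by simp
  then have "AE x in lborel. E n x = 0" by eventually_elim simp
  then show False using E_not_AE_0 by blast
 qed
 then show "\<zeta> \<in> L2_spectrum H T" by (simp add: L2_spectrum_def)
qed

text \<open>An eigenfunction for \<mu> has nonzero coefficients only at admissible indices with
  \<open>lam n = \<mu>\<close>, so the finitely many \<open>E n\<close> with such indices form a
  basis of the eigenspace.\<close>

theorem multiplicity: "has_multiplicity T (of_real \<mu>) (card {n. adm n \<and> lam n = \<mu>})"
proof -
 define S where "S = {n. adm n \<and> lam n = \<mu>}"
 have S: "finite S" unfolding S_def by (rule finite_subset[OF _ fin[of \<mu>]]) auto
 obtain g where g: "bij_betw g {..<card S} S" using ex_bij_betw_nat_finite[OF S] by (auto simp: lessThan_atLeast0)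
 have gS: "g i \<in> S" if "i < card S" for i using g that by (auto simp: bij_betw_def)
 have ginj: "g i = g j \<longleftrightarrow> i = j" if "i < card S" "j < card S" for i j
  using g that by (auto simp: bij_betw_def inj_on_def)
 have inner: "L2_inner (\<lambda>x. \<Sum>i<card S. a i *s E (g i) x) (E (g j)) = a j" if "j < card S" for a j
 proof -
  have "L2_inner (\<lambda>x. \<Sum>i<card S. a i *s E (g i) x) (E (g j)) = (\<Sum>i<card S. a i * (if i = j then 1 else 0))"
   by (subst L2_inner_sum_left) (auto simp: L2_fun_scale E_L2 L2_inner_scale_left E_orth ginj that intro!: sum.cong)
  then show ?thesis using that by (simp add: if_distrib sum.delta cong: if_cong)
 qed
 have sumL: "(\<lambda>x. \<Sum>i<card S. a i *s E (g i) x) \<in> L2_fun" for a by (intro L2_fun_sum L2_fun_scale E_L2)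
 show ?thesis
  unfolding has_multiplicity_def S_def[symmetric]
 proof (intro exI[of _ "\<lambda>i. E (g i)"] conjI allI impI)
  fix i assume "i < card S"
  then show "(E (g i), \<lambda>x. of_real \<mu> *s E (g i) x) \<in> T" using gS[of i] E_closure[of "g i"] by (auto simp: S_def)
 next
  fix u assume u: "(u, \<lambda>x. of_real \<mu> *s u x) \<in> T"
  have uL: "u \<in> L2_fun" by (rule T_L2(1)[OF u])
  define a where "a i = (if i < card S then L2_inner u (E (g i)) else 0)" for i
  define w where "w x = (\<Sum>i<card S. a i *s E (g i) x)" for x
  have wL: "w \<in> L2_fun" unfolding w_def by (rule sumL)
  have u0: "L2_inner u (E n) = 0" if "n \<notin> S" for n
  proof (cases "adm n")
   case True
   from T_inner(1)[OF u this] have "(complex_of_real (lam n) - of_real \<mu>) * L2_inner u (E n) = 0"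
    by (auto simp: L2_inner_scale_left left_diff_distrib)
   then show ?thesis using True that by (auto simp: S_def)
  qed (rule T_inner(2)[OF u])
  have wn: "L2_inner w (E n) = L2_inner u (E n)" for n
  proof (cases "n \<in> S")
   case True
   then obtain j where j: "j < card S" "n = g j" using g by (auto simp: bij_betw_def)
   then show ?thesis using inner[OF j(1), of a] by (simp add: w_def[abs_def] a_def)
  next
   case False
   have "L2_inner w (E n) = (\<Sum>i<card S. a i * L2_inner (E (g i)) (E n))"
    unfolding w_def by (subst L2_inner_sum_left) (auto simp: L2_fun_scale E_L2 L2_inner_scale_left)
   also have "\<dots> = 0" using False gS by (intro sum.neutral) (auto simp: E_orth)
   finally show ?thesis using u0[OF False] by simp
  qed
  have "L2_nrm (\<lambda>x. u x - w x) = 0"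
   by (rule E_complete) (auto simp: L2_fun_diff uL wL L2_inner_diff_left E_L2 wn)
  then have "AE x in lborel. u x - w x = 0" using L2_nrm_eq_0_iff[OF L2_fun_diff[OF uL wL]] by simp
  then have AEw: "AE x in lborel. u x = (\<Sum>i<card S. a i *s E (g i) x)"
   by eventually_elim (simp add: w_def)
  show "\<exists>!a. (\<forall>i\<ge>card S. a i = 0) \<and> (AE x in lborel. u x = (\<Sum>i<card S. a i *s E (g i) x))"
  proof (rule ex1I[of _ a])
   show "(\<forall>i\<ge>card S. a i = 0) \<and> (AE x in lborel. u x = (\<Sum>i<card S. a i *s E (g i) x))"
    using AEw by (simp add: a_def)
   fix a' assume a': "(\<forall>i\<ge>card S. a' i = 0) \<and> (AE x in lborel. u x = (\<Sum>i<card S. a' i *s E (g i) x))"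
   have "L2_inner u (E (g j)) = a' j" if "j < card S" for j
   proof -
    have "L2_inner u (E (g j)) = L2_inner (\<lambda>x. \<Sum>i<card S. a' i *s E (g i) x) (E (g j))"
     by (rule L2_inner_cong_AE) (use a' uL sumL E_L2 L2_funD in auto)
    then show ?thesis using inner[OF that, of a'] by simp
   qed
   then show "a' = a" using a' by (auto simp: a_def fun_eq_iff not_less)
  qed
 qed
qed

end

section \<open>Oscillator eigenfunctions\<close>

text \<open>Complex Hermite polynomials: \<open>ito \<kappa> a b\<close> has leading term \<open>\<kappa>\<^sup>a\<^sup>+\<^sup>b z\<^sup>a (cnj z)\<^sup>b\<close>, and
 \<open>exp (- \<kappa> |z|\<^sup>2 / 2) ito \<kappa> a b z\<close> is obtained from the Gaussian by \<open>a\<close> and \<open>b\<close> applications of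
 the two commuting creation operators of the planar oscillator.\<close>

fun ito :: "real => nat => nat => complex => complex" where
 "ito \<kappa> 0 b z = (of_real \<kappa> * cnj z) ^ b"
| "ito \<kappa> (Suc a) b z = of_real \<kappa> * z * ito \<kappa> a b z - of_real \<kappa> * of_nat b * ito \<kappa> a (b - 1) z"

text \<open>The defining recursion raises a; that b can be raised by the mirrored recursion
  expresses that the two creation operators commute. Every truncated a - 1 or b - 1 carries the
  factor a or b, so its value at 0 is harmless.\<close>

lemma ito_Suc_right:
 "ito \<kappa> a (Suc b) z = of_real \<kappa> * cnj z * ito \<kappa> a b z - of_real \<kappa> * of_nat a * ito \<kappa> (a - 1) b z"
proof (induction a arbitrary: b)
 case (Suc a)
 let ?k = "complex_of_real \<kappa>"
 define P where "P = ito \<kappa> a b z"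
 define Pa where "Pa = ito \<kappa> (a - 1) b z"
 define Pb where "Pb = ito \<kappa> a (b - 1) z"
 define Pab where "Pab = ito \<kappa> (a - 1) (b - 1) z"
 \<comment> \<open>The recursion one level lower, multiplied by a so that the case a = 0 is
   included; fact 2 does the same for b.\<close>
 have 1: "of_nat a * P = of_nat a * (?k * z * Pa - ?k * of_nat b * Pab)"
  unfolding P_def Pa_def Pab_def by (cases a) auto
 have 2: "of_nat b * P = of_nat b * (?k * cnj z * Pb - ?k * of_nat a * Pab)"
  unfolding P_def Pb_def Pab_def using Suc.IH[of "b - 1"] by (cases b) auto
 have "ito \<kappa> (Suc a) (Suc b) z = ?k * z * (?k * cnj z * P - ?k * of_nat a * Pa) - ?k * (1 + of_nat b) * P"
  by (simp add: Suc.IH P_def Pa_def)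
 also have "\<dots> = ?k * cnj z * (?k * z * P - ?k * of_nat b * Pb) - ?k * (1 + of_nat a) * P"
  using 1 2 by algebra
 finally show ?case by (simp add: P_def Pb_def)
qed simp

lemma ito_cnj: "cnj (ito \<kappa> a b z) = ito \<kappa> b a z"
proof (induction a arbitrary: b)
 case 0
 show ?case by (induction b) (simp_all add: power_mult_distrib)
next
 case (Suc a)
 then show ?case by (simp add: ito_Suc_right)
qed

text \<open>Writing the real derivative through h and cnj h displays the two Wirtinger derivatives;
  the induction rests on the recursion, again multiplied by a to include a = 0.\<close>

lemma ito_has_derivative:
 "(ito \<kappa> a b has_derivative
  (\<lambda>h. of_real \<kappa> * of_nat a * ito \<kappa> (a - 1) b z * h + of_real \<kappa> * of_nat b * ito \<kappa> a (b - 1) z * cnj h)) (at z)"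
proof (induction a arbitrary: b)
 case 0
 have "((\<lambda>z. (of_real \<kappa> * cnj z) ^ b) has_derivative
   (\<lambda>h. of_nat b * (of_real \<kappa> * cnj h) * (of_real \<kappa> * cnj z) ^ (b - 1))) (at z)"
  by (intro has_derivative_power has_derivative_mult_right has_derivative_cnj has_derivative_ident)
 then show ?case by (simp add: mult_ac)
next
 case (Suc a)
 let ?k = "complex_of_real \<kappa>"
 define P where "P i j = ito \<kappa> i j z" for i j
 have d: "((\<lambda>z. ?k * z * ito \<kappa> a b z - ?k * of_nat b * ito \<kappa> a (b - 1) z) has_derivative
   (\<lambda>h. (?k * z * (?k * of_nat a * P (a - 1) b * h + ?k * of_nat b * P a (b - 1) * cnj h) + ?k * h * P a b)
    - ?k * of_nat b * (?k * of_nat a * P (a - 1) (b - 1) * h + ?k * of_nat (b - 1) * P a (b - 1 - 1) * cnj h))) (at z)"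
  unfolding P_def
  by (intro has_derivative_diff has_derivative_mult has_derivative_mult_right has_derivative_ident Suc.IH)
 show ?case
  unfolding ito.simps(2)
 proof (rule has_derivative_eq_rhs[OF d], rule ext)
  fix h
  have 1: "of_nat a * P a b = of_nat a * (?k * z * P (a - 1) b - ?k * of_nat b * P (a - 1) (b - 1))"
   unfolding P_def by (cases a) auto
  have 2: "P (Suc a) (b - 1) = ?k * z * P a (b - 1) - ?k * of_nat (b - 1) * P a (b - 1 - 1)"
   by (simp add: P_def)
  show "(?k * z * (?k * of_nat a * P (a - 1) b * h + ?k * of_nat b * P a (b - 1) * cnj h) + ?k * h * P a b)
    - ?k * of_nat b * (?k * of_nat a * P (a - 1) (b - 1) * h + ?k * of_nat (b - 1) * P a (b - 1 - 1) * cnj h)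
   = ?k * of_nat (Suc a) * ito \<kappa> (Suc a - 1) b z * h + ?k * of_nat b * (?k * z * ito \<kappa> a (b - 1) z - ?k * of_nat (b - 1) * ito \<kappa> a (b - 1 - 1) z) * cnj h"
   using 1 2 unfolding P_def[symmetric] of_nat_Suc diff_Suc_1 by algebra
 qed
qed

lemma ito_bound: "\<exists>C\<ge>0. \<forall>z. cmod (ito \<kappa> a b z) \<le> C * (1 + cmod z) ^ (a + b)"
proof (induction a arbitrary: b)
 case 0
 have "cmod (ito \<kappa> 0 b z) \<le> \<bar>\<kappa>\<bar> ^ b * (1 + cmod z) ^ (0 + b)" for z
  by (simp add: norm_power norm_mult power_mult_distrib mult_left_mono power_mono)
 then show ?case by (intro exI[of _ "\<bar>\<kappa>\<bar> ^ b"]) auto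
next
 case (Suc a)
 obtain C where C: "C \<ge> 0" "\<And>z. cmod (ito \<kappa> a b z) \<le> C * (1 + cmod z) ^ (a + b)" using Suc.IH[of b] by auto
 obtain D where D: "D \<ge> 0" "\<And>z. cmod (ito \<kappa> a (b - 1) z) \<le> D * (1 + cmod z) ^ (a + (b - 1))" using Suc.IH[of "b - 1"] by auto
 have "cmod (ito \<kappa> (Suc a) b z) \<le> (\<bar>\<kappa>\<bar> * C + \<bar>\<kappa>\<bar> * real b * D) * (1 + cmod z) ^ (Suc a + b)" for z
 proof -
  have "cmod (ito \<kappa> (Suc a) b z) \<le> \<bar>\<kappa>\<bar> * cmod z * cmod (ito \<kappa> a b z) + \<bar>\<kappa>\<bar> * real b * cmod (ito \<kappa> a (b - 1) z)"
   using norm_triangle_ineq4[of "of_real \<kappa> * z * ito \<kappa> a b z" "of_real \<kappa> * of_nat b * ito \<kappa> a (b - 1) z"]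
   by (simp add: norm_mult)
  also have "\<dots> \<le> \<bar>\<kappa>\<bar> * (1 + cmod z) * (C * (1 + cmod z) ^ (a + b)) + \<bar>\<kappa>\<bar> * real b * (D * (1 + cmod z) ^ (Suc a + b))"
  proof (intro add_mono mult_mono C(2))
   have "(1 + cmod z) ^ (a + (b - 1)) \<le> (1 + cmod z) ^ (Suc a + b)" by (intro power_increasing) auto
   then show "cmod (ito \<kappa> a (b - 1) z) \<le> D * (1 + cmod z) ^ (Suc a + b)"
    using D(2)[of z] mult_left_mono[OF _ D(1)] order_trans by blast
  qed (use C D in auto)
  finally show ?thesis by (simp add: algebra_simps)
 qed
 then show ?case using C(1) D(1) by (intro exI[of _ "\<bar>\<kappa>\<bar> * C + \<bar>\<kappa>\<bar> * real b * D"]) auto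
qed

section \<open>The oscillator functions in several variables\<close>

lemma linear_zc: "linear (\<lambda>v. zc v l)"
 by (rule linearI) (auto simp: zc_def complex_eq_iff)

lemma bounded_linear_zc: "bounded_linear (\<lambda>v :: real ^ ('n::finite + 'n). zc v l)"
 by (rule linear_conv_bounded_linear[THEN iffD1, OF linear_zc])

lemma norm_zc_le: "cmod (zc v l) \<le> norm v"
proof (rule power2_le_imp_le)
 have "(cmod (zc v l))\<^sup>2 = (\<Sum>i\<in>{Inl l, Inr l}. (v $ i)\<^sup>2)" by (simp add: zc_def cmod_def)
 also have "\<dots> \<le> (\<Sum>i\<in>UNIV. (v $ i)\<^sup>2)" by (rule sum_mono2) auto
 also have "\<dots> = (norm v)\<^sup>2" by (simp add: norm_vec_def L2_set_def sum_nonneg)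
 finally show "(cmod (zc v l))\<^sup>2 \<le> (norm v)\<^sup>2" .
qed simp

lemma sum_UNIV_sum: "(\<Sum>i\<in>(UNIV :: ('n::finite + 'n) set). f i) = (\<Sum>l\<in>UNIV. f (Inl l) + f (Inr l))"
proof -
 have "(\<Sum>i\<in>(UNIV :: ('n + 'n) set). f i) = (\<Sum>i\<in>UNIV <+> UNIV. f i)" by simp
 also have "\<dots> = (\<Sum>l\<in>UNIV. f (Inl l)) + (\<Sum>l\<in>UNIV. f (Inr l))" by (subst sum.Plus) auto
 finally show ?thesis by (simp add: sum.distrib)
qed

lemma norm_power2_zc: "(norm v)\<^sup>2 = (\<Sum>l\<in>UNIV. (cmod (zc v l))\<^sup>2)"
proof -
 have "(norm v)\<^sup>2 = (\<Sum>i\<in>UNIV. (v $ i)\<^sup>2)" by (simp add: norm_vec_def L2_set_def sum_nonneg)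
 then show ?thesis by (simp add: sum_UNIV_sum zc_def cmod_def)
qed

lemma zc_axis: "zc (axis (Inl l) 1) m = (if l = m then 1 else 0)" "zc (axis (Inr l) 1) m = (if l = m then \<i> else 0)"
 by (auto simp: zc_def axis_def complex_eq_iff)

definition gaussian :: "('n::finite => real) => real ^ ('n + 'n) => complex" where
 "gaussian \<kappa> x = of_real (exp (- (\<Sum>l\<in>UNIV. \<kappa> l * (cmod (zc x l))\<^sup>2) / 2))"

definition osc :: "('n::finite => real) => ('n => nat) => ('n => nat) => real ^ ('n + 'n) => complex" where
 "osc \<kappa> a b x = gaussian \<kappa> x * (\<Prod>l\<in>UNIV. ito (\<kappa> l) (a l) (b l) (zc x l))"

text \<open>Isolates the l-th factor: changing a or b at l leaves this part alone, so identities for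
  \<open>ito\<close> in one variable carry over to \<open>osc\<close>.\<close>

definition osc_rest :: "('n::finite => real) => ('n => nat) => ('n => nat) => 'n => real ^ ('n + 'n) => complex" where
 "osc_rest \<kappa> a b l x = gaussian \<kappa> x * (\<Prod>m\<in>UNIV - {l}. ito (\<kappa> m) (a m) (b m) (zc x m))"

lemma osc_split: "osc \<kappa> a b x = osc_rest \<kappa> a b l x * ito (\<kappa> l) (a l) (b l) (zc x l)"
 unfolding osc_def osc_rest_def by (subst prod.remove[of _ l]) auto

lemma osc_rest_upd: "osc_rest \<kappa> (a(l := i)) b l x = osc_rest \<kappa> a b l x" "osc_rest \<kappa> a (b(l := i)) l x = osc_rest \<kappa> a b l x"
 unfolding osc_rest_def by (auto intro!: arg_cong[where f="\<lambda>p. gaussian \<kappa> x * p"] prod.cong)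

lemma osc_Suc_a: "osc \<kappa> (a(l := Suc (a l))) b x = of_real (\<kappa> l) * zc x l * osc \<kappa> a b x - of_real (\<kappa> l) * of_nat (b l) * osc \<kappa> a (b(l := b l - 1)) x"
 by (simp add: osc_split[of \<kappa> _ _ x l] osc_rest_upd algebra_simps)

lemma osc_Suc_b: "osc \<kappa> a (b(l := Suc (b l))) x = of_real (\<kappa> l) * cnj (zc x l) * osc \<kappa> a b x - of_real (\<kappa> l) * of_nat (a l) * osc \<kappa> (a(l := a l - 1)) b x"
 by (simp add: osc_split[of \<kappa> _ _ x l] osc_rest_upd ito_Suc_right algebra_simps del: ito.simps)

lemma osc_cnj: "cnj (osc \<kappa> a b x) = osc \<kappa> b a x"
 by (simp add: osc_def gaussian_def ito_cnj)

lemma gaussian_has_derivative: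
 "(gaussian \<kappa> has_derivative (\<lambda>h. - (1/2) * (\<Sum>l\<in>UNIV. of_real (\<kappa> l) * (cnj (zc x l) * zc h l + zc x l * cnj (zc h l))) * gaussian \<kappa> x)) (at x)"
proof -
 have e: "gaussian \<kappa> = (\<lambda>x. exp (- (1/2) * (\<Sum>l\<in>UNIV. of_real (\<kappa> l) * (zc x l * cnj (zc x l)))))"
  by (auto simp: gaussian_def complex_norm_square[symmetric] fun_eq_iff simp flip: exp_of_real)
 have z: "((\<lambda>x. zc x l) has_derivative (\<lambda>h. zc h l)) (at x)" for l
  by (rule bounded_linear_imp_has_derivative[OF bounded_linear_zc])
 have q: "((\<lambda>x. - (1/2) * (\<Sum>l\<in>UNIV. of_real (\<kappa> l) * (zc x l * cnj (zc x l)))) has_derivative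
   (\<lambda>h. - (1/2) * (\<Sum>l\<in>UNIV. of_real (\<kappa> l) * (zc x l * cnj (zc h l) + zc h l * cnj (zc x l))))) (at x)"
  by (intro has_derivative_mult_right has_derivative_sum has_derivative_mult has_derivative_cnj z)
 have "((\<lambda>x. exp (- (1/2) * (\<Sum>l\<in>UNIV. of_real (\<kappa> l) * (zc x l * cnj (zc x l))))) has_derivative
   (\<lambda>h. exp (- (1/2) * (\<Sum>l\<in>UNIV. of_real (\<kappa> l) * (zc x l * cnj (zc x l)))) *
    (- (1/2) * (\<Sum>l\<in>UNIV. of_real (\<kappa> l) * (zc x l * cnj (zc h l) + zc h l * cnj (zc x l)))))) (at x)"
  using has_derivative_compose[OF q DERIV_exp[unfolded has_field_derivative_def]] .
 then show ?thesis unfolding e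
  by (rule has_derivative_eq_rhs) (simp add: fun_eq_iff mult_ac add.commute)
qed

text \<open>Along z_l the polynomial contributes \<kappa> a times the lowered function, the Gaussian
  contributes -(\<kappa> / 2) cnj z_l. Rewriting \<kappa> cnj z_l osc by the recursion for b leaves
  oscillator functions only, without multiplication by coordinates; the conjugate part is
  alike.\<close>

lemma osc_has_derivative:
 "(osc \<kappa> a b has_derivative (\<lambda>h. (1/2) * (\<Sum>l\<in>UNIV.
   (of_real (\<kappa> l) * of_nat (a l) * osc \<kappa> (a(l := a l - 1)) b x - osc \<kappa> a (b(l := Suc (b l))) x) * zc h l
   + (of_real (\<kappa> l) * of_nat (b l) * osc \<kappa> a (b(l := b l - 1)) x - osc \<kappa> (a(l := Suc (a l))) b x) * cnj (zc h l)))) (at x)"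
proof -
 let ?i = "\<lambda>l. ito (\<kappa> l) (a l) (b l) (zc x l)"
 let ?d = "\<lambda>l h. of_real (\<kappa> l) * of_nat (a l) * ito (\<kappa> l) (a l - 1) (b l) (zc x l) * zc h l
  + of_real (\<kappa> l) * of_nat (b l) * ito (\<kappa> l) (a l) (b l - 1) (zc x l) * cnj (zc h l)"
 have z: "((\<lambda>x. zc x l) has_derivative (\<lambda>h. zc h l)) (at x)" for l
  by (rule bounded_linear_imp_has_derivative[OF bounded_linear_zc])
 have i: "((\<lambda>x. ito (\<kappa> l) (a l) (b l) (zc x l)) has_derivative ?d l) (at x)" for l
  by (rule has_derivative_compose[OF z ito_has_derivative])
 have "(osc \<kappa> a b has_derivative (\<lambda>h. gaussian \<kappa> x * (\<Sum>l\<in>UNIV. ?d l h * (\<Prod>m\<in>UNIV - {l}. ?i m))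
   + (- (1/2) * (\<Sum>l\<in>UNIV. of_real (\<kappa> l) * (cnj (zc x l) * zc h l + zc x l * cnj (zc h l))) * gaussian \<kappa> x) * (\<Prod>l\<in>UNIV. ?i l))) (at x)"
  unfolding osc_def[abs_def]
  by (intro has_derivative_mult gaussian_has_derivative has_derivative_prod i)
 then show ?thesis
 proof (rule has_derivative_eq_rhs, intro ext)
  fix h
  have "gaussian \<kappa> x * (\<Sum>l\<in>UNIV. ?d l h * (\<Prod>m\<in>UNIV - {l}. ?i m))
   + (- (1/2) * (\<Sum>l\<in>UNIV. of_real (\<kappa> l) * (cnj (zc x l) * zc h l + zc x l * cnj (zc h l))) * gaussian \<kappa> x) * (\<Prod>l\<in>UNIV. ?i l)
   = (\<Sum>l\<in>UNIV. ?d l h * osc_rest \<kappa> a b l x - (1/2) * (of_real (\<kappa> l) * (cnj (zc x l) * zc h l + zc x l * cnj (zc h l))) * osc \<kappa> a b x)"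
   unfolding osc_def osc_rest_def sum_subtractf sum_distrib_left sum_distrib_right
   by (simp add: sum_distrib_left sum_distrib_right mult_ac flip: sum_negf)
  also have "\<dots> = (\<Sum>l\<in>UNIV. (1/2) * (
   (of_real (\<kappa> l) * of_nat (a l) * osc \<kappa> (a(l := a l - 1)) b x - osc \<kappa> a (b(l := Suc (b l))) x) * zc h l
   + (of_real (\<kappa> l) * of_nat (b l) * osc \<kappa> a (b(l := b l - 1)) x - osc \<kappa> (a(l := Suc (a l))) b x) * cnj (zc h l)))"
  proof (rule sum.cong[OF refl])
   fix l
   have A: "osc \<kappa> (a(l := a l - 1)) b x = osc_rest \<kappa> a b l x * ito (\<kappa> l) (a l - 1) (b l) (zc x l)"
    "osc \<kappa> a (b(l := b l - 1)) x = osc_rest \<kappa> a b l x * ito (\<kappa> l) (a l) (b l - 1) (zc x l)"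
    by (simp_all add: osc_split[of \<kappa> _ _ x l] osc_rest_upd)
   show "?d l h * osc_rest \<kappa> a b l x - (1/2) * (of_real (\<kappa> l) * (cnj (zc x l) * zc h l + zc x l * cnj (zc h l))) * osc \<kappa> a b x
    = (1/2) * (
   (of_real (\<kappa> l) * of_nat (a l) * osc \<kappa> (a(l := a l - 1)) b x - osc \<kappa> a (b(l := Suc (b l))) x) * zc h l
   + (of_real (\<kappa> l) * of_nat (b l) * osc \<kappa> a (b(l := b l - 1)) x - osc \<kappa> (a(l := Suc (a l))) b x) * cnj (zc h l))"
    unfolding osc_Suc_a osc_Suc_b A by (simp add: field_simps)
  qed
  finally show "gaussian \<kappa> x * (\<Sum>l\<in>UNIV. ?d l h * (\<Prod>m\<in>UNIV - {l}. ?i m))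
   + (- (1/2) * (\<Sum>l\<in>UNIV. of_real (\<kappa> l) * (cnj (zc x l) * zc h l + zc x l * cnj (zc h l))) * gaussian \<kappa> x) * (\<Prod>l\<in>UNIV. ?i l)
   = (1/2) * (\<Sum>l\<in>UNIV.
   (of_real (\<kappa> l) * of_nat (a l) * osc \<kappa> (a(l := a l - 1)) b x - osc \<kappa> a (b(l := Suc (b l))) x) * zc h l
   + (of_real (\<kappa> l) * of_nat (b l) * osc \<kappa> a (b(l := b l - 1)) x - osc \<kappa> (a(l := Suc (a l))) b x) * cnj (zc h l))"
   by (simp only: sum_distrib_left)
 qed
qed

text \<open>The span is stable under derivatives and, for nonzero \<kappa>, under multiplication by
  z_l and cnj z_l, so it contains every polynomial times the Gaussian.\<close>

inductive_set osc_span :: "('n::finite => real) => (real ^ ('n + 'n) => complex) set" for \<kappa> where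
 osc_span_osc: "osc \<kappa> a b \<in> osc_span \<kappa>"
| osc_span_add: "f \<in> osc_span \<kappa> ==> g \<in> osc_span \<kappa> ==> (\<lambda>x. f x + g x) \<in> osc_span \<kappa>"
| osc_span_scale: "f \<in> osc_span \<kappa> ==> (\<lambda>x. c * f x) \<in> osc_span \<kappa>"

lemma osc_span_0: "(\<lambda>x. 0) \<in> osc_span \<kappa>"
 using osc_span_scale[OF osc_span_osc, of 0] by simp

lemma osc_span_diff: "f \<in> osc_span \<kappa> ==> g \<in> osc_span \<kappa> ==> (\<lambda>x. f x - g x) \<in> osc_span \<kappa>"
 using osc_span_add[of f \<kappa> "\<lambda>x. (-1) * g x"] osc_span_scale[of g \<kappa> "-1"] by simp

lemma osc_span_scale_right: "f \<in> osc_span \<kappa> ==> (\<lambda>x. f x * c) \<in> osc_span \<kappa>"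
 using osc_span_scale[of f \<kappa> c] by (simp add: mult.commute)

lemma osc_span_sum: "(\<And>i. i \<in> I ==> f i \<in> osc_span \<kappa>) ==> (\<lambda>x. \<Sum>i\<in>I. f i x) \<in> osc_span \<kappa>"
 by (induction I rule: infinite_finite_induct) (simp_all add: osc_span_0 osc_span_add)

lemma osc_span_differentiable: "f \<in> osc_span \<kappa> ==> f differentiable at x"
proof (induction rule: osc_span.induct)
 case (osc_span_osc a b)
 show ?case using osc_has_derivative differentiable_def by blast
qed (simp_all add: differentiable_mult)

lemma osc_span_pd: "f \<in> osc_span \<kappa> ==> pd f v \<in> osc_span \<kappa>"
proof (induction rule: osc_span.induct)
 case (osc_span_osc a b)
 have "pd (osc \<kappa> a b) v = (\<lambda>x. (1/2) * (\<Sum>l\<in>UNIV.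
   (of_real (\<kappa> l) * of_nat (a l) * osc \<kappa> (a(l := a l - 1)) b x - osc \<kappa> a (b(l := Suc (b l))) x) * zc v l
   + (of_real (\<kappa> l) * of_nat (b l) * osc \<kappa> a (b(l := b l - 1)) x - osc \<kappa> (a(l := Suc (a l))) b x) * cnj (zc v l)))"
  by (rule ext) (rule pd_eq_of_has_derivative[OF osc_has_derivative])
 also have "\<dots> \<in> osc_span \<kappa>"
  by (intro osc_span_scale osc_span_sum osc_span_add osc_span_scale_right osc_span_diff osc_span.osc_span_osc)
 finally show ?case .
next
 case (osc_span_add f g)
 have "pd (\<lambda>x. f x + g x) v = (\<lambda>x. pd f v x + pd g v x)"
  by (rule ext) (rule pd_add; rule osc_span_differentiable, fact)
 then show ?case using osc_span.osc_span_add[OF osc_span_add.IH] by simp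
next
 case (osc_span_scale f c)
 have "pd (\<lambda>x. c * f x) v = (\<lambda>x. c * pd f v x)"
  by (rule ext, rule pd_bounded_linear[OF bounded_linear_mult_right]) (rule osc_span_differentiable, fact)
 then show ?case using osc_span.osc_span_scale[OF osc_span_scale.IH] by simp
qed

lemma osc_span_smooth: "f \<in> osc_span \<kappa> ==> smooth_on UNIV f"
 by (rule smooth_on_coinduct[where P="\<lambda>f. f \<in> osc_span \<kappa>"])
  (simp_all add: osc_span_pd differentiable_on_def osc_span_differentiable)

lemma osc_span_continuous: "f \<in> osc_span \<kappa> ==> continuous_on UNIV f"
 using osc_span_smooth smooth_on_continuous by blast

lemma osc_span_measurable: "f \<in> osc_span \<kappa> ==> f \<in> meas"
 by (rule borel_measurable_continuous_onI[OF osc_span_continuous])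

text \<open>The two recursions, solved for the product with z_l or cnj z_l; this is where \<kappa>_l
  is divided out.\<close>

lemma osc_span_zc:
 assumes "f \<in> osc_span \<kappa>" "\<kappa> l \<noteq> 0"
 shows "(\<lambda>x. zc x l * f x) \<in> osc_span \<kappa>" "(\<lambda>x. cnj (zc x l) * f x) \<in> osc_span \<kappa>"
proof -
 have "(\<lambda>x. zc x l * f x) \<in> osc_span \<kappa> \<and> (\<lambda>x. cnj (zc x l) * f x) \<in> osc_span \<kappa>"
  using assms(1)
 proof induction
  case (osc_span_osc a b)
  have "(\<lambda>x. zc x l * osc \<kappa> a b x) = (\<lambda>x. (1 / of_real (\<kappa> l)) * (osc \<kappa> (a(l := Suc (a l))) b x + (of_real (\<kappa> l) * of_nat (b l)) * osc \<kappa> a (b(l := b l - 1)) x))"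
   using assms(2) by (simp add: fun_eq_iff osc_Suc_a field_simps)
  moreover have "(\<lambda>x. cnj (zc x l) * osc \<kappa> a b x) = (\<lambda>x. (1 / of_real (\<kappa> l)) * (osc \<kappa> a (b(l := Suc (b l))) x + (of_real (\<kappa> l) * of_nat (a l)) * osc \<kappa> (a(l := a l - 1)) b x))"
   using assms(2) by (simp add: fun_eq_iff osc_Suc_b field_simps)
  ultimately show ?case by (simp only:) (intro conjI osc_span_scale osc_span_add osc_span.osc_span_osc)
 next
  case (osc_span_add f g)
  then show ?case by (simp add: distrib_left osc_span.osc_span_add)
 next
  case (osc_span_scale f c)
  then show ?case by (simp add: mult.left_commute osc_span.osc_span_scale)
 qed
 then show "(\<lambda>x. zc x l * f x) \<in> osc_span \<kappa>" "(\<lambda>x. cnj (zc x l) * f x) \<in> osc_span \<kappa>" by auto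
qed

lemma gaussian_bounded:
 assumes "\<And>l. \<kappa> l > 0"
 shows "gauss_bounded (gaussian \<kappa>)"
proof -
 \<comment> \<open>The direction of slowest decay determines the common rate.\<close>
 define c where "c = Min (range \<kappa>)"
 have c: "c > 0" "\<And>l. c \<le> \<kappa> l" using assms unfolding c_def by (auto simp: Min_gr_iff)
 have "norm (gaussian \<kappa> x) \<le> 1 * exp (- (c / 2) * (norm x)\<^sup>2)" for x
 proof -
  have "c * (norm x)\<^sup>2 \<le> (\<Sum>l\<in>UNIV. \<kappa> l * (cmod (zc x l))\<^sup>2)"
   unfolding norm_power2_zc sum_distrib_left by (intro sum_mono mult_right_mono c) auto
  then show ?thesis by (simp add: gaussian_def)
 qed
 then show ?thesis using c(1) unfolding gauss_bounded_def by (intro exI[of _ 1] exI[of _ "c / 2"]) auto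
qed

lemma osc_gauss_bounded:
 assumes "\<And>l. \<kappa> l > 0"
 shows "gauss_bounded (osc \<kappa> a b)"
proof -
 have "\<forall>l. \<exists>C. C \<ge> 0 \<and> (\<forall>z. cmod (ito (\<kappa> l) (a l) (b l) z) \<le> C * (1 + cmod z) ^ (a l + b l))"
  using ito_bound by blast
 then obtain C where C: "\<And>l. C l \<ge> 0" "\<And>l z. cmod (ito (\<kappa> l) (a l) (b l) z) \<le> C l * (1 + cmod z) ^ (a l + b l)"
  by metis
 show ?thesis
 proof (rule gauss_bounded_poly_growth[OF gaussian_bounded[OF assms]])
  fix x :: "real ^ ('a + 'a)"
  have "cmod (\<Prod>l\<in>UNIV. ito (\<kappa> l) (a l) (b l) (zc x l)) \<le> (\<Prod>l\<in>UNIV. C l * (1 + norm x) ^ (a l + b l))"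
   unfolding prod_norm[symmetric]
  proof (intro prod_mono conjI)
   fix l
   have "C l * (1 + cmod (zc x l)) ^ (a l + b l) \<le> C l * (1 + norm x) ^ (a l + b l)"
    by (intro mult_left_mono power_mono add_left_mono norm_zc_le C(1)) auto
   then show "cmod (ito (\<kappa> l) (a l) (b l) (zc x l)) \<le> C l * (1 + norm x) ^ (a l + b l)"
    using C(2)[of l "zc x l"] by linarith
  qed simp
  also have "\<dots> = (\<Prod>l\<in>UNIV. C l) * (1 + norm x) ^ (\<Sum>l\<in>UNIV. a l + b l)"
   by (simp add: prod.distrib power_sum)
  finally show "norm (osc \<kappa> a b x) \<le> (\<Prod>l\<in>UNIV. C l) * (1 + norm x) ^ (\<Sum>l\<in>UNIV. a l + b l) * norm (gaussian \<kappa> x)"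
   unfolding osc_def norm_mult by (subst mult.commute) (rule mult_right_mono, auto)
 qed
qed

lemma osc_span_gauss_bounded:
 assumes "f \<in> osc_span \<kappa>" "\<And>l. \<kappa> l > 0"
 shows "gauss_bounded f"
 using assms(1)
proof induction
 case (osc_span_osc a b)
 show ?case by (rule osc_gauss_bounded[OF assms(2)])
next
 case (osc_span_add f g)
 then show ?case by (intro gauss_bounded_add)
next
 case (osc_span_scale f c)
 show ?case by (rule gauss_bounded_mono[OF osc_span_scale.IH, of _ "cmod c"]) (simp add: norm_mult)
qed

section \<open>Integration by parts\<close>

definition tame :: "('a::euclidean_space => complex) => bool" where
 "tame f \<longleftrightarrow> gauss_bounded f \<and> (\<forall>x. f differentiable at x) \<and>
  (\<forall>v. continuous_on UNIV (pd f v) \<and> gauss_bounded (pd f v))"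

definition sinner :: "('a::euclidean_space => complex) => ('a => complex) => complex" where
 "sinner f g = (LINT x|lborel. f x * cnj (g x))"

lemma tame_continuous: "tame f ==> continuous_on UNIV f"
 by (intro differentiable_imp_continuous_on) (auto simp: tame_def differentiable_on_def)

lemma tame_measurable: "tame f ==> f \<in> meas"
 by (rule borel_measurable_continuous_onI[OF tame_continuous])

lemma tame_osc: "f \<in> osc_span \<kappa> ==> (\<And>l. \<kappa> l > 0) ==> tame f"
 unfolding tame_def
 by (intro conjI allI osc_span_gauss_bounded[of _ \<kappa>] osc_span_differentiable[of _ \<kappa>] osc_span_continuous[of _ \<kappa>] osc_span_pd)
  assumption+

lemma bounded_support_pd:
 fixes f :: "'a::euclidean_space => 'b::real_normed_vector"
 assumes "bounded {x. f x \<noteq> 0}"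
 shows "bounded {x. pd f v x \<noteq> 0}"
proof (rule bounded_subset[OF bounded_closure[OF assms]], rule subsetI, rule ccontr)
 fix x assume "x \<in> {x. pd f v x \<noteq> 0}" and x: "x \<notin> closure {x. f x \<noteq> 0}"
 have "pd f v x = pd (\<lambda>x. 0) v x"
 proof (rule pd_cong_open)
  show "open (- closure {x. f x \<noteq> 0})" by auto
  show "f y = 0" if "y \<in> - closure {x. f x \<noteq> 0}" for y
   using that closure_subset[of "{x. f x \<noteq> 0}"] by auto
 qed (use x in auto)
 also have "pd (\<lambda>x. 0 :: 'b) v x = 0" by (rule pd_eq_of_has_derivative) simp
 finally show False using \<open>x \<in> {x. pd f v x \<noteq> 0}\<close> by simp
qed

lemma tame_bounded_support:
 fixes f :: "'a::euclidean_space => complex"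
 assumes "smooth_on UNIV f" "bounded {x. f x \<noteq> 0}"
 shows "tame f"
 unfolding tame_def
proof (intro conjI allI)
 show "gauss_bounded f" by (rule gauss_bounded_bounded_support[OF smooth_on_continuous[OF assms(1)] assms(2)])
 show "f differentiable at x" for x by (rule smooth_on_differentiable[OF assms(1)]) auto
 show "continuous_on UNIV (pd f v)" for v by (rule smooth_on_continuous[OF smooth_on_pd[OF assms(1)]])
 show "gauss_bounded (pd f v)" for v
  by (rule gauss_bounded_bounded_support[OF smooth_on_continuous[OF smooth_on_pd[OF assms(1)]] bounded_support_pd[OF assms(2)]])
qed

lemma integrable_sinner:
 assumes "gauss_bounded f" "gauss_bounded g" "f \<in> meas" "g \<in> meas"
 shows "integrable lborel (\<lambda>x. f x * cnj (g x))"
proof (rule gauss_bounded_integrable)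
 have "gauss_bounded (\<lambda>x. cnj (g x))" by (rule gauss_bounded_mono[OF assms(2), of _ 1]) simp
 then show "gauss_bounded (\<lambda>x. f x * cnj (g x))" by (rule gauss_bounded_mult[OF assms(1)])
 show "(\<lambda>x. f x * cnj (g x)) \<in> meas"
  using assms(3) measurable_compose[OF assms(4) borel_measurable_continuous_onI[OF continuous_on_cnj[OF continuous_on_id]]]
  by (simp add: borel_measurable_times)
qed

lemma tame_integrable: "tame f ==> tame g ==> integrable lborel (\<lambda>x. f x * cnj (g x))"
 by (rule integrable_sinner) (auto simp: tame_measurable tame_def)

text \<open>The product f cnj g and its derivative are Gaussian bounded, so the derivative
  integrates to 0. The conditions in \<open>tame\<close> are those that both oscillator functions
  and compactly supported smooth functions satisfy.\<close>

lemma by_parts: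
 assumes f: "tame f" and g: "tame g"
 shows "sinner (pd f v) g = - sinner f (pd g v)"
proof -
 define w where "w x = f x * cnj (g x)" for x
 have df: "f differentiable at x" and dg: "g differentiable at x" for x using f g by (auto simp: tame_def)
 have w': "(w has_derivative (\<lambda>v. f x * cnj (pd g v x) + pd f v x * cnj (g x))) (at x)" for x
  unfolding w_def by (intro has_derivative_mult has_derivative_cnj pd_works df dg)
 have pdw: "pd w v = (\<lambda>x. f x * cnj (pd g v x) + pd f v x * cnj (g x))"
  by (rule ext) (rule pd_eq_of_has_derivative[OF w'])
 have cg: "gauss_bounded (\<lambda>x. cnj (h x))" if "gauss_bounded h" for h :: "'a => complex"
  by (rule gauss_bounded_mono[OF that, of _ 1]) simp
 have gb: "gauss_bounded f" "gauss_bounded g" "gauss_bounded (pd f v)" "gauss_bounded (pd g v)"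
  using f g by (auto simp: tame_def)
 have cont: "continuous_on UNIV f" "continuous_on UNIV g" "continuous_on UNIV (pd f v)" "continuous_on UNIV (pd g v)"
  using tame_continuous f g by (auto simp: tame_def)
 have m: "f \<in> meas" "g \<in> meas" "pd f v \<in> meas" "pd g v \<in> meas"
  using cont by (auto intro: borel_measurable_continuous_onI)
 have "(LINT x|lborel. pd w v x) = 0"
 proof (rule integral_pd_eq_0_gauss)
  show "gauss_bounded w" unfolding w_def by (intro gauss_bounded_mult cg gb)
  show "gauss_bounded (pd w v)" unfolding pdw by (intro gauss_bounded_add gauss_bounded_mult cg gb)
  show "w differentiable at x" for x using w' differentiable_def by blast
  show "pd w v \<in> meas" unfolding pdw
   by (intro borel_measurable_continuous_onI continuous_intros cont)
 qed
 then show ?thesis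
  unfolding pdw sinner_def using integrable_sinner[OF gb(1,4) m(1,4)] integrable_sinner[OF gb(3,2) m(3,2)]
  by (simp add: eq_neg_iff_add_eq_0 add.commute)
qed

lemma sinner_add_left: "tame f ==> tame f' ==> tame g ==> sinner (\<lambda>x. f x + f' x) g = sinner f g + sinner f' g"
 by (simp add: sinner_def distrib_right tame_integrable)

lemma sinner_add_right: "tame f ==> tame g ==> tame g' ==> sinner f (\<lambda>x. g x + g' x) = sinner f g + sinner f g'"
 by (simp add: sinner_def distrib_left tame_integrable)

lemma sinner_scale_left: "sinner (\<lambda>x. c * f x) g = c * sinner f g"
 by (simp add: sinner_def mult.assoc)

lemma sinner_scale_right: "sinner f (\<lambda>x. c * g x) = cnj c * sinner f g"
 by (simp add: sinner_def mult.left_commute)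

lemma sinner_cnj: "cnj (sinner f g) = sinner g f"
 by (simp add: sinner_def mult.commute flip: Bochner_Integration.integral_cnj)

section \<open>Ladder relations and orthogonality\<close>

locale oscillator =
 fixes \<kappa> :: "'n::finite => real"
 assumes \<kappa>: "\<And>l. \<kappa> l > 0"
begin

abbreviation "e \<equiv> osc \<kappa>"

lemma tame_e: "tame (e a b)"
 by (rule tame_osc[OF osc_span_osc \<kappa>])

lemma tame_span: "f \<in> osc_span \<kappa> ==> tame f"
 by (rule tame_osc[OF _ \<kappa>])

definition lower :: "('n => nat) => ('n => nat) => 'n => real ^ ('n + 'n) => complex" where
 "lower a b l x = of_real (\<kappa> l) * of_nat (a l) * e (a(l := a l - 1)) b x - e a (b(l := Suc (b l))) x"

definition lower' :: "('n => nat) => ('n => nat) => 'n => real ^ ('n + 'n) => complex" where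
 "lower' a b l x = of_real (\<kappa> l) * of_nat (b l) * e a (b(l := b l - 1)) x - e (a(l := Suc (a l))) b x"

lemma lower_span: "lower a b l \<in> osc_span \<kappa>" "lower' a b l \<in> osc_span \<kappa>"
 unfolding lower_def[abs_def] lower'_def[abs_def] by (intro osc_span_diff osc_span_scale osc_span_osc)+

lemma pd_e:
 "pd (e a b) (axis (Inl l) 1) = (\<lambda>x. (1/2) * (lower a b l x + lower' a b l x))"
 "pd (e a b) (axis (Inr l) 1) = (\<lambda>x. (\<i>/2) * (lower a b l x - lower' a b l x))"
proof -
 have s: "(\<Sum>m\<in>UNIV. A m * (if l = m then c else 0) + B m * cnj (if l = m then c else 0)) = A l * c + B l * cnj c"
  for A B :: "'n => complex" and c
  by (simp add: if_distrib sum.distrib cong: if_cong)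
 show "pd (e a b) (axis (Inl l) 1) = (\<lambda>x. (1/2) * (lower a b l x + lower' a b l x))"
  by (rule ext, subst pd_eq_of_has_derivative[OF osc_has_derivative])
   (simp add: zc_axis lower_def lower'_def s[of _ 1, simplified] if_distrib sum.distrib cong: if_cong)
 show "pd (e a b) (axis (Inr l) 1) = (\<lambda>x. (\<i>/2) * (lower a b l x - lower' a b l x))"
  by (rule ext, subst pd_eq_of_has_derivative[OF osc_has_derivative])
   (simp add: zc_axis lower_def lower'_def if_distrib sum.distrib algebra_simps cong: if_cong)
qed

text \<open>\<open>lower\<close> is the differential operator \<open>2\<partial>\<^sub>z\<close> applied to an eigenfunction, \<open>lower'\<close> is its
  conjugate; the two operators are minus adjoint to each other.\<close>

lemma lower_eq: "lower a b l x = pd (e a b) (axis (Inl l) 1) x - \<i> * pd (e a b) (axis (Inr l) 1) x"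
 "lower' a b l x = pd (e a b) (axis (Inl l) 1) x + \<i> * pd (e a b) (axis (Inr l) 1) x"
 by (simp_all add: pd_e algebra_simps)

lemma sinner_lower: "sinner (lower a b l) (e a' b') = - sinner (e a b) (lower' a' b' l)"
proof -
 have t: "tame (pd (e a b) v)" for a b v by (rule tame_span[OF osc_span_pd[OF osc_span_osc]])
 have ts: "tame (\<lambda>x. c * pd (e a b) v x)" for a b v c by (rule tame_span[OF osc_span_scale[OF osc_span_pd[OF osc_span_osc]]])
 have "sinner (lower a b l) (e a' b') = sinner (\<lambda>x. pd (e a b) (axis (Inl l) 1) x + (- \<i>) * pd (e a b) (axis (Inr l) 1) x) (e a' b')"
  by (simp add: lower_eq(1)[abs_def])
 also have "\<dots> = - (sinner (e a b) (pd (e a' b') (axis (Inl l) 1)) + (- \<i>) * sinner (e a b) (pd (e a' b') (axis (Inr l) 1)))"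
  by (simp only: sinner_add_left[OF t ts tame_e] sinner_scale_left by_parts[OF tame_e tame_e]) (simp add: algebra_simps)
 also have "\<dots> = - sinner (e a b) (\<lambda>x. pd (e a' b') (axis (Inl l) 1) x + \<i> * pd (e a' b') (axis (Inr l) 1) x)"
  by (simp add: sinner_add_right[OF tame_e t ts] sinner_scale_right)
 finally show ?thesis by (simp add: lower_eq(2)[abs_def])
qed

lemma sinner_lower': "sinner (lower' a b l) (e a' b') = - sinner (e a b) (lower a' b' l)"
 using arg_cong[OF sinner_lower[of a' b' l a b], of cnj] by (simp add: sinner_cnj)

lemma e_Suc_a: "e (a(l := Suc (a l))) b = (\<lambda>x. (1/2) * (of_real (\<kappa> l) * (zc x l * e a b x) + (-1) * lower' a b l x))"
 by (rule ext) (simp add: lower'_def osc_Suc_a algebra_simps)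

text \<open>The creation operator is (\<kappa> z - 2 d/d(cnj z)) / 2, with adjoint (\<kappa> cnj z +
  2 d/dz) / 2. By the recursion for b the terms with raised b cancel in the adjoint, so that it only
  lowers a'.\<close>

lemma ladder_a:
 "sinner (e (a(l := Suc (a l))) b) (e a' b') = of_real (\<kappa> l) * of_nat (a' l) * sinner (e a b) (e (a'(l := a' l - 1)) b')"
proof -
 have k: "\<kappa> l \<noteq> 0" using \<kappa>[of l] by simp
 have t1: "tame (\<lambda>x. of_real (\<kappa> l) * (zc x l * e a b x))" for a b
  by (rule tame_span) (intro osc_span_scale osc_span_zc(1)[where f="e a b", OF osc_span_osc k])
 have t1': "tame (\<lambda>x. of_real (\<kappa> l) * (cnj (zc x l) * e a b x))" for a b
  by (rule tame_span) (intro osc_span_scale osc_span_zc(2)[where f="e a b", OF osc_span_osc k])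
 have t2: "tame (\<lambda>x. (-1) * lower' a b l x)" by (rule tame_span) (intro osc_span_scale lower_span)
 have "sinner (e (a(l := Suc (a l))) b) (e a' b')
   = (1/2) * (sinner (\<lambda>x. of_real (\<kappa> l) * (zc x l * e a b x)) (e a' b') - sinner (lower' a b l) (e a' b'))"
  unfolding e_Suc_a by (simp only: sinner_scale_left sinner_add_left[OF t1 t2 tame_e]) simp
 also have "sinner (\<lambda>x. of_real (\<kappa> l) * (zc x l * e a b x)) (e a' b') = sinner (e a b) (\<lambda>x. of_real (\<kappa> l) * (cnj (zc x l) * e a' b' x))"
  by (simp add: sinner_def mult_ac)
 also have "\<dots> - sinner (lower' a b l) (e a' b') = sinner (e a b) (\<lambda>x. of_real (\<kappa> l) * (cnj (zc x l) * e a' b' x) + lower a' b' l x)"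
  by (simp add: sinner_lower' sinner_add_right[OF tame_e t1' tame_span[OF lower_span(1)]])
 also have "(\<lambda>x. of_real (\<kappa> l) * (cnj (zc x l) * e a' b' x) + lower a' b' l x)
   = (\<lambda>x. (2 * of_real (\<kappa> l) * of_nat (a' l)) * e (a'(l := a' l - 1)) b' x)"
  by (rule ext) (simp add: lower_def osc_Suc_b algebra_simps)
 finally show ?thesis unfolding sinner_scale_right by (simp del: fun_upd_apply)
qed

text \<open>Complex conjugation exchanges a and b, which carries the ladder for a over to b.\<close>

lemma sinner_swap: "sinner (e a b) (e a' b') = cnj (sinner (e b a) (e b' a'))"
 unfolding sinner_cnj by (simp add: sinner_def osc_cnj mult.commute)

lemma ladder_b:
 "sinner (e a (b(l := Suc (b l)))) (e a' b') = of_real (\<kappa> l) * of_nat (b' l) * sinner (e a b) (e a' (b'(l := b' l - 1)))"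
 unfolding sinner_swap[of a] ladder_a by simp

text \<open>Lowering \<open>a l\<close> and \<open>a' l\<close> together keeps them different until
  one of them is 0, where the factor of the lowering operator annihilates the product.\<close>

lemma orth_a: "a l = n ==> a' l \<noteq> n ==> sinner (e a b) (e a' b') = 0"
proof (induction n arbitrary: a a')
 case 0
 then obtain m where m: "a' l = Suc m" by (cases "a' l") auto
 have "a' = (a'(l := m))(l := Suc ((a'(l := m)) l))" using m by auto
 then have "sinner (e a' b') (e a b) = of_real (\<kappa> l) * of_nat (a l) * sinner (e (a'(l := m)) b') (e (a(l := a l - 1)) b)"
  using ladder_a[of "a'(l := m)" l b' a b] by simp
 then have "sinner (e a' b') (e a b) = 0" using 0 by simp
 then show ?case using sinner_cnj[of "e a' b'" "e a b"] by simp
next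
 case (Suc m)
 have "a = (a(l := m))(l := Suc ((a(l := m)) l))" using Suc.prems by auto
 then have *: "sinner (e a b) (e a' b') = of_real (\<kappa> l) * of_nat (a' l) * sinner (e (a(l := m)) b) (e (a'(l := a' l - 1)) b')"
  using ladder_a[of "a(l := m)" l b a' b'] by simp
 show ?case
 proof (cases "a' l")
  case (Suc i)
  then have "sinner (e (a(l := m)) b) (e (a'(l := a' l - 1)) b') = 0"
   using Suc.prems by (intro Suc.IH) auto
  then show ?thesis using * by simp
 qed (use * in simp)
qed

lemma orth_b: "b l = n ==> b' l \<noteq> n ==> sinner (e a b) (e a' b') = 0"
 unfolding sinner_swap[of a] by (simp add: orth_a)

lemma orth: "(a, b) \<noteq> (a', b') ==> sinner (e a b) (e a' b') = 0"
proof -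
 assume "(a, b) \<noteq> (a', b')"
 then obtain l where "a l \<noteq> a' l \<or> b l \<noteq> b' l" by (auto simp: fun_eq_iff)
 then show ?thesis using orth_a[of a l "a l" a' b b'] orth_b[of b l "b l" b' a a'] by auto
qed

text \<open>The ladder relations lead down to the Gaussian, with a nonzero factor \<kappa>_l a_l or
  \<kappa>_l b_l at each step; the Gaussian itself is positive everywhere.\<close>

lemma sinner_e_ne_0: "sinner (e a b) (e a b) \<noteq> 0"
proof (induction "sum a UNIV + sum b UNIV" arbitrary: a b rule: less_induct)
 case less
 consider l m where "a l = Suc m" | l m where "b l = Suc m" | "a = (\<lambda>l. 0)" "b = (\<lambda>l. 0)"
  by (metis (full_types) ext not0_implies_Suc)
 then show ?case
 proof cases
  case 1
  have eq: "a = (a(l := m))(l := Suc ((a(l := m)) l))" using 1 by auto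
  have "sum (a(l := m)) UNIV < sum a UNIV" by (rule sum_strict_mono_ex1) (use 1 in auto)
  then have "sinner (e (a(l := m)) b) (e (a(l := m)) b) \<noteq> 0" by (intro less) auto
  moreover have "sinner (e a b) (e a b) = of_real (\<kappa> l) * of_nat (a l) * sinner (e (a(l := m)) b) (e (a(l := m)) b)"
   using ladder_a[of "a(l := m)" l b a b] eq 1 by simp
  ultimately show ?thesis using \<kappa>[of l] 1 by (simp del: of_nat_Suc)
 next
  case 2
  have eq: "b = (b(l := m))(l := Suc ((b(l := m)) l))" using 2 by auto
  have "sum (b(l := m)) UNIV < sum b UNIV" by (rule sum_strict_mono_ex1) (use 2 in auto)
  then have "sinner (e a (b(l := m))) (e a (b(l := m))) \<noteq> 0" by (intro less) auto
  moreover have "sinner (e a b) (e a b) = of_real (\<kappa> l) * of_nat (b l) * sinner (e a (b(l := m))) (e a (b(l := m)))"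
   using ladder_b[of a "b(l := m)" l a b] eq 2 by simp
  ultimately show ?thesis using \<kappa>[of l] 2 by (simp del: of_nat_Suc)
 next
  case 3
  define g where "g x = (cmod (e a b x))\<^sup>2" for x
  have gpos: "g x > 0" for x using 3 by (simp add: g_def osc_def gaussian_def)
  have s: "sinner (e a b) (e a b) = of_real (LINT x|lborel. g x)"
   unfolding sinner_def g_def by (simp add: complex_norm_square[symmetric] del: of_real_power flip: integral_complex_of_real)
  have "integrable lborel (\<lambda>x. Re (e a b x * cnj (e a b x)))"
   by (rule integrable_Re[OF tame_integrable[OF tame_e tame_e]])
  then have ig: "integrable lborel g" unfolding g_def cmod_power2 by (simp add: power2_eq_square)
  have "(LINT x|lborel. g x) \<noteq> 0"
  proof
   assume "(LINT x|lborel. g x) = 0"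
   then have "AE x in lborel. g x = 0" using integral_nonneg_eq_0_iff_AE[OF ig] gpos by (simp add: less_imp_le)
   then have "AE x in (lborel :: (real ^ ('n + 'n)) measure). False"
    by eventually_elim (use gpos in \<open>auto simp: less_le\<close>)
   then have "ae_filter (lborel :: (real ^ ('n + 'n)) measure) = bot" by (simp only: eventually_False)
   then show False by (simp add: ae_filter_eq_bot_iff emeasure_lborel_UNIV)
  qed
  then show ?thesis unfolding s by simp
 qed
qed

end

text \<open>Rotation invariance, without determinants: compute
 \<open>\<integral>\<integral> 1\<^sub>A(R x + y) 1\<^sub>B(y) dx dy\<close> for the unit ball \<open>B\<close> in both orders, using translations only.\<close>

lemma lborel_orthogonal:
 fixes R :: "'a::euclidean_space => 'a"
 assumes R: "orthogonal_transformation R"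
 shows "distr lborel borel R = lborel"
proof (rule measure_eqI)
 have lin: "linear R" and nR: "norm (R x) = norm x" for x
  using R by (auto simp: orthogonal_transformation)
 have cR: "continuous_on UNIV R" using lin by (rule linear_continuous_on_compose[OF continuous_on_id, unfolded id_def])
 have Rm[measurable]: "R \<in> meas" by (rule borel_measurable_continuous_onI[OF cR])
 fix A :: "'a set" assume "A \<in> sets (distr lborel borel R)"
 then have A[measurable]: "A \<in> sets borel" by simp
 define B where "B = ball (0 :: 'a) 1"
 have B[measurable]: "B \<in> sets borel" by (simp add: B_def)
 define m where "m = emeasure lborel B"
 have "0 < m" unfolding m_def B_def by (simp add: emeasure_ball)
 have "m < \<infinity>" unfolding m_def B_def using emeasure_bounded_finite[of "ball (0 :: 'a) 1"] by simp
 have shift: "(\<integral>\<^sup>+x. g (c + x) \<partial>lborel) = (\<integral>\<^sup>+x. g x \<partial>lborel)" if [measurable]: "g \<in> meas" for g :: "'a => ennreal" and c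
  using nn_integral_distr[of "(+) c" lborel borel g] by (simp add: lborel_distr_plus)
 define N where "N = (\<integral>\<^sup>+x. indicator A (R x) \<partial>lborel :: ennreal)"
 have "N * m = (\<integral>\<^sup>+y. N * indicator B y \<partial>lborel)" by (simp add: nn_integral_cmult m_def)
 also have "\<dots> = (\<integral>\<^sup>+y. (\<integral>\<^sup>+x. indicator A (R x + y) * indicator B y \<partial>lborel) \<partial>lborel)"
 proof (rule nn_integral_cong)
  fix y :: 'a
  obtain x0 where x0: "R x0 = y" using orthogonal_transformation_surj[OF R] by (metis surjD)
  have "(\<integral>\<^sup>+x. indicator A (R x + y) * indicator B y \<partial>lborel) = (\<integral>\<^sup>+x. indicator A (R (x0 + x)) \<partial>lborel) * (indicator B y :: ennreal)"
   by (subst nn_integral_multc) (simp_all add: linear_add[OF lin] x0 add.commute)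
  also have "(\<integral>\<^sup>+x. indicator A (R (x0 + x)) \<partial>lborel) = N"
   unfolding N_def by (rule shift[of "\<lambda>x. indicator A (R x)"]) measurable
  finally show "N * indicator B y = (\<integral>\<^sup>+x. indicator A (R x + y) * indicator B y \<partial>lborel)" by simp
 qed
 also have "\<dots> = (\<integral>\<^sup>+x. (\<integral>\<^sup>+y. indicator A (R x + y) * indicator B y \<partial>lborel) \<partial>lborel)"
  by (rule lborel_pair.Fubini') measurable
 also have "\<dots> = (\<integral>\<^sup>+x. (\<integral>\<^sup>+y. indicator A y * indicator B (y - R x) \<partial>lborel) \<partial>lborel)"
 proof (rule nn_integral_cong)
  fix x :: 'a
  have "(\<integral>\<^sup>+y. indicator A (R x + y) * indicator B ((R x + y) - R x) \<partial>lborel) = (\<integral>\<^sup>+y. indicator A y * (indicator B (y - R x) :: ennreal) \<partial>lborel)"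
   by (rule shift[of "\<lambda>y. indicator A y * indicator B (y - R x)"]) measurable
  then show "(\<integral>\<^sup>+y. indicator A (R x + y) * indicator B y \<partial>lborel) = (\<integral>\<^sup>+y. indicator A y * (indicator B (y - R x) :: ennreal) \<partial>lborel)" by simp
 qed
 also have "\<dots> = (\<integral>\<^sup>+y. (\<integral>\<^sup>+x. indicator A y * indicator B (y - R x) \<partial>lborel) \<partial>lborel)"
  by (rule lborel_pair.Fubini') measurable
 also have "\<dots> = (\<integral>\<^sup>+y. indicator A y * m \<partial>lborel)"
 proof (rule nn_integral_cong)
  fix y :: 'a
  obtain x0 where x0: "R x0 = y" using orthogonal_transformation_surj[OF R] by (metis surjD)
  \<comment> \<open>Here preservation of the norm enters: in the variable x the condition is again
    membership in a translate of the unit ball.\<close>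
  have "y - R x \<in> B \<longleftrightarrow> - x0 + x \<in> B" for x
  proof -
   have "norm (y - R x) = norm (R (x0 - x))" using x0 linear_diff[OF lin] by simp
   also have "\<dots> = norm (- x0 + x)" by (simp add: nR norm_minus_commute)
   finally show ?thesis by (simp add: B_def)
  qed
  then have "indicator B (y - R x) = (indicator B (- x0 + x) :: ennreal)" for x by (simp add: indicator_def)
  then have "(\<integral>\<^sup>+x. indicator A y * indicator B (y - R x) \<partial>lborel) = indicator A y * (\<integral>\<^sup>+x. (indicator B (- x0 + x) :: ennreal) \<partial>lborel)"
   by (simp add: nn_integral_cmult)
  also have "(\<integral>\<^sup>+x. (indicator B (- x0 + x) :: ennreal) \<partial>lborel) = m"
   unfolding m_def by (subst shift[of "indicator B"]) auto
  finally show "(\<integral>\<^sup>+x. indicator A y * indicator B (y - R x) \<partial>lborel) = indicator A y * m" .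
 qed
 also have "\<dots> = emeasure lborel A * m" by (simp add: nn_integral_multc)
 finally have "N * m = emeasure lborel A * m" .
 note eq = this
 have m: "m \<noteq> 0" "m \<noteq> top" using \<open>0 < m\<close> \<open>m < \<infinity>\<close> by auto
 have "N = N * m / m" by (rule ennreal_mult_divide_eq[OF m, symmetric])
 also have "\<dots> = emeasure lborel A" unfolding eq by (rule ennreal_mult_divide_eq[OF m])
 finally have "N = emeasure lborel A" .
 moreover have "emeasure (distr lborel borel R) A = N"
 proof -
  have "emeasure (distr lborel borel R) A = (\<integral>\<^sup>+x. indicator A x \<partial>distr lborel borel R)" by simp
  also have "\<dots> = N" unfolding N_def by (rule nn_integral_distr) measurable
  finally show ?thesis .
 qed
 ultimately show "emeasure (distr lborel borel R) A = emeasure lborel A" by simp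
qed simp

lemma integral_orthogonal:
 fixes R :: "'a::euclidean_space => 'a" and g :: "'a => 'b::{banach, second_countable_topology}"
 assumes R: "orthogonal_transformation R" and g: "g \<in> meas"
 shows "(LINT x|lborel. g (R x)) = (LINT x|lborel. g x)"
proof -
 have "linear R" using R by (auto simp: orthogonal_transformation)
 then have "continuous_on UNIV R" by (rule linear_continuous_on_compose[OF continuous_on_id, unfolded id_def])
 then have "R \<in> measurable lborel borel" using borel_measurable_continuous_onI by auto
 from integral_distr[OF this g] show ?thesis by (simp add: lborel_orthogonal[OF R])
qed

lemma integrable_L2_gauss:
 fixes u g :: "'a::euclidean_space => complex"
 assumes "u \<in> meas" "integrable lborel (\<lambda>x. (cmod (u x))\<^sup>2)"
  "gauss_bounded g" "g \<in> meas"
 shows "integrable lborel (\<lambda>x. u x * g x)"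
proof (rule integrable_of_norm_le)
 have "gauss_bounded (\<lambda>x. g x * g x)" by (rule gauss_bounded_mult) (rule assms)+
 then have "gauss_bounded (\<lambda>x. (cmod (g x))\<^sup>2)"
  by (rule gauss_bounded_mono[where A=1]) (simp add: norm_mult power2_eq_square)
 then have "integrable lborel (\<lambda>x. (cmod (g x))\<^sup>2)"
  by (rule gauss_bounded_integrable) (use assms(4) in measurable)
 then show "integrable lborel (\<lambda>x. (cmod (u x))\<^sup>2 + (cmod (g x))\<^sup>2)" by (intro Bochner_Integration.integrable_add assms(2))
 show "(\<lambda>x. u x * g x) \<in> meas" using assms(1,4) by measurable
 show "norm (u x * g x) \<le> (cmod (u x))\<^sup>2 + (cmod (g x))\<^sup>2" for x unfolding norm_mult by (rule norm_mult_norm_le)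
qed

lemma norm_exp_partial_sum_le: "cmod (\<Sum>k<N. z ^ k / fact k) \<le> exp (cmod z)"
proof -
 have "cmod (\<Sum>k<N. z ^ k / fact k) \<le> (\<Sum>k<N. cmod z ^ k /\<^sub>R fact k)"
  by (rule order_trans[OF norm_sum]) (simp add: norm_divide norm_power norm_mult norm_inverse divide_inverse mult.commute)
 also have "\<dots> \<le> exp (cmod z)"
  unfolding exp_def by (rule sum_le_suminf[OF summable_exp_generic]) auto
 finally show ?thesis .
qed

section \<open>Eigenvalue equation and completeness\<close>

context oscillator
begin

lemma pd_lin:
 assumes "f \<in> osc_span \<kappa>" "g \<in> osc_span \<kappa>"
 shows "pd (\<lambda>x. c * f x + d * g x) v x = c * pd f v x + d * pd g v x"
proof (rule pd_eq_of_has_derivative)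
 show "((\<lambda>x. c * f x + d * g x) has_derivative (\<lambda>v. c * pd f v x + d * pd g v x)) (at x)"
  by (intro has_derivative_add has_derivative_mult_right pd_works osc_span_differentiable[of _ \<kappa>] assms)
qed

text \<open>The planar Laplacian is (2 d/dz)(2 d/d(cnj z)), computed here by differentiating
  \<open>lower'\<close>. Both it and \<kappa>^2 |z|^2 e are expressed through three functions: e
  itself (\<open>e1\<close>), e lowered in both indices (\<open>e2\<close>) and e raised in both
  (\<open>e3\<close>). In the comparison \<open>e2\<close> and \<open>e3\<close> cancel.\<close>

lemma laplacian_e_coord:
 "pd (pd (e a b) (axis (Inl l) 1)) (axis (Inl l) 1) x + pd (pd (e a b) (axis (Inr l) 1)) (axis (Inr l) 1) x
  = of_real ((\<kappa> l)\<^sup>2 * (cmod (zc x l))\<^sup>2) * e a b x - 2 * of_real (\<kappa> l) * of_nat (a l + b l + 1) * e a b x"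
proof -
 let ?X = "axis (Inl l) 1" and ?Y = "axis (Inr l) 1" and ?k = "complex_of_real (\<kappa> l)"
 let ?am = "a(l := a l - 1)" and ?bm = "b(l := b l - 1)" and ?ap = "a(l := Suc (a l))" and ?bp = "b(l := Suc (b l))"
 have lp: "pd (lower' a b l) v x = pd (pd (e a b) ?X) v x + \<i> * pd (pd (e a b) ?Y) v x" for v
  using pd_lin[OF osc_span_pd osc_span_pd, OF osc_span_osc osc_span_osc, of 1 _ _ _ \<i>] by (simp add: lower_eq(2)[abs_def])
 have L': "pd (lower' a b l) v x = ?k * of_nat (b l) * pd (e a ?bm) v x + (-1) * pd (e ?ap b) v x" for v
 proof -
  have "lower' a b l = (\<lambda>x. (?k * of_nat (b l)) * e a ?bm x + (-1) * e ?ap b x)" by (simp add: fun_eq_iff lower'_def)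
  then show ?thesis by (simp only:) (rule pd_lin[OF osc_span_osc osc_span_osc])
 qed
 have "pd (pd (e a b) ?X) ?X x + pd (pd (e a b) ?Y) ?Y x = pd (lower' a b l) ?X x - \<i> * pd (lower' a b l) ?Y x"
  unfolding lp pd_commute[OF open_UNIV UNIV_I osc_span_smooth[OF osc_span_osc], where u="?X" and v="?Y"] by (simp add: algebra_simps)
 then have 1: "pd (pd (e a b) ?X) ?X x + pd (pd (e a b) ?Y) ?Y x = ?k * of_nat (b l) * lower a ?bm l x - lower ?ap b l x"
  unfolding L' lower_eq by (simp add: algebra_simps)
 define e1 where "e1 = e a b x"
 define e2 where "e2 = e ?am ?bm x"
 define e3 where "e3 = e ?ap ?bp x"
 \<comment> \<open>Raising after lowering returns to a only if \<open>a l\<close> is positive; the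
   factor \<open>a l\<close> absorbs the case 0, where truncated subtraction breaks the round
   trip.\<close>
 have a0: "of_nat (a l) * e (?am(l := Suc (?am l))) b x = of_nat (a l) * e1" unfolding e1_def by (cases "a l") (auto simp: fun_upd_idem)
 have b0: "of_nat (b l) * e a (?bm(l := Suc (?bm l))) x = of_nat (b l) * e1" unfolding e1_def by (cases "b l") (auto simp: fun_upd_idem)
 have l2: "of_nat (b l) * lower a ?bm l x = of_nat (b l) * (?k * of_nat (a l) * e2) - of_nat (b l) * e1"
  using b0 by (simp add: lower_def e2_def right_diff_distrib del: fun_upd_upd)
 have l4: "lower ?ap b l x = ?k * (1 + of_nat (a l)) * e1 - e3"
  by (simp add: lower_def e1_def e3_def)
 have 2: "pd (pd (e a b) ?X) ?X x + pd (pd (e a b) ?Y) ?Y x = ?k * ?k * of_nat (a l) * of_nat (b l) * e2 - ?k * of_nat (a l + b l + 1) * e1 + e3"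
  unfolding 1 l4 mult.assoc[of ?k "of_nat (b l)"] l2 by (simp add: algebra_simps)
 have z1: "?k * zc x l * e a ?bp x = e3 + ?k * (1 + of_nat (b l)) * e1"
  using osc_Suc_a[of \<kappa> a l ?bp x] by (simp add: e1_def e3_def algebra_simps)
 have z2: "of_nat (a l) * (?k * zc x l * e ?am b x) = of_nat (a l) * e1 + of_nat (a l) * (?k * of_nat (b l) * e2)"
 proof (cases "a l = 0")
  case False
  then have "e (?am(l := Suc (?am l))) b x = e1" using a0 by simp
  then have "?k * zc x l * e ?am b x = e1 + ?k * of_nat (b l) * e2"
   using osc_Suc_a[of \<kappa> ?am l b x] by (simp add: e2_def algebra_simps del: fun_upd_upd)
  then show ?thesis by (simp only: distrib_left)
 qed simp
 have z3: "?k * cnj (zc x l) * e1 = e a ?bp x + ?k * of_nat (a l) * e ?am b x"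
  using osc_Suc_b[of \<kappa> a b l x] by (simp add: e1_def algebra_simps)
 have "of_real ((\<kappa> l)\<^sup>2 * (cmod (zc x l))\<^sup>2) * e1 = ?k * zc x l * (?k * cnj (zc x l) * e1)"
  unfolding of_real_mult complex_norm_square by (simp add: power2_eq_square)
 also have "\<dots> = (e3 + ?k * (1 + of_nat (b l)) * e1) + ?k * (of_nat (a l) * e1 + of_nat (a l) * (?k * of_nat (b l) * e2))"
 proof -
  have "?k * zc x l * (?k * of_nat (a l) * e ?am b x) = ?k * (of_nat (a l) * (?k * zc x l * e ?am b x))" by (simp only: mult_ac)
  then show ?thesis unfolding z3 distrib_left[of "?k * zc x l"] z1 z2 by simp
 qed
 finally show ?thesis unfolding 2 e1_def[symmetric] by (simp add: algebra_simps)
qed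

lemma laplacian_e:
 "(\<Sum>i\<in>UNIV. pd (pd (e a b) (axis i 1)) (axis i 1) x)
  = of_real (\<Sum>l\<in>UNIV. (\<kappa> l)\<^sup>2 * (cmod (zc x l))\<^sup>2) * e a b x - of_real (2 * (\<Sum>l\<in>UNIV. \<kappa> l * real (a l + b l + 1))) * e a b x"
 unfolding sum_UNIV_sum laplacian_e_coord of_real_sum sum_distrib_left sum_distrib_right sum_subtractf[symmetric]
 by (intro sum.cong refl) (simp add: algebra_simps)

text \<open>Orthogonality to the span kills the integrals of u times the Gaussian against all powers
  of \<xi> . x. Summing the exponential series shows that the Fourier transform of u times the
  Gaussian vanishes, and the Gaussian has no zeros.\<close>

lemma complete:
 assumes u: "u \<in> meas" "integrable lborel (\<lambda>x. (cmod (u x))\<^sup>2)"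
  and 0: "\<And>a b. sinner u (e a b) = 0"
 shows "AE x in lborel. u x = 0"
proof -
 have cg: "gauss_bounded (\<lambda>x. cnj (f x))" "(\<lambda>x. cnj (f x)) \<in> meas" if "f \<in> osc_span \<kappa>" for f
  using gauss_bounded_mono[OF osc_span_gauss_bounded[OF that \<kappa>], of "\<lambda>x. cnj (f x)" 1]
   borel_measurable_continuous_onI[OF continuous_on_cnj[OF osc_span_continuous[OF that]]] by auto
 have int: "integrable lborel (\<lambda>x. u x * cnj (f x))" if "f \<in> osc_span \<kappa>" for f
  by (rule integrable_L2_gauss[OF u cg[OF that]])
 have span0: "sinner u f = 0" if "f \<in> osc_span \<kappa>" for f
  using that
 proof induction
  case (osc_span_add f g)
  then show ?case using int[OF osc_span_add.hyps(1)] int[OF osc_span_add.hyps(2)] by (simp add: sinner_def distrib_left)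
 qed (simp_all add: 0 sinner_scale_right)
 have g: "gaussian \<kappa> = e (\<lambda>l. 0) (\<lambda>l. 0)" by (simp add: fun_eq_iff osc_def)
 then have gs: "gaussian \<kappa> \<in> osc_span \<kappa>" using osc_span_osc by metis
 have lin: "(\<lambda>x. of_real (\<xi> \<bullet> x) * f x) \<in> osc_span \<kappa>" if f: "f \<in> osc_span \<kappa>" for \<xi> f
 proof -
  have k: "\<kappa> l \<noteq> 0" for l using \<kappa>[of l] by simp
  have "of_real (\<xi> \<bullet> x) * f x = (\<Sum>l\<in>UNIV. (Complex (\<xi> $ Inl l / 2) (- \<xi> $ Inr l / 2)) * (zc x l * f x)
   + (Complex (\<xi> $ Inl l / 2) (\<xi> $ Inr l / 2)) * (cnj (zc x l) * f x))" for x
  proof -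
   have "complex_of_real (\<xi> \<bullet> x) = (\<Sum>l\<in>UNIV. of_real (\<xi> $ Inl l * x $ Inl l + \<xi> $ Inr l * x $ Inr l))"
    by (simp add: inner_vec_def sum_UNIV_sum)
   also have "\<dots> = (\<Sum>l\<in>UNIV. (Complex (\<xi> $ Inl l / 2) (- \<xi> $ Inr l / 2)) * zc x l + (Complex (\<xi> $ Inl l / 2) (\<xi> $ Inr l / 2)) * cnj (zc x l))"
    by (intro sum.cong) (auto simp: complex_eq_iff zc_def)
   finally show ?thesis by (simp add: sum_distrib_right distrib_right mult.assoc)
  qed
  moreover have "(\<lambda>x. \<Sum>l\<in>UNIV. (Complex (\<xi> $ Inl l / 2) (- \<xi> $ Inr l / 2)) * (zc x l * f x)
   + (Complex (\<xi> $ Inl l / 2) (\<xi> $ Inr l / 2)) * (cnj (zc x l) * f x)) \<in> osc_span \<kappa>"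
   by (intro osc_span_sum osc_span_add osc_span_scale osc_span_zc f k)
  ultimately show ?thesis by (simp only:)
 qed
 have pow: "(\<lambda>x. of_real (\<xi> \<bullet> x) ^ n * gaussian \<kappa> x) \<in> osc_span \<kappa>" for \<xi> n
 proof (induction n)
  case (Suc n)
  from lin[OF Suc, of \<xi>] show ?case by (simp add: mult.assoc)
 qed (simp add: gs)
 have greal: "cnj (gaussian \<kappa> x) = gaussian \<kappa> x" for x by (simp add: gaussian_def)
 define h where "h x = u x * gaussian \<kappa> x" for x
 have gm[measurable]: "gaussian \<kappa> \<in> meas" by (rule osc_span_measurable[OF gs])
 have um[measurable]: "u \<in> meas" by (rule u)
 have "AE x in lborel. h x = 0"
 proof (rule AE_eq_0_of_fourier)
  show "integrable lborel h" using int[OF gs] by (simp add: h_def[abs_def] greal)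
  fix \<xi> :: "real ^ ('n + 'n)"
  \<comment> \<open>Dominates all partial sums of the exponential series at once and is still
    Gaussian bounded, hence integrable against u.\<close>
  define G where "G x = gaussian \<kappa> x * of_real (exp (norm \<xi> * norm x))" for x
  have G: "gauss_bounded G" unfolding G_def
   by (rule gauss_bounded_exp_growth[OF gaussian_bounded[of \<kappa>, OF \<kappa>], of _ 1 "norm \<xi>"]) (simp add: norm_mult)
  have Gm: "G \<in> meas" unfolding G_def by measurable
  have uG: "integrable lborel (\<lambda>x. cmod (u x * G x))" by (rule integrable_norm[OF integrable_L2_gauss[OF u G Gm]])
  define S where "S N x = h x * (\<Sum>k<N. (\<i> * of_real (\<xi> \<bullet> x)) ^ k / fact k)" for N x
  have S0: "(LINT x|lborel. S N x) = 0" for N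
  proof -
   have SN: "S N x = (\<Sum>k<N. (\<i> ^ k / fact k) * (u x * cnj (of_real (\<xi> \<bullet> x) ^ k * gaussian \<kappa> x)))" for x
    unfolding S_def h_def sum_distrib_left by (intro sum.cong) (auto simp: greal power_mult_distrib)
   have "(LINT x|lborel. S N x) = (\<Sum>k<N. (\<i> ^ k / fact k) * sinner u (\<lambda>x. of_real (\<xi> \<bullet> x) ^ k * gaussian \<kappa> x))"
    unfolding SN sinner_def
    by (subst Bochner_Integration.integral_sum) (auto intro!: integrable_mult_right int[OF pow] simp del: complex_cnj_mult)
   then show ?thesis by (simp add: span0[OF pow])
  qed
  have "(\<lambda>N. LINT x|lborel. S N x) \<longlonglongrightarrow> (LINT x|lborel. h x * exp (\<i> * of_real (\<xi> \<bullet> x)))"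
  proof (rule integral_dominated_convergence[OF _ _ uG])
   show "(\<lambda>x. h x * exp (\<i> * of_real (\<xi> \<bullet> x))) \<in> borel_measurable lborel" unfolding h_def by measurable
   show "S N \<in> borel_measurable lborel" for N unfolding S_def h_def by measurable
   show "AE x in lborel. (\<lambda>N. S N x) \<longlonglongrightarrow> h x * exp (\<i> * of_real (\<xi> \<bullet> x))"
   proof (rule AE_I2)
    fix x
    have "(\<lambda>k. (\<i> * of_real (\<xi> \<bullet> x)) ^ k / fact k) sums exp (\<i> * complex_of_real (\<xi> \<bullet> x))"
     using exp_converges[of "\<i> * complex_of_real (\<xi> \<bullet> x)"] by (simp add: scaleR_conv_of_real divide_inverse mult.commute)
    then show "(\<lambda>N. S N x) \<longlonglongrightarrow> h x * exp (\<i> * of_real (\<xi> \<bullet> x))"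
     unfolding S_def sums_def by (intro tendsto_mult_left)
   qed
   show "AE x in lborel. norm (S N x) \<le> cmod (u x * G x)" for N
   proof (rule AE_I2)
    fix x
    have "cmod (\<Sum>k<N. (\<i> * of_real (\<xi> \<bullet> x)) ^ k / fact k) \<le> exp (cmod (\<i> * of_real (\<xi> \<bullet> x)))"
     by (rule norm_exp_partial_sum_le)
    also have "\<dots> \<le> exp (norm \<xi> * norm x)" using Cauchy_Schwarz_ineq2[of \<xi> x] by (simp add: norm_mult)
    finally have "cmod (h x) * cmod (\<Sum>k<N. (\<i> * of_real (\<xi> \<bullet> x)) ^ k / fact k) \<le> cmod (h x) * exp (norm \<xi> * norm x)"
     by (intro mult_left_mono) auto
    then show "norm (S N x) \<le> cmod (u x * G x)" unfolding S_def G_def h_def norm_mult by (simp add: mult.assoc)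
   qed
  qed
  then show "(LINT x|lborel. h x * exp (\<i> * of_real (\<xi> \<bullet> x))) = 0"
   unfolding S0 by (simp add: LIMSEQ_const_iff)
 qed
 then show ?thesis by eventually_elim (simp add: h_def gaussian_def)
qed

end

section \<open>The model operator on sections of a given type\<close>

lemma zc_rot: "zc (rot k \<theta> v) l = cis (idot (k l) \<theta>) * zc v l"
 by (simp add: zc_def rot_def complex_eq_iff)

lemma vec_eq_zcI: "(\<And>l. zc v l = zc w l) ==> v = w"
proof -
 assume a: "\<And>l. zc v l = zc w l"
 have "v $ i = w $ i" for i using a by (cases i) (auto simp: zc_def)
 then show "v = w" by (simp add: vec_eq_iff)
qed

lemma zc_add: "zc (v + w) l = zc v l + zc w l" and zc_scaleR: "zc (c *\<^sub>R v) l = c *\<^sub>R zc v l"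
 by (auto simp: zc_def complex_eq_iff)

lemma linear_rot: "linear (rot k \<theta>)"
 by (rule linearI; rule vec_eq_zcI) (simp_all add: zc_rot zc_add zc_scaleR distrib_left)

lemma norm_rot: "norm (rot k \<theta> v) = norm v"
proof -
 have "(norm (rot k \<theta> v))\<^sup>2 = (norm v)\<^sup>2" by (simp add: norm_power2_zc zc_rot norm_mult)
 then show ?thesis by simp
qed

lemma orthogonal_rot: "orthogonal_transformation (rot k \<theta>)"
 by (simp add: orthogonal_transformation linear_rot norm_rot)

text \<open>The leading term z^a (cnj z)^b has weight a - b, and the correction in the recursion has
  the same weight because a creation of z is traded for a removal of cnj z.\<close>

lemma ito_cis: "ito \<kappa> a b (cis t * z) = cis ((real a - real b) * t) * ito \<kappa> a b z"
proof (induction a arbitrary: b)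
 case 0
 have "of_real \<kappa> * cnj (cis t * z) = cis (- t) * (of_real \<kappa> * cnj z)" by (simp add: cis_cnj)
 then have "(of_real \<kappa> * cnj (cis t * z)) ^ b = cis (real b * (- t)) * (of_real \<kappa> * cnj z) ^ b"
  by (simp only: power_mult_distrib Complex.DeMoivre)
 then show ?case unfolding ito.simps(1) by (simp only:) simp
next
 case (Suc a)
 have 1: "cis t * cis ((real a - real b) * t) = cis ((real (Suc a) - real b) * t)"
  by (simp add: cis_mult algebra_simps)
 have 2: "of_nat b * cis ((real a - real (b - 1)) * t) = of_nat b * cis ((real (Suc a) - real b) * t)"
  by (cases b) (auto simp: algebra_simps)
 have "ito \<kappa> (Suc a) b (cis t * z) = of_real \<kappa> * z * ito \<kappa> a b z * (cis t * cis ((real a - real b) * t))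
   - of_real \<kappa> * ito \<kappa> a (b - 1) z * (of_nat b * cis ((real a - real (b - 1)) * t))"
  unfolding ito.simps(2) Suc.IH by (simp add: mult_ac)
 then show ?case unfolding 1 2 by (simp add: algebra_simps)
qed

lemma osc_rot: "osc \<kappa> a b (rot k \<theta> x) = cis (\<Sum>l\<in>UNIV. (real (a l) - real (b l)) * idot (k l) \<theta>) * osc \<kappa> a b x"
proof -
 have c: "(\<Prod>l\<in>I. cis (t l)) = cis (\<Sum>l\<in>I. t l)" for I and t :: "'a => real"
  by (induction I rule: infinite_finite_induct) (auto simp: cis_mult)
 have "gaussian \<kappa> (rot k \<theta> x) = gaussian \<kappa> x" by (simp add: gaussian_def zc_rot norm_mult)
 then show ?thesis by (simp add: osc_def zc_rot ito_cis prod.distrib c del: ito.simps)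
qed

lemma idot_add: "idot (k + k') \<theta> = idot k \<theta> + idot k' \<theta>"
 by (simp add: idot_def distrib_right sum.distrib)

lemma idot_diff: "idot (k - k') \<theta> = idot k \<theta> - idot k' \<theta>"
 by (simp add: idot_def left_diff_distrib sum_subtractf)

lemma idot_minus_right: "idot k (- \<theta>) = - idot k \<theta>"
 by (simp add: idot_def sum_negf)

lemma idot_add_right: "idot k (\<theta> + \<eta>) = idot k \<theta> + idot k \<eta>"
 by (simp add: idot_def distrib_left sum.distrib)

lemma idot_scaleR: "idot k (c *\<^sub>R \<theta>) = c * idot k \<theta>"
 by (simp add: idot_def sum_distrib_left mult_ac)

lemma idot_smult_sum: "idot (\<Sum>h\<in>I. m h *s k h) \<theta> = (\<Sum>h\<in>I. of_int (m h) * idot (k h) \<theta>)"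
proof -
 have 0: "idot 0 \<theta> = 0" by (simp add: idot_def)
 have s: "idot (c *s l) \<theta> = of_int c * idot l \<theta>" for c l by (simp add: idot_def sum_distrib_left mult.assoc)
 show ?thesis by (induction I rule: infinite_finite_induct) (auto simp: 0 s idot_add)
qed

text \<open>Since L maps the lattice onto itself, its range contains the vectors of length 2 pi
  along the axes, and these span.\<close>

lemma torus_coords_surj:
 assumes "torus_coords L"
 shows "surj L"
proof -
 have lin: "linear L" and lat: "L ` lattice = lattice" using assms by (auto simp: torus_coords_def)
 have "\<theta> \<in> range L" for \<theta>
 proof -
  have "axis p (2 * pi) \<in> lattice" for p :: 'a
   unfolding lattice_def axis_def by (auto intro: exI[of _ "1::int"] exI[of _ "0::int"])
  then have "axis p (2 * pi) \<in> L ` lattice" for p by (simp only: lat)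
  note ax = this
  have "\<forall>p. \<exists>y. L y = axis p (2 * pi)"
  proof
   fix p show "\<exists>y. L y = axis p (2 * pi)" using ax[of p] by (elim imageE) (rule exI, erule sym)
  qed
  from choice[OF this] obtain y where y: "\<And>p. L (y p) = axis p (2 * pi)" by auto
  have "L (\<Sum>p\<in>UNIV. (\<theta> $ p / (2 * pi)) *\<^sub>R y p) = (\<Sum>p\<in>UNIV. (\<theta> $ p / (2 * pi)) *\<^sub>R axis p (2 * pi))"
   by (simp add: linear_sum[OF lin] linear_scale[OF lin] y)
  also have "\<dots> = \<theta>"
   by (simp add: vec_eq_iff axis_def if_distrib sum.delta cong: if_cong)
  finally show ?thesis by (rule range_eqI[OF sym])
 qed
 then show ?thesis by auto
qed

text \<open>The vectors f_i are the rows of a square matrix with A (cadj A) = 1; a one-sided inverse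
  of a square matrix is two-sided, and (cadj A) A = 1 is the completeness relation.\<close>

lemma orthonormal_expansion:
 fixes f :: "'r::finite => complex ^ 'r"
 assumes "\<And>i j. cinner (f i) (f j) = (if i = j then 1 else 0)"
 shows "w = (\<Sum>i\<in>UNIV. cinner w (f i) *s f i)"
proof -
 define A :: "complex ^ 'r ^ 'r" where "A = (\<chi> i j. f i $ j)"
 have "A ** cadj A = mat 1"
  using assms by (simp add: vec_eq_iff matrix_matrix_mult_def cadj_def A_def mat_def cinner_def)
 then have "cadj A ** A = mat 1" by (simp add: matrix_left_right_inverse)
 then have *: "(\<Sum>k\<in>UNIV. cnj (f k $ i) * f k $ j) = (if i = j then 1 else 0)" for i j
  by (simp add: vec_eq_iff matrix_matrix_mult_def cadj_def A_def mat_def)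
 have "(\<Sum>i\<in>UNIV. cinner w (f i) *s f i) $ j = w $ j" for j
 proof -
  have "(\<Sum>i\<in>UNIV. cinner w (f i) *s f i) $ j = (\<Sum>i\<in>UNIV. \<Sum>k\<in>UNIV. w $ k * (cnj (f i $ k) * f i $ j))"
   by (simp add: cinner_def sum_distrib_right mult.assoc)
  also have "\<dots> = (\<Sum>k\<in>UNIV. w $ k * (\<Sum>i\<in>UNIV. cnj (f i $ k) * f i $ j))"
   by (subst sum.swap) (simp add: sum_distrib_left)
  also have "\<dots> = w $ j" by (simp add: * if_distrib sum.delta cong: if_cong)
  finally show ?thesis .
 qed
 then show ?thesis by (simp add: vec_eq_iff)
qed

lemma continuous_AE_0:
 fixes g :: "'a::euclidean_space => complex"
 assumes "continuous_on UNIV g" "AE x in lborel. g x = 0"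
 shows "g x = 0"
proof (rule ccontr)
 assume "g x \<noteq> 0"
 have o: "open {y. g y \<noteq> 0}" by (rule open_Collect_neq[OF assms(1) continuous_on_const])
 then obtain e where e: "e > 0" "ball x e \<subseteq> {y. g y \<noteq> 0}" using \<open>g x \<noteq> 0\<close> openE[of "{y. g y \<noteq> 0}" x] by auto
 have "{y. g y \<noteq> 0} \<in> null_sets lborel"
  by (rule AE_iff_null_sets[THEN iffD2]) (use assms(2) o in auto)
 from emeasure_mono[OF e(2), of lborel] this have "emeasure lborel (ball x e) = 0"
  using o by (auto simp: null_sets_def)
 then show False using e(1) unit_ball_vol_pos[of "real DIM('a)"] by (simp add: emeasure_ball)
qed

lemma L2_nrm_tendsto_0:
 fixes g :: "nat => real ^ 'd::finite => complex ^ 'r::finite"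
 assumes W: "gauss_bounded W" "W \<in> meas" and g: "\<And>n. g n \<in> meas"
  and le: "\<And>n x. norm (g n x) \<le> (W x :: real)" and lim: "\<And>x. (\<lambda>n. g n x) \<longlonglongrightarrow> 0"
 shows "(\<lambda>n. L2_nrm (g n)) \<longlonglongrightarrow> 0"
proof -
 have "integrable lborel (\<lambda>x. W x * W x)"
  by (rule gauss_bounded_integrable[OF gauss_bounded_mult[OF W(1) W(1)]]) (use W(2) in measurable)
 then have WW: "integrable lborel (\<lambda>x. (W x)\<^sup>2)" by (simp add: power2_eq_square)
 have "(\<lambda>n. LINT x|lborel. (norm (g n x))\<^sup>2) \<longlonglongrightarrow> (LINT x|(lborel :: (real ^ 'd) measure). 0)"
 proof (rule integral_dominated_convergence[OF _ _ WW])
  show "(\<lambda>x. (norm (g n x))\<^sup>2) \<in> borel_measurable lborel" for n using g[of n] by measurable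
  show "AE x in lborel. (\<lambda>n. (norm (g n x))\<^sup>2) \<longlonglongrightarrow> 0"
  proof (rule AE_I2)
   fix x
   have "(\<lambda>n. (norm (g n x))\<^sup>2) \<longlonglongrightarrow> (norm (0 :: complex ^ 'r))\<^sup>2" by (intro tendsto_intros lim)
   then show "(\<lambda>n. (norm (g n x))\<^sup>2) \<longlonglongrightarrow> 0" by simp
  qed
  show "AE x in lborel. norm ((norm (g n x))\<^sup>2) \<le> (W x)\<^sup>2" for n
  proof (rule AE_I2)
   fix x show "norm ((norm (g n x))\<^sup>2) \<le> (W x)\<^sup>2"
    using power_mono[OF le[of n x] norm_ge_zero, of 2] by simp
  qed
 qed simp
 then have "(\<lambda>n. sqrt (LINT x|lborel. (norm (g n x))\<^sup>2)) \<longlonglongrightarrow> sqrt 0" by (intro tendsto_intros) simp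
 then show ?thesis by (simp add: L2_nrm_def)
qed

lemma L2_fun_gauss_bounded:
 assumes "gauss_bounded u" "u \<in> meas"
 shows "u \<in> L2_fun"
proof -
 have "gauss_bounded (\<lambda>x. norm (u x))" by (rule gauss_bounded_mono[OF assms(1), of _ 1]) simp
 then have "gauss_bounded (\<lambda>x. norm (u x) * norm (u x))" by (rule gauss_bounded_mult) (rule \<open>gauss_bounded (\<lambda>x. norm (u x))\<close>)
 then have "integrable lborel (\<lambda>x. norm (u x) * norm (u x))"
  by (rule gauss_bounded_integrable) (use assms(2) in measurable)
 then show ?thesis using assms(2) by (simp add: L2_fun_def power2_eq_square)
qed

section \<open>Radial cutoffs\<close>

lemma pd_cutoff: "pd cutoff h t = h * pd cutoff 1 t"
 using linear_scale[OF pd_linear[OF smooth_on_cutoff open_UNIV UNIV_I, of t], of h 1] by simp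

lemma pd2_cutoff: "pd (pd cutoff 1) h t = h * pd (pd cutoff 1) 1 t"
 using linear_scale[OF pd_linear[OF smooth_on_pd[OF smooth_on_cutoff] open_UNIV UNIV_I, of 1 t], of h 1] by simp

lemma bounded_of_vanishing:
 fixes g :: "real => real"
 assumes "continuous_on UNIV g" "\<And>t. t < 0 ==> g t = 0"
 shows "\<exists>C\<ge>0. \<forall>t\<le>1. \<bar>g t\<bar> \<le> C"
proof -
 have "compact (g ` {0..1})" by (rule compact_continuous_image[OF continuous_on_subset[OF assms(1)]]) auto
 then obtain C where C: "\<forall>y\<in>g ` {0..1}. norm y \<le> C" using compact_imp_bounded bounded_iff by blast
 have "\<bar>g t\<bar> \<le> \<bar>C\<bar>" if "t \<le> 1" for t
 proof (cases "t < 0")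
  case False
  then have "norm (g t) \<le> C" using C that by auto
  then show ?thesis by simp
 qed (simp add: assms(2))
 then show ?thesis by (intro exI[of _ "\<bar>C\<bar>"]) auto
qed

text \<open>\<open>radial\<close> evaluates \<open>cutoff\<close> only at arguments at most 1; among
  these only [0, 1] matters, since everything vanishes to the left of 0.\<close>

lemma cutoff_bounds:
 obtains C where "C \<ge> 0" "\<And>t. t \<le> 1 ==> \<bar>cutoff t\<bar> \<le> C" "\<And>t. t \<le> 1 ==> \<bar>pd cutoff 1 t\<bar> \<le> C"
  "\<And>t. t \<le> 1 ==> \<bar>pd (pd cutoff 1) 1 t\<bar> \<le> C"
proof -
 have z: "pd cutoff h t = 0" if "t < 0" for h t
 proof -
  have "pd cutoff h t = pd (\<lambda>x. 0) h t" by (rule pd_cong_open[of "{..<0}"]) (use that cutoff_nonpos in auto)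
  also have "\<dots> = 0" by (rule pd_eq_of_has_derivative) simp
  finally show ?thesis .
 qed
 have z2: "pd (pd cutoff 1) 1 t = 0" if "t < 0" for t
 proof -
  have "pd (pd cutoff 1) 1 t = pd (\<lambda>x. 0) 1 t" by (rule pd_cong_open[of "{..<0}"]) (use that z in auto)
  also have "\<dots> = 0" by (rule pd_eq_of_has_derivative) simp
  finally show ?thesis .
 qed
 obtain A where A: "A \<ge> 0" "\<And>t. t \<le> 1 ==> \<bar>cutoff t\<bar> \<le> A"
  using bounded_of_vanishing[OF smooth_on_continuous[OF smooth_on_cutoff]] cutoff_nonpos by (metis less_imp_le)
 obtain B where B: "B \<ge> 0" "\<And>t. t \<le> 1 ==> \<bar>pd cutoff 1 t\<bar> \<le> B"
  using bounded_of_vanishing[OF smooth_on_continuous[OF smooth_on_pd[OF smooth_on_cutoff]], of 1] z by blast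
 obtain D where D: "D \<ge> 0" "\<And>t. t \<le> 1 ==> \<bar>pd (pd cutoff 1) 1 t\<bar> \<le> D"
  using bounded_of_vanishing[OF smooth_on_continuous[OF smooth_on_pd[OF smooth_on_pd[OF smooth_on_cutoff]]], of 1 1] z2 by blast
 show ?thesis
 proof (rule that[of "A + B + D"])
  fix t :: real assume t: "t \<le> 1"
  show "\<bar>cutoff t\<bar> \<le> A + B + D" "\<bar>pd cutoff 1 t\<bar> \<le> A + B + D" "\<bar>pd (pd cutoff 1) 1 t\<bar> \<le> A + B + D"
   using A(1) A(2)[OF t] B(1) B(2)[OF t] D(1) D(2)[OF t] by linarith+
 qed (use A B D in simp)
qed

text \<open>A function of |x|^2: smooth at the origin, and invariant under rotations, so that
  multiplication by it preserves the type of a section.\<close>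

definition radial :: "real => 'a::real_inner => real" where
 "radial R x = cutoff (1 - (x \<bullet> x) / R\<^sup>2)"

lemma smooth_on_radial: "smooth_on UNIV (radial R :: 'a::euclidean_space => real)"
proof -
 have "smooth_on UNIV (\<lambda>x :: 'a. 1 - (1 / R\<^sup>2) * (x \<bullet> x))"
  by (intro smooth_on_diff smooth_on_const smooth_on_mult smooth_on_bounded_bilinear[OF bounded_bilinear_inner] smooth_on_ident open_UNIV)
 then have "smooth_on UNIV (\<lambda>x :: 'a. cutoff (1 - (1 / R\<^sup>2) * (x \<bullet> x)))"
  by (rule smooth_on_compose[OF open_UNIV open_UNIV UNIV_I _ smooth_on_cutoff])
 then show ?thesis by (simp add: radial_def[abs_def])
qed

lemma radial_eq_0: "R > 0 ==> norm x \<ge> R ==> radial R x = 0"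
proof -
 assume "R > 0" "norm x \<ge> R"
 then have "R\<^sup>2 \<le> x \<bullet> x" unfolding power2_norm_eq_inner[symmetric] by (intro power_mono) auto
 then show ?thesis using \<open>R > 0\<close> unfolding radial_def by (intro cutoff_nonpos) simp
qed

lemma radial_0: "radial R 0 = 1"
 by (simp add: radial_def cutoff_1)

lemma pd_radial: "pd (radial R) v x = - 2 / R\<^sup>2 * (x \<bullet> v) * pd cutoff 1 (1 - (x \<bullet> x) / R\<^sup>2)"
proof -
 have q: "((\<lambda>x :: 'a. 1 - (x \<bullet> x) / R\<^sup>2) has_derivative (\<lambda>v. - (x \<bullet> v + v \<bullet> x) / R\<^sup>2)) (at x)"
  by (auto intro!: derivative_eq_intros simp: fun_eq_iff divide_inverse algebra_simps)
 have "(radial R has_derivative (\<lambda>v. pd cutoff (- (x \<bullet> v + v \<bullet> x) / R\<^sup>2) (1 - (x \<bullet> x) / R\<^sup>2))) (at x)"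
  unfolding radial_def[abs_def]
  by (rule has_derivative_compose[OF q smooth_on_has_derivative[OF smooth_on_cutoff open_UNIV UNIV_I]])
 from pd_eq_of_has_derivative[OF this, of v]
 have "pd (radial R) v x = (- (x \<bullet> v + v \<bullet> x) / R\<^sup>2) * pd cutoff 1 (1 - (x \<bullet> x) / R\<^sup>2)"
  by (subst (asm) pd_cutoff)
 then show ?thesis by (simp add: inner_commute)
qed

lemma pd2_radial:
 "pd (pd (radial R) v) v x = - 2 / R\<^sup>2 * (v \<bullet> v) * pd cutoff 1 (1 - (x \<bullet> x) / R\<^sup>2)
  + (2 / R\<^sup>2 * (x \<bullet> v))\<^sup>2 * pd (pd cutoff 1) 1 (1 - (x \<bullet> x) / R\<^sup>2)"
proof -
 have q: "((\<lambda>x :: 'a. 1 - (x \<bullet> x) / R\<^sup>2) has_derivative (\<lambda>v. - (x \<bullet> v + v \<bullet> x) / R\<^sup>2)) (at x)"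
  by (auto intro!: derivative_eq_intros simp: fun_eq_iff divide_inverse algebra_simps)
 have D1: "((\<lambda>x :: 'a. pd cutoff 1 (1 - (x \<bullet> x) / R\<^sup>2)) has_derivative (\<lambda>v. pd (pd cutoff 1) (- (x \<bullet> v + v \<bullet> x) / R\<^sup>2) (1 - (x \<bullet> x) / R\<^sup>2))) (at x)"
  by (rule has_derivative_compose[OF q smooth_on_has_derivative[OF smooth_on_pd[OF smooth_on_cutoff] open_UNIV UNIV_I]])
 have D2: "((\<lambda>x :: 'a. - 2 / R\<^sup>2 * (x \<bullet> v)) has_derivative (\<lambda>h. - 2 / R\<^sup>2 * (h \<bullet> v))) (at x)"
  by (intro has_derivative_mult_right has_derivative_inner_left has_derivative_ident)
 have "pd (radial R) v = (\<lambda>x. - 2 / R\<^sup>2 * (x \<bullet> v) * pd cutoff 1 (1 - (x \<bullet> x) / R\<^sup>2))"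
  by (rule ext) (rule pd_radial)
 then have "(pd (radial R) v has_derivative (\<lambda>h. - 2 / R\<^sup>2 * (x \<bullet> v) * pd (pd cutoff 1) (- (x \<bullet> h + h \<bullet> x) / R\<^sup>2) (1 - (x \<bullet> x) / R\<^sup>2)
   + - 2 / R\<^sup>2 * (h \<bullet> v) * pd cutoff 1 (1 - (x \<bullet> x) / R\<^sup>2))) (at x)"
  using has_derivative_mult[OF D2 D1] by simp
 from pd_eq_of_has_derivative[OF this, of v]
 have "pd (pd (radial R) v) v x = - 2 / R\<^sup>2 * (x \<bullet> v) * ((- (x \<bullet> v + v \<bullet> x) / R\<^sup>2) * pd (pd cutoff 1) 1 (1 - (x \<bullet> x) / R\<^sup>2))
   + - 2 / R\<^sup>2 * (v \<bullet> v) * pd cutoff 1 (1 - (x \<bullet> x) / R\<^sup>2)"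
  by (subst (asm) pd2_cutoff)
 then show ?thesis by (simp add: inner_commute power2_eq_square)
qed

text \<open>What the geometry leaves behind on Euclidean space. \<open>B_f\<close> prescribes
  \<open>B\<close> only on those f_j whose weight equation has an integer solution m; nothing is
  known about \<open>B\<close> on the others. The bound -1 \<le> \<epsilon> is what keeps the levels
  nonnegative.\<close>

locale model = oscillator \<kappa> for \<kappa> :: "'n::finite => real" +
 fixes k :: "'n => int ^ 'p::finite" and L :: "real ^ 'p => real ^ 'p" and \<tau> :: "real ^ 'p"
  and a :: "'r::finite => int ^ 'p" and b :: "int ^ 'p" and \<epsilon> :: "'r => 'n => int"
  and f :: "'r => complex ^ 'r" and F :: "real ^ 'p => complex ^ 'r ^ 'r" and \<rho> :: "real ^ 'p => complex"
  and B :: "complex ^ 'r ^ 'r"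
  and K :: "(real ^ ('n + 'n) => complex ^ 'r) => real ^ ('n + 'n) => complex ^ 'r"
 assumes \<kappa>_eq: "\<And>l. \<kappa> l = idot (k l) \<tau>"
  and L_lin: "linear L" and L_surj: "surj L"
  and \<epsilon>: "\<And>j l. \<epsilon> j l \<ge> -1"
  and f_orth: "\<And>i j. cinner (f i) (f j) = (if i = j then 1 else 0)"
  and F_f: "\<And>\<theta> j. F \<theta> *v f j = cis (idot (a j) (L \<theta>)) *s f j"
  and \<rho>_eq: "\<And>\<theta>. \<rho> \<theta> = cis (idot b (L \<theta>))"
  and B_f: "\<And>j m. (\<Sum>h\<in>UNIV. m h *s k h) = a j + b ==>
   B *v f j = of_real (2 * (\<Sum>l\<in>UNIV. \<kappa> l * of_int (\<epsilon> j l)) + 2 * idot (a j + b) \<tau>) *s f j"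
  and K_eq: "\<And>u y. smooth_on UNIV u ==>
   K u y = - (\<Sum>i\<in>UNIV. pd (pd u (axis i 1)) (axis i 1) y) + B *v u y
    + of_real (\<Sum>l\<in>UNIV. (\<kappa> l)\<^sup>2 * (cmod (zc y l))\<^sup>2) *s u y"
begin

definition V :: "real ^ ('n + 'n) => real" where
 "V y = (\<Sum>l\<in>UNIV. (\<kappa> l)\<^sup>2 * (cmod (zc y l))\<^sup>2)"

definition beta :: "'r => real" where
 "beta j = 2 * (\<Sum>l\<in>UNIV. \<kappa> l * of_int (\<epsilon> j l)) + 2 * idot (a j + b) \<tau>"

definition lev :: "('n => nat) => ('n => nat) => real" where
 "lev \<alpha> \<beta> = 2 * (\<Sum>l\<in>UNIV. \<kappa> l * real (\<alpha> l + \<beta> l + 1))"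

text \<open>The condition under which the oscillator function for (\<alpha>, \<beta>) times f_j has
  type \<rho>.\<close>

definition adm3 :: "('n => nat) => ('n => nat) => 'r => bool" where
 "adm3 \<alpha> \<beta> j \<longleftrightarrow> (\<Sum>h\<in>UNIV. (int (\<alpha> h) - int (\<beta> h)) *s k h) = a j + b"

abbreviation "\<D> \<equiv> test_sections (\<lambda>\<theta>. rot k (L \<theta>)) F \<rho>"
abbreviation "\<H> \<equiv> L2_type (\<lambda>\<theta>. rot k (L \<theta>)) F \<rho>"

lemma adm3_beta: "adm3 \<alpha> \<beta> j ==> B *v f j = of_real (beta j) *s f j"
 unfolding adm3_def beta_def by (rule B_f[of "\<lambda>h. int (\<alpha> h) - int (\<beta> h)"])

lemma norm_f: "norm (f j) = 1"
proof -
 have "complex_of_real ((norm (f j))\<^sup>2) = of_real 1" using cinner_self[of "f j"] f_orth[of j j] by simp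
 then have "(norm (f j))\<^sup>2 = 1" by (simp only: of_real_eq_iff)
 then show ?thesis by (simp add: power2_eq_1_iff) (metis norm_ge_zero not_one_le_zero le_minus_one_simps(3))
qed

lemma continuous_V: "continuous_on UNIV V"
 unfolding V_def by (intro continuous_intros bounded_linear.continuous_on[OF bounded_linear_zc])

lemma pd_component:
 assumes "smooth_on UNIV (s :: real ^ ('n + 'n) => complex ^ 'r)"
 shows "pd (\<lambda>x. cinner (s x) w) v x = cinner (pd s v x) w"
 by (rule pd_bounded_linear[OF bounded_bilinear.bounded_linear_left[OF bounded_bilinear_cinner]])
  (rule smooth_on_differentiable[OF assms], auto)

lemma smooth_component:
 assumes "smooth_on UNIV (s :: real ^ ('n + 'n) => complex ^ 'r)"
 shows "smooth_on UNIV (\<lambda>x. cinner (s x) w)"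
 by (rule smooth_on_bounded_linear[OF bounded_bilinear.bounded_linear_left[OF bounded_bilinear_cinner] open_UNIV assms])

lemma pd2_component:
 assumes "smooth_on UNIV (s :: real ^ ('n + 'n) => complex ^ 'r)"
 shows "pd (pd (\<lambda>x. cinner (s x) w) v) v' x = cinner (pd (pd s v) v' x) w"
proof -
 have "pd (\<lambda>x. cinner (s x) w) v = (\<lambda>x. cinner (pd s v x) w)" by (rule ext) (rule pd_component[OF assms])
 then show ?thesis by (simp only: pd_component[OF smooth_on_pd[OF assms]])
qed

lemma pd_vscale:
 assumes "\<psi> differentiable at x"
 shows "pd (\<lambda>x. \<psi> x *s (w :: complex ^ 'r)) v x = pd \<psi> v x *s w"
 by (rule pd_bounded_linear[OF bounded_bilinear.bounded_linear_left[OF bounded_bilinear_vscale] assms])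

lemma smooth_vscale:
 fixes \<psi> :: "real ^ ('n + 'n) => complex"
 assumes "smooth_on UNIV \<psi>"
 shows "smooth_on UNIV (\<lambda>x. \<psi> x *s (w :: complex ^ 'r))"
 by (rule smooth_on_bounded_linear[OF bounded_bilinear.bounded_linear_left[OF bounded_bilinear_vscale] open_UNIV assms])

lemma pd2_vscale:
 fixes \<psi> :: "real ^ ('n + 'n) => complex"
 assumes "smooth_on UNIV \<psi>"
 shows "pd (pd (\<lambda>x. \<psi> x *s (w :: complex ^ 'r)) v) v' x = pd (pd \<psi> v) v' x *s w"
proof -
 have "pd (\<lambda>x. \<psi> x *s w) v = (\<lambda>x. pd \<psi> v x *s w)"
  by (rule ext) (rule pd_vscale[OF smooth_on_differentiable[OF assms open_UNIV UNIV_I]])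
 then show ?thesis
  by (simp only: pd_vscale[OF smooth_on_differentiable[OF smooth_on_pd[OF assms] open_UNIV UNIV_I]])
qed

lemma K_vscale:
 assumes "smooth_on UNIV \<psi>" "B *v f j = of_real (beta j) *s f j"
 shows "K (\<lambda>x. \<psi> x *s f j) y = (- (\<Sum>i\<in>UNIV. pd (pd \<psi> (axis i 1)) (axis i 1) y) + of_real (beta j) * \<psi> y + of_real (V y) * \<psi> y) *s f j"
proof -
 have s: "(\<Sum>i\<in>UNIV. g i *s w) = (\<Sum>i\<in>UNIV. g i) *s w" for g :: "'n + 'n => complex" and w :: "complex ^ 'r"
  by (simp add: vec_eq_iff sum_distrib_right)
 have Bs: "B *v (c *s w) = c *s (B *v w)" for c w by (simp add: vec.scale)
 show ?thesis
  unfolding K_eq[OF smooth_vscale[OF assms(1)]] pd2_vscale[OF assms(1)] s V_def[symmetric] Bs assms(2)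
  by (simp add: vec_eq_iff algebra_simps)
qed

lemma F_component: "cinner (F \<theta> *v w) (f j) = cis (idot (a j) (L \<theta>)) * cinner w (f j)"
proof -
 have "F \<theta> *v w = F \<theta> *v (\<Sum>i\<in>UNIV. cinner w (f i) *s f i)" using orthonormal_expansion[OF f_orth, of w] by simp
 also have "\<dots> = (\<Sum>i\<in>UNIV. cinner w (f i) *s (cis (idot (a i) (L \<theta>)) *s f i))"
  by (simp add: vec.sum vec.scale F_f)
 finally have "cinner (F \<theta> *v w) (f j) = (\<Sum>i\<in>UNIV. cinner w (f i) * (cis (idot (a i) (L \<theta>)) * cinner (f i) (f j)))"
  by (simp add: cinner_sum_left cinner_scale_left mult.assoc)
 also have "\<dots> = (\<Sum>i\<in>UNIV. if i = j then cis (idot (a j) (L \<theta>)) * cinner w (f j) else 0)"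
  by (intro sum.cong) (auto simp: f_orth)
 finally show ?thesis by simp
qed

lemma L_minus: "L (- \<theta>) = - L \<theta>"
 using linear_neg[OF L_lin] .

lemma type_component:
 assumes "F (- \<theta>) *v u (rot k (L \<theta>) x) = \<rho> \<theta> *s u x"
 shows "cinner (u (rot k (L \<theta>) x)) (f j) = cis (idot (a j + b) (L \<theta>)) * cinner (u x) (f j)"
proof -
 have "cis (- idot (a j) (L \<theta>)) * cinner (u (rot k (L \<theta>) x)) (f j) = cis (idot b (L \<theta>)) * cinner (u x) (f j)"
  using arg_cong[OF assms, of "\<lambda>w. cinner w (f j)"]
  by (simp add: F_component cinner_scale_left L_minus idot_minus_right \<rho>_eq)
 then have "cis (idot (a j) (L \<theta>)) * (cis (- idot (a j) (L \<theta>)) * cinner (u (rot k (L \<theta>) x)) (f j))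
   = cis (idot (a j) (L \<theta>)) * (cis (idot b (L \<theta>)) * cinner (u x) (f j))" by simp
 then show ?thesis by (simp add: cis_mult idot_add flip: mult.assoc)
qed

text \<open>If the weights differ by some q \<noteq> 0, a suitable torus element makes the integrand
  change sign; rotations preserve Lebesgue measure, so the integral equals its own negative.\<close>

lemma coefficient_eq_0:
 assumes u: "u \<in> L2_fun" and t: "\<And>\<theta>. AE x in lborel. F (- \<theta>) *v u (rot k (L \<theta>) x) = \<rho> \<theta> *s u x"
  and n: "\<not> adm3 \<alpha> \<beta> j"
 shows "sinner (\<lambda>x. cinner (u x) (f j)) (e \<alpha> \<beta>) = 0"
proof -
 define q where "q = a j + b - (\<Sum>h\<in>UNIV. (int (\<alpha> h) - int (\<beta> h)) *s k h)"
 have "q \<noteq> 0" using n by (auto simp: q_def adm3_def)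
 then obtain p where p: "q $ p \<noteq> 0" by (auto simp: vec_eq_iff)
 \<comment> \<open>Chosen so that q . L \<theta> = pi, that is, the relative phase is -1.\<close>
 obtain \<theta> where \<theta>: "L \<theta> = axis p (pi / of_int (q $ p))" using L_surj by (metis surjD)
 have "idot q (L \<theta>) = pi"
  using p unfolding \<theta> idot_def axis_def by (simp add: if_distrib sum.delta cong: if_cong)
 then have c: "cis (idot q (L \<theta>)) = -1" by simp
 define g where "g x = cinner (u x) (f j) * cnj (e \<alpha> \<beta> x)" for x
 have em: "e \<alpha> \<beta> \<in> meas" by (rule tame_measurable[OF tame_e])
 have [measurable]: "(\<lambda>x. cnj (e \<alpha> \<beta> x)) \<in> meas"
  by (rule borel_measurable_continuous_onI[OF continuous_on_cnj[OF tame_continuous[OF tame_e]]])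
 have [measurable]: "u \<in> meas" by (rule L2_funD(1)[OF u])
 have gm[measurable]: "g \<in> meas" unfolding g_def by measurable
 have cR: "continuous_on UNIV (rot k (L \<theta>))"
  by (rule linear_continuous_on_compose[OF continuous_on_id linear_rot, unfolded id_def])
 have [measurable]: "rot k (L \<theta>) \<in> meas" by (rule borel_measurable_continuous_onI[OF cR])
 have "(LINT x|lborel. g (rot k (L \<theta>) x)) = (LINT x|lborel. - g x)"
 proof (rule integral_cong_AE)
  show "AE x in lborel. g (rot k (L \<theta>) x) = - g x"
   using t[of \<theta>]
  proof eventually_elim
   fix x assume x: "F (- \<theta>) *v u (rot k (L \<theta>) x) = \<rho> \<theta> *s u x"
   have s: "(\<Sum>l\<in>UNIV. (real (\<alpha> l) - real (\<beta> l)) * idot (k l) (L \<theta>)) = idot (\<Sum>h\<in>UNIV. (int (\<alpha> h) - int (\<beta> h)) *s k h) (L \<theta>)"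
    unfolding idot_smult_sum by simp
   have "g (rot k (L \<theta>) x) = cis (idot (a j + b) (L \<theta>)) * cis (- idot (\<Sum>h\<in>UNIV. (int (\<alpha> h) - int (\<beta> h)) *s k h) (L \<theta>)) * g x"
    unfolding g_def type_component[OF x] osc_rot s by (simp add: cis_cnj mult_ac)
   also have "cis (idot (a j + b) (L \<theta>)) * cis (- idot (\<Sum>h\<in>UNIV. (int (\<alpha> h) - int (\<beta> h)) *s k h) (L \<theta>)) = cis (idot q (L \<theta>))"
    by (simp add: cis_mult q_def idot_diff)
   finally show "g (rot k (L \<theta>) x) = - g x" using c by simp
  qed
 qed measurable
 then have "(LINT x|lborel. g x) = - (LINT x|lborel. g x)"
  by (simp add: integral_orthogonal[OF orthogonal_rot gm])
 then show ?thesis by (simp add: sinner_def g_def[abs_def])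
qed

lemma \<D>D:
 assumes "s \<in> \<D>"
 shows "smooth_on UNIV s" "bounded {x. s x \<noteq> 0}" "F (- \<theta>) *v s (rot k (L \<theta>) x) = \<rho> \<theta> *s s x"
 using assms by (auto simp: test_sections_def)

lemma L2_bounded_support:
 fixes s :: "real ^ ('n + 'n) => complex ^ 'r"
 assumes "continuous_on UNIV s" "bounded {x. s x \<noteq> 0}"
 shows "s \<in> L2_fun"
 by (rule L2_fun_gauss_bounded[OF gauss_bounded_bounded_support[OF assms] borel_measurable_continuous_onI[OF assms(1)]])

lemma \<D>_L2: "s \<in> \<D> ==> s \<in> L2_fun"
 by (rule L2_bounded_support[OF smooth_on_continuous[OF \<D>D(1)] \<D>D(2)])

lemma tame_component:
 assumes "s \<in> \<D>"
 shows "tame (\<lambda>x. cinner (s x) w)"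
 by (rule tame_bounded_support[OF smooth_component[OF \<D>D(1)[OF assms]]])
  (rule bounded_subset[OF \<D>D(2)[OF assms]], auto simp: cinner_0)

text \<open>No oscillator function has the weight of this component, so all its coefficients vanish;
  completeness gives 0 almost everywhere, continuity gives 0 everywhere.\<close>

lemma component_eq_0:
 assumes s: "s \<in> \<D>" and j: "\<And>\<alpha> \<beta>. \<not> adm3 \<alpha> \<beta> j"
 shows "cinner (s x) (f j) = 0"
proof (rule continuous_AE_0[of "\<lambda>x. cinner (s x) (f j)" x])
 show c: "continuous_on UNIV (\<lambda>x. cinner (s x) (f j))" by (rule tame_continuous[OF tame_component[OF s]])
 show "AE x in lborel. cinner (s x) (f j) = 0"
 proof (rule complete[of "\<lambda>x. cinner (s x) (f j)"])
  show "(\<lambda>x. cinner (s x) (f j)) \<in> meas" by (rule borel_measurable_continuous_onI[OF c])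
  have "integrable lborel (\<lambda>x. Re (cinner (s x) (f j) * cnj (cinner (s x) (f j))))"
   by (rule integrable_Re[OF tame_integrable[OF tame_component[OF s] tame_component[OF s]]])
  then show "integrable lborel (\<lambda>x. (cmod (cinner (s x) (f j)))\<^sup>2)" unfolding cmod_power2 by (simp add: power2_eq_square)
  show "sinner (\<lambda>x. cinner (s x) (f j)) (e \<alpha> \<beta>) = 0" for \<alpha> \<beta>
   by (rule coefficient_eq_0[OF \<D>_L2[OF s] _ j]) (simp add: \<D>D(3)[OF s])
 qed
qed

text \<open>For each i either the eigenvalue of \<open>B\<close> on f_i is known or the component of
  s along f_i is 0. On test sections \<open>B\<close> therefore acts as the diagonal map with
  entries \<open>beta\<close>.\<close>

lemma B_component:
 assumes s: "s \<in> \<D>"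
 shows "cinner (B *v s x) (f j) = of_real (beta j) * cinner (s x) (f j)"
proof -
 have "B *v s x = B *v (\<Sum>i\<in>UNIV. cinner (s x) (f i) *s f i)" using orthonormal_expansion[OF f_orth, of "s x"] by simp
 also have "\<dots> = (\<Sum>i\<in>UNIV. cinner (s x) (f i) *s (B *v f i))" by (simp add: vec.sum vec.scale)
 also have "\<dots> = (\<Sum>i\<in>UNIV. cinner (s x) (f i) *s (of_real (beta i) *s f i))"
 proof (rule sum.cong[OF refl])
  fix i
  show "cinner (s x) (f i) *s (B *v f i) = cinner (s x) (f i) *s (of_real (beta i) *s f i)"
  proof (cases "\<exists>\<alpha> \<beta>. adm3 \<alpha> \<beta> i")
   case True
   then show ?thesis using adm3_beta by auto
  next
   case False
   then show ?thesis using component_eq_0[OF s, of i x] by simp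
  qed
 qed
 finally have "cinner (B *v s x) (f j) = (\<Sum>i\<in>UNIV. cinner (s x) (f i) * (of_real (beta i) * cinner (f i) (f j)))"
  by (simp add: cinner_sum_left cinner_scale_left mult.assoc)
 also have "\<dots> = (\<Sum>i\<in>UNIV. if i = j then of_real (beta j) * cinner (s x) (f j) else 0)"
  by (intro sum.cong) (auto simp: f_orth)
 finally show ?thesis by simp
qed

lemma K_component:
 assumes s: "s \<in> \<D>" and g: "g = (\<lambda>x. cinner (s x) (f j))"
 shows "cinner (K s x) (f j) = - (\<Sum>i\<in>UNIV. pd (pd g (axis i 1)) (axis i 1) x) + of_real (beta j) * g x + of_real (V x) * g x"
 unfolding K_eq[OF \<D>D(1)[OF s]] g pd2_component[OF \<D>D(1)[OF s]] V_def[symmetric]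
 by (simp add: cinner_add_left cinner_diff_left cinner_minus_left cinner_sum_left cinner_scale_left B_component[OF s])

lemma sinner_sum_left: "(\<And>i. i \<in> I ==> tame (g i)) ==> tame h ==> sinner (\<lambda>x. \<Sum>i\<in>I. g i x) h = (\<Sum>i\<in>I. sinner (g i) h)"
 unfolding sinner_def sum_distrib_right by (rule Bochner_Integration.integral_sum) (rule tame_integrable)

lemma sinner_sum_right: "(\<And>i. i \<in> I ==> tame (g i)) ==> tame h ==> sinner h (\<lambda>x. \<Sum>i\<in>I. g i x) = (\<Sum>i\<in>I. sinner h (g i))"
 unfolding sinner_def cnj_sum sum_distrib_left by (rule Bochner_Integration.integral_sum) (rule tame_integrable)

text \<open>Two integrations by parts move the Laplacian onto the oscillator function; its
  eigenvalue equation returns the potential, which cancels against the potential in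
  \<open>K\<close>.\<close>

lemma sinner_K:
 assumes s: "s \<in> \<D>"
 shows "sinner (\<lambda>x. cinner (K s x) (f j)) (e \<alpha> \<beta>) = of_real (lev \<alpha> \<beta> + beta j) * sinner (\<lambda>x. cinner (s x) (f j)) (e \<alpha> \<beta>)"
proof -
 define g where "g x = cinner (s x) (f j)" for x
 have gg: "g = (\<lambda>x. cinner (s x) (f j))" by (simp add: g_def fun_eq_iff)
 have g: "tame g" unfolding g_def by (rule tame_component[OF s])
 have gs: "smooth_on UNIV g" unfolding g_def by (rule smooth_component[OF \<D>D(1)[OF s]])
 have gb: "bounded {x. g x \<noteq> 0}" unfolding g_def by (rule bounded_subset[OF \<D>D(2)[OF s]]) (auto simp: cinner_0)
 have g1: "tame (pd g v)" for v by (rule tame_bounded_support[OF smooth_on_pd[OF gs] bounded_support_pd[OF gb]])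
 have g2: "tame (pd (pd g v) v)" for v
  by (rule tame_bounded_support[OF smooth_on_pd[OF smooth_on_pd[OF gs]] bounded_support_pd[OF bounded_support_pd[OF gb]]])
 have e1: "tame (pd (e \<alpha> \<beta>) v)" "tame (pd (pd (e \<alpha> \<beta>) v) v)" for v
  by (rule tame_span, intro osc_span_pd osc_span_osc)+
 let ?Lg = "\<lambda>x. \<Sum>i\<in>UNIV. pd (pd g (axis i 1)) (axis i 1) x"
 let ?Le = "\<lambda>x. \<Sum>i\<in>UNIV. pd (pd (e \<alpha> \<beta>) (axis i 1)) (axis i 1) x"
 have "sinner ?Lg (e \<alpha> \<beta>) = (\<Sum>i\<in>UNIV. sinner (pd (pd g (axis i 1)) (axis i 1)) (e \<alpha> \<beta>))"
  by (rule sinner_sum_left[OF g2 tame_e])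
 also have "\<dots> = (\<Sum>i\<in>UNIV. sinner g (pd (pd (e \<alpha> \<beta>) (axis i 1)) (axis i 1)))"
  by (simp add: by_parts[OF g1 tame_e] by_parts[OF g e1(1)])
 also have "\<dots> = sinner g ?Le" by (rule sinner_sum_right[OF e1(2) g, symmetric])
 finally have LL: "sinner ?Lg (e \<alpha> \<beta>) = sinner g ?Le" .
 have em: "e \<alpha> \<beta> \<in> meas" by (rule tame_measurable[OF tame_e])
 have gm: "g \<in> meas" by (rule tame_measurable[OF g])
 have cont: "continuous_on UNIV (\<lambda>x. of_real (V x) * g x)"
  by (intro continuous_intros continuous_V tame_continuous[OF g])
 have Vg: "gauss_bounded (\<lambda>x. of_real (V x) * g x)"
  by (rule gauss_bounded_bounded_support[OF cont bounded_subset[OF gb]]) auto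
 have iV: "integrable lborel (\<lambda>x. (of_real (V x) * g x) * cnj (e \<alpha> \<beta> x))"
  by (rule integrable_sinner[OF Vg _ borel_measurable_continuous_onI[OF cont] em]) (use tame_e tame_def in blast)
 have iL: "integrable lborel (\<lambda>x. ?Lg x * cnj (e \<alpha> \<beta> x))"
  unfolding sum_distrib_right by (rule Bochner_Integration.integrable_sum) (rule tame_integrable[OF g2 tame_e])
 have ig: "integrable lborel (\<lambda>x. g x * cnj (e \<alpha> \<beta> x))" by (rule tame_integrable[OF g tame_e])
 have "sinner (\<lambda>x. cinner (K s x) (f j)) (e \<alpha> \<beta>)
   = (LINT x|lborel. - (?Lg x * cnj (e \<alpha> \<beta> x)) + of_real (beta j) * (g x * cnj (e \<alpha> \<beta> x)) + (of_real (V x) * g x) * cnj (e \<alpha> \<beta> x))"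
  unfolding sinner_def K_component[OF s gg] by (simp add: algebra_simps)
 also have "\<dots> = - sinner ?Lg (e \<alpha> \<beta>) + of_real (beta j) * sinner g (e \<alpha> \<beta>) + (LINT x|lborel. (of_real (V x) * g x) * cnj (e \<alpha> \<beta> x))"
  using iV iL ig by (simp add: sinner_def)
 also have "sinner ?Lg (e \<alpha> \<beta>) = (LINT x|lborel. (of_real (V x) * g x) * cnj (e \<alpha> \<beta> x) - of_real (lev \<alpha> \<beta>) * (g x * cnj (e \<alpha> \<beta> x)))"
  unfolding LL unfolding sinner_def laplacian_e V_def lev_def by (simp add: algebra_simps)
 also have "\<dots> = (LINT x|lborel. (of_real (V x) * g x) * cnj (e \<alpha> \<beta> x)) - of_real (lev \<alpha> \<beta>) * sinner g (e \<alpha> \<beta>)"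
  using iV ig by (simp add: sinner_def)
 finally show ?thesis by (simp add: g_def[abs_def] algebra_simps)
qed

end

section \<open>Eigenfunctions in the closure\<close>

context model
begin

lemma smooth_cut: "smooth_on UNIV (\<lambda>x. complex_of_real (radial R x) * e \<alpha> \<beta> x)"
 by (intro smooth_on_mult open_UNIV smooth_on_bounded_linear[OF bounded_linear_of_real] smooth_on_radial
   osc_span_smooth[OF osc_span_osc])

lemma cut_test_section:
 assumes "adm3 \<alpha> \<beta> j" "R > 0"
 shows "(\<lambda>x. (complex_of_real (radial R x) * e \<alpha> \<beta> x) *s f j) \<in> \<D>"
proof -
 have "F (- \<theta>) *v ((complex_of_real (radial R (rot k (L \<theta>) x)) * e \<alpha> \<beta> (rot k (L \<theta>) x)) *s f j)
   = \<rho> \<theta> *s ((complex_of_real (radial R x) * e \<alpha> \<beta> x) *s f j)" for \<theta> x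
 proof -
  have r: "radial R (rot k (L \<theta>) x) = radial R x"
   using norm_rot[of k "L \<theta>" x] by (simp add: radial_def power2_norm_eq_inner[symmetric])
  have "(\<Sum>l\<in>UNIV. (real (\<alpha> l) - real (\<beta> l)) * idot (k l) (L \<theta>)) = idot (\<Sum>h\<in>UNIV. (int (\<alpha> h) - int (\<beta> h)) *s k h) (L \<theta>)"
   unfolding idot_smult_sum by simp
  also have "\<dots> = idot (a j) (L \<theta>) + idot b (L \<theta>)" using assms(1) by (simp add: adm3_def idot_add)
  finally have o: "e \<alpha> \<beta> (rot k (L \<theta>) x) = cis (idot (a j) (L \<theta>) + idot b (L \<theta>)) * e \<alpha> \<beta> x" by (simp add: osc_rot)
  have "F (- \<theta>) *v (c *s f j) = (c * cis (- idot (a j) (L \<theta>))) *s f j" for c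
   by (simp add: vec.scale F_f L_minus idot_minus_right)
  then show ?thesis by (simp add: r o \<rho>_eq mult_ac flip: cis_mult) (simp add: cis_mult flip: mult.assoc)
 qed
 moreover have "bounded {x. (complex_of_real (radial R x) * e \<alpha> \<beta> x) *s f j \<noteq> 0}"
 proof (rule bounded_subset[OF bounded_cball[of 0 R]], rule subsetI)
  fix x assume "x \<in> {x. (complex_of_real (radial R x) * e \<alpha> \<beta> x) *s f j \<noteq> 0}"
  then have "radial R x \<noteq> 0" by auto
  then show "x \<in> cball 0 R" using radial_eq_0[OF assms(2), of x] by (metis mem_cball_0 nle_le)
 qed
 ultimately show ?thesis unfolding test_sections_def using smooth_vscale[OF smooth_cut] by simp
qed

lemma pd_cut:
 "pd (pd (\<lambda>x. complex_of_real (radial R x) * e \<alpha> \<beta> x) v) v x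
  = of_real (radial R x) * pd (pd (e \<alpha> \<beta>) v) v x + 2 * of_real (pd (radial R) v x) * pd (e \<alpha> \<beta>) v x
   + of_real (pd (pd (radial R) v) v x) * e \<alpha> \<beta> x"
proof -
 let ?e = "e \<alpha> \<beta>"
 have dr: "radial R differentiable at x" "pd (radial R) v differentiable at x" for x :: "real ^ ('n + 'n)"
  by (rule smooth_on_differentiable[OF _ open_UNIV UNIV_I], intro smooth_on_pd smooth_on_radial)+
 have de: "?e differentiable at x" "pd ?e v differentiable at x" for x
  using osc_span_differentiable[OF osc_span_osc] osc_span_differentiable[OF osc_span_pd[OF osc_span_osc]] .
 have r1: "((\<lambda>x. complex_of_real (radial R x)) has_derivative (\<lambda>v. of_real (pd (radial R) v x))) (at x)" for x :: "real ^ ('n + 'n)"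
  by (rule has_derivative_of_real[OF pd_works[OF dr(1)]])
 have r2: "((\<lambda>x. complex_of_real (pd (radial R) v x)) has_derivative (\<lambda>w. of_real (pd (pd (radial R) v) w x))) (at x)" for x :: "real ^ ('n + 'n)"
  by (rule has_derivative_of_real[OF pd_works[OF dr(2)]])
 have "pd (\<lambda>x. of_real (radial R x) * ?e x) v = (\<lambda>x. of_real (radial R x) * pd ?e v x + of_real (pd (radial R) v x) * ?e x)"
  by (rule ext) (rule pd_eq_of_has_derivative[OF has_derivative_mult[OF r1 pd_works[OF de(1)]]])
 moreover have "pd (\<lambda>x. of_real (radial R x) * pd ?e v x + of_real (pd (radial R) v x) * ?e x) v x
  = (of_real (radial R x) * pd (pd ?e v) v x + of_real (pd (radial R) v x) * pd ?e v x)
   + (of_real (pd (radial R) v x) * pd ?e v x + of_real (pd (pd (radial R) v) v x) * ?e x)"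
  by (rule pd_eq_of_has_derivative, rule has_derivative_add)
   (rule has_derivative_mult[OF r1 pd_works[OF de(2)]], rule has_derivative_mult[OF r2 pd_works[OF de(1)]])
 ultimately show ?thesis by (simp add: algebra_simps)
qed

text \<open>Truncating an eigenfunction by \<open>radial n\<close> changes its image under \<open>K\<close> by terms that contain
 derivatives of \<open>radial n\<close>; these are dominated by a Gaussian and tend to \<open>0\<close> pointwise.\<close>

lemma eigenfunction_closure:
 assumes adm: "adm3 \<alpha> \<beta> j"
 shows "(\<lambda>x. e \<alpha> \<beta> x *s f j, \<lambda>x. of_real (lev \<alpha> \<beta> + beta j) *s (e \<alpha> \<beta> x *s f j)) \<in> L2_closure \<D> K"
proof -
 let ?e = "e \<alpha> \<beta>"
 let ?lam = "complex_of_real (lev \<alpha> \<beta> + beta j)"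
 obtain C where C: "C \<ge> 0" "\<And>t. t \<le> 1 ==> \<bar>cutoff t\<bar> \<le> C" "\<And>t. t \<le> 1 ==> \<bar>pd cutoff 1 t\<bar> \<le> C"
  "\<And>t. t \<le> 1 ==> \<bar>pd (pd cutoff 1) 1 t\<bar> \<le> C" by (rule cutoff_bounds) (rule that)
 define R where "R n = real (Suc n)" for n
 have R: "R n > 0" "1 \<le> R n" for n by (auto simp: R_def)
 let ?q = "\<lambda>n. 1 / (R n)\<^sup>2"
 define \<eta> where "\<eta> n x = radial (R n) x" for n and x :: "real ^ ('n + 'n)"
 define ax :: "'n + 'n => real ^ ('n + 'n)" where "ax i = axis i 1" for i
 let ?d1 = "\<lambda>n i x. pd (\<eta> n) (ax i) x" and ?d2 = "\<lambda>n i x. pd (pd (\<eta> n) (ax i)) (ax i) x"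
  and ?e1 = "\<lambda>i. pd ?e (ax i)" and ?m = "\<lambda>n x. complex_of_real (\<eta> n x) - 1" and ?c = "(C + 1) * (1 + cmod ?lam)"
 let ?Q = "\<lambda>x. \<Sum>i\<in>UNIV. 4 * C * (1 + norm x) * cmod (?e1 i x) + 6 * C * (1 + norm x)\<^sup>2 * cmod (?e x)"
 have ax: "ax i \<bullet> ax i = 1" for i by (simp add: ax_def inner_axis_axis)
 have xax: "\<bar>x \<bullet> ax i\<bar> \<le> norm x" for x i using Cauchy_Schwarz_ineq2[of x "ax i"] by (simp add: ax norm_eq_sqrt_inner)
 define t where "t n x = 1 - (x \<bullet> x) / (R n)\<^sup>2" for n and x :: "real ^ ('n + 'n)"
 have t1: "t n x \<le> 1" for n x unfolding t_def by simp
 have invR: "?q n \<le> 1" for n using one_le_power[OF R(2)[of n], of 2] by (simp add: divide_le_eq)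
 have p1: "?d1 n i x = ?q n * (- 2 * (x \<bullet> ax i) * pd cutoff 1 (t n x))" for n i x
  unfolding \<eta>_def[abs_def] by (simp add: pd_radial t_def)
 have p2: "?d2 n i x
   = ?q n * (- 2 * pd cutoff 1 (t n x) + ?q n * (2 * (x \<bullet> ax i))\<^sup>2 * pd (pd cutoff 1) 1 (t n x))" for n i x
  unfolding \<eta>_def[abs_def] pd2_radial t_def[symmetric] ax by (simp add: power_mult_distrib power_divide algebra_simps power2_eq_square)
 \<comment> \<open>First and second derivatives of the cutoff both carry the factor 1 / (R n)^2, at
   the price of growth of degree at most 2 in x.\<close>
 have b1: "\<bar>?d1 n i x\<bar> \<le> ?q n * (2 * C * (1 + norm x))" for n i x
 proof -
  have "\<bar>- 2 * (x \<bullet> ax i) * pd cutoff 1 (t n x)\<bar> \<le> 2 * (1 + norm x) * C"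
   unfolding abs_mult by (intro mult_mono C(3) t1) (use xax[of x i] in auto)
  then show ?thesis unfolding p1 abs_mult[of "?q n"] by (intro mult_mono) (auto simp: mult_ac)
 qed
 have b2: "\<bar>?d2 n i x\<bar> \<le> ?q n * (6 * C * (1 + norm x)\<^sup>2)" for n i x
 proof -
  have one: "1 \<le> (1 + norm x)\<^sup>2" by (simp add: one_le_power)
  have "\<bar>- 2 * pd cutoff 1 (t n x)\<bar> \<le> 2 * C * (1 + norm x)\<^sup>2"
   using C(3)[OF t1[of n x]] mult_left_mono[OF one, of "2 * C"] C(1) by (simp add: abs_mult)
  moreover have "\<bar>?q n * (2 * (x \<bullet> ax i))\<^sup>2 * pd (pd cutoff 1) 1 (t n x)\<bar> \<le> 1 * (4 * (1 + norm x)\<^sup>2) * C"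
   unfolding abs_mult
  proof (intro mult_mono C(4) t1)
   show "\<bar>?q n\<bar> \<le> 1" using invR[of n] by simp
   have "(x \<bullet> ax i)\<^sup>2 \<le> (1 + norm x)\<^sup>2" by (rule power2_le_iff_abs_le[THEN iffD2]) (use xax[of x i] in auto)
   then show "\<bar>(2 * (x \<bullet> ax i))\<^sup>2\<bar> \<le> 4 * (1 + norm x)\<^sup>2" by (simp add: power_mult_distrib)
  qed auto
  ultimately have "\<bar>- 2 * pd cutoff 1 (t n x) + ?q n * (2 * (x \<bullet> ax i))\<^sup>2 * pd (pd cutoff 1) 1 (t n x)\<bar> \<le> 6 * C * (1 + norm x)\<^sup>2"
   by (intro order_trans[OF abs_triangle_ineq]) (simp add: algebra_simps)
  then show ?thesis unfolding p2 abs_mult[of "?q n"] by (intro mult_mono) auto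
 qed
 have \<eta>b: "\<bar>\<eta> n x\<bar> \<le> C" for n x using C(2)[OF t1[of n x]] by (simp add: \<eta>_def radial_def t_def)
 have invR0: "(\<lambda>n. ?q n) \<longlonglongrightarrow> 0"
 proof -
  have "(\<lambda>n. (inverse (real (Suc n)))\<^sup>2) \<longlonglongrightarrow> 0\<^sup>2" by (intro tendsto_power LIMSEQ_inverse_real_of_nat)
  then show ?thesis by (simp add: R_def inverse_eq_divide power_divide del: of_nat_Suc)
 qed
 have \<eta>1: "(\<lambda>n. \<eta> n x) \<longlonglongrightarrow> 1" for x
 proof -
  have "(\<lambda>n. 1 - (x \<bullet> x) * ?q n) \<longlonglongrightarrow> 1 - (x \<bullet> x) * 0" by (intro tendsto_intros invR0)
  then have "(\<lambda>n. t n x) \<longlonglongrightarrow> 1" by (simp add: t_def)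
  moreover have "isCont cutoff 1" using smooth_on_continuous[OF smooth_on_cutoff] by (simp add: continuous_on_eq_continuous_at)
  ultimately have "(\<lambda>n. cutoff (t n x)) \<longlonglongrightarrow> cutoff 1" by (rule isCont_tendsto_compose[rotated])
  then show ?thesis by (simp add: \<eta>_def[abs_def] radial_def t_def cutoff_1)
 qed
 define s where "s n x = (complex_of_real (\<eta> n x) * ?e x) *s f j" for n x
 have sD: "s n \<in> \<D>" for n unfolding s_def[abs_def] \<eta>_def by (rule cut_test_section[OF adm R(1)])
 define err where "err n x = - (\<Sum>i\<in>UNIV. 2 * of_real (?d1 n i x) * ?e1 i x + of_real (?d2 n i x) * ?e x)" for n x
 have Ks: "K (s n) x = (of_real (\<eta> n x) * (?lam * ?e x) + err n x) *s f j" for n x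
 proof -
  have "K (s n) x = (- (\<Sum>i\<in>UNIV. pd (pd (\<lambda>x. complex_of_real (\<eta> n x) * ?e x) (ax i)) (ax i) x)
    + of_real (beta j) * (of_real (\<eta> n x) * ?e x) + of_real (V x) * (of_real (\<eta> n x) * ?e x)) *s f j"
   unfolding s_def[abs_def] \<eta>_def ax_def by (rule K_vscale[OF smooth_cut adm3_beta[OF adm]])
  also have "(\<Sum>i\<in>UNIV. pd (pd (\<lambda>x. complex_of_real (\<eta> n x) * ?e x) (ax i)) (ax i) x)
    = of_real (\<eta> n x) * (\<Sum>i\<in>UNIV. pd (?e1 i) (ax i) x) - err n x"
   unfolding err_def \<eta>_def pd_cut by (simp add: sum.distrib sum_distrib_left algebra_simps)
  also have "(\<Sum>i\<in>UNIV. pd (?e1 i) (ax i) x) = of_real (V x) * ?e x - of_real (lev \<alpha> \<beta>) * ?e x"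
   unfolding ax_def laplacian_e V_def lev_def ..
  finally show ?thesis by (simp add: algebra_simps)
 qed
 \<comment> \<open>One dominating function for both limits: the first term covers the factor
   \<open>\<eta> n x\<close> - 1 of modulus at most C + 1, with or without the eigenvalue; the sum
   covers \<open>err n\<close>.\<close>
 define W where "W x = ?c * cmod (?e x)
  + ?Q x" for x
 have es: "?e \<in> osc_span \<kappa>" "?e1 i \<in> osc_span \<kappa>" for i by (intro osc_span_osc osc_span_pd)+
 have eg: "gauss_bounded ?e" "gauss_bounded (?e1 i)" for i
  using osc_span_gauss_bounded[OF es(1) \<kappa>] osc_span_gauss_bounded[OF es(2) \<kappa>] .
 have gsum: "gauss_bounded (\<lambda>x. \<Sum>i\<in>I. g i x)" if "\<And>i. gauss_bounded (g i)" for I :: "('n + 'n) set" and g :: "'n + 'n => real ^ ('n + 'n) => real"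
 proof (induction I rule: infinite_finite_induct)
  case (insert i I)
  then show ?case using gauss_bounded_add[OF that[of i] insert.IH] by simp
 qed (auto simp: gauss_bounded_def intro!: exI[of _ 0] exI[of _ 1])
 have Wg: "gauss_bounded W"
  unfolding W_def
 proof (intro gauss_bounded_add gsum)
  show "gauss_bounded (\<lambda>x. ?c * cmod (?e x))"
   by (rule gauss_bounded_poly_growth[OF eg(1), where A="?c" and k=0]) (use C(1) in \<open>simp add: abs_mult\<close>)
  show "gauss_bounded (\<lambda>x. 4 * C * (1 + norm x) * cmod (?e1 i x))" for i
   by (rule gauss_bounded_poly_growth[OF eg(2)[of i], where A="4 * C" and k=1]) (use C(1) in \<open>simp add: abs_mult\<close>)
  show "gauss_bounded (\<lambda>x. 6 * C * (1 + norm x)\<^sup>2 * cmod (?e x))"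
   by (rule gauss_bounded_poly_growth[OF eg(1), where A="6 * C" and k=2]) (use C(1) in \<open>simp add: abs_mult\<close>)
 qed
 have em[measurable]: "?e \<in> meas" "?e1 i \<in> meas" for i
  using osc_span_measurable[OF es(1)] osc_span_measurable[OF es(2)] .
 have Wm: "W \<in> meas" unfolding W_def by measurable
 have W0: "W x \<ge> ?c * cmod (?e x)" for x
  unfolding W_def using C(1) by (auto intro!: sum_nonneg)
 have errb: "cmod (err n x) \<le> ?q n * ?Q x" for n x
  unfolding err_def norm_minus_cancel sum_distrib_left
 proof (rule order_trans[OF norm_sum], rule sum_mono)
  fix i :: "'n + 'n"
  have "cmod (2 * of_real (?d1 n i x) * ?e1 i x + of_real (?d2 n i x) * ?e x)
    \<le> 2 * \<bar>?d1 n i x\<bar> * cmod (?e1 i x) + \<bar>?d2 n i x\<bar> * cmod (?e x)"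
   by (rule order_trans[OF norm_triangle_ineq]) (simp add: norm_mult)
  also have "\<dots> \<le> 2 * (?q n * (2 * C * (1 + norm x))) * cmod (?e1 i x) + (?q n * (6 * C * (1 + norm x)\<^sup>2)) * cmod (?e x)"
   by (intro add_mono mult_right_mono mult_left_mono b1 b2) auto
  finally show "cmod (2 * of_real (?d1 n i x) * ?e1 i x + of_real (?d2 n i x) * ?e x)
    \<le> ?q n * (4 * C * (1 + norm x) * cmod (?e1 i x) + 6 * C * (1 + norm x)\<^sup>2 * cmod (?e x))"
   by (simp add: algebra_simps)
 qed
 have err0: "(\<lambda>n. err n x) \<longlonglongrightarrow> 0" for x
  by (rule Lim_null_comparison[OF always_eventually[OF allI[OF errb]]])
   (rule tendsto_mult_left_zero[OF invR0])
 have vs: "(\<lambda>n. g n *s f j) \<longlonglongrightarrow> 0" if "g \<longlonglongrightarrow> 0" for g :: "nat => complex"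
  using tendsto_norm[OF that] by - (rule tendsto_norm_zero_cancel, simp add: norm_vscale norm_f)
 have L1: "(\<lambda>n. L2_nrm (\<lambda>x. s n x - ?e x *s f j)) \<longlonglongrightarrow> 0"
 proof (rule L2_nrm_tendsto_0[OF Wg Wm])
  have eq: "s n x - ?e x *s f j = (?m n x * ?e x) *s f j" for n x by (simp add: s_def vec_eq_iff algebra_simps)
  show "(\<lambda>x. s n x - ?e x *s f j) \<in> meas" for n
   using L2_funD(1)[OF \<D>_L2[OF sD[of n]]] by measurable
  show "norm (s n x - ?e x *s f j) \<le> W x" for n x
  proof -
   have "cmod (?m n x) \<le> C + 1" using \<eta>b[of n x] norm_triangle_ineq4[of "complex_of_real (\<eta> n x)" 1] by simp
   then have "cmod (?m n x) * cmod (?e x) \<le> ?c * cmod (?e x)"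
    using C(1) mult_mono[of "cmod (?m n x)" "C + 1" 1 "1 + cmod ?lam"] by (intro mult_right_mono) auto
   then show ?thesis using W0[of x] unfolding eq norm_vscale norm_f norm_mult by linarith
  qed
  show "(\<lambda>n. s n x - ?e x *s f j) \<longlonglongrightarrow> 0" for x
  proof -
   have "(\<lambda>n. ?m n x * ?e x) \<longlonglongrightarrow> (of_real 1 - 1) * ?e x" by (intro tendsto_intros \<eta>1)
   then show ?thesis unfolding eq by (intro vs) simp
  qed
 qed
 have L2: "(\<lambda>n. L2_nrm (\<lambda>x. K (s n) x - ?lam *s (?e x *s f j))) \<longlonglongrightarrow> 0"
 proof (rule L2_nrm_tendsto_0[OF Wg Wm])
  have eq: "K (s n) x - ?lam *s (?e x *s f j) = (?m n x * (?lam * ?e x) + err n x) *s f j" for n x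
   unfolding Ks by (simp add: vec_eq_iff algebra_simps)
  have cc: "continuous_on UNIV (\<eta> n)" "continuous_on UNIV (pd (\<eta> n) v)" "continuous_on UNIV (pd (pd (\<eta> n) v) v)" for n v
   unfolding \<eta>_def[abs_def] by (intro smooth_on_continuous[of UNIV] smooth_on_pd smooth_on_radial)+
  have ce: "continuous_on UNIV ?e" "continuous_on UNIV (?e1 i)" for i
   using osc_span_continuous[OF es(1)] osc_span_continuous[OF es(2)] .
  show "(\<lambda>x. K (s n) x - ?lam *s (?e x *s f j)) \<in> meas" for n
  proof -
   have "continuous_on UNIV (\<lambda>x. ?m n x * (?lam * ?e x) + err n x)"
    unfolding err_def by (intro continuous_intros cc ce)
   then have "(\<lambda>x. ?m n x * (?lam * ?e x) + err n x) \<in> meas"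
    by (rule borel_measurable_continuous_onI)
   then show ?thesis unfolding eq by measurable
  qed
  show "norm (K (s n) x - ?lam *s (?e x *s f j)) \<le> W x" for n x
  proof -
   have "cmod (?m n x) \<le> C + 1" using \<eta>b[of n x] norm_triangle_ineq4[of "complex_of_real (\<eta> n x)" 1] by simp
   then have A: "cmod (?m n x * (?lam * ?e x)) \<le> ?c * cmod (?e x)"
    using C(1) mult_mono[of "cmod (?m n x)" "C + 1" "cmod ?lam" "1 + cmod ?lam"]
    unfolding norm_mult mult.assoc[symmetric] by (intro mult_right_mono) auto
   have S0: "0 \<le> ?Q x"
    using C(1) by (intro sum_nonneg) auto
   have "cmod (err n x) \<le> ?Q x"
    using errb[of n x] mult_right_mono[OF invR[of n] S0] by linarith
   then show ?thesis
    using A norm_triangle_ineq[of "?m n x * (?lam * ?e x)" "err n x"]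
    unfolding eq norm_vscale norm_f W_def by linarith
  qed
  show "(\<lambda>n. K (s n) x - ?lam *s (?e x *s f j)) \<longlonglongrightarrow> 0" for x
  proof -
   have "(\<lambda>n. ?m n x * (?lam * ?e x) + err n x) \<longlonglongrightarrow> (of_real 1 - 1) * (?lam * ?e x) + 0"
    by (intro tendsto_intros \<eta>1 err0)
   then show ?thesis unfolding eq by (intro vs) simp
  qed
 qed
 have "(\<lambda>x. ?e x *s f j) \<in> L2_fun"
 proof (rule L2_fun_gauss_bounded)
  show "gauss_bounded (\<lambda>x. ?e x *s f j)" by (rule gauss_bounded_mono[OF eg(1), of _ 1]) (simp add: norm_vscale norm_f)
 qed measurable
 then show ?thesis unfolding L2_closure_def using L1 L2 sD L2_fun_scale by blast
qed

end

section \<open>The spectrum of the model\<close>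

context model
begin

definition eig :: "int ^ 'n => nat ^ 'n => 'r => real" where
 "eig m d j = 2 * (\<Sum>l\<in>UNIV. \<kappa> l * real_of_int (\<bar>m $ l\<bar> + m $ l + 2 * int (d $ l) + 1 + \<epsilon> j l))"

definition admissible :: "int ^ 'n => 'r => bool" where
 "admissible m j \<longleftrightarrow> (\<Sum>h\<in>UNIV. m $ h *s k h) = a j + b"

text \<open>Admissibility turns the term 2 (a_j + b) . \<tau> of \<open>beta\<close> into 2 \<Sum>
  \<kappa>_l (\<alpha>_l - \<beta>_l), which cancels \<beta> from \<open>lev\<close>.\<close>

lemma level_adm3:
 assumes "adm3 \<alpha> \<beta> j"
 shows "lev \<alpha> \<beta> + beta j = (\<Sum>l\<in>UNIV. 2 * \<kappa> l * (2 * real (\<alpha> l) + 1 + of_int (\<epsilon> j l)))"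
proof -
 have "idot (a j + b) \<tau> = (\<Sum>l\<in>UNIV. (real (\<alpha> l) - real (\<beta> l)) * \<kappa> l)"
  using assms unfolding adm3_def by (elim subst) (simp only: idot_smult_sum \<kappa>_eq, simp)
 then show ?thesis unfolding lev_def beta_def
  by (simp add: sum_distrib_left flip: sum.distrib) (intro sum.cong refl, simp add: algebra_simps)
qed

text \<open>The two parametrizations: \<open>m = \<alpha> - \<beta>\<close> and \<open>d = min \<alpha> \<beta>\<close>.\<close>

definition par :: "(int ^ 'n) \<times> (nat ^ 'n) \<times> 'r => ('n => nat) \<times> ('n => nat) \<times> 'r" where
 "par = (\<lambda>(m, d, j). (\<lambda>l. nat (m $ l) + d $ l, \<lambda>l. nat (- (m $ l)) + d $ l, j))"

lemma bij_par: "bij par"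
proof (rule bij_betw_byWitness[where f'="\<lambda>(\<alpha>, \<beta>, j). (\<chi> l. int (\<alpha> l) - int (\<beta> l), \<chi> l. min (\<alpha> l) (\<beta> l), j)"])
 show "\<forall>t\<in>UNIV. (\<lambda>(\<alpha>, \<beta>, j). (\<chi> l. int (\<alpha> l) - int (\<beta> l), \<chi> l. min (\<alpha> l) (\<beta> l), j)) (par t) = t"
  by (auto simp: par_def vec_eq_iff)
 show "\<forall>t\<in>UNIV. par ((\<lambda>(\<alpha>, \<beta>, j). (\<chi> l. int (\<alpha> l) - int (\<beta> l), \<chi> l. min (\<alpha> l) (\<beta> l), j)) t) = t"
  by (auto simp: par_def fun_eq_iff)
qed auto

lemma adm3_par: "adm3 (fst (par (m, d, j))) (fst (snd (par (m, d, j)))) (snd (snd (par (m, d, j)))) \<longleftrightarrow> admissible m j"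
proof -
 have "int (nat (m $ h) + d $ h) - int (nat (- (m $ h)) + d $ h) = m $ h" for h by simp
 then show ?thesis by (simp add: adm3_def admissible_def par_def)
qed

lemma level_par:
 assumes "admissible m j"
 shows "lev (fst (par (m, d, j))) (fst (snd (par (m, d, j)))) + beta (snd (snd (par (m, d, j)))) = eig m d j"
proof -
 have "2 * real (nat (m $ l) + d $ l) = real_of_int (\<bar>m $ l\<bar> + m $ l + 2 * int (d $ l))" for l by simp
 then show ?thesis
  using level_adm3[of "fst (par (m, d, j))" "fst (snd (par (m, d, j)))" "snd (snd (par (m, d, j)))"] assms
  unfolding adm3_par eig_def by (simp add: par_def sum_distrib_left mult.assoc del: of_nat_add)
qed

text \<open>Since 1 + \<epsilon> \<ge> 0, the eigenvalue is at least 4 \<kappa>_l \<alpha>_l, which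
  bounds \<alpha>. It is blind to \<beta>, but admissibility gives \<Sum> \<kappa>_l \<beta>_l =
  \<Sum> \<kappa>_l \<alpha>_l - (a_j + b) . \<tau>, and j ranges over a finite set.\<close>

lemma finite_adm3: "finite {(\<alpha>, \<beta>, j). adm3 \<alpha> \<beta> j \<and> lev \<alpha> \<beta> + beta j \<le> R}"
proof -
 define M where "M l = nat \<lceil>\<bar>R\<bar> / (4 * \<kappa> l)\<rceil>" for l
 define S where "S = (\<Sum>l\<in>UNIV. \<kappa> l * real (M l)) + (\<Sum>j\<in>UNIV. \<bar>idot (a j + b) \<tau>\<bar>)"
 define N where "N l = nat \<lceil>S / \<kappa> l\<rceil>" for l
 have fin: "finite {\<alpha> :: 'n => nat. \<forall>l. \<alpha> l \<le> P l}" for P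
 proof -
  have "finite (PiE (UNIV :: 'n set) (\<lambda>l. {..P l}))" by (intro finite_PiE) auto
  then show ?thesis by (simp add: PiE_UNIV_domain Pi_def)
 qed
 have "{(\<alpha>, \<beta>, j). adm3 \<alpha> \<beta> j \<and> lev \<alpha> \<beta> + beta j \<le> R} \<subseteq> {\<alpha>. \<forall>l. \<alpha> l \<le> M l} \<times> {\<beta>. \<forall>l. \<beta> l \<le> N l} \<times> UNIV"
 proof (rule subsetI)
  fix t assume "t \<in> {(\<alpha>, \<beta>, j). adm3 \<alpha> \<beta> j \<and> lev \<alpha> \<beta> + beta j \<le> R}"
  then obtain \<alpha> \<beta> j where t: "t = (\<alpha>, \<beta>, j)" and adm: "adm3 \<alpha> \<beta> j" and R: "lev \<alpha> \<beta> + beta j \<le> R" by auto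
  have pos: "0 \<le> 1 + real_of_int (\<epsilon> j l)" for l using \<epsilon>[of j l] by linarith
  have \<alpha>: "\<alpha> l \<le> M l" for l
  proof -
   have "4 * \<kappa> l * real (\<alpha> l) \<le> 2 * \<kappa> l * (2 * real (\<alpha> l) + 1 + of_int (\<epsilon> j l))"
    using mult_nonneg_nonneg[OF less_imp_le[OF \<kappa>[of l]] pos[of l]] by (simp add: algebra_simps)
   also have "\<dots> \<le> (\<Sum>l\<in>UNIV. 2 * \<kappa> l * (2 * real (\<alpha> l) + 1 + of_int (\<epsilon> j l)))"
   proof (rule member_le_sum)
    fix l'
    have "0 \<le> 2 * real (\<alpha> l') + 1 + of_int (\<epsilon> j l')" using pos[of l'] by linarith
    then show "0 \<le> 2 * \<kappa> l' * (2 * real (\<alpha> l') + 1 + of_int (\<epsilon> j l'))" using less_imp_le[OF \<kappa>[of l']] by simp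
   qed auto
   also have "\<dots> \<le> \<bar>R\<bar>" using R level_adm3[OF adm] by linarith
   finally have "real (\<alpha> l) \<le> \<bar>R\<bar> / (4 * \<kappa> l)" using \<kappa>[of l] by (simp add: pos_le_divide_eq mult.commute)
   then show ?thesis unfolding M_def by linarith
  qed
  have \<beta>: "\<beta> l \<le> N l" for l
  proof -
   have "idot (a j + b) \<tau> = (\<Sum>l\<in>UNIV. (real (\<alpha> l) - real (\<beta> l)) * \<kappa> l)"
    using adm unfolding adm3_def by (elim subst) (simp only: idot_smult_sum \<kappa>_eq, simp)
   then have "(\<Sum>l\<in>UNIV. \<kappa> l * real (\<beta> l)) = (\<Sum>l\<in>UNIV. \<kappa> l * real (\<alpha> l)) - idot (a j + b) \<tau>"
    by (simp add: algebra_simps sum_subtractf)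
   also have "\<dots> \<le> (\<Sum>l\<in>UNIV. \<kappa> l * real (M l)) + (\<Sum>j\<in>UNIV. \<bar>idot (a j + b) \<tau>\<bar>)"
   proof -
    have "(\<Sum>l\<in>UNIV. \<kappa> l * real (\<alpha> l)) \<le> (\<Sum>l\<in>UNIV. \<kappa> l * real (M l))"
     by (intro sum_mono mult_left_mono) (use \<alpha> less_imp_le[OF \<kappa>] in auto)
    moreover have "\<bar>idot (a j + b) \<tau>\<bar> \<le> (\<Sum>j\<in>UNIV. \<bar>idot (a j + b) \<tau>\<bar>)"
     by (rule member_le_sum[where f="\<lambda>j. \<bar>idot (a j + b) \<tau>\<bar>"]) auto
    ultimately show ?thesis by linarith
   qed
   finally have "(\<Sum>l\<in>UNIV. \<kappa> l * real (\<beta> l)) \<le> S" by (simp add: S_def)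
   moreover have "\<kappa> l * real (\<beta> l) \<le> (\<Sum>l\<in>UNIV. \<kappa> l * real (\<beta> l))"
    by (rule member_le_sum[where f="\<lambda>l. \<kappa> l * real (\<beta> l)"]) (use less_imp_le[OF \<kappa>] in auto)
   ultimately have "\<kappa> l * real (\<beta> l) \<le> S" by linarith
   then have "real (\<beta> l) \<le> S / \<kappa> l" using \<kappa>[of l] by (simp add: pos_le_divide_eq mult.commute)
   then show ?thesis unfolding N_def by linarith
  qed
  show "t \<in> {\<alpha>. \<forall>l. \<alpha> l \<le> M l} \<times> {\<beta>. \<forall>l. \<beta> l \<le> N l} \<times> UNIV" using \<alpha> \<beta> by (simp add: t)
 qed
 moreover have "finite ({\<alpha>. \<forall>l. \<alpha> l \<le> M l} \<times> {\<beta>. \<forall>l. \<beta> l \<le> N l} \<times> (UNIV :: 'r set))" using fin by simp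
 ultimately show ?thesis by (rule finite_subset)
qed

definition nrm2 :: "('n => nat) => ('n => nat) => real" where
 "nrm2 \<alpha> \<beta> = Re (sinner (e \<alpha> \<beta>) (e \<alpha> \<beta>))"

lemma nrm2: "nrm2 \<alpha> \<beta> > 0" "sinner (e \<alpha> \<beta>) (e \<alpha> \<beta>) = of_real (nrm2 \<alpha> \<beta>)"
proof -
 have s: "sinner (e \<alpha> \<beta>) (e \<alpha> \<beta>) = of_real (LINT x|lborel. (cmod (e \<alpha> \<beta> x))\<^sup>2)"
  unfolding sinner_def by (simp add: complex_norm_square[symmetric] del: of_real_power flip: integral_complex_of_real)
 then show 2: "sinner (e \<alpha> \<beta>) (e \<alpha> \<beta>) = of_real (nrm2 \<alpha> \<beta>)" by (simp add: nrm2_def)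
 have "nrm2 \<alpha> \<beta> \<ge> 0" using s by (simp add: nrm2_def)
 moreover have "nrm2 \<alpha> \<beta> \<noteq> 0" using sinner_e_ne_0[of \<alpha> \<beta>] 2 by auto
 ultimately show "nrm2 \<alpha> \<beta> > 0" by simp
qed

definition basis :: "('n => nat) \<times> ('n => nat) \<times> 'r => real ^ ('n + 'n) => complex ^ 'r" where
 "basis = (\<lambda>(\<alpha>, \<beta>, j) x. complex_of_real (1 / sqrt (nrm2 \<alpha> \<beta>)) *s (e \<alpha> \<beta> x *s f j))"

lemma basis_L2: "basis i \<in> L2_fun"
proof -
 obtain \<alpha> \<beta> j where i: "i = (\<alpha>, \<beta>, j)" by (cases i)
 have "(\<lambda>x. e \<alpha> \<beta> x *s f j) \<in> L2_fun"
 proof (rule L2_fun_gauss_bounded)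
  have "gauss_bounded (e \<alpha> \<beta>)" using tame_e unfolding tame_def by blast
  then show "gauss_bounded (\<lambda>x. e \<alpha> \<beta> x *s f j)" by (rule gauss_bounded_mono[where A=1]) (simp add: norm_vscale norm_f)
  show "(\<lambda>x. e \<alpha> \<beta> x *s f j) \<in> meas" using tame_measurable[OF tame_e] by measurable
 qed
 then show ?thesis unfolding i basis_def prod.case by (rule L2_fun_scale)
qed

lemma L2_inner_basis:
 "L2_inner u (basis (\<alpha>, \<beta>, j)) = of_real (1 / sqrt (nrm2 \<alpha> \<beta>)) * sinner (\<lambda>x. cinner (u x) (f j)) (e \<alpha> \<beta>)"
 unfolding basis_def prod.case L2_inner_scale_right
 by (simp add: L2_inner_def sinner_def cinner_scale_right mult.commute)

lemma basis_orth: "L2_inner (basis i) (basis i') = (if i = i' then 1 else 0)"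
proof -
 obtain \<alpha> \<beta> j where i: "i = (\<alpha>, \<beta>, j)" by (cases i)
 obtain \<alpha>' \<beta>' j' where i': "i' = (\<alpha>', \<beta>', j')" by (cases i')
 have "sinner (\<lambda>x. cinner (basis i x) (f j')) (e \<alpha>' \<beta>') = of_real (1 / sqrt (nrm2 \<alpha> \<beta>)) * cinner (f j) (f j') * sinner (e \<alpha> \<beta>) (e \<alpha>' \<beta>')"
  unfolding i basis_def prod.case cinner_scale_left
  using sinner_scale_left[of "of_real (1 / sqrt (nrm2 \<alpha> \<beta>)) * cinner (f j) (f j')" "e \<alpha> \<beta>"] by (simp add: mult_ac)
 then have *: "L2_inner (basis i) (basis i') = of_real (1 / sqrt (nrm2 \<alpha>' \<beta>')) * (of_real (1 / sqrt (nrm2 \<alpha> \<beta>)) * cinner (f j) (f j') * sinner (e \<alpha> \<beta>) (e \<alpha>' \<beta>'))"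
  unfolding i' L2_inner_basis by simp
 show ?thesis
 proof (cases "i = i'")
  case True
  have "complex_of_real (1 / sqrt (nrm2 \<alpha> \<beta>)) * (of_real (1 / sqrt (nrm2 \<alpha> \<beta>)) * of_real (nrm2 \<alpha> \<beta>))
    = of_real ((1 / sqrt (nrm2 \<alpha> \<beta>)) * (1 / sqrt (nrm2 \<alpha> \<beta>)) * nrm2 \<alpha> \<beta>)" by (simp only: of_real_mult mult.assoc)
  also have "(1 / sqrt (nrm2 \<alpha> \<beta>)) * (1 / sqrt (nrm2 \<alpha> \<beta>)) * nrm2 \<alpha> \<beta> = 1"
   using nrm2(1)[of \<alpha> \<beta>] by simp
  finally show ?thesis using True * i i' by (simp add: f_orth nrm2(2))
 next
  case False
  then consider "j \<noteq> j'" | "(\<alpha>, \<beta>) \<noteq> (\<alpha>', \<beta>')" using i i' by auto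
  then show ?thesis using False by cases (simp_all add: * f_orth orth)
 qed
qed

lemma basis_complete:
 assumes u: "u \<in> L2_fun" and 0: "\<And>i. L2_inner u (basis i) = 0"
 shows "L2_nrm u = 0"
proof -
 have um: "u \<in> meas" by (rule L2_funD(1)[OF u])
 have "AE x in lborel. cinner (u x) (f j) = 0" for j
 proof (rule complete[of "\<lambda>x. cinner (u x) (f j)"])
  show "(\<lambda>x. cinner (u x) (f j)) \<in> meas" using um by measurable
  show "integrable lborel (\<lambda>x. (cmod (cinner (u x) (f j)))\<^sup>2)"
  proof (rule integrable_of_norm_le[OF L2_funD(2)[OF u]])
   show "(\<lambda>x. (cmod (cinner (u x) (f j)))\<^sup>2) \<in> meas" using um by measurable
   show "norm ((cmod (cinner (u x) (f j)))\<^sup>2) \<le> (norm (u x))\<^sup>2" for x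
    using power_mono[OF norm_cinner_le[of "u x" "f j"] norm_ge_zero, of 2] by (simp add: norm_f)
  qed
  show "sinner (\<lambda>x. cinner (u x) (f j)) (e \<alpha> \<beta>) = 0" for \<alpha> \<beta>
   using 0[of "(\<alpha>, \<beta>, j)"] nrm2(1)[of \<alpha> \<beta>] by (simp add: L2_inner_basis)
 qed
 then have "AE x in lborel. \<forall>j\<in>UNIV. cinner (u x) (f j) = 0" by (intro AE_finite_allI) auto
 then have "AE x in lborel. u x = 0"
 proof eventually_elim
  fix x assume "\<forall>j\<in>UNIV. cinner (u x) (f j) = 0"
  then show "u x = 0" using orthonormal_expansion[OF f_orth, of "u x"] by simp
 qed
 then show ?thesis using L2_nrm_eq_0_iff[OF u] by blast
qed

lemma \<D>_add: "s \<in> \<D> ==> t \<in> \<D> ==> (\<lambda>x. s x + t x) \<in> \<D>"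
proof -
 assume s: "s \<in> \<D>" and t: "t \<in> \<D>"
 have "bounded {x. s x + t x \<noteq> 0}"
  by (rule bounded_subset[of "{x. s x \<noteq> 0} \<union> {x. t x \<noteq> 0}"]) (use \<D>D(2)[OF s] \<D>D(2)[OF t] in auto)
 then show ?thesis unfolding test_sections_def
  using \<D>D(3)[OF s] \<D>D(3)[OF t] smooth_on_add[OF open_UNIV \<D>D(1)[OF s] \<D>D(1)[OF t]]
  by (simp add: matrix_vector_right_distrib vector_add_ldistrib)
qed

lemma \<D>_scale: "s \<in> \<D> ==> (\<lambda>x. z *s s x) \<in> \<D>"
proof -
 assume s: "s \<in> \<D>"
 have "bounded {x. z *s s x \<noteq> 0}" by (rule bounded_subset[OF \<D>D(2)[OF s]]) auto
 then show ?thesis unfolding test_sections_def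
  using \<D>D(3)[OF s] smooth_on_bounded_linear[OF bounded_bilinear.bounded_linear_right[OF bounded_bilinear_vscale] open_UNIV \<D>D(1)[OF s], of z]
  by (simp add: vec.scale vec_eq_iff mult.left_commute)
qed

lemma pd2_add:
 assumes "smooth_on UNIV (s :: real ^ ('n + 'n) => complex ^ 'r)" "smooth_on UNIV t"
 shows "pd (pd (\<lambda>x. s x + t x) v) w x = pd (pd s v) w x + pd (pd t v) w x"
proof -
 have "pd (\<lambda>x. s x + t x) v = (\<lambda>x. pd s v x + pd t v x)"
  by (rule ext) (rule pd_add[OF smooth_on_differentiable[OF assms(1) open_UNIV UNIV_I] smooth_on_differentiable[OF assms(2) open_UNIV UNIV_I]])
 then show ?thesis
  by (simp only: pd_add[OF smooth_on_differentiable[OF smooth_on_pd[OF assms(1)] open_UNIV UNIV_I] smooth_on_differentiable[OF smooth_on_pd[OF assms(2)] open_UNIV UNIV_I]])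
qed

lemma pd2_scale:
 assumes "smooth_on UNIV (s :: real ^ ('n + 'n) => complex ^ 'r)"
 shows "pd (pd (\<lambda>x. z *s s x) v) w x = z *s pd (pd s v) w x"
proof -
 note bl = bounded_bilinear.bounded_linear_right[OF bounded_bilinear_vscale, of z]
 have "pd (\<lambda>x. z *s s x) v = (\<lambda>x. z *s pd s v x)"
  by (rule ext) (rule pd_bounded_linear[OF bl smooth_on_differentiable[OF assms(1) open_UNIV UNIV_I]])
 then show ?thesis
  by (simp only: pd_bounded_linear[OF bl smooth_on_differentiable[OF smooth_on_pd[OF assms(1)] open_UNIV UNIV_I]])
qed

lemma K_add: "s \<in> \<D> ==> t \<in> \<D> ==> K (\<lambda>x. s x + t x) = (\<lambda>x. K s x + K t x)"
 by (rule ext) (simp add: K_eq \<D>D(1) \<D>D(1)[OF \<D>_add] pd2_add sum.distrib matrix_vector_right_distrib vector_add_ldistrib)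

lemma K_scale: "s \<in> \<D> ==> K (\<lambda>x. z *s s x) = (\<lambda>x. z *s K s x)"
 by (rule ext) (simp add: K_eq \<D>D(1) \<D>D(1)[OF \<D>_scale] pd2_scale vec.scale vec_eq_iff sum_distrib_left algebra_simps)

lemma K_L2:
 assumes s: "s \<in> \<D>"
 shows "K s \<in> L2_fun"
proof (rule L2_bounded_support)
 have c: "continuous_on UNIV s" "continuous_on UNIV (pd (pd s v) w)" for v w
  by (intro smooth_on_continuous smooth_on_pd \<D>D(1)[OF s])+
 have cB: "continuous_on UNIV (\<lambda>x. B *v s x)"
  using matrix_vector_mul_bounded_linear c(1) by (rule bounded_linear.continuous_on)
 have cV: "continuous_on UNIV (\<lambda>x. complex_of_real (V x) *s s x)"
  by (rule bounded_bilinear.continuous_on[OF bounded_bilinear_vscale continuous_on_of_real[OF continuous_V] c(1)])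
 have K: "K s = (\<lambda>x. - (\<Sum>i\<in>UNIV. pd (pd s (axis i 1)) (axis i 1) x) + B *v s x + complex_of_real (V x) *s s x)"
  by (rule ext) (simp add: K_eq[OF \<D>D(1)[OF s]] V_def)
 show "continuous_on UNIV (K s)" unfolding K by (intro continuous_intros c cB cV)
 show "bounded {x. K s x \<noteq> 0}"
 proof (rule bounded_subset)
  show "bounded ({x. s x \<noteq> 0} \<union> (\<Union>i\<in>UNIV. {x. pd (pd s (axis i 1)) (axis i 1) x \<noteq> 0}))"
   by (intro bounded_Un[THEN iffD2] conjI bounded_UN finite ballI bounded_support_pd \<D>D(2)[OF s])
  show "{x. K s x \<noteq> 0} \<subseteq> {x. s x \<noteq> 0} \<union> (\<Union>i\<in>UNIV. {x. pd (pd s (axis i 1)) (axis i 1) x \<noteq> 0})"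
  proof (rule subsetI, rule ccontr)
   fix x assume x: "x \<in> {x. K s x \<noteq> 0}" and n: "x \<notin> {x. s x \<noteq> 0} \<union> (\<Union>i\<in>UNIV. {x. pd (pd s (axis i 1)) (axis i 1) x \<noteq> 0})"
   then have "s x = 0" "\<And>i. pd (pd s (axis i 1)) (axis i 1) x = 0" by auto
   then show False using x unfolding K by simp
  qed
 qed
qed

text \<open>All triples (\<alpha>, \<beta>, j) are enumerated, because the basis has to be complete
  in the whole space; \<open>adm\<close> then singles out those of type \<rho>, and \<open>q\<close>
  relabels the triples by (m, d, j).\<close>

theorem model_spectrum:
 "L2_spectrum \<H> (L2_closure \<D> K) = {complex_of_real (eig m d j) | m d j. admissible m j} \<and>
 (\<forall>lam. finite {(m, d, j). admissible m j \<and> eig m d j = lam} \<and>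
  has_multiplicity (L2_closure \<D> K) (of_real lam) (card {(m, d, j). admissible m j \<and> eig m d j = lam}))"
proof -
 \<comment> \<open>The basis is indexed by all natural numbers, so the set of triples has to be
   infinite.\<close>
 have "infinite (UNIV :: (('n => nat) \<times> ('n => nat) \<times> 'r) set)" by (simp add: finite_prod finite_UNIV_fun)
 then obtain en :: "nat => ('n => nat) \<times> ('n => nat) \<times> 'r" where en: "bij en"
  using bij_betw_from_nat_into[OF countableI_type] by blast
 define lam where "lam n = (case en n of (\<alpha>, \<beta>, j) => lev \<alpha> \<beta> + beta j)" for n
 define adm where "adm n = (case en n of (\<alpha>, \<beta>, j) => adm3 \<alpha> \<beta> j)" for n
 define E where "E n = basis (en n)" for n
 have coeff0: "L2_inner u (E n) = 0" if u: "u \<in> L2_fun" "\<And>\<theta>. AE x in lborel. F (- \<theta>) *v u (rot k (L \<theta>) x) = \<rho> \<theta> *s u x"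
  and n: "\<not> adm n" for u n
 proof -
  obtain \<alpha> \<beta> j where i: "en n = (\<alpha>, \<beta>, j)" by (cases "en n")
  have "sinner (\<lambda>x. cinner (u x) (f j)) (e \<alpha> \<beta>) = 0"
   by (rule coefficient_eq_0[OF u]) (use n i in \<open>simp add: adm_def\<close>)
  then show ?thesis by (simp add: E_def i L2_inner_basis)
 qed
 interpret L2_eigenbasis \<D> K \<H> E lam adm
 proof
  show "s \<in> \<D> ==> s \<in> L2_fun" for s by (rule \<D>_L2)
  show "s \<in> \<D> ==> K s \<in> L2_fun" for s by (rule K_L2)
  show "(\<lambda>x. 0) \<in> \<D>" by (simp add: test_sections_def smooth_on_const)
  show "(\<lambda>x. s x + t x) \<in> \<D>" if "s \<in> \<D>" "t \<in> \<D>" for s t by (rule \<D>_add[OF that])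
  show "(\<lambda>x. z *s s x) \<in> \<D>" if "s \<in> \<D>" for s z by (rule \<D>_scale[OF that])
  show "K (\<lambda>x. s x + t x) = (\<lambda>x. K s x + K t x)" if "s \<in> \<D>" "t \<in> \<D>" for s t by (rule K_add[OF that])
  show "K (\<lambda>x. z *s s x) = (\<lambda>x. z *s K s x)" if "s \<in> \<D>" for s z by (rule K_scale[OF that])
  show "E n \<in> L2_fun" for n unfolding E_def by (rule basis_L2)
  show "L2_inner (E m) (E n) = (if m = n then 1 else 0)" for m n
   unfolding E_def basis_orth using bij_is_inj[OF en] by (simp add: inj_eq)
  show "L2_nrm u = 0" if "u \<in> L2_fun" "\<And>n. L2_inner u (E n) = 0" for u
  proof (rule basis_complete[OF that(1)])
   fix i
   obtain n where "i = en n" using bij_is_surj[OF en] by (metis surjD)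
   then show "L2_inner u (basis i) = 0" using that(2)[of n] by (simp add: E_def)
  qed
  show "(\<lambda>x. 0) \<in> \<H>" by (simp add: L2_type_def L2_fun_0)
  show "u \<in> L2_fun" if "u \<in> \<H>" for u using that by (simp add: L2_type_def)
  show "L2_inner u (E n) = 0" if "u \<in> \<H>" "\<not> adm n" for u n
   by (rule coeff0[OF _ _ that(2)]) (use that(1) in \<open>auto simp: L2_type_def\<close>)
  show "L2_inner s (E n) = 0" if "s \<in> \<D>" "\<not> adm n" for s n
   by (rule coeff0[OF \<D>_L2[OF that(1)] _ that(2)]) (simp add: \<D>D(3)[OF that(1)])
  show "(E n, \<lambda>x. of_real (lam n) *s E n x) \<in> L2_closure \<D> K" if "adm n" for n
  proof -
   obtain \<alpha> \<beta> j where i: "en n = (\<alpha>, \<beta>, j)" by (cases "en n")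
   have adm3: "adm3 \<alpha> \<beta> j" using that i by (simp add: adm_def)
   from eigenfunction_closure[OF adm3]
   obtain s where s: "\<And>i. s i \<in> \<D>" "(\<lambda>i. L2_nrm (\<lambda>x. s i x - e \<alpha> \<beta> x *s f j)) \<longlonglongrightarrow> 0"
    "(\<lambda>i. L2_nrm (\<lambda>x. K (s i) x - of_real (lam n) *s (e \<alpha> \<beta> x *s f j))) \<longlonglongrightarrow> 0"
    unfolding L2_closure_def lam_def i by auto
   define c where "c = complex_of_real (1 / sqrt (nrm2 \<alpha> \<beta>))"
   have E: "E n = (\<lambda>x. c *s (e \<alpha> \<beta> x *s f j))" by (simp add: E_def i basis_def c_def fun_eq_iff)
   have "(\<lambda>i. L2_nrm (\<lambda>x. c *s s i x - E n x)) \<longlonglongrightarrow> 0"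
   proof -
    have "L2_nrm (\<lambda>x. c *s s i x - E n x) = cmod c * L2_nrm (\<lambda>x. s i x - e \<alpha> \<beta> x *s f j)" for i
     unfolding E L2_nrm_scale[symmetric] by (simp only: vector_ssub_ldistrib)
    then show ?thesis using tendsto_mult_left[OF s(2), of "cmod c"] by simp
   qed
   moreover have "(\<lambda>i. L2_nrm (\<lambda>x. K (\<lambda>x. c *s s i x) x - of_real (lam n) *s E n x)) \<longlonglongrightarrow> 0"
   proof -
    have "L2_nrm (\<lambda>x. K (\<lambda>x. c *s s i x) x - of_real (lam n) *s E n x) = cmod c * L2_nrm (\<lambda>x. K (s i) x - of_real (lam n) *s (e \<alpha> \<beta> x *s f j))" for i
    proof -
     have "K (\<lambda>x. c *s s i x) x - of_real (lam n) *s E n x = c *s (K (s i) x - of_real (lam n) *s (e \<alpha> \<beta> x *s f j))" for x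
      unfolding K_scale[OF s(1)] E by (simp add: vec_eq_iff algebra_simps)
     then show ?thesis by (simp only: L2_nrm_scale)
    qed
    then show ?thesis using tendsto_mult_left[OF s(3), of "cmod c"] by simp
   qed
   moreover have "E n \<in> L2_fun" unfolding E_def by (rule basis_L2)
   ultimately show ?thesis
    unfolding L2_closure_def using \<D>_scale[OF s(1), of c] L2_fun_scale[of "E n" "of_real (lam n)"]
    by (auto intro!: exI[of _ "\<lambda>i x. c *s s i x"])
  qed
  show "L2_inner (K s) (E n) = of_real (lam n) * L2_inner s (E n)" if "s \<in> \<D>" "adm n" for s n
  proof -
   obtain \<alpha> \<beta> j where i: "en n = (\<alpha>, \<beta>, j)" by (cases "en n")
   show ?thesis unfolding E_def i L2_inner_basis sinner_K[OF that(1)] by (simp add: lam_def i)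
  qed
  show "finite {n. adm n \<and> lam n \<le> R}" for R
  proof -
   have "{n. adm n \<and> lam n \<le> R} = en -` {(\<alpha>, \<beta>, j). adm3 \<alpha> \<beta> j \<and> lev \<alpha> \<beta> + beta j \<le> R}"
    by (auto simp: adm_def lam_def split: prod.splits)
   then show ?thesis by (simp only:) (rule finite_vimageI[OF finite_adm3 bij_is_inj[OF en]])
  qed
 qed
 define q where "q = inv en \<circ> par"
 have q: "bij q" unfolding q_def by (intro bij_comp bij_par bij_imp_bij_inv en)
 have enq: "en (q t) = par t" for t unfolding q_def using bij_is_surj[OF en] by (simp add: surj_f_inv_f)
 have adm_q: "adm (q (m, d, j)) \<longleftrightarrow> admissible m j" for m d j
  using adm3_par[of m d j] by (simp add: adm_def enq split_beta)
 have lam_q: "lam (q (m, d, j)) = eig m d j" if "admissible m j" for m d j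
  using level_par[OF that, of d] by (simp add: lam_def enq split_beta)
 have "{complex_of_real (lam n) | n. adm n} = {complex_of_real (eig m d j) | m d j. admissible m j}" (is "?A = ?B")
 proof (intro equalityI subsetI)
  fix z assume "z \<in> ?A"
  then obtain n where n: "adm n" "z = of_real (lam n)" by blast
  obtain m d j where "n = q (m, d, j)" using bij_is_surj[OF q] by (metis prod_cases3 surjD)
  then show "z \<in> ?B" using n adm_q lam_q by auto
 next
  fix z assume "z \<in> ?B"
  then obtain m d j where "admissible m j" "z = of_real (eig m d j)" by blast
  then show "z \<in> ?A" using adm_q[of m d j] lam_q[of m j d] by (intro CollectI exI[of _ "q (m, d, j)"]) simp
 qed
 moreover have img: "{n. adm n \<and> lam n = x} = q ` {(m, d, j). admissible m j \<and> eig m d j = x}" for x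
 proof (intro equalityI subsetI)
  fix n assume n: "n \<in> {n. adm n \<and> lam n = x}"
  obtain m d j where "n = q (m, d, j)" using bij_is_surj[OF q] by (metis prod_cases3 surjD)
  then show "n \<in> q ` {(m, d, j). admissible m j \<and> eig m d j = x}" using n adm_q lam_q by auto
 next
  fix n assume "n \<in> q ` {(m, d, j). admissible m j \<and> eig m d j = x}"
  then show "n \<in> {n. adm n \<and> lam n = x}" using adm_q lam_q by auto
 qed
 moreover have "finite {(m, d, j). admissible m j \<and> eig m d j = x}" for x
 proof (rule finite_imageD)
  show "finite (q ` {(m, d, j). admissible m j \<and> eig m d j = x})"
   unfolding img[symmetric] by (rule finite_subset[OF _ fin[of x]]) auto
  show "inj_on q {(m, d, j). admissible m j \<and> eig m d j = x}" using bij_is_inj[OF q] inj_on_subset by blast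
 qed
 moreover have "card {n. adm n \<and> lam n = x} = card {(m, d, j). admissible m j \<and> eig m d j = x}" for x
  unfolding img by (rule card_image) (use bij_is_inj[OF q] inj_on_subset in blast)
 ultimately show ?thesis using spectrum multiplicity by simp
qed

end

section \<open>Matrix-valued maps and parameter integrals\<close>

lemma bounded_bilinear_mm: "bounded_bilinear ((**) :: complex ^ 'r::finite ^ 'r => complex ^ 'r ^ 'r => complex ^ 'r ^ 'r)"
 unfolding bilinear_conv_bounded_bilinear[symmetric] bilinear_def
 by (intro conjI allI linearI)
  (simp_all add: vec_eq_iff matrix_matrix_mult_def distrib_left distrib_right sum.distrib scaleR_sum_right)

lemma bounded_bilinear_mv: "bounded_bilinear ((*v) :: complex ^ 'r::finite ^ 'r => complex ^ 'r => complex ^ 'r)"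
 unfolding bilinear_conv_bounded_bilinear[symmetric] bilinear_def
 by (intro conjI allI linearI)
  (simp_all add: vec_eq_iff matrix_vector_mult_def distrib_left distrib_right sum.distrib scaleR_sum_right)

lemma bounded_linear_cadj: "bounded_linear (cadj :: complex ^ 'r::finite ^ 'r => complex ^ 'r ^ 'r)"
 unfolding linear_conv_bounded_linear[symmetric]
 by (intro linearI) (simp_all add: vec_eq_iff cadj_def)

lemma cadj_cadj: "cadj (cadj A) = A"
 by (simp add: cadj_def vec_eq_iff)

lemma cadj_mult: "cadj (A ** B) = cadj B ** cadj A"
 by (simp add: cadj_def matrix_matrix_mult_def vec_eq_iff mult.commute)

lemma vector_smult_mv: "A *v (c *s w) = c *s (A *v w)" for A :: "complex ^ 'r::finite ^ 'r"
 by (simp add: vec_eq_iff matrix_vector_mult_def sum_distrib_left mult_ac)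

lemma scaleR_mv: "(s *\<^sub>R A) *v w = s *\<^sub>R (A *v w)" and mv_scaleR: "A *v (s *\<^sub>R w) = s *\<^sub>R (A *v w)"
 for A :: "complex ^ 'r::finite ^ 'r"
 by (simp_all add: vec_eq_iff matrix_vector_mult_def scaleR_sum_right)

lemma minus_mv: "(- A) *v w = - (A *v w)" and mv_minus: "A *v (- w) = - (A *v w)"
 for A :: "complex ^ 'r::finite ^ 'r"
 by (simp_all add: vec_eq_iff matrix_vector_mult_def sum_negf)

lemma sum_mv: "(\<Sum>i\<in>I. A i) *v w = (\<Sum>i\<in>I. A i *v w)" for A :: "_ => complex ^ 'r::finite ^ 'r"
 by (induction I rule: infinite_finite_induct) (simp_all add: matrix_vector_mult_add_rdistrib)

lemma mv_sum: "A *v (\<Sum>i\<in>I. w i) = (\<Sum>i\<in>I. A *v w i)" for A :: "complex ^ 'r::finite ^ 'r"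
 by (induction I rule: infinite_finite_induct) (simp_all add: matrix_vector_right_distrib)

lemmas smooth_on_mv = smooth_on_bounded_bilinear[OF bounded_bilinear_mv]
lemmas smooth_on_smult = smooth_on_bounded_bilinear[OF bounded_bilinear_vscale]

lemma smooth_on_cis:
 fixes h :: "'a::real_normed_vector => real"
 assumes "bounded_linear h"
 shows "smooth_on S (\<lambda>x. cis (h x))"
proof -
 have d: "((\<lambda>x. C * cis (h x)) has_derivative (\<lambda>v. (\<i> * of_real (h v) * C) * cis (h x))) (at x)" for C :: complex and x
  by (rule has_derivative_eq_rhs, (rule derivative_intros bounded_linear.has_derivative[OF assms] has_derivative_cis)+)
   (simp add: fun_eq_iff mult_ac scaleR_conv_of_real)
 have "smooth_on UNIV (\<lambda>x. 1 * cis (h x))"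
 proof (rule smooth_on_coinduct[where P="\<lambda>f. \<exists>C. f = (\<lambda>x. C * cis (h x))"], rule exI[of _ 1], rule refl)
  fix f :: "'a => complex" assume "\<exists>C. f = (\<lambda>x. C * cis (h x))"
  then obtain C where C: "f = (\<lambda>x. C * cis (h x))" by blast
  have "pd f v = (\<lambda>x. (\<i> * of_real (h v) * C) * cis (h x))" for v
   unfolding C by (rule ext) (rule pd_eq_of_has_derivative[OF d])
  moreover have "f differentiable_on UNIV"
   unfolding C by (rule differentiable_on_of_has_derivative[OF d])
  ultimately show "f differentiable_on UNIV \<and> (\<forall>v. \<exists>C. pd f v = (\<lambda>x. C * cis (h x)))" by auto
 qed
 then show ?thesis using smooth_on_subset by auto
qed

text \<open>The Leibniz rule is applied on a ball around y, which is convex. The partial derivatives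
  are packed into bounded linear maps because their continuity is demanded in operator norm; in
  finite dimension it follows from continuity in each direction.\<close>

lemma has_derivative_integral_param:
 fixes \<Phi> :: "'a::euclidean_space \<times> 'b::euclidean_space => 'c::euclidean_space"
 assumes W: "open W" and y: "y \<in> W" and \<Phi>: "C_on 1 (W \<times> UNIV) \<Phi>"
 shows "((\<lambda>y. integral (cbox a b) (\<lambda>\<theta>. \<Phi> (y, \<theta>))) has_derivative
  (\<lambda>v. integral (cbox a b) (\<lambda>\<theta>. pd \<Phi> (v, 0) (y, \<theta>)))) (at y)"
proof -
 obtain e where e: "e > 0" "ball y e \<subseteq> W" using W y by (meson openE)
 define B where "B = ball y e"
 have B: "open B" "convex B" "y \<in> B" "B \<subseteq> W" using e by (auto simp: B_def)
 have op: "open (W \<times> (UNIV :: 'b set))" using W by (simp add: open_Times)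
 have df: "(\<Phi> has_derivative (\<lambda>v. pd \<Phi> v z)) (at z)" if "fst z \<in> W" for z
  using \<Phi> op that differentiable_on_openD[of \<Phi> "W \<times> UNIV" z] pd_works by (cases z) auto
 have bl: "bounded_linear (\<lambda>v. pd \<Phi> (v, 0) z)" if "fst z \<in> W" for z
  using bounded_linear_compose[OF has_derivative_bounded_linear[OF df[OF that]]
    bounded_linear_Pair[OF bounded_linear_ident bounded_linear_zero]] by simp
 define fx where "fx y \<theta> = Blinfun (\<lambda>v. pd \<Phi> (v, 0) (y, \<theta>))" for y \<theta>
 have fx: "blinfun_apply (fx x \<theta>) v = pd \<Phi> (v, 0) (x, \<theta>)" if "x \<in> W" for x \<theta> v
  unfolding fx_def using bounded_linear_Blinfun_apply[OF bl[of "(x, \<theta>)"]] that by simp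
 have co: "continuous_on (W \<times> UNIV) (pd \<Phi> v)" for v
  using \<Phi> by (cases v) simp
 have "((\<lambda>y. integral (cbox a b) (\<lambda>\<theta>. \<Phi> (y, \<theta>))) has_derivative integral (cbox a b) (fx y)) (at y within B)"
 proof (rule leibniz_rule[OF _ _ _ B(3,2)])
  fix x \<theta> assume "x \<in> B"
  then have x: "x \<in> W" using B by auto
  have "((\<lambda>x. \<Phi> (x, \<theta>)) has_derivative (\<lambda>v. pd \<Phi> (v, 0) (x, \<theta>))) (at x)"
   by (rule has_derivative_compose[of "\<lambda>x. (x, \<theta>)" "\<lambda>v. (v, 0)" _ UNIV])
    (use x df in \<open>auto intro!: derivative_eq_intros\<close>)
  then show "((\<lambda>x. \<Phi> (x, \<theta>)) has_derivative blinfun_apply (fx x \<theta>)) (at x within B)"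
   unfolding ext[of "blinfun_apply (fx x \<theta>)" "\<lambda>v. pd \<Phi> (v, 0) (x, \<theta>)", OF fx[OF x]] by (rule has_derivative_at_withinI)
 next
  fix x assume "x \<in> B"
  then have x: "x \<in> W" using B by auto
  have "continuous_on (cbox a b) (\<lambda>\<theta>. \<Phi> (x, \<theta>))"
   by (rule continuous_on_compose2[OF C_on_continuous[OF \<Phi>]]) (use x in \<open>auto intro!: continuous_intros\<close>)
  then show "(\<lambda>\<theta>. \<Phi> (x, \<theta>)) integrable_on cbox a b" by (rule integrable_continuous)
 next
  show "continuous_on (B \<times> cbox a b) (\<lambda>(x, \<theta>). fx x \<theta>)"
  proof (rule continuous_on_blinfun_componentwise)
   fix i :: 'a
   have "continuous_on (B \<times> cbox a b) (pd \<Phi> (i, 0))"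
    by (rule continuous_on_subset[OF co]) (use B in auto)
   then show "continuous_on (B \<times> cbox a b) (\<lambda>x. blinfun_apply (case x of (x, \<theta>) => fx x \<theta>) i)"
    by (rule continuous_on_eq) (use fx B in auto)
  qed
 qed
 moreover
 have "blinfun_apply (integral (cbox a b) (fx y)) v = integral (cbox a b) (\<lambda>\<theta>. pd \<Phi> (v, 0) (y, \<theta>))" for v
 proof -
  have "continuous_on (cbox a b) (fx y)"
  proof (rule continuous_on_blinfun_componentwise)
   fix i :: 'a
   have "continuous_on (cbox a b) (\<lambda>\<theta>. pd \<Phi> (i, 0) (y, \<theta>))"
    by (rule continuous_on_compose2[OF co]) (use y in \<open>auto intro!: continuous_intros\<close>)
   then show "continuous_on (cbox a b) (\<lambda>\<theta>. blinfun_apply (fx y \<theta>) i)" using fx[OF y] by simp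
  qed
  then have "fx y integrable_on cbox a b" by (rule integrable_continuous)
  from integral_linear[OF this, of "\<lambda>F. blinfun_apply F v"] show ?thesis
   using fx[OF y] by (simp add: o_def blinfun.bounded_linear_left)
 qed
 then have "blinfun_apply (integral (cbox a b) (fx y)) = (\<lambda>v. integral (cbox a b) (\<lambda>\<theta>. pd \<Phi> (v, 0) (y, \<theta>)))" by (rule ext)
 ultimately show ?thesis by (simp only: at_within_open[OF B(3,1)])
qed

lemma C_on_integral_param:
 fixes \<Phi> :: "'a::euclidean_space \<times> 'b::euclidean_space => 'c::euclidean_space"
 assumes "open W"
 shows "C_on k (W \<times> UNIV) \<Phi> ==> C_on k W (\<lambda>y. integral (cbox a b) (\<lambda>\<theta>. \<Phi> (y, \<theta>)))"
proof (induction k arbitrary: \<Phi>)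
 case 0
 have "continuous_on (W \<times> cbox a b) (\<lambda>(y, \<theta>). \<Phi> (y, \<theta>))"
  using continuous_on_subset[of "W \<times> UNIV" \<Phi> "W \<times> cbox a b"] 0 by auto
 from integral_continuous_on_param[OF this] show ?case by simp
next
 case (Suc k)
 have "C_on 1 (W \<times> UNIV) \<Phi>" using Suc.prems C_on_continuous by (simp only: C_on.simps One_nat_def) blast
 note d = has_derivative_integral_param[OF assms _ this]
 have "pd (\<lambda>y. integral (cbox a b) (\<lambda>\<theta>. \<Phi> (y, \<theta>))) v y = integral (cbox a b) (\<lambda>\<theta>. pd \<Phi> (v, 0) (y, \<theta>))" if "y \<in> W" for v y
  by (rule pd_eq_of_has_derivative[OF d[OF that]])
 moreover have "C_on k (W \<times> UNIV) (pd \<Phi> (v, 0))" for v using Suc.prems by simp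
 ultimately have "C_on k W (pd (\<lambda>y. integral (cbox a b) (\<lambda>\<theta>. \<Phi> (y, \<theta>))) v)" for v
  using C_on_cong[OF assms _ Suc.IH[of "pd \<Phi> (v, 0)"], of "pd (\<lambda>y. integral (cbox a b) (\<lambda>\<theta>. \<Phi> (y, \<theta>))) v"] by metis
 moreover have "(\<lambda>y. integral (cbox a b) (\<lambda>\<theta>. \<Phi> (y, \<theta>))) differentiable_on W"
  by (rule differentiable_on_of_has_derivative[OF d])
 ultimately show ?case by simp
qed

lemma smooth_on_integral_param:
 fixes \<Phi> :: "'a::euclidean_space \<times> 'b::euclidean_space => 'c::euclidean_space"
 assumes "open W" "smooth_on (W \<times> UNIV) \<Phi>"
 shows "smooth_on W (\<lambda>y. integral (cbox a b) (\<lambda>\<theta>. \<Phi> (y, \<theta>)))"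
 using assms C_on_integral_param unfolding smooth_on_def by blast

text \<open>A fundamental domain of the lattice; integration over the torus is integration over this
  box.\<close>

abbreviation tbox :: "(real ^ 'p::finite) set" where
 "tbox \<equiv> cbox 0 (\<chi> i. 2 * pi)"

text \<open>The shifted box sticks out of the original one by a slab of width s; periodicity moves
  the slab back by 2 pi to the side that was vacated.\<close>

lemma integral_tbox_shift_axis:
 fixes g :: "real ^ 'p::finite => 'c::euclidean_space"
 assumes g: "continuous_on UNIV g" "\<And>\<theta> h. h \<in> lattice ==> g (\<theta> + h) = g \<theta>" and s: "0 \<le> s" "s \<le> 2 * pi"
 shows "integral tbox (\<lambda>\<theta>. g (\<theta> + s *\<^sub>R axis i 1)) = integral tbox g"
proof -
 define T where "T = (\<chi> i::'p. 2 * pi)"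
 have int: "g integrable_on cbox a b" for a b
  using g(1) by (intro integrable_continuous) (rule continuous_on_subset, auto)
 define S where "S = s *\<^sub>R axis i (1::real)"
 define P where "P = (2 * pi) *\<^sub>R axis i (1::real)"
 have P: "P \<in> lattice" unfolding lattice_def P_def
  by (auto simp: axis_def intro: exI[of _ "1::int"] exI[of _ "0::int"])
 have "integral (cbox 0 T) (\<lambda>\<theta>. g (\<theta> + S)) = integral (cbox S (T + S)) g"
  using integral_shift_cbox_plus[of 0 T g S] by (simp add: o_def add.commute)
 also have "\<dots> = integral (cbox S (T + S) \<inter> {x. x $ i \<le> 2 * pi}) g + integral (cbox S (T + S) \<inter> {x. x $ i \<ge> 2 * pi}) g"
  using integral_split[OF int, of "axis i 1" S "T + S" "2 * pi"] by (simp add: inner_axis)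
 also have "cbox S (T + S) \<inter> {x. x $ i \<le> 2 * pi} = cbox 0 T \<inter> {x. x $ i \<ge> s}"
  using s by (auto simp: mem_box_cart S_def T_def axis_def split: if_splits) (smt (verit) | fastforce)+
 also have "integral (cbox S (T + S) \<inter> {x. x $ i \<ge> 2 * pi}) g = integral (cbox 0 T \<inter> {x. x $ i \<le> s}) g"
 proof -
  have e: "cbox S (T + S) \<inter> {x. x $ i \<ge> 2 * pi} = cbox P (T + S)"
   "cbox 0 T \<inter> {x. x $ i \<le> s} = cbox (P - P) (T + S - P)"
   using s by (auto simp: mem_box_cart S_def T_def P_def axis_def split: if_splits) (smt (verit) | fastforce)+
  show ?thesis unfolding e using integral_shift_cbox[of P P "T + S" g] g(2)[OF P] by simp
 qed
 also have "integral (cbox 0 T \<inter> {x. x $ i \<ge> s}) g + integral (cbox 0 T \<inter> {x. x $ i \<le> s}) g = integral (cbox 0 T) g"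
  using integral_split[OF int, of "axis i 1" 0 T s] by (simp add: inner_axis)
 finally show ?thesis by (simp add: T_def S_def)
qed

text \<open>Modulo the lattice every coordinate of \<eta> lies in [0, 2 pi], and the shift is
  carried out one axis at a time.\<close>

lemma integral_tbox_shift:
 fixes g :: "real ^ 'p::finite => 'c::euclidean_space"
 assumes g: "continuous_on UNIV g" "\<And>\<theta> h. h \<in> lattice ==> g (\<theta> + h) = g \<theta>"
 shows "integral tbox (\<lambda>\<theta>. g (\<theta> + \<eta>)) = integral tbox g"
proof -
 define s where "s i = \<eta> $ i - 2 * pi * of_int \<lfloor>\<eta> $ i / (2 * pi)\<rfloor>" for i
 have s: "0 \<le> s i" "s i \<le> 2 * pi" for i
 proof -
  have "of_int \<lfloor>\<eta> $ i / (2 * pi)\<rfloor> \<le> \<eta> $ i / (2 * pi)" "\<eta> $ i / (2 * pi) \<le> of_int \<lfloor>\<eta> $ i / (2 * pi)\<rfloor> + 1" by linarith+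
  then have "of_int \<lfloor>\<eta> $ i / (2 * pi)\<rfloor> * (2 * pi) \<le> \<eta> $ i" "\<eta> $ i \<le> (of_int \<lfloor>\<eta> $ i / (2 * pi)\<rfloor> + 1) * (2 * pi)"
   by (simp_all only: pos_le_divide_eq pos_divide_le_eq pi_gt_zero zero_less_mult_iff zero_less_numeral simp_thms)
  then show "0 \<le> s i" "s i \<le> 2 * pi" by (simp_all add: s_def algebra_simps)
 qed
 have "integral tbox (\<lambda>\<theta>. g (\<theta> + (\<Sum>i\<in>I. s i *\<^sub>R axis i 1))) = integral tbox g" for I
 proof (induction I rule: infinite_finite_induct)
  case (insert i I)
  let ?g = "\<lambda>\<theta>. g (\<theta> + (\<Sum>i\<in>I. s i *\<^sub>R axis i 1))"
  have "integral tbox (\<lambda>\<theta>. ?g (\<theta> + s i *\<^sub>R axis i 1)) = integral tbox ?g"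
  proof (rule integral_tbox_shift_axis[OF _ _ s])
   show "continuous_on UNIV ?g"
    by (rule continuous_on_compose2[OF g(1)]) (auto intro!: continuous_intros)
   fix \<theta> h :: "real ^ 'p" assume "h \<in> lattice"
   then show "?g (\<theta> + h) = ?g \<theta>" using g(2)[of h "\<theta> + (\<Sum>i\<in>I. s i *\<^sub>R axis i 1)"] by (simp add: add_ac)
  qed
  then show ?case using insert by (simp add: add_ac)
 qed auto
 from this[of UNIV] have "integral tbox (\<lambda>\<theta>. g (\<theta> + (\<Sum>i\<in>UNIV. s i *\<^sub>R axis i 1))) = integral tbox g" .
 moreover have "g (\<theta> + \<eta>) = g (\<theta> + (\<Sum>i\<in>UNIV. s i *\<^sub>R axis i 1))" for \<theta>
 proof -
  define h where "h = \<eta> - (\<Sum>i\<in>UNIV. s i *\<^sub>R axis i 1)"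
  have "h $ p = 2 * pi * of_int \<lfloor>\<eta> $ p / (2 * pi)\<rfloor>" for p
   by (simp add: h_def s_def axis_def if_distrib[of "(*) _"] cong: if_cong)
  then have "h \<in> lattice" unfolding lattice_def by blast
  then have "g ((\<theta> + (\<Sum>i\<in>UNIV. s i *\<^sub>R axis i 1)) + h) = g (\<theta> + (\<Sum>i\<in>UNIV. s i *\<^sub>R axis i 1))" by (rule g(2))
  then show ?thesis by (simp add: h_def)
 qed
 ultimately show ?thesis by simp
qed

text \<open>Gram-Schmidt over finite index sets I: fewer vectors than the dimension cannot span, so
  a vector outside their span is always available.\<close>

lemma orthonormal_frame_exists:
 fixes g :: "real ^ 'd::finite => real ^ 'd => real"
 assumes g: "bilinear g" "\<And>v w. g v w = g w v" "\<And>v. v \<noteq> 0 ==> g v v > 0"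
 obtains e :: "'d => real ^ 'd" where "\<And>i j. g (e i) (e j) = (if i = j then 1 else 0)"
proof -
 have "\<exists>e. \<forall>i\<in>I. \<forall>j\<in>I. g (e i) (e j) = (if i = j then 1 else 0)" if "finite I" for I :: "'d set"
  using that
 proof (induction I)
  case (insert k I)
  then obtain e where e: "\<forall>i\<in>I. \<forall>j\<in>I. g (e i) (e j) = (if i = j then 1 else 0)" by blast
  have "dim (e ` I) \<le> card (e ` I)" using insert by (intro dim_le_card') auto
  also have "\<dots> \<le> card I" using insert by (intro card_image_le) auto
  also have "\<dots> < card (insert k I)" using insert by simp
  also have "\<dots> \<le> DIM(real ^ 'd)" by (simp add: card_mono)
  finally have "span (e ` I) \<noteq> UNIV" using dim_span[of "e ` I"] by (metis dim_UNIV less_irrefl)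
  then obtain w where w: "w \<notin> span (e ` I)" by auto
  define w' where "w' = w - (\<Sum>i\<in>I. g w (e i) *\<^sub>R e i)"
  have "(\<Sum>i\<in>I. g w (e i) *\<^sub>R e i) \<in> span (e ` I)" by (intro span_sum span_scale span_base) auto
  then have "w' \<noteq> 0" using w by (auto simp: w'_def)
  then have pos: "g w' w' > 0" by (rule g(3))
  have ll: "linear (\<lambda>v. g v w)" "linear (g v)" for v w using g(1) by (auto simp: bilinear_def)
  have orth: "g w' (e j) = 0" if "j \<in> I" for j
  proof -
   have "g w' (e j) = g w (e j) - (\<Sum>i\<in>I. g w (e i) * g (e i) (e j))"
    unfolding w'_def by (simp add: linear_diff[OF ll(1)] linear_sum[OF ll(1)] linear_scale[OF ll(1)])
   also have "(\<Sum>i\<in>I. g w (e i) * g (e i) (e j)) = (\<Sum>i\<in>I. if i = j then g w (e j) else 0)"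
    using e that by (intro sum.cong) auto
   finally show ?thesis using that insert by simp
  qed
  define n where "n = (1 / sqrt (g w' w')) *\<^sub>R w'"
  have n: "g n n = 1" "g n (e j) = 0" "g (e j) n = 0" if "j \<in> I" for j
   using pos orth that by (simp_all add: n_def linear_scale[OF ll(1)] linear_scale[OF ll(2)] g(2)[of "e j"])
  have n1: "g n n = 1" using pos by (simp add: n_def linear_scale[OF ll(1)] linear_scale[OF ll(2)])
  show ?case
   by (rule exI[of _ "e(k := n)"]) (use e n n1 insert in auto)
 qed auto
 from this[of UNIV] that show ?thesis by auto
qed

section \<open>Charts and smooth functions\<close>

lemma cinv_snd: "chart c ==> x \<in> fst c ==> cinv c (snd c x) = x"
 unfolding chart_def homeomorphism_def by blast

lemma snd_cinv: "chart c ==> y \<in> snd c ` fst c ==> snd c (cinv c y) = y"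
 unfolding chart_def homeomorphism_def by blast

lemma cinv_in: "chart c ==> y \<in> snd c ` fst c ==> cinv c y \<in> fst c"
 using cinv_snd by fastforce

lemma chart_image_iff: "chart c ==> y \<in> snd c ` (fst c \<inter> S) \<longleftrightarrow> y \<in> snd c ` fst c \<and> cinv c y \<in> S"
 using cinv_snd[of c] snd_cinv[of c] cinv_in[of c] by (force simp: image_iff)

lemma chart_open_image:
 assumes "chart c" "open S"
 shows "open (snd c ` (fst c \<inter> S))"
proof -
 have "open (cinv c -` S \<inter> snd c ` fst c)"
  using assms unfolding chart_def homeomorphism_def by (intro continuous_open_preimage[unfolded Int_commute[of _ "vimage _ _"]]) auto
 moreover have "snd c ` (fst c \<inter> S) = cinv c -` S \<inter> snd c ` fst c"
  using chart_image_iff[OF assms(1)] by blast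
 ultimately show ?thesis by simp
qed

lemma smooth_chartD: "smooth_chart M c ==> chart c"
 by (simp add: smooth_chart_def)

locale rman =
 fixes M :: "('m::t2_space, 'd::finite, 'z) rmanifold_scheme"
 assumes M: "closed_oriented_riemannian M"
begin

lemma atlas_smooth_chart: "c \<in> atlas M ==> smooth_chart M c"
 using M unfolding closed_oriented_riemannian_def smooth_chart_def by blast

lemma atlas_chart: "c \<in> atlas M ==> chart c"
 using atlas_smooth_chart smooth_chartD by blast

lemma atlas_cover: obtains c where "c \<in> atlas M" "x \<in> fst c"
 using M unfolding closed_oriented_riemannian_def by (metis UNIV_I UN_iff)

lemma chart_at: "chart_at M x \<in> atlas M" "x \<in> fst (chart_at M x)"
 using someI_ex[of "\<lambda>c. c \<in> atlas M \<and> x \<in> fst c"] atlas_cover[of x] unfolding chart_at_def by blast+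

text \<open>Smoothness is defined through atlas charts, while normal coordinates are an arbitrary
  chart of the smooth structure; near each point an atlas chart is interposed.\<close>

lemma smooth_fun_on_chart:
 fixes f :: "'m => 'b::real_normed_vector"
 assumes f: "smooth_fun_on M S f" and S: "open S" and c: "smooth_chart M c"
 shows "smooth_on (snd c ` (fst c \<inter> S)) (\<lambda>y. f (cinv c y))"
proof (rule smooth_on_local)
 note cc = smooth_chartD[OF c]
 show "open (snd c ` (fst c \<inter> S))" using cc S by (rule chart_open_image)
 fix y assume y: "y \<in> snd c ` (fst c \<inter> S)"
 obtain c' where c': "c' \<in> atlas M" "cinv c y \<in> fst c'" by (rule atlas_cover)
 note cc' = atlas_chart[OF c'(1)]
 have op: "open (fst c')" using cc' by (simp add: chart_def)
 define T where "T = snd c ` (fst c \<inter> fst c')"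
 have T: "open T" unfolding T_def using cc op by (rule chart_open_image)
 have y2: "y \<in> T" using y c' cc by (simp add: T_def chart_image_iff)
 let ?W = "snd c ` (fst c \<inter> S) \<inter> T"
 have Wo: "open ?W" using T chart_open_image[OF cc S] by blast
 have "smooth_on ?W (\<lambda>y. (f \<circ> cinv c') ((snd c' \<circ> cinv c) y))"
 proof (rule smooth_on_compose[OF Wo, of "snd c' ` (fst c' \<inter> S)"])
  show "open (snd c' ` (fst c' \<inter> S))" using cc' S by (rule chart_open_image)
  show "(snd c' \<circ> cinv c) x \<in> snd c' ` (fst c' \<inter> S)" if "x \<in> ?W" for x
   using that cc by (auto simp: T_def chart_image_iff)
  show "smooth_on ?W (snd c' \<circ> cinv c)"
   by (rule smooth_on_subset[of T]) (use c c' in \<open>auto simp: smooth_chart_def smooth_transition_def T_def\<close>)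
  show "smooth_on (snd c' ` (fst c' \<inter> S)) (f \<circ> cinv c')" using f c' by (simp add: smooth_fun_on_def)
 qed
 then have "smooth_on ?W (\<lambda>y. f (cinv c y))"
 proof (rule smooth_on_cong[OF _ Wo])
  fix z assume "z \<in> ?W"
  then have "cinv c z \<in> fst c'" using cc by (simp add: T_def chart_image_iff)
  then show "(f \<circ> cinv c') ((snd c' \<circ> cinv c) z) = f (cinv c z)" using cinv_snd[OF cc'] by simp
 qed
 then show "\<exists>T. open T \<and> y \<in> T \<and> smooth_on (snd c ` (fst c \<inter> S) \<inter> T) (\<lambda>y. f (cinv c y))"
  using T y2 by blast
qed

lemma smooth_fun_on_snd:
 assumes "smooth_chart M c"
 shows "smooth_fun_on M (fst c) (snd c)"
 using assms unfolding smooth_fun_on_def smooth_chart_def smooth_transition_def by auto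

lemma smooth_fun_on_subset: "smooth_fun_on M S f ==> T \<subseteq> S ==> smooth_fun_on M T f"
 unfolding smooth_fun_on_def by (meson Int_mono image_mono order_refl smooth_on_subset)

lemma smooth_fun_on_bounded_bilinear:
 assumes "bounded_bilinear h" "open S" "smooth_fun_on M S f" "smooth_fun_on M S g"
 shows "smooth_fun_on M S (\<lambda>x. h (f x) (g x))"
 unfolding smooth_fun_on_def
proof
 fix c assume c: "c \<in> atlas M"
 have "smooth_on (snd c ` (fst c \<inter> S)) (\<lambda>y. h ((f \<circ> cinv c) y) ((g \<circ> cinv c) y))"
  by (rule smooth_on_bounded_bilinear[OF assms(1) chart_open_image[OF atlas_chart[OF c] assms(2)]])
   (use assms c in \<open>auto simp: smooth_fun_on_def o_def\<close>)
 then show "smooth_on (snd c ` (fst c \<inter> S)) ((\<lambda>x. h (f x) (g x)) \<circ> cinv c)" by (simp add: o_def)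
qed

lemma smooth_fun_on_bounded_linear:
 assumes "bounded_linear h" "open S" "smooth_fun_on M S f"
 shows "smooth_fun_on M S (\<lambda>x. h (f x))"
 unfolding smooth_fun_on_def
proof
 fix c assume c: "c \<in> atlas M"
 have "smooth_on (snd c ` (fst c \<inter> S)) (\<lambda>y. h ((f \<circ> cinv c) y))"
  by (rule smooth_on_bounded_linear[OF assms(1) chart_open_image[OF atlas_chart[OF c] assms(2)]])
   (use assms c in \<open>auto simp: smooth_fun_on_def o_def\<close>)
 then show "smooth_on (snd c ` (fst c \<inter> S)) ((\<lambda>x. h (f x)) \<circ> cinv c)" by (simp add: o_def)
qed

lemma smooth_fun_on_compose:
 fixes f :: "'m => 'b::euclidean_space"
 assumes "open S" "smooth_fun_on M S f" "smooth_on UNIV h"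
 shows "smooth_fun_on M S (\<lambda>x. h (f x))"
 unfolding smooth_fun_on_def
proof
 fix c assume c: "c \<in> atlas M"
 have "smooth_on (snd c ` (fst c \<inter> S)) (\<lambda>y. h ((f \<circ> cinv c) y))"
  by (rule smooth_on_compose[OF chart_open_image[OF atlas_chart[OF c] assms(1)] open_UNIV UNIV_I _ assms(3)])
   (use assms c in \<open>auto simp: smooth_fun_on_def o_def\<close>)
 then show "smooth_on (snd c ` (fst c \<inter> S)) ((\<lambda>x. h (f x)) \<circ> cinv c)" by (simp add: o_def)
qed

lemma smooth_fun_on_const: "smooth_fun_on M S (\<lambda>x. C)"
 by (simp add: smooth_fun_on_def o_def smooth_on_const)

lemma smooth_fun_on_cong:
 assumes "smooth_fun_on M S f" "open S" "\<And>x. x \<in> S ==> f x = g x"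
 shows "smooth_fun_on M S g"
 unfolding smooth_fun_on_def
proof
 fix c assume c: "c \<in> atlas M"
 have "smooth_on (snd c ` (fst c \<inter> S)) (f \<circ> cinv c)" using assms c by (simp add: smooth_fun_on_def)
 then show "smooth_on (snd c ` (fst c \<inter> S)) (g \<circ> cinv c)"
  by (rule smooth_on_cong[OF _ chart_open_image[OF atlas_chart[OF c] assms(2)]])
   (use assms(3) chart_image_iff[OF atlas_chart[OF c]] in auto)
qed

text \<open>Serves extension by zero: one open set carries the local formula, the other is the
  complement of a closed support.\<close>

lemma smooth_fun_on_Un:
 assumes "smooth_fun_on M S f" "smooth_fun_on M T f" "open S" "open T"
 shows "smooth_fun_on M (S \<union> T) f"
 unfolding smooth_fun_on_def
proof
 fix c assume c: "c \<in> atlas M"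
 note op = chart_open_image[OF atlas_chart[OF c]]
 show "smooth_on (snd c ` (fst c \<inter> (S \<union> T))) (f \<circ> cinv c)"
 proof (rule smooth_on_local)
  show "open (snd c ` (fst c \<inter> (S \<union> T)))" using assms by (intro op) blast
  fix y assume "y \<in> snd c ` (fst c \<inter> (S \<union> T))"
  then consider "y \<in> snd c ` (fst c \<inter> S)" | "y \<in> snd c ` (fst c \<inter> T)" by blast
  then show "\<exists>V. open V \<and> y \<in> V \<and> smooth_on (snd c ` (fst c \<inter> (S \<union> T)) \<inter> V) (f \<circ> cinv c)"
  proof cases
   case 1
   have "smooth_on (snd c ` (fst c \<inter> (S \<union> T)) \<inter> snd c ` (fst c \<inter> S)) (f \<circ> cinv c)"
    by (rule smooth_on_subset[of "snd c ` (fst c \<inter> S)"]) (use assms c in \<open>auto simp: smooth_fun_on_def\<close>)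
   then show ?thesis using op[OF assms(3)] 1 by blast
  next
   case 2
   have "smooth_on (snd c ` (fst c \<inter> (S \<union> T)) \<inter> snd c ` (fst c \<inter> T)) (f \<circ> cinv c)"
    by (rule smooth_on_subset[of "snd c ` (fst c \<inter> T)"]) (use assms c in \<open>auto simp: smooth_fun_on_def\<close>)
   then show ?thesis using op[OF assms(4)] 2 by blast
  qed
 qed
qed

text \<open>\<open>mdiff\<close> and \<open>dvec\<close> both refer to the chart picked by
  \<open>chart_at\<close>; by the chain rule this choice cancels and only the chart c
  remains.\<close>

lemma mdiff_dvec:
 fixes f :: "'m => 'b::real_normed_vector"
 assumes f: "smooth_fun_on M S f" and S: "open S" "x \<in> S" and c: "smooth_chart M c" "x \<in> fst c"
 shows "mdiff M f x (dvec M c x a) = pd (\<lambda>y. f (cinv c y)) a (snd c x)"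
proof -
 note cc = smooth_chartD[OF c(1)]
 define ca where "ca = chart_at M x"
 have ca: "ca \<in> atlas M" "x \<in> fst ca" using chart_at unfolding ca_def by blast+
 note cca = atlas_chart[OF ca(1)]
 have op: "open (fst ca)" using cca by (simp add: chart_def)
 define W where "W = snd c ` (fst c \<inter> fst ca)"
 have W: "open W" "snd c x \<in> W" unfolding W_def using chart_open_image[OF cc op] c ca by auto
 have d1: "(snd ca \<circ> cinv c) differentiable at (snd c x)"
  by (rule smooth_on_differentiable[OF _ W])
   (use c(1) ca(1) in \<open>auto simp: smooth_chart_def smooth_transition_def W_def\<close>)
 have e: "(snd ca \<circ> cinv c) (snd c x) = snd ca x" using cinv_snd[OF cc c(2)] by simp
 have d2: "(f \<circ> cinv ca) differentiable at ((snd ca \<circ> cinv c) (snd c x))"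
  unfolding e by (rule smooth_on_differentiable[of "snd ca ` (fst ca \<inter> S)"])
   (use f ca S chart_open_image[OF cca S(1)] in \<open>auto simp: smooth_fun_on_def\<close>)
 have "pd (\<lambda>y. f (cinv c y)) a (snd c x) = pd (\<lambda>y. (f \<circ> cinv ca) ((snd ca \<circ> cinv c) y)) a (snd c x)"
  by (rule pd_cong_open[OF W]) (use cinv_snd[OF cca] chart_image_iff[OF cc] in \<open>auto simp: W_def\<close>)
 also have "\<dots> = pd (f \<circ> cinv ca) (pd (snd ca \<circ> cinv c) a (snd c x)) ((snd ca \<circ> cinv c) (snd c x))"
  by (rule pd_compose[OF d1 d2])
 finally show ?thesis unfolding mdiff_def dvec_def e by (simp add: pd_def ca_def)
qed

lemma linear_dvec:
 assumes c: "smooth_chart M c" "x \<in> fst c"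
 shows "linear (dvec M c x)"
proof -
 have op: "open (fst (chart_at M x))" using atlas_chart[OF chart_at(1)] by (simp add: chart_def)
 have "linear (\<lambda>a. pd (snd (chart_at M x) \<circ> cinv c) a (snd c x))"
  by (rule pd_linear[of "snd c ` (fst c \<inter> fst (chart_at M x))"])
   (use c chart_at[of x] chart_open_image[OF smooth_chartD[OF c(1)] op] in \<open>auto simp: smooth_chart_def smooth_transition_def\<close>)
 then show ?thesis by (simp add: dvec_def[abs_def] pd_def)
qed

lemma mdiff_snd_dvec:
 assumes c: "smooth_chart M c" "x \<in> fst c"
 shows "mdiff M (snd c) x (dvec M c x a) = a"
proof -
 note cc = smooth_chartD[OF c(1)]
 have op: "open (fst c)" "open (snd c ` fst c)" using cc by (auto simp: chart_def)
 have "mdiff M (snd c) x (dvec M c x a) = pd (\<lambda>y. snd c (cinv c y)) a (snd c x)"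
  by (rule mdiff_dvec[OF smooth_fun_on_snd[OF c(1)] op(1) c(2) c])
 also have "\<dots> = pd (\<lambda>y. y) a (snd c x)"
  by (rule pd_cong_open[OF op(2)]) (use c snd_cinv[OF cc] in auto)
 also have "\<dots> = a" by (rule pd_eq_of_has_derivative) (rule has_derivative_ident)
 finally show ?thesis .
qed

text \<open>The left inverse makes \<open>dvec\<close> injective, hence onto between spaces of equal
  dimension.\<close>

lemma dvec_mdiff_snd:
 assumes c: "smooth_chart M c" "x \<in> fst c"
 shows "dvec M c x (mdiff M (snd c) x v) = v"
proof -
 have "inj (dvec M c x)" by (rule inj_on_inverseI[of _ "mdiff M (snd c) x"]) (rule mdiff_snd_dvec[OF c])
 then have "surj (dvec M c x)" by (rule linear_inj_imp_surj[OF linear_dvec[OF c]])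
 then obtain a where "v = dvec M c x a" by (metis surjD)
 then show ?thesis using mdiff_snd_dvec[OF c] by simp
qed

lemma mdiff_eq:
 assumes "smooth_fun_on M S f" "open S" "x \<in> S" "smooth_chart M c" "x \<in> fst c"
 shows "mdiff M f x v = pd (\<lambda>y. f (cinv c y)) (mdiff M (snd c) x v) (snd c x)"
 using mdiff_dvec[OF assms, of "mdiff M (snd c) x v"] dvec_mdiff_snd[OF assms(4,5)] by simp

lemma smooth_fun_on_differentiable:
 assumes "smooth_fun_on M S f" "open S" "x \<in> S" "smooth_chart M c" "x \<in> fst c"
 shows "(\<lambda>y. f (cinv c y)) differentiable at (snd c x)"
 using smooth_on_differentiable[OF smooth_fun_on_chart[OF assms(1,2,4)] chart_open_image[OF smooth_chartD[OF assms(4)] assms(2)]]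
  assms by blast

lemma linear_mdiff:
 assumes "smooth_fun_on M S f" "open S" "x \<in> S"
 shows "linear (mdiff M f x)"
proof -
 note c = atlas_smooth_chart[OF chart_at(1)[of x]] chart_at(2)[of x]
 have "linear (\<lambda>v. pd (f \<circ> cinv (chart_at M x)) v (snd (chart_at M x) x))"
  by (rule pd_linear[of "snd (chart_at M x) ` (fst (chart_at M x) \<inter> S)"])
   (use assms c chart_at(1)[of x] chart_open_image[OF smooth_chartD[OF c(1)] assms(2)] in \<open>auto simp: smooth_fun_on_def\<close>)
 then show ?thesis by (simp add: mdiff_def[abs_def] pd_def)
qed

lemma metric_facts: "bilinear (metric M x)" "metric M x v w = metric M x w v" "v \<noteq> 0 ==> metric M x v v > 0"
 using M unfolding closed_oriented_riemannian_def by blast+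

end

section \<open>Sections and the torus action\<close>

locale tbun = rman M
 for M :: "('m::t2_space, 'd::finite, 'p::finite, 'r::finite, 'z) tbundle_scheme" +
 assumes action: "isometric_action M" and hermitian: "hermitian_bundle M"
  and grad: "graded M" and equivariant: "equivariant_bundle M"
begin

lemma triv_cover: obtains t where "t \<in> trivs M" "x \<in> fst t"
 using hermitian unfolding hermitian_bundle_def by (metis UNIV_I UN_iff)

lemma triv_open: "t \<in> trivs M ==> open (fst t)"
 using hermitian unfolding hermitian_bundle_def by blast

lemma triv_unitary:
 assumes "t \<in> trivs M" "x \<in> fst t"
 shows "snd t x ** cadj (snd t x) = mat 1" "cadj (snd t x) ** snd t x = mat 1"
 using assms hermitian unfolding hermitian_bundle_def unitary_def by blast+

lemma smooth_section_iff:
 "smooth_section_on M S u \<longleftrightarrow> (\<forall>t\<in>trivs M. smooth_fun_on M (fst t \<inter> S) (\<lambda>x. snd t x *v u x))"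
 unfolding smooth_section_on_def smooth_fun_on_def o_def Int_assoc by blast

lemma smooth_endo_iff:
 "smooth_endo_on M S A \<longleftrightarrow> (\<forall>t\<in>trivs M. smooth_fun_on M (fst t \<inter> S) (\<lambda>x. snd t x ** A x ** cadj (snd t x)))"
 unfolding smooth_endo_on_def smooth_fun_on_def o_def Int_assoc by blast

lemma sections_iff: "u \<in> sections M \<longleftrightarrow> (\<forall>t\<in>trivs M. smooth_fun_on M (fst t) (\<lambda>x. snd t x *v u x))"
 by (simp add: sections_def smooth_section_iff)

lemma smooth_section_on_subset: "u \<in> sections M ==> smooth_section_on M S u"
 unfolding sections_iff smooth_section_iff
 by (rule ballI, drule bspec, assumption) (erule smooth_fun_on_subset, simp)

lemma section_smult:
 assumes "smooth_fun_on M UNIV f" "u \<in> sections M"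
 shows "(\<lambda>x. f x *s u x) \<in> sections M"
 unfolding sections_iff
proof
 fix t assume t: "t \<in> trivs M"
 have "smooth_fun_on M (fst t) (\<lambda>x. f x *s (snd t x *v u x))"
  by (rule smooth_fun_on_bounded_bilinear[OF bounded_bilinear_vscale triv_open[OF t]])
   (use assms t smooth_fun_on_subset[OF assms(1)] in \<open>auto simp: sections_iff\<close>)
 then show "smooth_fun_on M (fst t) (\<lambda>x. snd t x *v (f x *s u x))" by (simp add: vector_smult_mv)
qed

lemma section_endo:
 assumes "smooth_endo_on M UNIV A" "u \<in> sections M"
 shows "(\<lambda>x. A x *v u x) \<in> sections M"
 unfolding sections_iff
proof
 fix t assume t: "t \<in> trivs M"
 have "smooth_fun_on M (fst t) (\<lambda>x. (snd t x ** A x ** cadj (snd t x)) *v (snd t x *v u x))"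
  by (rule smooth_fun_on_bounded_bilinear[OF bounded_bilinear_mv triv_open[OF t]])
   (use assms t in \<open>auto simp: sections_iff smooth_endo_iff\<close>)
 then show "smooth_fun_on M (fst t) (\<lambda>x. snd t x *v (A x *v u x))"
  by (rule smooth_fun_on_cong[OF _ triv_open[OF t]])
   (use triv_unitary[OF t] in \<open>simp add: matrix_vector_mul_assoc matrix_mul_assoc[symmetric]\<close>)
qed

lemma section_add:
 assumes "u \<in> sections M" "w \<in> sections M"
 shows "(\<lambda>x. u x + w x) \<in> sections M"
 unfolding sections_iff smooth_fun_on_def matrix_vector_right_distrib
proof (intro ballI)
 fix t c assume t: "t \<in> trivs M" and c: "c \<in> atlas M"
 have "smooth_on (snd c ` (fst c \<inter> fst t)) (\<lambda>y. ((\<lambda>x. snd t x *v u x) \<circ> cinv c) y + ((\<lambda>x. snd t x *v w x) \<circ> cinv c) y)"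
  by (rule smooth_on_add[OF chart_open_image[OF atlas_chart[OF c] triv_open[OF t]]])
   (use assms t c in \<open>simp_all add: sections_iff smooth_fun_on_def o_def\<close>)
 then show "smooth_on (snd c ` (fst c \<inter> fst t)) ((\<lambda>x. snd t x *v u x + snd t x *v w x) \<circ> cinv c)" by (simp add: o_def)
qed

lemma section_scaleR:
 assumes "u \<in> sections M"
 shows "(\<lambda>x. s *\<^sub>R u x) \<in> sections M"
proof -
 have "complex_of_real s *s w = s *\<^sub>R w" for w :: "complex ^ 'r" by (simp add: vec_eq_iff scaleR_conv_of_real[where 'a=complex])
 then show ?thesis using section_smult[OF smooth_fun_on_const[of _ "of_real s"] assms] by simp
qed

lemma smooth_endo_on_subset: "smooth_endo_on M UNIV A ==> smooth_endo_on M S A"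
 unfolding smooth_endo_iff
 by (rule ballI, drule bspec, assumption) (erule smooth_fun_on_subset, simp)

text \<open>Over another trivialization two open sets suffice: the overlap with t, where the
  transition matrix is smooth, and the complement of C, where the section vanishes.\<close>

lemma section_of_triv:
 assumes t: "t \<in> trivs M" and f: "smooth_fun_on M UNIV f" and C: "closed C" "C \<subseteq> fst t" "\<And>x. x \<notin> C ==> f x = 0"
 shows "(\<lambda>x. f x *s (cadj (snd t x) *v w)) \<in> sections M"
 unfolding sections_iff
proof
 fix t' assume t': "t' \<in> trivs M"
 let ?f = "\<lambda>x. snd t' x *v (f x *s (cadj (snd t x) *v w))"
 have op: "open (fst t \<inter> fst t')" using triv_open t t' by blast
 have "smooth_fun_on M (fst t \<inter> fst t') (\<lambda>x. f x *s ((snd t' x ** cadj (snd t x)) *v w))"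
  by (intro smooth_fun_on_bounded_bilinear[OF bounded_bilinear_vscale op smooth_fun_on_subset[OF f subset_UNIV]]
    smooth_fun_on_bounded_bilinear[OF bounded_bilinear_mv op _ smooth_fun_on_const])
   (use hermitian t t' in \<open>simp add: hermitian_bundle_def\<close>)
 then have 1: "smooth_fun_on M (fst t \<inter> fst t') ?f"
  by (simp add: vector_smult_mv matrix_vector_mul_assoc)
 have 2: "smooth_fun_on M (fst t' - C) ?f"
  by (rule smooth_fun_on_cong[OF smooth_fun_on_const[of _ 0]]) (use C triv_open[OF t'] in auto)
 have "(fst t \<inter> fst t') \<union> (fst t' - C) = fst t'" using C by blast
 then show "smooth_fun_on M (fst t') ?f"
  using smooth_fun_on_Un[OF 1 2 op] C triv_open[OF t'] by (simp add: open_Diff)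
qed

lemma smooth_fun_of_chart:
 fixes G :: "real ^ 'd => 'b::real_normed_vector"
 assumes c: "smooth_chart M c" and r: "cball 0 r \<subseteq> snd c ` fst c"
  and G: "smooth_on UNIV G" "\<And>y. norm y \<ge> r ==> G y = 0"
 shows "smooth_fun_on M UNIV (\<lambda>x. if x \<in> fst c then G (snd c x) else 0)"
  "closed (cinv c ` cball 0 r)" "x \<notin> cinv c ` cball 0 r ==> (if x \<in> fst c then G (snd c x) else 0) = 0"
proof -
 note cc = smooth_chartD[OF c]
 have op: "open (fst c)" using cc by (simp add: chart_def)
 have "continuous_on (cball 0 r) (cinv c)"
  by (rule continuous_on_subset[OF _ r]) (use cc in \<open>simp add: chart_def homeomorphism_def\<close>)
 then show cl: "closed (cinv c ` cball 0 r)"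
  by (intro compact_imp_closed compact_continuous_image) auto
 show z: "(if x \<in> fst c then G (snd c x) else 0) = 0" if "x \<notin> cinv c ` cball 0 r" for x
 proof (cases "x \<in> fst c")
  case True
  then have "snd c x \<notin> cball 0 r" using that cinv_snd[OF cc] by (metis image_eqI)
  then show ?thesis using G(2) by simp
 qed simp
 have 1: "smooth_fun_on M (fst c) (\<lambda>x. if x \<in> fst c then G (snd c x) else 0)"
  by (rule smooth_fun_on_cong[OF smooth_fun_on_compose[OF op smooth_fun_on_snd[OF c] G(1)] op]) simp
 have 2: "smooth_fun_on M (- cinv c ` cball 0 r) (\<lambda>x. if x \<in> fst c then G (snd c x) else 0)"
  by (rule smooth_fun_on_cong[OF smooth_fun_on_const[of _ 0]]) (use cl z in auto)
 have "cinv c ` cball 0 r \<subseteq> fst c" using r cinv_in[OF cc] by blast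
 then have "fst c \<union> - cinv c ` cball 0 r = UNIV" by blast
 then show "smooth_fun_on M UNIV (\<lambda>x. if x \<in> fst c then G (snd c x) else 0)"
  using smooth_fun_on_Un[OF 1 2 op] cl by auto
qed

lemma ract_add: "ract M x (\<theta> + \<eta>) = ract M (ract M x \<theta>) \<eta>"
 using action unfolding isometric_action_def by blast

lemma ract_lattice: "\<theta> \<in> lattice ==> ract M x \<theta> = x"
 using action unfolding isometric_action_def by blast

lemma zero_lattice: "0 \<in> lattice"
 by (auto simp: lattice_def intro: exI[of _ "0::int"])

lemma ract_0: "ract M x 0 = x"
 by (rule ract_lattice[OF zero_lattice])

lemma continuous_ract: "continuous_on UNIV (\<lambda>z. ract M (fst z) (snd z))"
 using action unfolding isometric_action_def by (simp add: case_prod_beta')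

text \<open>The inverse of the unitary F_\<theta> is its adjoint, which expresses the action on
  sections through the lift at x itself.\<close>

lemma lift_inverse: "lift M (- \<theta>) (ract M x \<theta>) = cadj (lift M \<theta> x)"
proof -
 have "lift M (- \<theta>) (ract M x \<theta>) ** lift M \<theta> x = lift M (\<theta> + - \<theta>) x"
  using equivariant unfolding equivariant_bundle_def by metis
 moreover have "lift M 0 x = mat 1" using equivariant zero_lattice unfolding equivariant_bundle_def by blast
 ultimately have e: "lift M (- \<theta>) (ract M x \<theta>) ** lift M \<theta> x = mat 1" by simp
 have u: "lift M \<theta> x ** cadj (lift M \<theta> x) = mat 1"
  using equivariant unfolding equivariant_bundle_def unitary_def by blast
 have "lift M (- \<theta>) (ract M x \<theta>) = lift M (- \<theta>) (ract M x \<theta>) ** (lift M \<theta> x ** cadj (lift M \<theta> x))" by (simp add: u)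
 also have "\<dots> = cadj (lift M \<theta> x)" by (simp add: matrix_mul_assoc e)
 finally show ?thesis .
qed

lemma sec_act_eq: "sec_act M \<theta> u x = cadj (lift M \<theta> x) *v u (ract M x \<theta>)"
 by (simp add: sec_act_def lift_inverse)

lemma sec_act_add: "sec_act M (\<theta> + \<eta>) u x = sec_act M \<theta> (sec_act M \<eta> u) x"
proof -
 have "lift M (\<theta> + \<eta>) x = lift M \<eta> (ract M x \<theta>) ** lift M \<theta> x"
  using equivariant unfolding equivariant_bundle_def by blast
 then show ?thesis by (simp add: sec_act_eq cadj_mult ract_add matrix_vector_mul_assoc)
qed

section \<open>Orbits in local coordinates\<close>

definition orbit_map :: "('m, 'd) chart => (real ^ 'd) \<times> (real ^ 'p) => 'm" where
 "orbit_map c z = ract M (cinv c (fst z)) (snd z)"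

text \<open>Fixing an open set for the start and one for the end of an orbit makes one chart or
  trivialization available at either end.\<close>

definition orbit_dom :: "('m, 'd) chart => 'm set => 'm set => ((real ^ 'd) \<times> (real ^ 'p)) set" where
 "orbit_dom c S T = {z. fst z \<in> snd c ` (fst c \<inter> S) \<and> orbit_map c z \<in> T}"

lemma orbit_dom_UNIV: "orbit_dom c S UNIV = (snd c ` (fst c \<inter> S)) \<times> UNIV"
 by (auto simp: orbit_dom_def)

lemma open_orbit_dom:
 assumes c: "chart c" and S: "open S" and T: "open T"
 shows "open (orbit_dom c S T)"
proof -
 let ?D = "snd c ` (fst c \<inter> S) \<times> (UNIV :: (real ^ 'p) set)"
 have "open (snd c ` (fst c \<inter> S))" by (rule chart_open_image[OF c S])
 then have op: "open ?D" by (intro open_Times) auto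
 have "continuous_on (snd c ` fst c) (cinv c)" using c by (simp add: chart_def homeomorphism_def)
 then have "continuous_on ?D (\<lambda>z. cinv c (fst z))"
  by (rule continuous_on_compose2) (auto intro!: continuous_intros)
 then have "continuous_on ?D (\<lambda>z. (cinv c (fst z), snd z))" by (intro continuous_intros)
 then have "continuous_on ?D (orbit_map c)"
  unfolding orbit_map_def[abs_def]
  using continuous_on_compose2[OF continuous_ract, of ?D "\<lambda>z. (cinv c (fst z), snd z)"] by simp
 from continuous_open_preimage[OF this op T] have "open (?D \<inter> orbit_map c -` T)" .
 moreover have "orbit_dom c S T = ?D \<inter> orbit_map c -` T" by (auto simp: orbit_dom_def)
 ultimately show ?thesis by simp
qed

text \<open>Smoothness of the action is assumed between atlas charts; near each pair (y, \<theta>)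
  atlas charts are interposed at the start and at the end of the orbit.\<close>

lemma smooth_orbit:
 fixes w :: "'m => 'b::real_normed_vector"
 assumes w: "smooth_fun_on M T w" "open T" and c: "smooth_chart M c"
 shows "smooth_on (orbit_dom c UNIV T) (\<lambda>z. w (orbit_map c z))"
proof (rule smooth_on_local)
 note cc = smooth_chartD[OF c]
 show op: "open (orbit_dom c UNIV T)" by (rule open_orbit_dom[OF cc open_UNIV w(2)])
 fix z assume z: "z \<in> orbit_dom c UNIV T"
 obtain c0 where c0: "c0 \<in> atlas M" "cinv c (fst z) \<in> fst c0" by (rule atlas_cover)
 obtain c' where c': "c' \<in> atlas M" "orbit_map c z \<in> fst c'" by (rule atlas_cover)
 note cc0 = atlas_chart[OF c0(1)] and cc' = atlas_chart[OF c'(1)]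
 have o: "open (fst c0)" "open (fst c')" using cc0 cc' by (auto simp: chart_def)
 define V where "V = orbit_dom c (fst c0) (T \<inter> fst c')"
 have V: "open V" unfolding V_def using open_orbit_dom[OF cc o(1), of "T \<inter> fst c'"] o w(2) by blast
 have zV: "z \<in> V" using z c0 c' cc by (auto simp: V_def orbit_dom_def chart_image_iff)
 define P where "P z = (snd c0 (cinv c (fst z)), snd z)" for z :: "(real ^ 'd) \<times> (real ^ 'p)"
 define D' where "D' = {(y, \<theta>). y \<in> snd c0 ` fst c0 \<and> ract M (cinv c0 y) \<theta> \<in> fst c'}"
 have D': "D' = orbit_dom c0 UNIV (fst c')" by (auto simp: D'_def orbit_dom_def orbit_map_def)
 have oD: "open D'" unfolding D' by (rule open_orbit_dom[OF cc0 open_UNIV o(2)])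
 have V1: "cinv c (fst y) \<in> fst c0" "orbit_map c y \<in> T" "orbit_map c y \<in> fst c'" "cinv c0 (fst (P y)) = cinv c (fst y)" if "y \<in> V" for y
  using that cc cinv_snd[OF cc0] by (auto simp: V_def orbit_dom_def chart_image_iff P_def)
 have oP: "orbit_map c0 (P y) = orbit_map c y" if "y \<in> V" for y
  using V1(4)[OF that] by (simp only: orbit_map_def) (simp only: P_def snd_conv)
 have sP: "smooth_on V P"
  unfolding P_def
 proof (rule smooth_on_Pair[OF V _ smooth_on_linear[OF bounded_linear_snd]])
  show "smooth_on V (\<lambda>z. snd c0 (cinv c (fst z)))"
  proof (rule smooth_on_compose[OF V, of "snd c ` (fst c \<inter> fst c0)" fst "\<lambda>y. snd c0 (cinv c y)"])
   show "smooth_on (snd c ` (fst c \<inter> fst c0)) (\<lambda>y. snd c0 (cinv c y))"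
    using c c0 unfolding smooth_chart_def smooth_transition_def o_def by blast
   show "open (snd c ` (fst c \<inter> fst c0))" by (rule chart_open_image[OF cc o(1)])
  qed (auto simp: V_def orbit_dom_def smooth_on_linear[OF bounded_linear_fst])
 qed
 have PD: "P y \<in> D'" if "y \<in> V" for y
  using V1[OF that] by (auto simp: D' orbit_dom_def orbit_map_def) (auto simp: P_def)
 have "smooth_on D' (\<lambda>z. snd c' (orbit_map c0 z))"
  using action c0 c' unfolding isometric_action_def D'_def orbit_map_def by (simp add: case_prod_beta')
 from smooth_on_compose[OF V oD PD sP this]
 have s1: "smooth_on V (\<lambda>y. snd c' (orbit_map c y))"
  by (rule smooth_on_cong[OF _ V]) (simp_all add: oP)
 have "smooth_on V (\<lambda>y. w (cinv c' (snd c' (orbit_map c y))))"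
  by (rule smooth_on_compose[OF V _ _ s1 smooth_fun_on_chart[OF w atlas_smooth_chart[OF c'(1)]]])
   (use V1 chart_open_image[OF cc' w(2)] in auto)
 then have "smooth_on V (\<lambda>y. w (orbit_map c y))"
  by (rule smooth_on_cong[OF _ V]) (use V1 cinv_snd[OF cc'] in simp)
 then have "smooth_on (orbit_dom c UNIV T \<inter> V) (\<lambda>y. w (orbit_map c y))" by (rule smooth_on_subset) auto
 then show "\<exists>V. open V \<and> z \<in> V \<and> smooth_on (orbit_dom c UNIV T \<inter> V) (\<lambda>z. w (orbit_map c z))" using V zV by blast
qed

text \<open>The action on sections contains the inverse lift, whereas smoothness is given for the
  lift; unitarity turns the inverse into the adjoint \<open>cadj (H z)\<close>, which is smooth
  together with \<open>H\<close>.\<close>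

lemma smooth_sec_act:
 assumes s: "s \<in> sections M" and c: "c \<in> atlas M" and t: "t \<in> trivs M"
 shows "smooth_on (orbit_dom c (fst t) UNIV) (\<lambda>z. snd t (cinv c (fst z)) *v sec_act M (snd z) s (cinv c (fst z)))"
  (is "smooth_on ?D ?F")
proof (rule smooth_on_local)
 note cc = atlas_chart[OF c]
 show "open ?D" by (rule open_orbit_dom[OF cc triv_open[OF t] open_UNIV])
 fix z assume z: "z \<in> ?D"
 obtain t' where t': "t' \<in> trivs M" "orbit_map c z \<in> fst t'" by (rule triv_cover)
 define V where "V = orbit_dom c (fst t) (fst t')"
 have V: "open V" unfolding V_def by (rule open_orbit_dom[OF cc triv_open[OF t] triv_open[OF t'(1)]])
 have zV: "z \<in> V" using z t' by (auto simp: V_def orbit_dom_def)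
 define H where "H z = snd t' (orbit_map c z) ** lift M (snd z) (cinv c (fst z)) ** cadj (snd t (cinv c (fst z)))" for z
 have "smooth_on V H"
  using equivariant c t t' unfolding equivariant_bundle_def V_def orbit_dom_def H_def orbit_map_def by (simp add: case_prod_beta')
 moreover have "smooth_on V (\<lambda>z. snd t' (orbit_map c z) *v s (orbit_map c z))"
  by (rule smooth_on_subset[OF smooth_orbit[OF _ triv_open[OF t'(1)] atlas_smooth_chart[OF c]]])
   (use s t' in \<open>auto simp: sections_iff V_def orbit_dom_def\<close>)
 ultimately have "smooth_on V (\<lambda>z. cadj (H z) *v (snd t' (orbit_map c z) *v s (orbit_map c z)))"
  by (rule smooth_on_mv[OF V smooth_on_bounded_linear[OF bounded_linear_cadj V]])
 then have "smooth_on V ?F"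
 proof (rule smooth_on_cong[OF _ V])
  fix z assume "z \<in> V"
  then have "orbit_map c z \<in> fst t'" by (simp add: V_def orbit_dom_def)
  from triv_unitary[OF t'(1) this]
  show "cadj (H z) *v (snd t' (orbit_map c z) *v s (orbit_map c z)) = ?F z"
   by (simp add: H_def cadj_mult cadj_cadj matrix_vector_mul_assoc matrix_mul_assoc[symmetric])
    (simp add: sec_act_eq orbit_map_def matrix_vector_mul_assoc matrix_mul_assoc[symmetric])
 qed
 then have "smooth_on (?D \<inter> V) ?F" by (rule smooth_on_subset) auto
 then show "\<exists>V. open V \<and> z \<in> V \<and> smooth_on (?D \<inter> V) ?F" using V zV by blast
qed

end

section \<open>Averages over the torus\<close>

lemma pd_slice:
 assumes "F differentiable at (y, \<theta>)"
 shows "pd (\<lambda>y. F (y, \<theta>)) a y = pd F (a, 0) (y, \<theta>)" "pd (\<lambda>\<theta>. F (y, \<theta>)) b \<theta> = pd F (0, b) (y, \<theta>)"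
proof -
 have 1: "((\<lambda>y. (y, \<theta>)) has_derivative (\<lambda>a. (a, 0))) (at y)" by (auto intro!: derivative_eq_intros)
 have 2: "((\<lambda>\<theta>. (y, \<theta>)) has_derivative (\<lambda>a. (0, a))) (at \<theta>)" by (auto intro!: derivative_eq_intros)
 show "pd (\<lambda>y. F (y, \<theta>)) a y = pd F (a, 0) (y, \<theta>)"
  using pd_compose[OF differentiableI[OF 1] assms, of a] by (simp add: pd_eq_of_has_derivative[OF 1])
 show "pd (\<lambda>\<theta>. F (y, \<theta>)) b \<theta> = pd F (0, b) (y, \<theta>)"
  using pd_compose[OF differentiableI[OF 2] assms, of b] by (simp add: pd_eq_of_has_derivative[OF 2])
qed

lemma cadj_mat_1: "cadj (mat 1) = mat 1"
 by (simp add: cadj_def mat_def vec_eq_iff)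

definition character :: "(real ^ 'p::finite => complex) => bool" where
 "character g \<longleftrightarrow> smooth_on UNIV g \<and> (\<forall>\<theta> \<eta>. g (\<theta> + \<eta>) = g \<theta> * g \<eta>) \<and> (\<forall>h\<in>lattice. g h = 1)"

text \<open>L maps the lattice into itself and q is integral, so q . L h is an integer multiple of 2
  pi for h in the lattice.\<close>

lemma character_cis:
 fixes L :: "real ^ 'p::finite => real ^ 'p"
 assumes L: "torus_coords L"
 shows "character (\<lambda>\<theta>. cis (idot q (L \<theta>)))"
 unfolding character_def
proof (intro conjI allI ballI)
 have ll: "linear L" using L by (simp add: torus_coords_def)
 have "linear (\<lambda>\<theta>. idot q (L \<theta>))"
  by (rule linearI) (simp_all add: linear_add[OF ll] linear_scale[OF ll] idot_add_right idot_scaleR)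
 then show "smooth_on UNIV (\<lambda>\<theta>. cis (idot q (L \<theta>)))" by (intro smooth_on_cis) (simp add: linear_conv_bounded_linear)
 show "cis (idot q (L (\<theta> + \<eta>))) = cis (idot q (L \<theta>)) * cis (idot q (L \<eta>))" for \<theta> \<eta>
  by (simp add: linear_add[OF ll] idot_add_right cis_mult)
 fix h :: "real ^ 'p" assume "h \<in> lattice"
 then have "L h \<in> lattice" using L by (auto simp: torus_coords_def)
 then obtain z where z: "\<And>p. L h $ p = 2 * pi * of_int (z p)" unfolding lattice_def by (auto simp: choice_iff)
 have "idot q (L h) = 2 * pi * of_int (\<Sum>p\<in>UNIV. q $ p * z p)"
  by (simp add: idot_def z sum_distrib_left mult_ac)
 then show "cis (idot q (L h)) = 1" by (simp only: cis_multiple_2pi Ints_of_int)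
qed

lemma content_tbox: "measure lborel (tbox :: (real ^ 'p::finite) set) > 0"
proof -
 have "(0::real ^ 'p) \<in> tbox" by (simp add: mem_box_cart)
 then have "tbox \<noteq> ({} :: (real ^ 'p) set)" by blast
 then show ?thesis by (simp add: content_cbox_cart prod_pos)
qed

context tbun
begin

text \<open>For a character g this is the projection onto the functions with w(x \<eta>) =
  g(\<eta>)^(-1) w(x); \<open>savg\<close> is its analogue for sections.\<close>

definition favg :: "(real ^ 'p => complex) => ('m => complex) => 'm => complex" where
 "favg g w x = (1 / measure lborel (tbox :: (real ^ 'p) set)) *\<^sub>R integral tbox (\<lambda>\<theta>. g \<theta> * w (ract M x \<theta>))"

definition savg :: "(real ^ 'p => complex) => ('m, 'r) sec => ('m, 'r) sec" where
 "savg g s x = (1 / measure lborel (tbox :: (real ^ 'p) set)) *\<^sub>R integral tbox (\<lambda>\<theta>. g \<theta> *s sec_act M \<theta> s x)"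

lemma smooth_favg_kernel:
 assumes g: "character g" and w: "smooth_fun_on M UNIV w" and c: "smooth_chart M c"
 shows "smooth_on (snd c ` fst c \<times> UNIV) (\<lambda>z. g (snd z) * w (orbit_map c z))"
proof -
 have op: "open (snd c ` fst c \<times> (UNIV :: (real ^ 'p) set))"
  using smooth_chartD[OF c] by (intro open_Times) (auto simp: chart_def)
 have "smooth_on (snd c ` fst c \<times> UNIV) (\<lambda>z. w (orbit_map c z))"
  using smooth_orbit[OF w open_UNIV c] by (simp add: orbit_dom_UNIV)
 moreover have "smooth_on (snd c ` fst c \<times> UNIV) (\<lambda>z. g (snd z))"
  by (rule smooth_on_compose[OF op open_UNIV UNIV_I smooth_on_linear[OF bounded_linear_snd]])
   (use g in \<open>simp add: character_def\<close>)
 ultimately show ?thesis by (intro smooth_on_mult[OF op])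
qed

lemma smooth_favg:
 assumes g: "character g" and w: "smooth_fun_on M UNIV w"
 shows "smooth_fun_on M UNIV (favg g w)"
 unfolding smooth_fun_on_def
proof
 fix c assume c: "c \<in> atlas M"
 have op: "open (snd c ` fst c)" using atlas_chart[OF c] by (simp add: chart_def)
 have "smooth_on (snd c ` fst c) (\<lambda>y. integral tbox (\<lambda>\<theta>. g (snd (y, \<theta>)) * w (orbit_map c (y, \<theta>))))"
  by (rule smooth_on_integral_param[OF op smooth_favg_kernel[OF g w atlas_smooth_chart[OF c]]])
 then show "smooth_on (snd c ` (fst c \<inter> UNIV)) (favg g w \<circ> cinv c)"
  using smooth_on_bounded_linear[OF bounded_linear_scaleR_right op, of _ "1 / measure lborel (tbox :: (real ^ 'p) set)"]
  by (simp add: o_def favg_def[abs_def] orbit_map_def)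
qed

lemma favg_ract:
 assumes g: "character g" and w: "smooth_fun_on M UNIV w"
 shows "g \<eta> * favg g w (ract M x \<eta>) = favg g w x"
proof -
 obtain c where c: "c \<in> atlas M" "x \<in> fst c" by (rule atlas_cover)
 define h where "h = (\<lambda>\<theta>. g \<theta> * w (ract M x \<theta>))"
 have "continuous_on UNIV (\<lambda>\<theta>. (\<lambda>z. g (snd z) * w (orbit_map c z)) (snd c x, \<theta>))"
  by (rule continuous_on_compose2[OF smooth_on_continuous[OF smooth_favg_kernel[OF g w atlas_smooth_chart[OF c(1)]]]])
   (use c in \<open>auto intro!: continuous_intros\<close>)
 then have co: "continuous_on UNIV h"
  by (simp add: h_def orbit_map_def cinv_snd[OF atlas_chart[OF c(1)] c(2)])
 have "h (\<theta> + l) = h \<theta>" if "l \<in> lattice" for \<theta> l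
  using g that ract_add[of x l \<theta>] ract_lattice[OF that] by (simp add: h_def character_def add.commute)
 from integral_tbox_shift[OF co this, of \<eta>]
 have "integral tbox (\<lambda>\<theta>. g \<eta> * (g \<theta> * w (ract M (ract M x \<eta>) \<theta>))) = integral tbox h"
  using g by (simp add: h_def character_def ract_add[symmetric] add.commute mult_ac)
 then show ?thesis by (simp add: favg_def h_def)
qed

lemma savg_kernel:
 assumes g: "character g" and s: "s \<in> sections M" and c: "c \<in> atlas M" and t: "t \<in> trivs M"
 shows "smooth_on (snd c ` (fst c \<inter> fst t) \<times> UNIV)
  (\<lambda>z. g (snd z) *s (snd t (cinv c (fst z)) *v sec_act M (snd z) s (cinv c (fst z))))"
proof -
 have op: "open (snd c ` (fst c \<inter> fst t) \<times> (UNIV :: (real ^ 'p) set))"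
  by (intro open_Times chart_open_image[OF atlas_chart[OF c] triv_open[OF t]] open_UNIV)
 have "smooth_on (snd c ` (fst c \<inter> fst t) \<times> UNIV) (\<lambda>z. g (snd z))"
  by (rule smooth_on_compose[OF op open_UNIV UNIV_I smooth_on_linear[OF bounded_linear_snd]])
   (use g in \<open>simp add: character_def\<close>)
 from smooth_on_smult[OF op this smooth_sec_act[OF s c t, unfolded orbit_dom_UNIV]] show ?thesis .
qed

lemma continuous_sec_act:
 assumes g: "character g" and s: "s \<in> sections M"
 shows "continuous_on UNIV (\<lambda>\<theta>. g \<theta> *s sec_act M \<theta> s x)"
proof -
 obtain c where c: "c \<in> atlas M" "x \<in> fst c" by (rule atlas_cover)
 obtain t where t: "t \<in> trivs M" "x \<in> fst t" by (rule triv_cover)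
 have "continuous_on UNIV (\<lambda>\<theta>. (\<lambda>z. g (snd z) *s (snd t (cinv c (fst z)) *v sec_act M (snd z) s (cinv c (fst z)))) (snd c x, \<theta>))"
  by (rule continuous_on_compose2[OF smooth_on_continuous[OF savg_kernel[OF g s c(1) t(1)]]])
   (use c t in \<open>auto intro!: continuous_intros\<close>)
 then have "continuous_on UNIV (\<lambda>\<theta>. g \<theta> *s (snd t x *v sec_act M \<theta> s x))"
  by (simp add: cinv_snd[OF atlas_chart[OF c(1)] c(2)])
 then have "continuous_on UNIV (\<lambda>\<theta>. cadj (snd t x) *v (g \<theta> *s (snd t x *v sec_act M \<theta> s x)))"
  by (intro bounded_bilinear.continuous_on[OF bounded_bilinear_mv] continuous_on_const)
 then show ?thesis by (simp add: vector_smult_mv matrix_vector_mul_assoc triv_unitary[OF t])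
qed

lemma mv_integral_sec_act:
 fixes A :: "complex ^ 'r ^ 'r"
 assumes g: "character g" and s: "s \<in> sections M"
 shows "A *v integral tbox (\<lambda>\<theta>. g \<theta> *s sec_act M \<theta> s x) = integral tbox (\<lambda>\<theta>. g \<theta> *s (A *v sec_act M \<theta> s x))"
proof -
 have "(\<lambda>\<theta>. g \<theta> *s sec_act M \<theta> s x) integrable_on tbox"
  by (rule integrable_continuous, rule continuous_on_subset[OF continuous_sec_act[OF g s]]) auto
 from integral_linear[OF this bounded_bilinear.bounded_linear_right[OF bounded_bilinear_mv], of A]
 show ?thesis by (simp add: o_def vector_smult_mv)
qed

lemma savg_section:
 assumes g: "character g" and s: "s \<in> sections M"
 shows "savg g s \<in> sections M"
 unfolding sections_iff smooth_fun_on_def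
proof (intro ballI)
 fix t c assume t: "t \<in> trivs M" and c: "c \<in> atlas M"
 have op: "open (snd c ` (fst c \<inter> fst t))" by (rule chart_open_image[OF atlas_chart[OF c] triv_open[OF t]])
 from smooth_on_integral_param[OF op savg_kernel[OF g s c t], of 0 "\<chi> i. 2 * pi"]
 have "smooth_on (snd c ` (fst c \<inter> fst t)) (\<lambda>y. snd t (cinv c y) *v integral tbox (\<lambda>\<theta>. g \<theta> *s sec_act M \<theta> s (cinv c y)))"
  by (simp add: mv_integral_sec_act[OF g s])
 from smooth_on_bounded_linear[OF bounded_linear_scaleR_right op this, of "1 / measure lborel (tbox :: (real ^ 'p) set)"]
 show "smooth_on (snd c ` (fst c \<inter> fst t)) ((\<lambda>x. snd t x *v savg g s x) \<circ> cinv c)"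
  by (simp add: o_def savg_def mv_scaleR)
qed

lemma sec_act_savg:
 assumes g: "character g" and s: "s \<in> sections M"
 shows "g \<eta> *s sec_act M \<eta> (savg g s) x = savg g s x"
proof -
 define h where "h = (\<lambda>\<theta>. g \<theta> *s sec_act M \<theta> s x)"
 have "h (\<theta> + l) = h \<theta>" if l: "l \<in> lattice" for \<theta> l
 proof -
  have "lift M l x = mat 1" using equivariant l unfolding equivariant_bundle_def by blast
  then have "sec_act M (l + \<theta>) s x = sec_act M \<theta> s x"
   by (simp only: sec_act_add) (simp add: sec_act_eq ract_lattice[OF l] cadj_mat_1)
  then show ?thesis using g l by (simp add: h_def character_def add.commute)
 qed
 from integral_tbox_shift[OF continuous_sec_act[OF g s, of x, folded h_def] this, of \<eta>]
 have e: "integral tbox (\<lambda>\<theta>. g (\<eta> + \<theta>) *s sec_act M (\<eta> + \<theta>) s x) = integral tbox h"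
  by (simp add: h_def add.commute)
 have "g \<eta> *s (cadj (lift M \<eta> x) *v integral tbox (\<lambda>\<theta>. g \<theta> *s sec_act M \<theta> s (ract M x \<eta>)))
  = integral tbox (\<lambda>\<theta>. g (\<eta> + \<theta>) *s sec_act M (\<eta> + \<theta>) s x)"
 proof -
  have i: "(\<lambda>\<theta>. g \<theta> *s sec_act M \<theta> s (ract M x \<eta>)) integrable_on tbox"
   by (rule integrable_continuous, rule continuous_on_subset[OF continuous_sec_act[OF g s]]) auto
  have "(\<lambda>\<theta>. g \<theta> *s (cadj (lift M \<eta> x) *v sec_act M \<theta> s (ract M x \<eta>))) integrable_on tbox"
   using integrable_linear[OF i bounded_bilinear.bounded_linear_right[OF bounded_bilinear_mv], of "cadj (lift M \<eta> x)"]
   by (simp add: o_def vector_smult_mv)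
  from integral_linear[OF this bounded_bilinear.bounded_linear_right[OF bounded_bilinear_vscale], of "g \<eta>"]
  show ?thesis using g
   by (simp add: o_def mv_integral_sec_act[OF g s] sec_act_add sec_act_eq[of \<eta>] character_def vector_smult_assoc)
 qed
 moreover have "g \<eta> *s (q *\<^sub>R w) = q *\<^sub>R (g \<eta> *s w)" for q and w :: "complex ^ 'r" by (simp add: vec_eq_iff)
 ultimately show ?thesis by (simp only: savg_def sec_act_eq[of \<eta>] mv_scaleR e h_def)
qed

text \<open>At a fixed point a value of the right weight makes the integrand constant, so a section
  can be made equivariant without changing its value there.\<close>

lemma savg_fixed:
 assumes "\<And>\<theta>. ract M x \<theta> = x" "\<And>\<theta>. g \<theta> *s (cadj (lift M \<theta> x) *v s x) = s x"
 shows "savg g s x = s x"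
 using content_tbox[where 'p='p] by (simp add: savg_def sec_act_eq assms)

lemma favg_fixed: "(\<And>\<theta>. ract M x \<theta> = x) ==> w x = 0 ==> favg g w x = 0"
 by (simp add: favg_def)

lemma smooth_ract_snd:
 assumes c: "smooth_chart M c" and S: "S = (\<lambda>x. ract M x \<theta>) -` fst c"
 shows "smooth_fun_on M S (\<lambda>x. snd c (ract M x \<theta>))" "open S"
proof -
 have op: "open (fst c)" using smooth_chartD[OF c] by (simp add: chart_def)
 show So: "open S" unfolding S
  by (rule open_vimage[OF op], rule continuous_on_compose2[OF continuous_ract, of _ "\<lambda>x. (x, \<theta>)", simplified]) (intro continuous_intros)
 show "smooth_fun_on M S (\<lambda>x. snd c (ract M x \<theta>))"
  unfolding smooth_fun_on_def
 proof
  fix c' assume c': "c' \<in> atlas M"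
  note cc' = atlas_chart[OF c']
  have o: "open (snd c' ` (fst c' \<inter> S))" by (rule chart_open_image[OF cc' So])
  have "smooth_on (snd c' ` (fst c' \<inter> S)) (\<lambda>y. snd c (orbit_map c' (y, \<theta>)))"
   by (rule smooth_on_compose[OF o open_orbit_dom[OF cc' open_UNIV op] _ smooth_on_Pair[OF o smooth_on_ident smooth_on_const]
      smooth_orbit[OF smooth_fun_on_snd[OF c] op atlas_smooth_chart[OF c']]])
    (simp add: orbit_dom_def chart_image_iff[OF cc'] S orbit_map_def)
  then show "smooth_on (snd c' ` (fst c' \<inter> S)) ((\<lambda>x. snd c (ract M x \<theta>)) \<circ> cinv c')"
   by (simp add: o_def orbit_map_def)
 qed
qed

lemma pd_orbit_fixed:
 assumes c: "smooth_chart M c" and x: "x \<in> fst c" "\<And>\<theta>. ract M x \<theta> = x"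
 shows "pd (\<lambda>y. snd c (orbit_map c (y, \<theta>))) (mdiff M (snd c) x v) (snd c x) = mdiff M (\<lambda>x. snd c (ract M x \<theta>)) x v"
 using mdiff_eq[OF smooth_ract_snd[OF c refl, of \<theta>] _ c x(1), of v] x by (simp add: orbit_map_def)

lemma orbit_chart:
 assumes c: "smooth_chart M c"
 shows "open (orbit_dom c UNIV (fst c))" "smooth_on (orbit_dom c UNIV (fst c)) (\<lambda>z. snd c (orbit_map c z))"
  "y \<in> snd c ` fst c ==> (y, 0) \<in> orbit_dom c UNIV (fst c)"
proof -
 note cc = smooth_chartD[OF c]
 have op: "open (fst c)" using cc by (simp add: chart_def)
 show "open (orbit_dom c UNIV (fst c))" by (rule open_orbit_dom[OF cc open_UNIV op])
 show "smooth_on (orbit_dom c UNIV (fst c)) (\<lambda>z. snd c (orbit_map c z))"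
  by (rule smooth_orbit[OF smooth_fun_on_snd[OF c] op c])
 show "(y, 0) \<in> orbit_dom c UNIV (fst c)" if "y \<in> snd c ` fst c"
  using that cinv_in[OF cc] by (simp add: orbit_dom_def orbit_map_def ract_0)
qed

text \<open>At a fixed point the action maps the chart coordinates linearly to first order, so
  differentiation under the integral replaces the direction by its image R \<theta>. If the
  character compensates this change, the integrand is constant and its average is C.\<close>

lemma pd_favg:
 assumes g: "character g" and w: "smooth_fun_on M UNIV w" and c: "smooth_chart M c"
  and x: "x \<in> fst c" "\<And>\<theta>. ract M x \<theta> = x"
  and R: "\<And>\<theta>. mdiff M (\<lambda>x. snd c (ract M x \<theta>)) x v = R \<theta>"
  and K: "\<And>\<theta>. g \<theta> * pd (\<lambda>y. w (cinv c y)) (R \<theta>) (snd c x) = C"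
 shows "pd (\<lambda>y. favg g w (cinv c y)) (mdiff M (snd c) x v) (snd c x) = C"
proof -
 note cc = smooth_chartD[OF c]
 have op: "open (snd c ` fst c)" "open (fst c)" using cc by (auto simp: chart_def)
 have y: "snd c x \<in> snd c ` fst c" using x by blast
 note cx = cinv_snd[OF cc x(1)]
 let ?a = "mdiff M (snd c) x v"
 define \<Phi> where "\<Phi> z = g (snd z) * w (orbit_map c z)" for z
 have sm: "smooth_on (snd c ` fst c \<times> UNIV) \<Phi>" unfolding \<Phi>_def by (rule smooth_favg_kernel[OF g w c])
 have "pd \<Phi> (?a, 0) (snd c x, \<theta>) = C" for \<theta>
 proof -
  let ?D = "orbit_dom c UNIV (fst c)" and ?o = "\<lambda>y. snd c (orbit_map c (y, \<theta>))" and ?w = "\<lambda>y. w (cinv c y)"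
  note oc = orbit_chart[OF c]
  define D1 where "D1 = (\<lambda>y. (y, \<theta>)) -` ?D"
  have D1: "open D1" unfolding D1_def by (rule open_vimage[OF oc(1)]) (intro continuous_intros)
  have y1: "snd c x \<in> D1" using x y by (simp add: D1_def orbit_dom_def orbit_map_def cx)
  have f1: "?o differentiable at (snd c x)"
   by (rule smooth_on_differentiable[OF smooth_on_compose[OF D1 oc(1) _ smooth_on_Pair[OF D1 smooth_on_ident smooth_on_const] oc(2)] D1 y1])
    (simp add: D1_def)
  have o0: "?o (snd c x) = snd c x" by (simp add: orbit_map_def cx x)
  have f2: "?w differentiable at (?o (snd c x))"
   unfolding o0 by (rule smooth_fun_on_differentiable[OF w open_UNIV UNIV_I c x(1)])
  have e: "w (orbit_map c (y, \<theta>)) = ?w (?o y)" if "y \<in> D1" for y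
   using that by (simp add: D1_def orbit_dom_def cinv_snd[OF cc])
  have "pd \<Phi> (?a, 0) (snd c x, \<theta>) = pd (\<lambda>y. \<Phi> (y, \<theta>)) ?a (snd c x)"
   by (rule pd_slice(1)[symmetric, OF smooth_on_differentiable[OF sm]]) (use op y in \<open>auto intro!: open_Times\<close>)
  also have "\<dots> = pd (\<lambda>y. g \<theta> * ?w (?o y)) ?a (snd c x)"
   by (rule pd_cong_open[OF D1 y1]) (simp add: \<Phi>_def e)
  also have "\<dots> = g \<theta> * pd (\<lambda>y. ?w (?o y)) ?a (snd c x)"
   by (rule pd_bounded_linear[OF bounded_linear_mult_right differentiable_chain_at[OF f1 f2, unfolded o_def]])
  also have "pd (\<lambda>y. ?w (?o y)) ?a (snd c x) = pd ?w (pd ?o ?a (snd c x)) (?o (snd c x))"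
   by (rule pd_compose[OF f1 f2])
  finally show ?thesis unfolding o0 pd_orbit_fixed[OF c x] R K .
 qed
 moreover have "((\<lambda>y. integral tbox (\<lambda>\<theta>. \<Phi> (y, \<theta>))) has_derivative
  (\<lambda>v. integral tbox (\<lambda>\<theta>. pd \<Phi> (v, 0) (snd c x, \<theta>)))) (at (snd c x))"
  by (rule has_derivative_integral_param[OF op(1) y]) (use sm in \<open>simp only: smooth_on_def\<close>)
 from pd_eq_of_has_derivative[OF has_derivative_scaleR_right[OF this]]
 have "pd (\<lambda>y. favg g w (cinv c y)) ?a (snd c x)
  = (1 / measure lborel (tbox :: (real ^ 'p) set)) *\<^sub>R integral tbox (\<lambda>\<theta>. pd \<Phi> (?a, 0) (snd c x, \<theta>))"
  by (simp add: favg_def[abs_def] \<Phi>_def orbit_map_def)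
 ultimately show ?thesis using content_tbox[where 'p='p] by simp
qed

end

section \<open>The Dirac operator near a singular point\<close>

text \<open>The ball of radius r fits into the normal chart, the trivialization and the region of
  the Dirac structure at once. Local objects cut off by \<open>radial r\<close> thereby become
  global sections, to which the hypotheses on \<open>D\<close> apply.\<close>

locale dirac_pt = tbun M
 for M :: "('m::t2_space, 'd::finite, 'p::finite, 'r::finite, 'z) tbundle_scheme" +
 fixes D :: "('m, 'r) sec => ('m, 'r) sec" and S :: "'m set"
  and c :: "'m => real ^ 'd => complex ^ 'r ^ 'r"
  and nab :: "'m => real ^ 'd => ('m, 'r) sec => complex ^ 'r"
  and xb :: 'm and ch :: "('m, 'd) chart" and t :: "('m, 'r) triv" and r :: real
 assumes D_section: "\<And>u. u \<in> sections M ==> D u \<in> sections M"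
  and dirac: "dirac_near M D xb S c nab"
  and normal: "normal_chart M xb ch"
  and t: "t \<in> trivs M" "xb \<in> fst t"
  and r: "r > 0" "cball 0 r \<subseteq> snd ch ` (fst ch \<inter> (fst t \<inter> S))"
begin

lemma ch: "smooth_chart M ch" "xb \<in> fst ch" and ch_xb: "snd ch xb = 0"
 using normal unfolding normal_chart_def by blast+

lemmas cch = smooth_chartD[OF ch(1)]

lemma open_ch: "open (fst ch)"
 using cch by (simp add: chart_def)

lemma cinv_0: "cinv ch 0 = xb"
 using cinv_snd[OF cch ch(2)] ch_xb by simp

lemma S: "open S" "xb \<in> S"
 using dirac unfolding dirac_near_def by blast+

abbreviation "tx \<equiv> snd t xb"
abbreviation E :: "real ^ 'd => real ^ 'd" where "E \<equiv> dvec M ch xb"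
abbreviation "N0 \<equiv> snd ch ` (fst ch \<inter> (fst t \<inter> S))"

lemma N0: "open N0" "0 \<in> N0"
proof -
 show "open N0" by (rule chart_open_image[OF cch]) (use S triv_open[OF t(1)] in blast)
 show "0 \<in> N0" using r by force
qed

definition onf :: "'m => ('d => real ^ 'd) => bool" where
 "onf x e \<longleftrightarrow> (\<forall>i j. metric M x (e i) (e j) = (if i = j then 1 else 0))"

lemma onf_exists: obtains e where "onf x e"
 using orthonormal_frame_exists[of "metric M x"] metric_facts[where x=x] unfolding onf_def by metis

lemma onf_E: "onf xb (\<lambda>i. E (axis i 1))"
 unfolding onf_def
proof (intro allI)
 fix i j
 have "gmat M ch 0 $ i $ j = mat 1 $ i $ j" using normal unfolding normal_chart_def by simp
 then show "metric M xb (E (axis i 1)) (E (axis j 1)) = (if i = j then 1 else 0)"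
  by (simp add: gmat_def cinv_0 mat_def)
qed

lemma nab_add:
 assumes "x \<in> S" "u \<in> sections M" "u' \<in> sections M"
 shows "nab x v (\<lambda>y. u y + u' y) = nab x v u + nab x v u'"
proof -
 have "\<forall>x \<in> S. \<forall>v u u'. smooth_section_on M S u \<and> smooth_section_on M S u' \<longrightarrow>
    nab x v (\<lambda>y. u y + u' y) = nab x v u + nab x v u'"
  using dirac unfolding dirac_near_def clifford_connection_on_def by (elim conjE)
 then show ?thesis using assms smooth_section_on_subset[OF assms(2)] smooth_section_on_subset[OF assms(3)] by simp
qed

lemma nab_smult:
 assumes "x \<in> S" "smooth_fun_on M S f" "u \<in> sections M"
 shows "nab x v (\<lambda>y. f y *s u y) = mdiff M f x v *s u x + f x *s nab x v u"
proof -
 have "\<forall>x \<in> S. \<forall>v f u. smooth_fun_on M S f \<and> smooth_section_on M S u \<longrightarrow>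
    nab x v (\<lambda>y. f y *s u y) = mdiff M f x v *s u x + f x *s nab x v u"
  using dirac unfolding dirac_near_def clifford_connection_on_def by (elim conjE)
 then show ?thesis using assms smooth_section_on_subset[OF assms(3)] by simp
qed

lemma D_eq: "u \<in> sections M ==> x \<in> S ==> onf x e ==> D u x = (\<Sum>i\<in>UNIV. c x (e i) *v nab x (e i) u)"
 using dirac unfolding dirac_near_def dirac_operator_on_def onf_def by simp

lemma linear_c: "x \<in> S ==> linear (c x)"
 using dirac unfolding dirac_near_def clifford_structure_on_def by blast

lemma c_square: "x \<in> S ==> c x v ** c x v = - mat (of_real (metric M x v v))"
 using dirac unfolding dirac_near_def clifford_structure_on_def by blast

lemma c_square_mv: "x \<in> S ==> c x v *v (c x v *v w) = - of_real (metric M x v v) *s w"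
 by (simp add: matrix_vector_mul_assoc c_square minus_mv)
  (simp add: vec_eq_iff matrix_vector_mult_def mat_def if_distrib[of "\<lambda>z. z * _"] cong: if_cong)

lemma c_anticomm:
 assumes x: "x \<in> S"
 shows "c x v *v (c x v' *v w) + c x v' *v (c x v *v w) = - of_real (2 * metric M x v v') *s w"
proof -
 have l: "linear (\<lambda>v. metric M x v v')" "linear (metric M x v')" for v'
  using metric_facts(1)[of x] by (auto simp: bilinear_def)
 have "c x (v + v') *v (c x (v + v') *v w) = - of_real (metric M x (v + v') (v + v')) *s w" by (rule c_square_mv[OF x])
 then have "(c x v *v (c x v *v w) + c x v' *v (c x v' *v w)) + (c x v *v (c x v' *v w) + c x v' *v (c x v *v w))
  = - of_real (metric M x v v + metric M x v' v' + 2 * metric M x v v') *s w"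
  by (simp add: linear_add[OF linear_c[OF x]] linear_add[OF l(1)] linear_add[OF l(2)] metric_facts(2)[of x v' v]
    matrix_vector_right_distrib matrix_vector_mult_add_rdistrib algebra_simps)
 then show ?thesis by (simp add: c_square_mv[OF x] vec_eq_iff algebra_simps eq_neg_iff_add_eq_0)
qed

text \<open>The Leibniz rule of the connection makes Clifford multiplication by df the symbol of
  \<open>D\<close>; it is written in an orthonormal frame.\<close>

lemma D_smult:
 assumes f: "smooth_fun_on M UNIV f" and u: "u \<in> sections M" and x: "x \<in> S" and e: "onf x e"
 shows "D (\<lambda>y. f y *s u y) x = f x *s D u x + (\<Sum>i\<in>UNIV. mdiff M f x (e i) *s (c x (e i) *v u x))"
 unfolding D_eq[OF section_smult[OF f u] x e] D_eq[OF u x e] nab_smult[OF x smooth_fun_on_subset[OF f subset_UNIV] u]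
 by (simp add: matrix_vector_right_distrib vector_smult_mv sum.distrib add.commute)
  (simp add: vec_eq_iff sum_distrib_left)

lemma D_add:
 assumes "u \<in> sections M" "w \<in> sections M" "x \<in> S"
 shows "D (\<lambda>y. u y + w y) x = D u x + D w x"
proof -
 obtain e where e: "onf x e" by (rule onf_exists)
 show ?thesis using D_eq[OF section_add[OF assms(1,2)] assms(3) e] D_eq[OF assms(1,3) e] D_eq[OF assms(2,3) e]
  by (simp add: nab_add[OF assms(3,1,2)] matrix_vector_right_distrib sum.distrib)
qed

lemma section_zero: "(\<lambda>x. 0) \<in> sections M"
 by (simp add: sections_iff smooth_fun_on_const)

lemma section_sum: "(\<And>a. a \<in> A ==> u a \<in> sections M) ==> (\<lambda>y. \<Sum>a\<in>A. u a y) \<in> sections M"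
 by (induction A rule: infinite_finite_induct) (simp_all add: section_zero section_add)

lemma D_sum:
 assumes "\<And>a. a \<in> A ==> u a \<in> sections M" "x \<in> S"
 shows "D (\<lambda>y. \<Sum>a\<in>A. u a y) x = (\<Sum>a\<in>A. D (u a) x)"
 using assms(1)
proof (induction A rule: infinite_finite_induct)
 case (insert a A)
 then show ?case using D_add[of "u a" "\<lambda>y. \<Sum>a\<in>A. u a y" x] section_sum[of A u] assms(2) by simp
qed (use D_add[OF section_zero section_zero assms(2)] in simp_all)

text \<open>A difference of sections that vanishes on \<open>S\<close> is its own product with the indicator function of
 the complement of \<open>S\<close>, which is smooth on \<open>S\<close>.\<close>

lemma D_local:
 assumes u: "u \<in> sections M" and w: "w \<in> sections M" and eq: "\<And>x. x \<in> S ==> u x = w x" and x: "x \<in> S"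
 shows "D u x = D w x"
proof -
 obtain e where e: "onf x e" by (rule onf_exists)
 define d where "d = (\<lambda>x. u x + (-1) *\<^sub>R w x)"
 have d: "d \<in> sections M" unfolding d_def by (rule section_add[OF u section_scaleR[OF w]])
 define f where "f x = (if x \<in> S then 0 else 1 :: complex)" for x
 have f: "smooth_fun_on M S f" by (rule smooth_fun_on_cong[OF smooth_fun_on_const S(1)]) (simp add: f_def)
 have "d = (\<lambda>y. f y *s d y)" by (rule ext) (simp add: f_def d_def eq)
 then have "nab x v d = mdiff M f x v *s d x + f x *s nab x v d" for v using nab_smult[OF x f d, of v] by simp
 then have "nab x v d = 0" for v using x eq[OF x] by (simp add: f_def d_def)
 then have "D d x = 0" using D_eq[OF d x e] by simp
 moreover have "u = (\<lambda>y. w y + d y)" by (rule ext) (simp add: d_def)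
 ultimately show ?thesis using D_add[OF w d x] by simp
qed

definition bt :: "'m => real" where
 "bt x = (if x \<in> fst ch then radial r (snd ch x) else 0)"

definition C0 :: "'m set" where
 "C0 = cinv ch ` cball 0 r"

lemma C0: "C0 \<subseteq> fst ch" "C0 \<subseteq> fst t" "C0 \<subseteq> S"
proof -
 have "cinv ch y \<in> fst ch \<inter> (fst t \<inter> S)" if "y \<in> cball 0 r" for y
 proof -
  from that r have "y \<in> N0" by blast
  then show ?thesis using cinv_in[OF cch] chart_image_iff[OF cch] by blast
 qed
 then show "C0 \<subseteq> fst ch" "C0 \<subseteq> fst t" "C0 \<subseteq> S" by (auto simp: C0_def)
qed

lemma r_sub: "cball 0 r \<subseteq> snd ch ` fst ch"
 using r(2) by blast

lemma bt: "smooth_fun_on M UNIV bt" "closed C0" "x \<notin> C0 ==> bt x = 0"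
 unfolding bt_def[abs_def] C0_def
 by (intro smooth_fun_of_chart[OF ch(1) r_sub smooth_on_radial radial_eq_0[OF r(1)]]; assumption)+

lemma bt_xb: "bt xb = 1"
 by (simp add: bt_def ch ch_xb radial_0)

lemma bt_cinv: "y \<in> N0 ==> bt (cinv ch y) = radial r y"
 using snd_cinv[OF cch] cinv_in[OF cch] by (auto simp: bt_def chart_image_iff[OF cch])

lemma smooth_cut:
 assumes f: "smooth_fun_on M W f" and W: "open W" "C0 \<subseteq> W"
 shows "smooth_fun_on M UNIV (\<lambda>x. bt x *\<^sub>R f x)"
proof -
 have 1: "smooth_fun_on M W (\<lambda>x. bt x *\<^sub>R f x)"
  by (rule smooth_fun_on_bounded_bilinear[OF bounded_bilinear_scaleR W(1) smooth_fun_on_subset[OF bt(1) subset_UNIV] f])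
 have 2: "smooth_fun_on M (- C0) (\<lambda>x. bt x *\<^sub>R f x)"
  by (rule smooth_fun_on_cong[OF smooth_fun_on_const[of _ 0]]) (use bt in auto)
 have "W \<union> - C0 = UNIV" using W by blast
 then show ?thesis using smooth_fun_on_Un[OF 1 2 W(1)] bt(2) by auto
qed

definition sec0 :: "complex ^ 'r => ('m, 'r) sec" where
 "sec0 w x = of_real (bt x) *s (cadj (snd t x) *v w)"

lemma sec0: "sec0 w \<in> sections M"
 unfolding sec0_def[abs_def]
 by (rule section_of_triv[OF t(1) smooth_fun_on_bounded_linear[OF bounded_linear_of_real open_UNIV bt(1)] bt(2) C0(2)]) (simp add: bt)

lemma sec0_xb: "sec0 w xb = cadj tx *v w"
 by (simp add: sec0_def bt_xb)

lemma t_inv: "tx *v (cadj tx *v w) = w" "cadj tx *v (tx *v w) = w"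
 using triv_unitary[OF t] by (simp_all add: matrix_vector_mul_assoc)

lemma mdiff_E: "smooth_fun_on M W f ==> open W ==> xb \<in> W ==> mdiff M f xb (E a) = pd (\<lambda>y. f (cinv ch y)) a 0"
 using mdiff_dvec[OF _ _ _ ch, of W f a] by (simp add: ch_xb)

lemma differentiable_0: "smooth_fun_on M W f ==> open W ==> xb \<in> W ==> (\<lambda>y. f (cinv ch y)) differentiable (at 0)"
 using smooth_fun_on_differentiable[OF _ _ _ ch, of W f] by (simp add: ch_xb)

lemma smooth_local_rep: "u \<in> sections M ==> smooth_on N0 (local_rep ch t u)"
 unfolding local_rep_def
 by (rule smooth_on_subset[OF smooth_fun_on_chart[of "fst t" "\<lambda>x. snd t x *v u x", OF _ triv_open[OF t(1)] ch(1)]])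
  (use t in \<open>auto simp: sections_iff\<close>)

text \<open>A cut-off copy of u is written as a sum of global functions f_a that vanish at xb times
  the sections \<open>sec0\<close>; in the Leibniz rule only the derivatives of the f_a survive at
  xb.\<close>

lemma D_vanish:
 assumes u: "u \<in> sections M" and u0: "u xb = 0"
 shows "D u xb = (\<Sum>i\<in>UNIV. c xb (E (axis i 1)) *v (cadj tx *v pd (local_rep ch t u) (axis i 1) 0))"
proof -
 let ?b = "\<lambda>x. complex_of_real (bt x)"
 have b: "smooth_fun_on M UNIV ?b" by (rule smooth_fun_on_bounded_linear[OF bounded_linear_of_real open_UNIV bt(1)])
 define f where "f a x = bt x *\<^sub>R (snd t x *v u x) $ a" for a x
 have ut: "smooth_fun_on M (fst t) (\<lambda>x. (snd t x *v u x) $ a)" for a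
  by (rule smooth_fun_on_bounded_linear[OF bounded_linear_vec_nth triv_open[OF t(1)]]) (use u t in \<open>simp add: sections_iff\<close>)
 have f: "smooth_fun_on M UNIV (f a)" for a
  unfolding f_def by (rule smooth_cut[OF ut triv_open[OF t(1)] C0(2)])
 have f0: "f a xb = 0" for a by (simp add: f_def u0)
 have df: "mdiff M (f a) xb (E h) = pd (local_rep ch t u) h 0 $ a" for a h
 proof -
  have dl: "local_rep ch t u differentiable (at 0)"
   by (rule smooth_on_differentiable[OF smooth_local_rep[OF u] N0])
  have dla: "(\<lambda>y. local_rep ch t u y $ a) differentiable (at 0)"
   using bounded_linear.has_derivative[OF bounded_linear_vec_nth pd_works[OF dl]] by (rule differentiableI)
  have dr: "radial r differentiable (at (0::real ^ 'd))"
   by (rule smooth_on_differentiable[OF smooth_on_radial open_UNIV UNIV_I])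
  have "mdiff M (f a) xb (E h) = pd (\<lambda>y. radial r y *\<^sub>R (local_rep ch t u y $ a)) h 0"
   unfolding mdiff_E[OF f open_UNIV UNIV_I]
   by (rule pd_cong_open[OF N0]) (simp add: f_def local_rep_def bt_cinv)
  also have "\<dots> = pd (\<lambda>y. local_rep ch t u y $ a) h 0"
   by (subst pd_bounded_bilinear[OF bounded_bilinear_scaleR dr dla]) (simp add: u0 radial_0 local_rep_def cinv_0)
  also have "\<dots> = pd (local_rep ch t u) h 0 $ a" by (rule pd_bounded_linear[OF bounded_linear_vec_nth dl])
  finally show ?thesis .
 qed
 have bu: "(\<lambda>x. ?b x *s u x) \<in> sections M" by (rule section_smult[OF b u])
 \<comment> \<open>One factor \<open>bt\<close> globalizes the coefficients, the other one the
   frame. Although \<open>bt\<close> is not constant near xb, both leave \<open>D u xb\<close>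
   unchanged: bt xb = 1, and u xb = 0 kills the terms with its derivative.\<close>
 have "D (\<lambda>x. ?b x *s (?b x *s u x)) xb = D u xb"
  using D_smult[OF b bu S(2) onf_E] D_smult[OF b u S(2) onf_E] by (simp add: bt_xb u0)
 moreover have "(\<lambda>x. ?b x *s (?b x *s u x)) = (\<lambda>x. \<Sum>a\<in>UNIV. f a x *s sec0 (axis a 1) x)"
 proof
  fix x
  show "?b x *s (?b x *s u x) = (\<Sum>a\<in>UNIV. f a x *s sec0 (axis a 1) x)"
  proof (cases "x \<in> fst t")
   case True
   have "(\<Sum>a\<in>UNIV. f a x *s sec0 (axis a 1) x)
    = cadj (snd t x) *v (\<Sum>a\<in>UNIV. (?b x * ?b x) *s ((snd t x *v u x) $ a *s axis a 1))"
    by (simp add: mv_sum f_def sec0_def vector_smult_mv vector_smult_assoc scaleR_conv_of_real mult_ac)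
   also have "(\<Sum>a\<in>UNIV. (?b x * ?b x) *s ((snd t x *v u x) $ a *s axis a 1)) = (?b x * ?b x) *s (snd t x *v u x)"
    by (subst (2) basis_expansion[symmetric]) (simp add: vec_eq_iff sum_distrib_left)
   finally show ?thesis using triv_unitary[OF t(1) True]
    by (simp add: vector_smult_mv matrix_vector_mul_assoc vector_smult_assoc)
  next
   case False
   then have "bt x = 0" using C0(2) bt(3) by blast
   then show ?thesis by (simp add: f_def)
  qed
 qed
 moreover have "D (\<lambda>x. \<Sum>a\<in>UNIV. f a x *s sec0 (axis a 1) x) xb
   = (\<Sum>a\<in>UNIV. \<Sum>i\<in>UNIV. pd (local_rep ch t u) (axis i 1) 0 $ a *s (c xb (E (axis i 1)) *v (cadj tx *v axis a 1)))"
  by (subst D_sum[OF section_smult[OF f sec0] S(2)])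
   (simp add: D_smult[OF f sec0 S(2) onf_E] f0 df sec0_xb)
 ultimately have "D u xb = (\<Sum>i\<in>UNIV. \<Sum>a\<in>UNIV. pd (local_rep ch t u) (axis i 1) 0 $ a *s (c xb (E (axis i 1)) *v (cadj tx *v axis a 1)))"
  by (subst sum.swap) simp
 also have "\<dots> = (\<Sum>i\<in>UNIV. c xb (E (axis i 1)) *v (cadj tx *v (\<Sum>a\<in>UNIV. pd (local_rep ch t u) (axis i 1) 0 $ a *s axis a 1)))"
  by (simp add: mv_sum vector_smult_mv)
 finally show ?thesis by (simp only: basis_expansion)
qed

text \<open>The i-th normal coordinate made global; it vanishes at xb, and its differential there is
  dx_i.\<close>

definition ph :: "'d => 'm => complex" where
 "ph i x = (if x \<in> fst ch then of_real (radial r (snd ch x) * snd ch x $ i) else 0)"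

lemma smooth_rad_coord: "smooth_on UNIV (\<lambda>y::real ^ 'd. radial r y * y $ i)"
 by (rule smooth_on_mult[OF open_UNIV smooth_on_radial smooth_on_linear[OF bounded_linear_vec_nth]])

lemma ph: "smooth_fun_on M UNIV (ph i)"
proof -
 have "smooth_on UNIV (\<lambda>y::real ^ 'd. complex_of_real (radial r y * y $ i))"
  by (rule smooth_on_bounded_linear[OF bounded_linear_of_real open_UNIV smooth_rad_coord])
 from smooth_fun_of_chart(1)[OF ch(1) r_sub this] show ?thesis
  unfolding ph_def[abs_def] by (simp add: radial_eq_0[OF r(1)])
qed

lemma ph_xb: "ph i xb = 0"
 by (simp add: ph_def ch_xb)

lemma pd_rad_coord: "pd (\<lambda>y::real ^ 'd. radial r y * y $ i) h 0 = h $ i"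
proof -
 have dr: "radial r differentiable (at (0::real ^ 'd))"
  by (rule smooth_on_differentiable[OF smooth_on_radial open_UNIV UNIV_I])
 show ?thesis
  by (subst pd_mult[OF dr bounded_linear_imp_differentiable[OF bounded_linear_vec_nth]])
   (simp add: radial_0 pd_eq_of_has_derivative[OF bounded_linear_imp_has_derivative[OF bounded_linear_vec_nth]])
qed

lemma mdiff_ph: "mdiff M (ph i) xb (E h) = of_real (h $ i)"
proof -
 have "mdiff M (ph i) xb (E h) = pd (\<lambda>y. complex_of_real (radial r y * y $ i)) h 0"
  unfolding mdiff_E[OF ph open_UNIV UNIV_I]
  by (rule pd_cong_open[OF N0]) (use snd_cinv[OF cch] cinv_in[OF cch] in \<open>auto simp: ph_def chart_image_iff[OF cch]\<close>)
 also have "\<dots> = of_real (pd (\<lambda>y. radial r y * y $ i) h 0)"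
  by (rule pd_bounded_linear[OF bounded_linear_of_real smooth_on_differentiable[OF smooth_rad_coord open_UNIV UNIV_I]])
 finally show ?thesis by (simp add: pd_rad_coord)
qed

lemma D_ph:
 assumes "u \<in> sections M"
 shows "D (\<lambda>x. ph i x *s u x) xb = c xb (E (axis i 1)) *v u xb"
proof -
 have "(\<Sum>j\<in>UNIV. mdiff M (ph i) xb (E (axis j 1)) *s (c xb (E (axis j 1)) *v u xb))
   = (\<Sum>j\<in>UNIV. if j = i then c xb (E (axis i 1)) *v u xb else 0)"
  by (rule sum.cong) (auto simp: mdiff_ph axis_def)
 then show ?thesis by (simp add: D_smult[OF ph assms S(2) onf_E] ph_xb)
qed

text \<open>A second order operator is tested on x_i x_j s; what survives at xb is c_i c_j + c_j
  c_i, to which the Clifford relation applies.\<close>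

lemma D_D_ph_ph:
 assumes s: "s \<in> sections M"
 shows "D (D (\<lambda>x. ph i x *s (ph j x *s s x))) xb = - of_real (if i = j then 2 else 0) *s s xb"
proof -
 \<comment> \<open>T is the commutator of \<open>D\<close> with \<open>ph i\<close> applied to s,
   that is, Clifford multiplication of s by d(ph i). Written as a difference it is visibly a global
   section, while the Clifford formula holds only on S.\<close>
 define T where "T = (\<lambda>x. D (\<lambda>x. ph i x *s s x) x + (-1) *\<^sub>R (ph i x *s D s x))"
 have T: "T \<in> sections M"
  unfolding T_def by (intro section_add section_scaleR D_section section_smult ph s)
 note pj = section_smult[OF ph s, of j] and pi = section_smult[OF ph s, of i]
 note Dpj = D_section[OF pj]
 let ?Y = "\<lambda>x. ph i x *s D (\<lambda>x. ph j x *s s x) x + ph j x *s T x"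
 have Y: "?Y \<in> sections M" by (intro section_add section_smult ph T Dpj)
 have X: "D (\<lambda>x. ph i x *s (ph j x *s s x)) \<in> sections M" by (intro D_section section_smult ph s)
 have "D (\<lambda>x. ph i x *s (ph j x *s s x)) x = ?Y x" if x: "x \<in> S" for x
 proof -
  obtain e where e: "onf x e" by (rule onf_exists)
  have "T x = (\<Sum>k\<in>UNIV. mdiff M (ph i) x (e k) *s (c x (e k) *v s x))"
   unfolding T_def D_smult[OF ph s x e] by simp
  then have "ph j x *s T x = (\<Sum>k\<in>UNIV. mdiff M (ph i) x (e k) *s (c x (e k) *v (ph j x *s s x)))"
   by (simp add: vector_smult_mv vec_eq_iff sum_distrib_left mult_ac)
  then show ?thesis unfolding D_smult[OF ph pj x e] by simp
 qed
 from D_local[OF X Y this S(2)]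
 have "D (D (\<lambda>x. ph i x *s (ph j x *s s x))) xb = D ?Y xb" by simp
 also have "\<dots> = D (\<lambda>x. ph i x *s D (\<lambda>x. ph j x *s s x) x) xb + D (\<lambda>x. ph j x *s T x) xb"
  by (rule D_add[OF section_smult[OF ph Dpj] section_smult[OF ph T] S(2)])
 finally have X2: "D (D (\<lambda>x. ph i x *s (ph j x *s s x))) xb = D (\<lambda>x. ph i x *s D (\<lambda>x. ph j x *s s x) x) xb + D (\<lambda>x. ph j x *s T x) xb" .
 have Txb: "T xb = c xb (E (axis i 1)) *v s xb" by (simp add: T_def D_ph[OF s] ph_xb)
 have "D (\<lambda>x. ph i x *s D (\<lambda>x. ph j x *s s x) x) xb + D (\<lambda>x. ph j x *s T x) xb
  = c xb (E (axis i 1)) *v (c xb (E (axis j 1)) *v s xb) + c xb (E (axis j 1)) *v (c xb (E (axis i 1)) *v s xb)"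
  by (simp only: D_ph[OF Dpj] D_ph[OF T] D_ph[OF s] Txb)
 also have "\<dots> = - of_real (if i = j then 2 else 0) *s s xb"
  using c_anticomm[OF S(2), of "E (axis i 1)" "E (axis j 1)" "s xb"] onf_E by (simp add: onf_def)
 finally show ?thesis by (simp only: X2)
qed

end

text \<open>Both factors vanish at x, so only the terms with one derivative on each factor remain.
  It serves for Z^2 and for products of coordinates.\<close>

lemma pd2_bilinear:
 assumes h: "bounded_bilinear h" and W: "open W" "x \<in> W" and f: "smooth_on W f" "f x = 0" and g: "smooth_on W g" "g x = 0"
 shows "pd (\<lambda>y. h (f y) (g y)) a x = 0"
  "pd (pd (\<lambda>y. h (f y) (g y)) a) b x = h (pd f b x) (pd g a x) + h (pd f a x) (pd g b x)"
proof -
 note d = smooth_on_differentiable[OF _ W(1)]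
 note z = bounded_bilinear.zero_left[OF h] bounded_bilinear.zero_right[OF h]
 have e: "pd (\<lambda>y. h (f y) (g y)) a y = h (f y) (pd g a y) + h (pd f a y) (g y)" if "y \<in> W" for y
  by (rule pd_bounded_bilinear[OF h d[OF f(1) that] d[OF g(1) that]])
 show "pd (\<lambda>y. h (f y) (g y)) a x = 0" using e[OF W(2)] f g z by simp
 note df = d[OF f(1) W(2)] and dg = d[OF g(1) W(2)] and df' = d[OF smooth_on_pd[OF f(1)] W(2)] and dg' = d[OF smooth_on_pd[OF g(1)] W(2)]
 have "pd (pd (\<lambda>y. h (f y) (g y)) a) b x = pd (\<lambda>y. h (f y) (pd g a y) + h (pd f a y) (g y)) b x"
  by (rule pd_cong_open[OF W e])
 also have "\<dots> = pd (\<lambda>y. h (f y) (pd g a y)) b x + pd (\<lambda>y. h (pd f a y) (g y)) b x"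
  by (rule pd_add; rule d[OF smooth_on_bounded_bilinear[OF h W(1)] W(2)]; intro smooth_on_pd f(1) g(1))
 finally show "pd (pd (\<lambda>y. h (f y) (g y)) a) b x = h (pd f b x) (pd g a x) + h (pd f a x) (pd g b x)"
  unfolding pd_bounded_bilinear[OF h df dg'] pd_bounded_bilinear[OF h df' dg] using f g z by simp
qed

section \<open>The vector field of a one-parameter subgroup\<close>

context tbun
begin

text \<open>The infinitesimal generator in the coordinates of c. It is taken as a derivative of the
  joint map of (y, \<theta>), which makes its dependence on y accessible to calculus.\<close>

definition gen :: "('m, 'd) chart => real ^ 'p => real ^ 'd => real ^ 'd" where
 "gen c v y = pd (\<lambda>z. snd c (orbit_map c z)) (0, v) (y, 0)"

lemma orbit_deriv_chart:
 fixes f :: "'m => 'b::real_normed_vector"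
 assumes c: "smooth_chart M c" "x \<in> fst c" and f: "smooth_fun_on M T f" "open T" "x \<in> T"
 shows "((\<lambda>s. f (ract M x (s *\<^sub>R v))) has_vector_derivative mdiff M f x (dvec M c x (gen c v (snd c x)))) (at 0)"
proof -
 note cc = smooth_chartD[OF c(1)] and oc = orbit_chart[OF c(1)]
 have op: "open (fst c)" using cc by (simp add: chart_def)
 have y: "snd c x \<in> snd c ` fst c" using c by blast
 define \<Phi> where "\<Phi> = (\<lambda>z. snd c (orbit_map c z))"
 note z0 = oc(3)[OF y]
 have sm: "smooth_on (orbit_dom c UNIV (fst c)) \<Phi>" using oc(2) by (simp add: \<Phi>_def)
 note d\<Phi> = smooth_on_has_derivative[OF sm oc(1) z0] and l\<Phi> = pd_linear[OF sm oc(1) z0]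
 let ?P = "\<lambda>s. (snd c x, s *\<^sub>R v)"
 have P: "(?P has_derivative (\<lambda>s. (0, s *\<^sub>R v))) (at 0)" by (auto intro!: derivative_eq_intros)
 have "((\<lambda>s. \<Phi> (?P s)) has_derivative (\<lambda>s. pd \<Phi> (0, s *\<^sub>R v) (snd c x, 0))) (at 0)"
  using has_derivative_compose[OF P, of \<Phi> "\<lambda>w. pd \<Phi> w (snd c x, 0)"] d\<Phi> by simp
 moreover have "pd \<Phi> (0, s *\<^sub>R v) (snd c x, 0) = s *\<^sub>R gen c v (snd c x)" for s
  using linear_scale[OF l\<Phi>, of s "(0, v)"] by (simp add: gen_def \<Phi>_def)
 ultimately have g: "((\<lambda>s. \<Phi> (?P s)) has_derivative (\<lambda>s. s *\<^sub>R gen c v (snd c x))) (at 0)" by simp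
 have \<Phi>0: "\<Phi> (?P 0) = snd c x" by (simp add: \<Phi>_def orbit_map_def ract_0 cinv_snd[OF cc c(2)])
 note fd = smooth_fun_on_differentiable[OF f c]
 have "((\<lambda>s. f (cinv c (\<Phi> (?P s)))) has_derivative (\<lambda>s. pd (\<lambda>y. f (cinv c y)) (s *\<^sub>R gen c v (snd c x)) (snd c x))) (at 0)"
  by (rule has_derivative_compose[OF g, unfolded \<Phi>0, OF pd_works[OF fd]])
 moreover have "pd (\<lambda>y. f (cinv c y)) (s *\<^sub>R w) (snd c x) = s *\<^sub>R pd (\<lambda>y. f (cinv c y)) w (snd c x)" for s w
  using linear_scale[OF has_derivative_linear[OF pd_works[OF fd]]] .
 ultimately have "((\<lambda>s. f (cinv c (\<Phi> (?P s)))) has_vector_derivative mdiff M f x (dvec M c x (gen c v (snd c x)))) (at 0)"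
  by (simp add: has_vector_derivative_def mdiff_dvec[OF f c])
 moreover have "open ((\<lambda>s. ract M x (s *\<^sub>R v)) -` fst c)"
  by (rule open_vimage[OF op], rule continuous_on_compose2[OF continuous_ract, of _ "\<lambda>s. (x, s *\<^sub>R v)", simplified])
   (intro continuous_intros)
 ultimately show ?thesis
  by (rule has_vector_derivative_transform_within_open)
   (use c in \<open>simp_all add: ract_0 \<Phi>_def orbit_map_def cinv_snd[OF cc c(2)] cinv_snd[OF cc]\<close>)
qed

text \<open>\<open>orbit_field\<close> has its components in the chart picked at each point, a
  choice that may jump; \<open>gen\<close> describes the same vector in one fixed chart.\<close>

lemma orbit_field_eq:
 assumes c: "smooth_chart M c" "x \<in> fst c"
 shows "orbit_field M v x = dvec M c x (gen c v (snd c x))"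
proof -
 define ca where "ca = chart_at M x"
 have ca: "smooth_chart M ca" "x \<in> fst ca" using atlas_smooth_chart[OF chart_at(1)] chart_at(2) unfolding ca_def by auto
 have op: "open (fst ca)" using smooth_chartD[OF ca(1)] by (simp add: chart_def)
 let ?V = "dvec M c x (gen c v (snd c x))"
 have op': "open (snd ca ` fst ca)" using smooth_chartD[OF ca(1)] by (simp add: chart_def)
 have "orbit_field M v x = mdiff M (snd ca) x ?V"
  using vector_derivative_at[OF orbit_deriv_chart[OF c smooth_fun_on_snd[OF ca(1)] op ca(2)]]
  by (simp add: orbit_field_def ca_def)
 also have "\<dots> = pd (\<lambda>y. snd ca (cinv ca y)) ?V (snd ca x)" by (simp add: mdiff_def pd_def ca_def o_def)
 also have "\<dots> = pd (\<lambda>y. y) ?V (snd ca x)"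
  by (rule pd_cong_open[OF op']) (use ca snd_cinv[OF smooth_chartD[OF ca(1)]] in auto)
 also have "\<dots> = ?V" by (rule pd_eq_of_has_derivative) (rule has_derivative_ident)
 finally show ?thesis .
qed

lemma orbit_deriv:
 fixes f :: "'m => 'b::real_normed_vector"
 assumes "smooth_fun_on M T f" "open T" "x \<in> T"
 shows "((\<lambda>s. f (ract M x (s *\<^sub>R v))) has_vector_derivative mdiff M f x (orbit_field M v x)) (at 0)"
 using orbit_deriv_chart[OF atlas_smooth_chart[OF chart_at(1)] chart_at(2) assms]
  orbit_field_eq[OF atlas_smooth_chart[OF chart_at(1)] chart_at(2)] by simp

end

section \<open>The bundle map Z near the fixed point\<close>

locale dirac_Z = dirac_pt M D S c nab xb ch t r
 for M :: "('m::t2_space, 'd::finite, 'p::finite, 'r::finite, 'z) tbundle_scheme" and D S c nab xb ch t r +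
 fixes Z :: "('m, 'r) endo" and vv :: "real ^ 'p" and R :: "real ^ 'p => real ^ 'd => real ^ 'd"
 assumes Z_smooth: "smooth_endo_on M UNIV Z"
  and Z_eq: "\<And>x w. x \<in> S ==> Z x *v w = \<i> *s (c x (orbit_field M vv x) *v w)"
  and fixed: "\<And>\<theta>. ract M xb \<theta> = xb"
  and R: "\<And>\<theta> w. mdiff M (\<lambda>x. snd ch (ract M x \<theta>)) xb w = R \<theta> (mdiff M (snd ch) xb w)"
begin

abbreviation "X \<equiv> gen ch vv"
text \<open>The generator of the linearized action R; it turns out to be the derivative of the field
  X at its zero.\<close>

definition "X' a = pd (\<lambda>\<theta>. R \<theta> a) vv 0"

lemma mdiff_snd_E: "mdiff M (snd ch) xb (E a) = a"
 by (rule mdiff_snd_dvec[OF ch])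

text \<open>For the joint map of (y, \<theta>) the derivative in \<theta> at \<theta> = 0 along
  \<open>vv\<close> is X(y), and the derivative in y at the fixed point y = 0 is R \<theta>.
  Equality of mixed derivatives identifies the linearization of X with the generator of R.\<close>

lemma X_0: "X 0 = 0" and X_deriv: "(X has_derivative X') (at 0)"
proof -
 note oc = orbit_chart[OF ch(1)]
 define \<Phi> where "\<Phi> = (\<lambda>z. snd ch (orbit_map ch z))"
 let ?D = "orbit_dom ch UNIV (fst ch)"
 have sm: "smooth_on ?D \<Phi>" using oc(2) by (simp add: \<Phi>_def)
 have in_D: "(0, \<theta>) \<in> ?D" for \<theta>
  using ch ch_xb by (force simp: orbit_dom_def orbit_map_def cinv_0 fixed)
 note d = smooth_on_differentiable[OF _ oc(1) in_D]
 have "X 0 = pd (\<lambda>\<theta>. \<Phi> (0, \<theta>)) vv 0"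
  unfolding gen_def using pd_slice(2)[OF d[OF sm], where b=vv] by (simp add: \<Phi>_def)
 also have "(\<lambda>\<theta>. \<Phi> (0, \<theta>)) = (\<lambda>\<theta>. 0)" by (simp add: \<Phi>_def orbit_map_def cinv_0 fixed ch_xb)
 finally show "X 0 = 0" by (simp add: pd_eq_of_has_derivative[OF has_derivative_const])
 have dR: "pd \<Phi> (a, 0) (0, \<theta>) = R \<theta> a" for a \<theta>
 proof -
  have "pd \<Phi> (a, 0) (0, \<theta>) = pd (\<lambda>y. \<Phi> (y, \<theta>)) a 0" by (rule pd_slice(1)[OF d[OF sm], symmetric])
  also have "\<dots> = R \<theta> a" using pd_orbit_fixed[OF ch fixed, of \<theta> "E a"] R[of \<theta> "E a"] by (simp add: \<Phi>_def mdiff_snd_E ch_xb)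
  finally show ?thesis .
 qed
 have X: "X = (\<lambda>y. pd \<Phi> (0, vv) (y, 0))" by (simp add: gen_def[abs_def] \<Phi>_def)
 have "((\<lambda>y. (y, 0)) has_derivative (\<lambda>a. (a, 0))) (at (0::real ^ 'd))" by (auto intro!: derivative_eq_intros)
 from has_derivative_compose[OF this pd_works[OF d[OF smooth_on_pd[OF sm]]]]
 have "(X has_derivative (\<lambda>a. pd (pd \<Phi> (0, vv)) (a, 0) (0, 0))) (at 0)" unfolding X .
 moreover have "pd (pd \<Phi> (0, vv)) (a, 0) (0, 0) = X' a" for a
 proof -
  have "pd (pd \<Phi> (0, vv)) (a, 0) (0, 0) = pd (pd \<Phi> (a, 0)) (0, vv) (0, 0)"
   by (rule pd_commute[OF oc(1) in_D sm])
  also have "\<dots> = pd (\<lambda>\<theta>. pd \<Phi> (a, 0) (0, \<theta>)) vv 0" by (rule pd_slice(2)[OF d[OF smooth_on_pd[OF sm]], symmetric])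
  finally show ?thesis by (simp add: dR X'_def)
 qed
 ultimately show "(X has_derivative X') (at 0)" by simp
qed

text \<open>Clifford multiplication is known to be smooth along vector fields that are smooth on all
  of S, so the coordinate fields of the normal chart have to be cut off.\<close>

definition vf :: "'d => 'm => real ^ 'd" where
 "vf k x = bt x *\<^sub>R dvec M ch x (axis k 1)"

lemma smooth_vf: "smooth_vfield_on M S (vf k)"
 unfolding smooth_vfield_on_def
proof
 fix c' assume c': "c' \<in> atlas M"
 note c's = atlas_smooth_chart[OF c'] and cc' = atlas_chart[OF c']
 have o': "open (fst c')" using cc' by (simp add: chart_def)
 let ?f = "\<lambda>x. mdiff M (snd c') x (vf k x)"
 have lin: "linear (mdiff M (snd c') x)" if "x \<in> fst c'" for x
  by (rule linear_mdiff[OF smooth_fun_on_snd[OF c's] o' that])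
 define F where "F = pd (\<lambda>y. snd c' (cinv ch y)) (axis k 1)"
 define Q where "Q = snd ch ` (fst ch \<inter> fst c')"
 have Q: "open Q" unfolding Q_def by (rule chart_open_image[OF cch o'])
 have F: "smooth_on Q F" unfolding F_def Q_def
  by (rule smooth_on_pd, rule smooth_fun_on_chart[OF smooth_fun_on_snd[OF c's] o' ch(1)])
 have 1: "smooth_fun_on M (fst ch \<inter> fst c') (\<lambda>x. F (snd ch x))"
  unfolding smooth_fun_on_def
 proof
  fix c2 assume c2: "c2 \<in> atlas M"
  note cc2 = atlas_chart[OF c2]
  have o: "open (snd c2 ` (fst c2 \<inter> (fst ch \<inter> fst c')))" by (rule chart_open_image[OF cc2]) (use open_ch o' in blast)
  have "smooth_on (snd c2 ` (fst c2 \<inter> (fst ch \<inter> fst c'))) (\<lambda>y. F ((snd ch \<circ> cinv c2) y))"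
   by (rule smooth_on_compose[OF o Q _ _ F])
    (use smooth_fun_on_subset[OF smooth_fun_on_snd[OF ch(1)], of "fst ch \<inter> fst c'"] c2
     in \<open>auto simp: Q_def chart_image_iff[OF cc2] smooth_fun_on_def o_def\<close>)
  then show "smooth_on (snd c2 ` (fst c2 \<inter> (fst ch \<inter> fst c'))) ((\<lambda>x. F (snd ch x)) \<circ> cinv c2)" by (simp add: o_def)
 qed
 have op: "open (fst ch \<inter> fst c')" using open_ch o' by blast
 have "smooth_fun_on M (fst ch \<inter> fst c') (\<lambda>x. bt x *\<^sub>R F (snd ch x))"
  by (rule smooth_fun_on_bounded_bilinear[OF bounded_bilinear_scaleR op smooth_fun_on_subset[OF bt(1) subset_UNIV] 1])
 then have 2: "smooth_fun_on M (fst ch \<inter> fst c') ?f"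
 proof (rule smooth_fun_on_cong[OF _ op])
  fix x assume x: "x \<in> fst ch \<inter> fst c'"
  then have "mdiff M (snd c') x (dvec M ch x (axis k 1)) = F (snd ch x)"
   unfolding F_def by (intro mdiff_dvec[OF smooth_fun_on_snd[OF c's] o' _ ch(1)]) auto
  then show "bt x *\<^sub>R F (snd ch x) = ?f x" using x by (simp add: vf_def linear_scale[OF lin])
 qed
 have o3: "open (fst c' - C0)" by (rule open_Diff[OF o' bt(2)])
 have 3: "smooth_fun_on M (fst c' - C0) ?f"
  by (rule smooth_fun_on_cong[OF smooth_fun_on_const[of _ 0] o3]) (simp add: vf_def bt linear_0[OF lin])
 have "(fst ch \<inter> fst c') \<union> (fst c' - C0) = fst c'" using C0 by blast
 then have "smooth_fun_on M (fst c') ?f" using smooth_fun_on_Un[OF 2 3 op o3] by simp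
 then have "smooth_on (snd c' ` fst c') (?f \<circ> cinv c')" using c' by (auto simp: smooth_fun_on_def)
 then show "smooth_on (snd c' ` (fst c' \<inter> S)) (\<lambda>y. mdiff M (snd c') (cinv c' y) (vf k (cinv c' y)))"
  unfolding o_def by (rule smooth_on_subset) blast
qed

definition tconj :: "('m, 'r) endo => real ^ 'd => complex ^ 'r ^ 'r" where
 "tconj A y = snd t (cinv ch y) ** A (cinv ch y) ** cadj (snd t (cinv ch y))"

lemma smooth_tconj: "smooth_endo_on M S A ==> smooth_on N0 (tconj A)"
 unfolding tconj_def[abs_def]
 by (rule smooth_fun_on_chart[OF _ _ ch(1)]) (use t S triv_open[OF t(1)] in \<open>auto simp: smooth_endo_iff\<close>)

lemma N0_cinv: "y \<in> N0 ==> cinv ch y \<in> fst ch" "y \<in> N0 ==> cinv ch y \<in> fst t" "y \<in> N0 ==> cinv ch y \<in> S"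
 using chart_image_iff[OF cch] cinv_in[OF cch] by auto

lemma Z_xb: "Z xb *v w = 0"
proof -
 have "orbit_field M vv xb = 0"
  unfolding orbit_field_eq[OF ch] ch_xb X_0 by (rule linear_0[OF linear_dvec[OF ch]])
 then show ?thesis using Z_eq[OF S(2)] linear_0[OF linear_c[OF S(2)]] by simp
qed

text \<open>Since Z = i c(V) with V zero at xb, differentiation reaches only the coefficients of V
  and replaces V by its linearization.\<close>

lemma pd_tconj_Z: "pd (tconj Z) a 0 *v w = \<i> *s (tx *v (c xb (E (X' a)) *v (cadj tx *v w)))"
proof -
 define C where "C k = tconj (\<lambda>x. c x (vf k x))" for k
 have "smooth_endo_on M S (\<lambda>x. c x (vf k x))" for k
  using dirac smooth_vf unfolding dirac_near_def clifford_structure_on_def by blast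
 then have C: "smooth_on N0 (C k)" for k unfolding C_def by (rule smooth_tconj)
 note dC = smooth_on_has_derivative[OF C N0]
 have sW: "smooth_on N0 (tconj Z)" by (rule smooth_tconj[OF smooth_endo_on_subset[OF Z_smooth]])
 note dW = smooth_on_differentiable[OF sW N0]
 have dWw: "(\<lambda>y. tconj Z y *v w) differentiable (at 0)"
  by (rule differentiableI[OF bounded_linear.has_derivative[OF bounded_bilinear.bounded_linear_left[OF bounded_bilinear_mv] pd_works[OF dW]]])
 have W0: "tconj Z 0 *v w = 0" by (simp add: tconj_def cinv_0 matrix_vector_mul_assoc[symmetric] Z_xb)
 have dr: "radial r differentiable (at (0::real ^ 'd))"
  by (rule smooth_on_differentiable[OF smooth_on_radial open_UNIV UNIV_I])
 have "pd (tconj Z) a 0 *v w = pd (\<lambda>y. tconj Z y *v w) a 0"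
  by (rule pd_bounded_linear[OF bounded_bilinear.bounded_linear_left[OF bounded_bilinear_mv] dW, symmetric])
 \<comment> \<open>The cutoff does not change the derivative because the map vanishes at 0; it turns
   the coordinate fields into the fields \<open>vf\<close>.\<close>
 also have "\<dots> = pd (\<lambda>y. radial r y *\<^sub>R (tconj Z y *v w)) a 0"
  by (subst pd_bounded_bilinear[OF bounded_bilinear_scaleR dr dWw]) (simp add: W0 radial_0)
 also have "\<dots> = pd (\<lambda>y. \<i> *s (\<Sum>k\<in>UNIV. X y $ k *\<^sub>R (C k y *v w))) a 0"
 proof (rule pd_cong_open[OF N0])
  fix y assume y: "y \<in> N0"
  let ?x = "cinv ch y"
  note x = N0_cinv[OF y]
  have y': "y \<in> snd ch ` fst ch" using y by blast
  note ld = linear_dvec[OF ch(1) x(1)] and lc = linear_c[OF x(3)]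
  have "dvec M ch ?x (X y) = (\<Sum>k\<in>UNIV. X y $ k *\<^sub>R dvec M ch ?x (axis k 1))"
   by (subst basis_expansion[of "X y", symmetric, unfolded scalar_mult_eq_scaleR]) (simp add: linear_sum[OF ld] linear_scale[OF ld])
  then have "radial r y *\<^sub>R c ?x (orbit_field M vv ?x) = (\<Sum>k\<in>UNIV. X y $ k *\<^sub>R c ?x (vf k ?x))"
   by (simp add: orbit_field_eq[OF ch(1) x(1)] snd_cinv[OF cch y'] vf_def bt_cinv[OF y] linear_sum[OF lc] linear_scale[OF lc] scaleR_sum_right mult.commute)
  then have "radial r y *\<^sub>R (c ?x (orbit_field M vv ?x) *v w') = (\<Sum>k\<in>UNIV. X y $ k *\<^sub>R (c ?x (vf k ?x) *v w'))" for w'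
   by (simp add: scaleR_mv[symmetric] sum_mv[symmetric])
  note e = this[of "cadj (snd t ?x) *v w"]
  have "radial r y *\<^sub>R (tconj Z y *v w) = \<i> *s (snd t ?x *v (radial r y *\<^sub>R (c ?x (orbit_field M vv ?x) *v (cadj (snd t ?x) *v w))))"
   by (simp add: tconj_def matrix_vector_mul_assoc[symmetric] Z_eq[OF x(3)] vector_smult_mv mv_scaleR) (simp add: vec_eq_iff)
  also have "\<dots> = \<i> *s (\<Sum>k\<in>UNIV. X y $ k *\<^sub>R (C k y *v w))"
   unfolding e by (simp add: mv_sum mv_scaleR C_def tconj_def matrix_vector_mul_assoc[symmetric])
  finally show "radial r y *\<^sub>R (tconj Z y *v w) = \<i> *s (\<Sum>k\<in>UNIV. X y $ k *\<^sub>R (C k y *v w))" .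
 qed
 also have "\<dots> = \<i> *s (\<Sum>k\<in>UNIV. X' a $ k *\<^sub>R (C k 0 *v w))"
 proof (rule pd_eq_of_has_derivative)
  have "((\<lambda>y. X y $ k *\<^sub>R (C k y *v w)) has_derivative (\<lambda>a. X' a $ k *\<^sub>R (C k 0 *v w))) (at 0)" for k
   by (rule has_derivative_eq_rhs, rule bounded_bilinear.FDERIV[OF bounded_bilinear_scaleR
      bounded_linear.has_derivative[OF bounded_linear_vec_nth X_deriv]
      bounded_linear.has_derivative[OF bounded_bilinear.bounded_linear_left[OF bounded_bilinear_mv] dC]])
    (simp add: X_0)
  from bounded_linear.has_derivative[OF bounded_bilinear.bounded_linear_right[OF bounded_bilinear_vscale] has_derivative_sum[OF this]]
  show "((\<lambda>y. \<i> *s (\<Sum>k\<in>UNIV. X y $ k *\<^sub>R (C k y *v w))) has_derivative (\<lambda>a. \<i> *s (\<Sum>k\<in>UNIV. X' a $ k *\<^sub>R (C k 0 *v w)))) (at 0)" .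
 qed
 also have "(\<Sum>k\<in>UNIV. X' a $ k *\<^sub>R (C k 0 *v w)) = tx *v (c xb (E (X' a)) *v (cadj tx *v w))"
 proof -
  note ld = linear_dvec[OF ch] and lc = linear_c[OF S(2)]
  have "c xb (E (X' a)) = (\<Sum>k\<in>UNIV. X' a $ k *\<^sub>R c xb (E (axis k 1)))"
   by (subst basis_expansion[of "X' a", symmetric, unfolded scalar_mult_eq_scaleR])
    (simp add: linear_sum[OF ld] linear_scale[OF ld] linear_sum[OF lc] linear_scale[OF lc])
  then show ?thesis
   by (simp add: C_def tconj_def cinv_0 vf_def bt_xb sum_mv mv_sum scaleR_mv mv_scaleR matrix_vector_mul_assoc[symmetric])
 qed
 finally show ?thesis .
qed

lemma metric_E: "metric M xb (E v) (E v) = (norm v)\<^sup>2"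
proof -
 note ld = linear_dvec[OF ch]
 have l: "linear (\<lambda>v. metric M xb v v')" "linear (metric M xb v')" for v'
  using metric_facts(1)[of xb] by (auto simp: bilinear_def)
 have Ev: "E v = (\<Sum>k\<in>UNIV. v $ k *\<^sub>R E (axis k 1))"
  by (subst basis_expansion[of v, symmetric, unfolded scalar_mult_eq_scaleR]) (simp add: linear_sum[OF ld] linear_scale[OF ld])
 have "metric M xb (E (axis i 1)) (E v) = (\<Sum>k\<in>UNIV. v $ k * metric M xb (E (axis i 1)) (E (axis k 1)))" for i
  by (subst Ev) (simp add: linear_sum[OF l(2)] linear_scale[OF l(2)])
 also have "(\<Sum>k\<in>UNIV. v $ k * metric M xb (E (axis i 1)) (E (axis k 1))) = v $ i" for i
  using onf_E by (simp add: onf_def if_distrib[of "(*) _"] cong: if_cong)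
 finally have 1: "metric M xb (E (axis i 1)) (E v) = v $ i" for i .
 have "metric M xb (E v) (E v) = metric M xb (\<Sum>k\<in>UNIV. v $ k *\<^sub>R E (axis k 1)) (E v)" by (simp only: Ev[symmetric])
 also have "\<dots> = (\<Sum>i\<in>UNIV. v $ i * v $ i)" by (simp add: linear_sum[OF l(1)] linear_scale[OF l(1)] 1)
 finally show ?thesis by (simp add: power2_norm_eq_inner inner_vec_def)
qed

text \<open>Z vanishes at xb, so half the second derivative of Z^2 is the square of the first
  derivative of Z; and i c(w) squares to |w|^2.\<close>

lemma hessian_Z:
 "(cadj tx ** ((1/2) *\<^sub>R pd (pd (\<lambda>y. snd t (cinv ch y) ** (Z (cinv ch y) ** Z (cinv ch y)) ** cadj (snd t (cinv ch y))) a) a 0) ** tx) *v w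
  = of_real ((norm (X' a))\<^sup>2) *s w"
proof -
 let ?F = "\<lambda>y. snd t (cinv ch y) ** (Z (cinv ch y) ** Z (cinv ch y)) ** cadj (snd t (cinv ch y))"
 have sW: "smooth_on N0 (tconj Z)" by (rule smooth_tconj[OF smooth_endo_on_subset[OF Z_smooth]])
 have W0: "tconj Z 0 = 0"
  by (simp add: matrix_eq tconj_def cinv_0 matrix_vector_mul_assoc[symmetric] Z_xb)
 have "?F y = tconj Z y ** tconj Z y" if "y \<in> N0" for y
 proof -
  have "tconj Z y ** tconj Z y = snd t (cinv ch y) ** Z (cinv ch y) ** (cadj (snd t (cinv ch y)) ** snd t (cinv ch y)) ** Z (cinv ch y) ** cadj (snd t (cinv ch y))"
   by (simp add: tconj_def matrix_mul_assoc)
  then show ?thesis by (simp add: triv_unitary(2)[OF t(1) N0_cinv(2)[OF that]] matrix_mul_assoc)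
 qed
 then have "pd ?F a y = pd (\<lambda>y. tconj Z y ** tconj Z y) a y" if "y \<in> N0" for y
  by (intro pd_cong_open[OF N0(1) that])
 then have "pd (pd ?F a) a 0 = pd (pd (\<lambda>y. tconj Z y ** tconj Z y) a) a 0"
  by (intro pd_cong_open[OF N0])
 also have "\<dots> = 2 *\<^sub>R (pd (tconj Z) a 0 ** pd (tconj Z) a 0)"
  unfolding pd2_bilinear(2)[OF bounded_bilinear_mm N0 sW W0 sW W0] by (simp add: scaleR_2)
 finally have "(1/2) *\<^sub>R pd (pd ?F a) a 0 = pd (tconj Z) a 0 ** pd (tconj Z) a 0" by simp
 then show ?thesis
  by (simp add: matrix_vector_mul_assoc[symmetric] pd_tconj_Z t_inv vector_smult_mv vector_smult_assoc c_square_mv[OF S(2)] metric_E mv_minus)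
qed

text \<open>The section Z u vanishes at xb, so \<open>D_vanish\<close> applies and only the
  derivative of Z contributes.\<close>

lemma D_Z:
 assumes u: "u \<in> sections M"
 shows "D (\<lambda>x. Z x *v u x) xb = (\<Sum>i\<in>UNIV. \<i> *s (c xb (E (axis i 1)) *v (c xb (E (X' (axis i 1))) *v u xb)))"
proof -
 have sW: "smooth_on N0 (tconj Z)" by (rule smooth_tconj[OF smooth_endo_on_subset[OF Z_smooth]])
 note dW = smooth_on_differentiable[OF sW N0] and du = smooth_on_differentiable[OF smooth_local_rep[OF u] N0]
 have W0: "tconj Z 0 *v w = 0" for w by (simp add: tconj_def cinv_0 matrix_vector_mul_assoc[symmetric] Z_xb)
 have "pd (local_rep ch t (\<lambda>x. Z x *v u x)) h 0 = pd (\<lambda>y. tconj Z y *v local_rep ch t u y) h 0" for h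
 proof (rule pd_cong_open[OF N0])
  fix y assume "y \<in> N0"
  from triv_unitary(2)[OF t(1) N0_cinv(2)[OF this]]
  show "local_rep ch t (\<lambda>x. Z x *v u x) y = tconj Z y *v local_rep ch t u y"
   by (simp add: local_rep_def tconj_def matrix_vector_mul_assoc matrix_mul_assoc[symmetric])
 qed
 also have "pd (\<lambda>y. tconj Z y *v local_rep ch t u y) h 0 = \<i> *s (tx *v (c xb (E (X' h)) *v u xb))" for h
  by (subst pd_bounded_bilinear[OF bounded_bilinear_mv dW du]) (simp add: W0 pd_tconj_Z local_rep_def cinv_0 t_inv)
 finally show ?thesis
  by (simp add: D_vanish[OF section_endo[OF Z_smooth u] Z_xb] vector_smult_mv t_inv)
qed

end

section \<open>The principal part of the square of D\<close>

context dirac_pt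
begin

text \<open>On x_i x_j s the operator sees the sum of \<open>a2 i j\<close> and
  \<open>a2 j i\<close> at the origin. The coefficients need not be symmetric, and only this sum is
  determined.\<close>

lemma second_order_coeffs:
 assumes a2: "local_coeffs2 ch t (sections M) (\<lambda>u. D (D u)) a2 a1 a0"
 shows "cadj tx *v (a2 i j 0 *v (tx *v w)) + cadj tx *v (a2 j i 0 *v (tx *v w)) = - of_real (if i = j then 2 else 0) *s w"
proof -
 define s where "s = sec0 (tx *v w)"
 have s: "s \<in> sections M" "s xb = w" by (simp_all add: s_def sec0 sec0_xb t_inv)
 define u where "u = (\<lambda>x. ph i x *s (ph j x *s s x))"
 have u: "u \<in> sections M" unfolding u_def by (intro section_smult ph s)
 define p where "p i y = complex_of_real (radial r y * y $ i)" for i and y :: "real ^ 'd"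
 have p: "smooth_on N0 (p i)" "p i 0 = 0" for i
  using smooth_on_bounded_linear[OF bounded_linear_of_real open_UNIV smooth_rad_coord]
  by (auto simp: p_def[abs_def] intro: smooth_on_subset)
 have dp: "pd (p i) h 0 = of_real (h $ i)" for i h
  unfolding p_def pd_bounded_linear[OF bounded_linear_of_real smooth_on_differentiable[OF smooth_rad_coord open_UNIV UNIV_I]] by (simp add: pd_rad_coord)
 let ?q = "\<lambda>y. p j y *s local_rep ch t s y"
 have q: "smooth_on N0 ?q" "?q 0 = 0"
  by (rule smooth_on_smult[OF N0(1) p(1) smooth_local_rep[OF s(1)]]) (simp add: p)
 have dq: "pd ?q h 0 = of_real (h $ j) *s (tx *v w)" for h
  by (subst pd_bounded_bilinear[OF bounded_bilinear_vscale smooth_on_differentiable[OF p(1) N0] smooth_on_differentiable[OF smooth_local_rep[OF s(1)] N0]])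
   (simp add: p dp local_rep_def cinv_0 s(2))
 have ph_cinv: "ph i (cinv ch y) = p i y" if "y \<in> N0" for i y
  using that snd_cinv[OF cch] cinv_in[OF cch] by (auto simp: ph_def p_def chart_image_iff[OF cch])
 have lu: "local_rep ch t u y = p i y *s ?q y" if "y \<in> N0" for y
  by (simp add: local_rep_def u_def vector_smult_mv ph_cinv[OF that])
 have l1: "pd (local_rep ch t u) h y = pd (\<lambda>y. p i y *s ?q y) h y" if "y \<in> N0" for h y
  by (rule pd_cong_open[OF N0(1) that lu])
 have 1: "pd (local_rep ch t u) h 0 = 0" for h
  using l1[OF N0(2)] pd2_bilinear(1)[OF bounded_bilinear_vscale N0 p q] by simp
 have "pd (pd (local_rep ch t u) h) k 0 = pd (pd (\<lambda>y. p i y *s ?q y) h) k 0" for h k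
  by (rule pd_cong_open[OF N0 l1])
 also have "pd (pd (\<lambda>y. p i y *s ?q y) h) k 0 = of_real (k $ i) *s (of_real (h $ j) *s (tx *v w)) + of_real (h $ i) *s (of_real (k $ j) *s (tx *v w))" for h k
  unfolding pd2_bilinear(2)[OF bounded_bilinear_vscale N0 p q] dp dq ..
 finally have 2: "pd (pd (local_rep ch t u) (axis l 1)) (axis k 1) 0
  = (if l = j then if k = i then tx *v w else 0 else 0) + (if l = i then if k = j then tx *v w else 0 else 0)" for k l
  by (simp add: axis_def)
 have 0: "local_rep ch t u 0 = 0" using lu[OF N0(2)] by (simp add: p)
 have "0 \<in> snd ch ` (fst ch \<inter> fst t)" using N0(2) by blast
 then have "local_rep ch t (D (D u)) 0 = (\<Sum>k\<in>UNIV. \<Sum>l\<in>UNIV. a2 k l 0 *v pd (pd (local_rep ch t u) (axis l 1)) (axis k 1) 0)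
   + (\<Sum>k\<in>UNIV. a1 k 0 *v pd (local_rep ch t u) (axis k 1) 0) + a0 0 *v local_rep ch t u 0"
  using a2 u unfolding local_coeffs2_def by blast
 also have "\<dots> = a2 i j 0 *v (tx *v w) + a2 j i 0 *v (tx *v w)"
  unfolding 2 1 0
  by (simp add: matrix_vector_right_distrib sum.distrib if_distrib[of "(*v) _"] cong: if_cong)
 finally have "tx *v D (D u) xb = a2 i j 0 *v (tx *v w) + a2 j i 0 *v (tx *v w)" by (simp add: local_rep_def cinv_0)
 then have "cadj tx *v (tx *v D (D u) xb) = cadj tx *v (a2 i j 0 *v (tx *v w)) + cadj tx *v (a2 j i 0 *v (tx *v w))"
  by (simp add: matrix_vector_right_distrib)
 then show ?thesis using D_D_ph_ph[OF s(1), of i j] by (simp add: t_inv u_def s(2))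
qed

text \<open>The Hessian is symmetric, so only the symmetrized coefficients enter.\<close>

lemma second_order_part:
 assumes a2: "local_coeffs2 ch t (sections M) (\<lambda>u. D (D u)) a2 a1 a0" and u: "smooth_on UNIV u"
 shows "(\<Sum>i\<in>UNIV. \<Sum>j\<in>UNIV. (cadj tx ** a2 i j 0 ** tx) *v pd (pd u (axis j 1)) (axis i 1) y)
  = - (\<Sum>i\<in>UNIV. pd (pd u (axis i 1)) (axis i 1) y)"
proof -
 define H where "H i j = pd (pd u (axis j 1)) (axis i 1) y" for i j
 define A where "A i j = (cadj tx ** a2 i j 0 ** tx)" for i j
 have H: "H i j = H j i" for i j unfolding H_def by (rule pd_commute[OF open_UNIV UNIV_I u])
 have A: "A i j *v w + A j i *v w = (if i = j then -2 *\<^sub>R w else 0)" for i j w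
  using second_order_coeffs[OF a2, of i j w]
  by (auto simp: A_def matrix_vector_mul_assoc[symmetric] vec_eq_iff scaleR_conv_of_real[where 'a=complex])
 have "(\<Sum>i\<in>UNIV. \<Sum>j\<in>UNIV. A i j *v H i j) + (\<Sum>i\<in>UNIV. \<Sum>j\<in>UNIV. A i j *v H i j)
  = (\<Sum>i\<in>UNIV. \<Sum>j\<in>UNIV. A i j *v H i j) + (\<Sum>i\<in>UNIV. \<Sum>j\<in>UNIV. A j i *v H j i)"
  by (subst (2) sum.swap) simp
 also have "\<dots> = (\<Sum>i\<in>UNIV. \<Sum>j\<in>UNIV. A i j *v H i j + A j i *v H i j)"
  by (simp add: sum.distrib H)
 also have "\<dots> = (-2) *\<^sub>R (\<Sum>i\<in>UNIV. H i i)" by (simp add: A scaleR_sum_right)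
 finally have "2 *\<^sub>R (\<Sum>i\<in>UNIV. \<Sum>j\<in>UNIV. A i j *v H i j) = 2 *\<^sub>R (- (\<Sum>i\<in>UNIV. H i i))" by (simp add: scaleR_2)
 then have "(\<Sum>i\<in>UNIV. \<Sum>j\<in>UNIV. A i j *v H i j) = - (\<Sum>i\<in>UNIV. H i i)" by (simp only: scaleR_cancel_left) simp
 then show ?thesis by (simp add: A_def H_def)
qed

end

section \<open>The bundle map at a singular point\<close>

lemma has_derivative_rot:
 fixes L :: "real ^ 'p::finite => real ^ 'p"
 assumes L: "linear L"
 shows "((\<lambda>\<theta>. rot k (L \<theta>) y) has_derivative (\<lambda>w. \<chi> i. case i of
  Inl l => Re (\<i> * of_real (idot (k l) (L w)) * zc y l) | Inr l => Im (\<i> * of_real (idot (k l) (L w)) * zc y l))) (at 0)"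
proof -
 have li: "bounded_linear (\<lambda>w. idot (k l) (L w))" for l
  unfolding linear_conv_bounded_linear[symmetric]
  by (rule linearI) (simp_all add: linear_add[OF L] linear_scale[OF L] idot_add_right idot_scaleR)
 have d: "((\<lambda>\<theta>. cis (idot (k l) (L \<theta>)) * zc y l) has_derivative (\<lambda>w. \<i> * of_real (idot (k l) (L w)) * zc y l)) (at 0)" for l
  by (rule has_derivative_eq_rhs, (rule derivative_intros bounded_linear.has_derivative[OF li] has_derivative_cis)+)
   (simp add: fun_eq_iff linear_0[OF L] idot_def scaleR_conv_of_real)
 show ?thesis
 proof (subst has_derivative_componentwise_within, rule ballI)
  fix i :: "real ^ ('a + 'a)" assume "i \<in> Basis"
  then obtain j where j: "i = axis j 1" by (auto simp: Basis_vec_def)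
  note 1 = bounded_linear.has_derivative[OF bounded_linear_Re d] and 2 = bounded_linear.has_derivative[OF bounded_linear_Im d]
  show "((\<lambda>\<theta>. rot k (L \<theta>) y \<bullet> i) has_derivative (\<lambda>w. (\<chi> i. case i of
   Inl l => Re (\<i> * of_real (idot (k l) (L w)) * zc y l) | Inr l => Im (\<i> * of_real (idot (k l) (L w)) * zc y l)) \<bullet> i)) (at 0)"
  proof (cases j)
   case (Inl l)
   show ?thesis using 1[of l] by (simp only: j Inl rot_def inner_axis vec_lambda_beta sum.case inner_real_def mult_1_right)
  next
   case (Inr l)
   show ?thesis using 2[of l] by (simp only: j Inr rot_def inner_axis vec_lambda_beta sum.case inner_real_def mult_1_right)
  qed
 qed
qed

lemma vector_smult_right_cancel: "c \<noteq> 0 ==> c *s u = c *s w ==> u = w" for u :: "complex ^ 'r::finite"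
 by (simp add: vec_eq_iff)

context dirac_pt
begin

text \<open>Pairing with the e_j shows that the map from coordinates to combinations of the frame is
  injective, hence onto by dimension.\<close>

lemma onf_expansion:
 assumes "onf x e"
 shows "v = (\<Sum>i\<in>UNIV. metric M x (e i) v *\<^sub>R e i)"
proof -
 have l: "linear (metric M x v')" for v' using metric_facts(1)[of x] by (auto simp: bilinear_def)
 define P where "P a = (\<Sum>i\<in>UNIV. a $ i *\<^sub>R e i)" for a :: "real ^ 'd"
 have P: "metric M x (e j) (P a) = a $ j" for a j
  using assms by (simp add: P_def linear_sum[OF l] linear_scale[OF l] onf_def if_distrib[of "(*) _"] cong: if_cong)
 have lP: "linear P" unfolding P_def by (rule linearI) (simp_all add: scaleR_left_distrib sum.distrib scaleR_sum_right)
 have "inj P"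
 proof (rule injI)
  fix a b assume "P a = P b"
  then have "a $ j = b $ j" for j using P[of j a] P[of j b] by simp
  then show "a = b" by (simp add: vec_eq_iff)
 qed
 then obtain a where a: "v = P a" using linear_inj_imp_surj[OF lP] by (metis surjD)
 show ?thesis unfolding a P by (rule P_def)
qed

end

context dirac_Z
begin

text \<open>The Leibniz terms add up to \<Sum> df(e_i) (c(e_i) Z + Z c(e_i)); with Z = i c(V) the
  Clifford relation makes this -2 i \<Sum> df(e_i) <e_i, V> = -2 i df(V).\<close>

lemma anticomm_smult:
 assumes f: "smooth_fun_on M UNIV f" and u: "u \<in> sections M" and x: "x \<in> S"
 shows "anticomm D Z (\<lambda>y. f y *s u y) x = f x *s anticomm D Z u x - (2 * \<i> * mdiff M f x (orbit_field M vv x)) *s u x"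
proof -
 obtain e where e: "onf x e" by (rule onf_exists)
 let ?V = "orbit_field M vv x"
 have Zu: "(\<lambda>x. Z x *v u x) \<in> sections M" by (rule section_endo[OF Z_smooth u])
 have "D (\<lambda>y. Z y *v (f y *s u y)) x = f x *s D (\<lambda>y. Z y *v u y) x + (\<Sum>i\<in>UNIV. mdiff M f x (e i) *s (c x (e i) *v (Z x *v u x)))"
  using D_smult[OF f Zu x e] by (simp add: vector_smult_mv)
 moreover have "Z x *v D (\<lambda>y. f y *s u y) x = f x *s (Z x *v D u x) + (\<Sum>i\<in>UNIV. mdiff M f x (e i) *s (Z x *v (c x (e i) *v u x)))"
  using D_smult[OF f u x e] by (simp add: matrix_vector_right_distrib mv_sum vector_smult_mv)
 moreover have "(\<Sum>i\<in>UNIV. mdiff M f x (e i) *s (c x (e i) *v (Z x *v u x))) + (\<Sum>i\<in>UNIV. mdiff M f x (e i) *s (Z x *v (c x (e i) *v u x)))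
  = - (2 * \<i> * mdiff M f x ?V) *s u x"
 proof -
  have "c x (e i) *v (Z x *v u x) + Z x *v (c x (e i) *v u x) = (- 2 * \<i> * of_real (metric M x (e i) ?V)) *s u x" for i
  proof -
   have "c x (e i) *v (Z x *v u x) + Z x *v (c x (e i) *v u x)
    = \<i> *s (c x (e i) *v (c x ?V *v u x) + c x ?V *v (c x (e i) *v u x))"
    by (simp add: Z_eq[OF x] vector_smult_mv vector_add_ldistrib)
   then show ?thesis by (simp add: c_anticomm[OF x] vector_smult_assoc)
  qed
  then have "(\<Sum>i\<in>UNIV. mdiff M f x (e i) *s (c x (e i) *v (Z x *v u x))) + (\<Sum>i\<in>UNIV. mdiff M f x (e i) *s (Z x *v (c x (e i) *v u x)))
   = (\<Sum>i\<in>UNIV. mdiff M f x (e i) *s ((- 2 * \<i> * of_real (metric M x (e i) ?V)) *s u x))"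
   by (simp only: sum.distrib[symmetric] vector_add_ldistrib[symmetric])
  also have "\<dots> = - (2 * \<i> * (\<Sum>i\<in>UNIV. metric M x (e i) ?V *\<^sub>R mdiff M f x (e i))) *s u x"
   by (simp add: vec_eq_iff sum_distrib_left sum_distrib_right sum_negf scaleR_conv_of_real mult_ac)
  also have "(\<Sum>i\<in>UNIV. metric M x (e i) ?V *\<^sub>R mdiff M f x (e i)) = mdiff M f x ?V"
  proof -
   note lm = linear_mdiff[OF f open_UNIV UNIV_I, of x]
   show ?thesis
    using arg_cong[OF onf_expansion[OF e, of ?V], of "mdiff M f x"] by (simp add: linear_sum[OF lm] linear_scale[OF lm])
  qed
  finally show ?thesis .
 qed
 ultimately show ?thesis by (simp add: anticomm_def vec_eq_iff algebra_simps)
qed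

text \<open>Along the curve \<open>s e\<close> the function \<open>f\<close> does not vanish, so that it can be cancelled there;
 the value at \<open>xb\<close>, where \<open>f\<close> may vanish, is then obtained by continuity.\<close>

lemma bundle_map_limit:
 assumes f: "smooth_fun_on M UNIV f" and u: "u \<in> sections M"
  and B: "restricts_to_bundle_map M (anticomm D Z) \<sigma> B" and type: "(\<lambda>x. f x *s u x) \<in> type_sections M \<sigma>"
  and orb: "\<And>x s. f (ract M x (s *\<^sub>R vv)) = cis (s * q) * f x"
  and nz: "\<forall>\<^sub>F s in at_right 0. f (cinv ch (s *\<^sub>R e)) \<noteq> 0"
 shows "B xb *v u xb = anticomm D Z u xb + of_real (2 * q) *s u xb"
proof -
 \<comment> \<open>Equivariance along the flow of \<open>vv\<close> differentiates to V f = i q f,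
   so the Leibniz term -2 i df(V) becomes 2 q f.\<close>
 have df: "mdiff M f x (orbit_field M vv x) = \<i> * of_real q * f x" for x
 proof -
  have "((\<lambda>s. cis (s * q) * f x) has_vector_derivative \<i> * of_real q * f x) (at 0)"
   unfolding has_vector_derivative_def
   by (rule has_derivative_eq_rhs, (rule derivative_intros has_derivative_cis)+) (simp add: fun_eq_iff scaleR_conv_of_real mult_ac)
  with orbit_deriv[OF f open_UNIV UNIV_I, of x vv] show ?thesis
   unfolding orb by (rule vector_derivative_unique_at)
 qed
 have BE: "smooth_endo_on M UNIV B" and Bu: "anticomm D Z (\<lambda>x. f x *s u x) = (\<lambda>x. B x *v (f x *s u x))"
  using B type unfolding restricts_to_bundle_map_def by blast+
 \<comment> \<open>The difference of the two sides as a smooth section. By the bundle map property f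
   Y = 0 on S, so Y vanishes wherever f does not.\<close>
 define Y where "Y x = B x *v u x + (- 1) *\<^sub>R (anticomm D Z u x + of_real (2 * q) *s u x)" for x
 have Y0: "Y x = 0" if x: "x \<in> S" "f x \<noteq> 0" for x
 proof -
  have "f x *s (B x *v u x) = f x *s (anticomm D Z u x + of_real (2 * q) *s u x)"
   using anticomm_smult[OF f u x(1)] fun_cong[OF Bu, of x] by (simp add: df vector_smult_mv vec_eq_iff algebra_simps)
  from vector_smult_right_cancel[OF x(2) this] show ?thesis by (simp add: Y_def)
 qed
 have Y: "Y \<in> sections M"
  unfolding Y_def anticomm_def[abs_def]
  by (intro section_add section_scaleR section_endo[OF BE] section_endo[OF Z_smooth] D_section u
    section_smult[OF smooth_fun_on_const])
 have "continuous_on N0 (local_rep ch t Y)" by (rule smooth_on_continuous[OF smooth_local_rep[OF Y]])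
 then have "isCont (local_rep ch t Y) 0" by (rule continuous_on_interior) (simp only: interior_open[OF N0(1)] N0(2))
 moreover have se: "((\<lambda>s. s *\<^sub>R e) \<longlongrightarrow> 0 *\<^sub>R e) (at_right 0)" by (intro tendsto_intros)
 ultimately have lim: "((\<lambda>s. local_rep ch t Y (s *\<^sub>R e)) \<longlongrightarrow> local_rep ch t Y 0) (at_right 0)"
  using isCont_tendsto_compose by fastforce
 have "\<forall>\<^sub>F s in at_right 0. s *\<^sub>R e \<in> N0"
  by (rule topological_tendstoD[OF se N0(1)]) (simp only: scaleR_zero_left N0(2))
 with nz have "\<forall>\<^sub>F s in at_right 0. local_rep ch t Y (s *\<^sub>R e) = 0"
  by eventually_elim (use Y0 N0_cinv in \<open>auto simp: local_rep_def\<close>)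
 from tendsto_eventually[OF this] lim have "local_rep ch t Y 0 = 0"
  using tendsto_unique trivial_limit_at_right_real by blast
 then have "cadj tx *v (tx *v Y xb) = 0" by (simp add: local_rep_def cinv_0)
 then have "Y xb = 0" by (simp only: t_inv)
 then show ?thesis by (simp only: Y_def scaleR_minus1_left add_uminus_conv_diff right_minus_eq)
qed

end

locale model_pt = dirac_Z M D S c nab xb ch t r Z vv "\<lambda>\<theta>. rot k (L \<theta>)"
 for M :: "('m::t2_space, 'n::finite + 'n, 'p::finite, 'r::finite, 'z) tbundle_scheme" and D S c nab xb ch t r Z vv
  and k :: "'n => int ^ 'p" and L :: "real ^ 'p => real ^ 'p" +
 fixes \<kappa> :: "'n => real" and f :: "'r => complex ^ 'r" and a :: "'r => int ^ 'p" and b :: "int ^ 'p"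
  and \<epsilon> :: "'r => 'n => int" and \<rho> :: "real ^ 'p => complex" and B :: "('m, 'r) endo"
 assumes L: "torus_coords L" and \<kappa>: "\<And>l. \<kappa> l = idot (k l) (L vv)"
  and lift_f: "\<And>j \<theta>. lift M \<theta> xb *v f j = cis (idot (a j) (L \<theta>)) *s f j"
  and \<epsilon>: "\<And>j l. \<i> *s ((c xb (E (axis (Inl l) 1)) ** c xb (E (axis (Inr l) 1))) *v f j) = of_int (\<epsilon> j l) *s f j"
  and \<rho>: "\<And>\<theta>. \<rho> \<theta> = cis (idot b (L \<theta>))"
  and B: "restricts_to_bundle_map M (anticomm D Z) \<rho> B"
begin

lemma linear_L: "linear L"
 using L by (simp add: torus_coords_def)

lemma zc_X': "zc (X' y) l = \<i> * of_real (\<kappa> l) * zc y l"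
 unfolding X'_def pd_eq_of_has_derivative[OF has_derivative_rot[OF linear_L]]
 by (simp add: zc_def[of "vec_lambda _"] \<kappa> complex_eq_iff)

lemma norm_X': "(norm (X' y))\<^sup>2 = (\<Sum>l\<in>UNIV. (\<kappa> l)\<^sup>2 * (cmod (zc y l))\<^sup>2)"
 by (simp add: norm_power2_zc zc_X' norm_mult power_mult_distrib)

text \<open>The linearized field sends the x_l axis to \<kappa>_l times the y_l axis and the y_l
  axis to -\<kappa>_l times the x_l axis. The products c(x_l) c(y_l) and -c(y_l) c(x_l) agree by the
  Clifford relation, which accounts for the factor 2.\<close>

lemma D_Z_f:
 assumes u: "u \<in> sections M" and uf: "u xb = f j"
 shows "anticomm D Z u xb = of_real (2 * (\<Sum>l\<in>UNIV. \<kappa> l * of_int (\<epsilon> j l))) *s f j"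
proof -
 let ?c = "\<lambda>i. c xb (E (axis i 1))"
 have X1: "X' (axis (Inl l) 1) = \<kappa> l *\<^sub>R axis (Inr l) 1" and X2: "X' (axis (Inr l) 1) = (- \<kappa> l) *\<^sub>R axis (Inl l) 1" for l
  by (rule vec_eq_zcI, simp add: zc_X', simp add: zc_def axis_def complex_eq_iff)+
 note lin = linear_scale[OF linear_dvec[OF ch]] linear_scale[OF linear_c[OF S(2)]]
 have e: "\<i> *s (?c (Inl l) *v (?c (Inr l) *v f j)) = of_int (\<epsilon> j l) *s f j" for l
  using \<epsilon>[of l j] by (simp add: matrix_vector_mul_assoc)
 have "?c (Inl l) *v (?c (Inr l) *v f j) + ?c (Inr l) *v (?c (Inl l) *v f j) = 0" for l
  using onf_E by (simp add: c_anticomm[OF S(2)] onf_def)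
 then have "?c (Inr l) *v (?c (Inl l) *v f j) = - (?c (Inl l) *v (?c (Inr l) *v f j))" for l
  by (simp add: eq_neg_iff_add_eq_0 add.commute)
 then have e2: "\<i> *s (?c (Inr l) *v (?c (Inl l) *v f j)) = - of_int (\<epsilon> j l) *s f j" for l
  using e[of l] by (simp add: vec_eq_iff)
 have sc: "\<i> *s (q *\<^sub>R w) = q *\<^sub>R (\<i> *s w)" for q and w :: "complex ^ 'r" by (simp add: vec_eq_iff)
 have "anticomm D Z u xb = (\<Sum>i\<in>UNIV. \<i> *s (?c i *v (c xb (E (X' (axis i 1))) *v f j)))"
  by (simp add: anticomm_def Z_xb D_Z[OF u] uf)
 also have "\<dots> = (\<Sum>l\<in>UNIV. \<kappa> l *\<^sub>R (of_int (\<epsilon> j l) *s f j) + (- \<kappa> l) *\<^sub>R (- of_int (\<epsilon> j l) *s f j))"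
  unfolding sum_UNIV_sum X1 X2 lin scaleR_mv mv_scaleR sc e e2 ..
 also have "\<dots> = of_real (2 * (\<Sum>l\<in>UNIV. \<kappa> l * of_int (\<epsilon> j l))) *s f j"
  by (simp add: vec_eq_iff sum_distrib_left sum_distrib_right sum.distrib[symmetric] scaleR_conv_of_real[where 'a=complex] algebra_simps)
 finally show ?thesis .
qed

definition zw :: "'n => 'm => complex" where
 "zw h x = (if x \<in> fst ch then radial r (snd ch x) *\<^sub>R zc (snd ch x) h else 0)"

text \<open>The weight is -k_h because averaging with g yields functions that transform by the
  inverse of g.\<close>

definition zeta :: "'n => 'm => complex" where
 "zeta h = favg (\<lambda>\<theta>. cis (idot (- k h) (L \<theta>))) (zw h)"

lemma smooth_zw: "smooth_fun_on M UNIV (zw h)"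
 unfolding zw_def[abs_def]
 by (rule smooth_fun_of_chart(1)[OF ch(1) r_sub smooth_on_scaleR[OF open_UNIV smooth_on_radial smooth_on_linear[OF bounded_linear_zc]]])
  (simp add: radial_eq_0[OF r(1)])

lemma smooth_zeta: "smooth_fun_on M UNIV (zeta h)"
 unfolding zeta_def by (rule smooth_favg[OF character_cis[OF L] smooth_zw])

lemma idot_minus_left: "idot (- q) \<theta> = - idot q \<theta>"
 by (simp add: idot_def sum_negf)

lemma zeta_ract: "zeta h (ract M x \<eta>) = cis (idot (k h) (L \<eta>)) * zeta h x"
proof -
 have "cis (idot (- k h) (L \<eta>)) * zeta h (ract M x \<eta>) = zeta h x"
  unfolding zeta_def by (rule favg_ract[OF character_cis[OF L] smooth_zw])
 then have "cis (idot (k h) (L \<eta>)) * (cis (idot (- k h) (L \<eta>)) * zeta h (ract M x \<eta>)) = cis (idot (k h) (L \<eta>)) * zeta h x" by simp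
 then show ?thesis by (simp add: mult.assoc[symmetric] cis_mult idot_minus_left)
qed

lemma zeta_xb: "zeta h xb = 0"
 unfolding zeta_def by (rule favg_fixed[OF fixed]) (simp add: zw_def ch_xb zc_def complex_eq_iff)

text \<open>The linearized action multiplies z_h by exactly the phase that the averaging weight
  removes, so the differential dz_h survives the average.\<close>

lemma zeta_deriv: "((\<lambda>y. zeta h (cinv ch y)) has_derivative (\<lambda>v. zc v h)) (at 0)"
proof -
 have dr: "radial r differentiable (at (0::real ^ ('n + 'n)))"
  by (rule smooth_on_differentiable[OF smooth_on_radial open_UNIV UNIV_I])
 have dz: "((\<lambda>y. zc y h) has_derivative (\<lambda>v. zc v h)) (at 0)"
  by (rule bounded_linear_imp_has_derivative[OF bounded_linear_zc])
 have w: "pd (\<lambda>y. zw h (cinv ch y)) v 0 = zc v h" for v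
 proof -
  have "pd (\<lambda>y. zw h (cinv ch y)) v 0 = pd (\<lambda>y. radial r y *\<^sub>R zc y h) v 0"
   by (rule pd_cong_open[OF N0]) (use snd_cinv[OF cch] N0_cinv in \<open>auto simp: zw_def\<close>)
  also have "\<dots> = zc v h"
   by (subst pd_bounded_bilinear[OF bounded_bilinear_scaleR dr differentiableI[OF dz]])
    (simp add: radial_0 pd_eq_of_has_derivative[OF dz], simp add: zc_def complex_eq_iff)
  finally show ?thesis .
 qed
 have "pd (\<lambda>y. zeta h (cinv ch y)) v 0 = zc v h" for v
 proof -
  have "pd (\<lambda>y. zeta h (cinv ch y)) (mdiff M (snd ch) xb (E v)) (snd ch xb) = zc v h"
   unfolding zeta_def
  proof (rule pd_favg[OF character_cis[OF L] smooth_zw ch fixed R])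
   show "cis (idot (- k h) (L \<theta>)) * pd (\<lambda>y. zw h (cinv ch y)) (rot k (L \<theta>) (mdiff M (snd ch) xb (E v))) (snd ch xb) = zc v h" for \<theta>
    by (simp add: ch_xb w zc_rot mdiff_snd_E mult.assoc[symmetric] cis_mult idot_minus_left)
  qed
  then show ?thesis by (simp add: mdiff_snd_E ch_xb)
 qed
 then show ?thesis using pd_works[OF differentiable_0[OF smooth_zeta[of h] open_UNIV UNIV_I]] by simp
qed

text \<open>A negative power is replaced by a power of the conjugate: the same weight under
  rotation, but smooth at 0.\<close>

definition zpow :: "int => complex => complex" where
 "zpow m z = (if m \<ge> 0 then z ^ nat m else cnj z ^ nat (- m))"

lemma zpow_cis: "zpow m (cis s * z) = cis (of_int m * s) * zpow m z"
proof -
 have "cis s ^ n = cis (of_nat n * s)" for n s by (rule Complex.DeMoivre)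
 then show ?thesis by (auto simp: zpow_def power_mult_distrib cis_cnj)
qed

lemma smooth_zpow: "smooth_on UNIV (zpow m)"
proof (cases "m \<ge> 0")
 case True
 then show ?thesis unfolding zpow_def[abs_def] by (simp add: smooth_on_power[OF open_UNIV smooth_on_ident])
next
 case False
 then show ?thesis unfolding zpow_def[abs_def]
  by (simp add: smooth_on_power[OF open_UNIV smooth_on_linear[OF bounded_linear_cnj]])
qed

definition zmon :: "('n => int) => 'm => complex" where
 "zmon m x = (\<Prod>h\<in>UNIV. zpow (m h) (zeta h x))"

lemma smooth_zmon: "smooth_fun_on M UNIV (zmon m)"
proof -
 have "smooth_fun_on M UNIV (\<lambda>x. \<Prod>h\<in>I. zpow (m h) (zeta h x))" for I
 proof (induction I rule: infinite_finite_induct)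
  case (insert h I)
  then show ?case
   using smooth_fun_on_bounded_bilinear[OF bounded_bilinear_mult open_UNIV smooth_fun_on_compose[OF open_UNIV smooth_zeta smooth_zpow] insert.IH]
   by simp
 qed (simp_all add: smooth_fun_on_const)
 then show ?thesis by (simp add: zmon_def[abs_def])
qed

lemma zmon_ract: "zmon m (ract M x \<eta>) = cis (idot (\<Sum>h\<in>UNIV. m h *s k h) (L \<eta>)) * zmon m x"
proof -
 have "(\<Prod>h\<in>I. cis (s h)) = cis (\<Sum>h\<in>I. s h)" for I and s :: "'n => real"
  by (induction I rule: infinite_finite_induct) (simp_all add: cis_mult)
 then show ?thesis by (simp add: zmon_def zeta_ract zpow_cis prod.distrib idot_smult_sum)
qed

text \<open>Along this direction every z_h equals the real parameter s, so no factor of the monomial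
  vanishes to higher than its expected order.\<close>

definition e0 :: "real ^ ('n + 'n)" where
 "e0 = (\<chi> i. case i of Inl l => 1 | Inr l => 0)"

lemma zmon_nonzero: "\<forall>\<^sub>F s in at_right 0. zmon m (cinv ch (s *\<^sub>R e0)) \<noteq> 0"
proof -
 have "\<forall>\<^sub>F s in at_right 0. zeta h (cinv ch (s *\<^sub>R e0)) \<noteq> 0" for h
 proof -
  have z: "zc (s *\<^sub>R e0) h = of_real s" for s by (simp add: zc_def e0_def complex_eq_iff)
  have "((\<lambda>s. s *\<^sub>R e0) has_derivative (\<lambda>s. s *\<^sub>R e0)) (at 0)" by (auto intro!: derivative_eq_intros)
  from has_derivative_compose[OF this, of "\<lambda>y. zeta h (cinv ch y)" "\<lambda>v. zc v h"] zeta_deriv[of h]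
  have "((\<lambda>s. zeta h (cinv ch (s *\<^sub>R e0))) has_derivative of_real) (at 0)" by (simp add: z)
  \<comment> \<open>With an error of at most s / 2 the value stays at distance less than s from s
    and hence differs from 0.\<close>
  then obtain d where d: "d > 0" "\<And>s. norm (s - 0) < d ==>
    norm (zeta h (cinv ch (s *\<^sub>R e0)) - zeta h (cinv ch (0 *\<^sub>R e0)) - of_real (s - 0)) \<le> 1/2 * norm (s - 0)"
   unfolding has_derivative_at_alt using zero_less_divide_1_iff zero_less_numeral by metis
  have "zeta h (cinv ch (s *\<^sub>R e0)) \<noteq> 0" if "0 < s" "s < d" for s
   using d(2)[of s] that by (auto simp: cinv_0 zeta_xb)
  then show ?thesis unfolding eventually_at_right_field using d(1) by blast
 qed
 then have "\<forall>\<^sub>F s in at_right 0. \<forall>h. zeta h (cinv ch (s *\<^sub>R e0)) \<noteq> 0" by (rule eventually_all_finite)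
 then show ?thesis by eventually_elim (simp add: zmon_def zpow_def)
qed

text \<open>The action on sections multiplies u by the inverse phase of a_j, and the monomial
  contributes the phase of a_j + b; the product has the phase of b, which is \<rho>.\<close>

lemma B_f:
 assumes m: "(\<Sum>h\<in>UNIV. m h *s k h) = a j + b"
 shows "B xb *v f j = of_real (2 * (\<Sum>l\<in>UNIV. \<kappa> l * of_int (\<epsilon> j l)) + 2 * idot (a j + b) (L vv)) *s f j"
proof -
 define u where "u = savg (\<lambda>\<theta>. cis (idot (a j) (L \<theta>))) (sec0 (tx *v f j))"
 note ca = character_cis[OF L, of "a j"]
 have u: "u \<in> sections M" unfolding u_def by (rule savg_section[OF ca sec0])
 have "cadj (lift M \<theta> xb) *v f j = cis (- idot (a j) (L \<theta>)) *s f j" for \<theta>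
 proof -
  have "cadj (lift M \<theta> xb) *v (lift M \<theta> xb *v f j) = f j"
   using equivariant unfolding equivariant_bundle_def unitary_def by (simp add: matrix_vector_mul_assoc)
  then have "cis (idot (a j) (L \<theta>)) *s (cadj (lift M \<theta> xb) *v f j) = f j" by (simp add: lift_f vector_smult_mv)
  then have "cis (- idot (a j) (L \<theta>)) *s (cis (idot (a j) (L \<theta>)) *s (cadj (lift M \<theta> xb) *v f j)) = cis (- idot (a j) (L \<theta>)) *s f j" by simp
  then show ?thesis by (simp add: vector_smult_assoc cis_mult)
 qed
 then have uf: "u xb = f j"
  unfolding u_def by (subst savg_fixed[OF fixed]) (simp_all add: sec0_xb t_inv vector_smult_assoc cis_mult)
 have u_act: "sec_act M \<eta> u x = cis (- idot (a j) (L \<eta>)) *s u x" for \<eta> x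
 proof -
  have "cis (idot (a j) (L \<eta>)) *s sec_act M \<eta> u x = u x" unfolding u_def by (rule sec_act_savg[OF ca sec0])
  then have "cis (- idot (a j) (L \<eta>)) *s (cis (idot (a j) (L \<eta>)) *s sec_act M \<eta> u x) = cis (- idot (a j) (L \<eta>)) *s u x" by simp
  then show ?thesis by (simp add: vector_smult_assoc cis_mult)
 qed
 have type: "(\<lambda>x. zmon m x *s u x) \<in> type_sections M \<rho>"
  unfolding type_sections_def
 proof (intro CollectI conjI allI ext)
  show "(\<lambda>x. zmon m x *s u x) \<in> sections M" by (rule section_smult[OF smooth_zmon u])
  fix \<eta> x
  have "sec_act M \<eta> (\<lambda>x. zmon m x *s u x) x = zmon m (ract M x \<eta>) *s sec_act M \<eta> u x"
   by (simp add: sec_act_eq vector_smult_mv)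
  also have "\<dots> = \<rho> \<eta> *s (zmon m x *s u x)"
   by (simp add: zmon_ract m u_act vector_smult_assoc \<rho> idot_add) (simp add: mult.commute mult.left_commute cis_mult flip: mult.assoc)
  finally show "sec_act M \<eta> (\<lambda>x. zmon m x *s u x) x = \<rho> \<eta> *s (zmon m x *s u x)" .
 qed
 have orb: "zmon m (ract M x (s *\<^sub>R vv)) = cis (s * idot (a j + b) (L vv)) * zmon m x" for x s
  by (simp add: zmon_ract m linear_scale[OF linear_L] idot_scaleR)
 from bundle_map_limit[OF smooth_zmon u B type orb zmon_nonzero]
 have "B xb *v u xb = anticomm D Z u xb + of_real (2 * idot (a j + b) (L vv)) *s u xb" .
 then show ?thesis by (simp only: D_Z_f[OF u uf] uf of_real_add vector_sadd_rdistrib)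
qed

end

section \<open>Singular points and the full operator\<close>

context tbun
begin

text \<open>Equivariance makes the finite set of singular points invariant, and an orbit of the
  torus is connected; a finite connected set is a single point.\<close>

lemma singular_point_fixed:
 assumes Z: "equivariant_endo M Z" "finite (singular_points Z)" and x: "x \<in> singular_points Z"
 shows "ract M x \<theta> = x"
proof -
 have inv: "ract M x \<theta> \<in> singular_points Z" for \<theta>
 proof (rule ccontr)
  assume "ract M x \<theta> \<notin> singular_points Z"
  then have i: "invertible (Z (ract M x \<theta>))" by (simp add: singular_points_def)
  have u: "cadj (lift M \<theta> x) ** lift M \<theta> x = mat 1" "lift M \<theta> x ** cadj (lift M \<theta> x) = mat 1"
   using equivariant unfolding equivariant_bundle_def unitary_def by blast+
  then have l: "invertible (lift M \<theta> x)" "invertible (cadj (lift M \<theta> x))" unfolding invertible_def by blast+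
  have "Z (ract M x \<theta>) ** lift M \<theta> x = lift M \<theta> x ** Z x" using Z(1) unfolding equivariant_endo_def by blast
  then have "cadj (lift M \<theta> x) ** (Z (ract M x \<theta>) ** lift M \<theta> x) = Z x"
   by (simp add: matrix_mul_assoc u)
  then have "invertible (Z x)" using invertible_mult[OF l(2) invertible_mult[OF i l(1)]] by simp
  then show False using x by (simp add: singular_points_def)
 qed
 have "continuous_on UNIV (ract M x)"
  by (rule continuous_on_compose2[OF continuous_ract, of _ "\<lambda>\<theta>. (x, \<theta>)", simplified]) (intro continuous_intros)
 then have "connected (range (ract M x))" by (rule connected_continuous_image) (rule connected_UNIV)
 moreover have "finite (range (ract M x))" by (rule finite_subset[OF _ Z(2)]) (use inv in blast)
 ultimately have "{x} \<inter> range (ract M x) = {} \<or> (range (ract M x) - {x}) \<inter> range (ract M x) = {}"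
  by (intro connected_closedD) (auto intro: finite_imp_closed)
 moreover have "x \<in> range (ract M x)" using ract_0[of x] by (metis rangeI)
 ultimately show ?thesis by blast
qed

text \<open>The projections onto the two graded parts are smooth because the grading is, and each
  half of the operator maps sections to sections.\<close>

lemma full_op_section:
 assumes Dp: "first_order_op M Dp" and Dm: "formal_adjoint M vol Dp Dm" and u: "u \<in> sections M"
 shows "full_op M Dp Dm u \<in> sections M"
proof -
 have g: "smooth_endo_on M UNIV (grading M)" "grading M x ** grading M x = mat 1" for x
  using grad unfolding graded_def by blast+
 have gg: "grading M x *v (grading M x *v w) = w" for x w by (simp add: matrix_vector_mul_assoc g)
 have gu: "(\<lambda>y. grading M y *v u y) \<in> sections M" by (rule section_endo[OF g(1) u])
 have "(\<lambda>y. (1/2) *\<^sub>R (u y + grading M y *v u y)) \<in> graded_sections M 1"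
  using section_scaleR[OF section_add[OF u gu], of "1/2"]
  by (simp add: graded_sections_def fibre_def mv_scaleR matrix_vector_right_distrib gg add.commute)
 moreover have "(\<lambda>y. (1/2) *\<^sub>R (u y - grading M y *v u y)) \<in> graded_sections M (-1)"
 proof -
  have "(\<lambda>y. (1/2) *\<^sub>R (u y + (- 1) *\<^sub>R (grading M y *v u y))) \<in> sections M"
   by (intro section_scaleR section_add u gu)
  then show ?thesis
   by (simp add: graded_sections_def fibre_def mv_scaleR matrix_vector_mult_diff_distrib gg) (simp add: vec_eq_iff algebra_simps)
 qed
 ultimately show ?thesis
  unfolding full_op_def[abs_def]
  by (intro section_add) (use Dp Dm in \<open>auto simp: first_order_op_def formal_adjoint_def graded_sections_def\<close>)
qed

end

theorem theorem3p8:
  fixes M :: "('m::t2_space, 'n::finite + 'n, 'p::finite, 'r::finite) tbundle"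
    and vol :: "'m measure"
    and Dp Dm D :: "('m \<Rightarrow> complex ^ 'r) \<Rightarrow> ('m \<Rightarrow> complex ^ 'r)"
    and Z :: "'m \<Rightarrow> complex ^ 'r ^ 'r"
    and U :: "'m \<Rightarrow> 'm set"
    and c :: "'m \<Rightarrow> 'm \<Rightarrow> real ^ ('n + 'n) \<Rightarrow> complex ^ 'r ^ 'r"
    and nab :: "'m \<Rightarrow> 'm \<Rightarrow> real ^ ('n + 'n) \<Rightarrow> ('m \<Rightarrow> complex ^ 'r) \<Rightarrow> complex ^ 'r"
    and v :: "'m \<Rightarrow> real ^ 'p"
    and \<rho> :: "real ^ 'p \<Rightarrow> complex"
    and xb :: 'm
    and L :: "real ^ 'p \<Rightarrow> real ^ 'p"
    and \<tau> :: "real ^ 'p" and b :: "int ^ 'p"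
    and \<chi>c :: "'m set \<times> ('m \<Rightarrow> real ^ ('n + 'n))"
    and k :: "'n \<Rightarrow> int ^ 'p" and \<kappa> :: "'n \<Rightarrow> real"
    and f :: "'r \<Rightarrow> complex ^ 'r" and a :: "'r \<Rightarrow> int ^ 'p"
    and \<epsilon> :: "'r \<Rightarrow> 'n \<Rightarrow> int"
    and K :: "(real ^ ('n + 'n) \<Rightarrow> complex ^ 'r) \<Rightarrow> (real ^ ('n + 'n) \<Rightarrow> complex ^ 'r)"
  defines "eig \<equiv> \<lambda>(m :: int ^ 'n) (d :: nat ^ 'n) j.
             2 * (\<Sum>l\<in>UNIV. \<kappa> l * real_of_int (\<bar>m $ l\<bar> + m $ l + 2 * int (d $ l) + 1 + \<epsilon> j l))"
    and "admissible \<equiv> \<lambda>(m :: int ^ 'n) j. (\<Sum>h\<in>UNIV. m $ h *s k h) = a j + b"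
    and "Kbar \<equiv> L2_closure (test_sections (\<lambda>\<theta>. rot k (L \<theta>)) (\<lambda>\<theta>. lift M \<theta> xb) \<rho>) K"
  assumes \<comment> \<open>manifold, bundle, operator\<close>
        "closed_oriented_riemannian M" and "riemannian_volume M vol" and "isometric_action M"
    and "hermitian_bundle M" and "graded M" and "equivariant_bundle M"
    and "first_order_op M Dp" and "equivariant_op M Dp" and "transversally_elliptic M Dp"
    and "formal_adjoint M vol Dp Dm" and "D = full_op M Dp Dm"
      \<comment> \<open>(1)\<close>
    and "\<forall>x. odd_at M x (Z x) \<and> cadj (Z x) = Z x" and "smooth_endo_on M UNIV Z"
    and "equivariant_endo M Z" and "finite (singular_points Z)"
      \<comment> \<open>(2)\<close>
    and "\<forall>\<sigma>. torus_irrep \<sigma> \<longrightarrow> (\<exists>B. restricts_to_bundle_map M (anticomm D Z) \<sigma> B)"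
      \<comment> \<open>(3)\<close>
    and "\<forall>x \<in> singular_points Z. dirac_near M D x (U x) (c x) (nab x)"
      \<comment> \<open>(4)\<close>
    and "\<forall>x \<in> singular_points Z. dense_one_parameter (v x) \<and>
           (\<forall>y \<in> U x. \<forall>w. Z y *v w = \<i> *s (c x y (orbit_field M (v x) y) *v w))"
      \<comment> \<open>the representation, the singular point, the torus coordinates\<close>
    and "torus_irrep \<rho>" and "xb \<in> singular_points Z"
    and "torus_coords L" and "\<tau> = L (v xb)" and "\<forall>p. \<tau> $ p > 0"
    and "\<forall>\<theta>. \<rho> \<theta> = cis (idot b (L \<theta>))"
      \<comment> \<open>geodesic normal coordinates in which the linearized action is diagonal\<close>
    and "normal_chart M xb \<chi>c"
    and "\<forall>\<theta> w. mdiff M (\<lambda>x. snd \<chi>c (ract M x \<theta>)) xb w = rot k (L \<theta>) (mdiff M (snd \<chi>c) xb w)"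
    and "\<forall>l. \<kappa> l = idot (k l) \<tau> \<and> \<kappa> l > 0"
      \<comment> \<open>the unitary basis of the fibre over the singular point\<close>
    and "\<forall>i j. cinner (f i) (f j) = (if i = j then 1 else 0)"
    and "\<forall>j \<theta>. lift M \<theta> xb *v f j = cis (idot (a j) (L \<theta>)) *s f j"
    and "\<forall>j. f j \<in> fibre M 1 xb \<union> fibre M (-1) xb"
    and "\<forall>j l. \<epsilon> j l \<in> {-1, 1} \<and>
           \<i> *s ((c xb xb (dvec M \<chi>c xb (axis (Inl l) 1)) ** c xb xb (dvec M \<chi>c xb (axis (Inr l) 1))) *v f j)
             = of_int (\<epsilon> j l) *s f j"
      \<comment> \<open>the model operator\<close>
    and "model_operator M D Z \<rho> xb \<chi>c K"
  shows "L2_spectrum (L2_type (\<lambda>\<theta>. rot k (L \<theta>)) (\<lambda>\<theta>. lift M \<theta> xb) \<rho>) Kbar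
           = {complex_of_real (eig m d j) | m d j. admissible m j}
       \<comment> \<open>a pair \<open>(m, d)\<close> is counted once for each basis index \<open>j\<close> that realizes it\<close>
       \<and> (\<forall>lam. complex_of_real lam \<in> L2_spectrum (L2_type (\<lambda>\<theta>. rot k (L \<theta>)) (\<lambda>\<theta>. lift M \<theta> xb) \<rho>) Kbar \<longrightarrow>
            finite {(m, d, j). admissible m j \<and> eig m d j = lam} \<and>
            has_multiplicity Kbar (complex_of_real lam)
              (card {(m, d, j). admissible m j \<and> eig m d j = lam}))"
proof -
 interpret tbun M using assms(4,6-9) by (simp add: tbun_def tbun_axioms_def rman_def)
 obtain t a2 a1 a0 B where t: "t \<in> trivs M" "xb \<in> fst t"
  and a2: "local_coeffs2 \<chi>c t (sections M) (\<lambda>u. D (D u)) a2 a1 a0"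
  and B: "restricts_to_bundle_map M (anticomm D Z) \<rho> B"
  and K: "K = (\<lambda>u y. (\<Sum>i\<in>UNIV. \<Sum>j\<in>UNIV.
      (cadj (snd t xb) ** a2 i j 0 ** snd t xb) *v pd (pd u (axis j 1)) (axis i 1) y)
     + B xb *v u y
     + (cadj (snd t xb)
      ** ((1/2) *\<^sub>R pd (pd (\<lambda>y. snd t (cinv \<chi>c y) ** (Z (cinv \<chi>c y) ** Z (cinv \<chi>c y))
                   ** cadj (snd t (cinv \<chi>c y))) y) y 0)
      ** snd t xb) *v u y)"
  using assms(35) unfolding model_operator_def by (elim bexE exE conjE)
 note dirac = bspec[OF assms(20,23)] and Zx = conjunct2[OF bspec[OF assms(21,23)]]
 have ch: "smooth_chart M \<chi>c" "xb \<in> fst \<chi>c" "snd \<chi>c xb = 0" using assms(28) unfolding normal_chart_def by blast+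
 have U: "open (U xb)" "xb \<in> U xb" using dirac unfolding dirac_near_def by blast+
 \<comment> \<open>The common domain of normal chart, trivialization and Dirac structure is a
   neighbourhood of 0 in coordinates; this supplies the radius r.\<close>
 have "open (snd \<chi>c ` (fst \<chi>c \<inter> (fst t \<inter> U xb)))"
  by (rule chart_open_image[OF smooth_chartD[OF ch(1)] open_Int[OF triv_open[OF t(1)] U(1)]])
 moreover have "0 \<in> snd \<chi>c ` (fst \<chi>c \<inter> (fst t \<inter> U xb))"
  by (rule image_eqI[of _ _ xb]) (simp_all add: ch t U)
 ultimately obtain r where r: "r > 0" "cball 0 r \<subseteq> snd \<chi>c ` (fst \<chi>c \<inter> (fst t \<inter> U xb))"
  unfolding open_contains_cball by blast
 have "\<epsilon> j l \<in> {-1, 1}" for j l using assms(34) by blast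
 then have "\<epsilon> j l \<ge> -1" for j l by (smt (verit) insert_iff empty_iff)
 have eps: "\<i> *s ((c xb xb (dvec M \<chi>c xb (axis (Inl l) 1)) ** c xb xb (dvec M \<chi>c xb (axis (Inr l) 1))) *v f j)
      = of_int (\<epsilon> j l) *s f j" for j l
  using assms(34) by blast
 \<comment> \<open>The geometric layer, which evaluates the three ingredients of \<open>K\<close> at
   the singular point.\<close>
 interpret pt: model_pt M D "U xb" "c xb" "nab xb" xb \<chi>c t r Z "v xb" k L \<kappa> f a b \<epsilon> \<rho> B
 proof
  show "D u \<in> sections M" if "u \<in> sections M" for u
   unfolding assms(14) by (rule full_op_section[OF assms(10,13) that])
  show "dirac_near M D xb (U xb) (c xb) (nab xb)" by (rule dirac)
  show "normal_chart M xb \<chi>c" by (rule assms(28))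
  show "t \<in> trivs M" "xb \<in> fst t" by (rule t)+
  show "0 < r" "cball 0 r \<subseteq> snd \<chi>c ` (fst \<chi>c \<inter> (fst t \<inter> U xb))" by (rule r)+
  show "smooth_endo_on M UNIV Z" by (rule assms(16))
  show "Z x *v w = \<i> *s (c xb x (orbit_field M (v xb) x) *v w)" if "x \<in> U xb" for x w
   using Zx that by simp
  show "ract M xb \<theta> = xb" for \<theta> by (rule singular_point_fixed[OF assms(17,18,23)])
  show "mdiff M (\<lambda>x. snd \<chi>c (ract M x \<theta>)) xb w = rot k (L \<theta>) (mdiff M (snd \<chi>c) xb w)" for \<theta> w
   using assms(29) by simp
  show "torus_coords L" by (rule assms(24))
  show "\<kappa> l = idot (k l) (L (v xb))" for l using assms(30) by (simp add: assms(25))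
  show "lift M \<theta> xb *v f j = cis (idot (a j) (L \<theta>)) *s f j" for j \<theta> using assms(32) by simp
  show "\<i> *s ((c xb xb (dvec M \<chi>c xb (axis (Inl l) 1)) ** c xb xb (dvec M \<chi>c xb (axis (Inr l) 1))) *v f j)
      = of_int (\<epsilon> j l) *s f j" for j l by (rule eps)
  show "\<rho> \<theta> = cis (idot b (L \<theta>))" for \<theta> using assms(27) by simp
  show "restricts_to_bundle_map M (anticomm D Z) \<rho> B" by (rule B)
 qed
 \<comment> \<open>The analytic layer receives \<open>K\<close> in Euclidean form: minus the
   Laplacian, the constant \<open>B xb\<close>, and the potential |X' y|^2 = \<Sum> \<kappa>_l^2
   |z_l|^2.\<close>
 interpret md: model \<kappa> k L \<tau> a b \<epsilon> f "\<lambda>\<theta>. lift M \<theta> xb" \<rho> "B xb" K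
 proof
  show "0 < \<kappa> l" "\<kappa> l = idot (k l) \<tau>" for l using assms(30) by blast+
  show "L (\<theta> + \<eta>) = L \<theta> + L \<eta>" "L (s *\<^sub>R \<theta>) = s *\<^sub>R L \<theta>" for \<theta> \<eta> s
   by (simp_all add: linear_add[OF pt.linear_L] linear_scale[OF pt.linear_L])
  show "surj L" by (rule torus_coords_surj[OF assms(24)])
  show "- 1 \<le> \<epsilon> j l" for j l by fact
  show "cinner (f i) (f j) = (if i = j then 1 else 0)" for i j using assms(31) by simp
  show "lift M \<theta> xb *v f j = cis (idot (a j) (L \<theta>)) *s f j" for \<theta> j by (rule pt.lift_f)
  show "\<rho> \<theta> = cis (idot b (L \<theta>))" for \<theta> by (rule pt.\<rho>)
  show "B xb *v f j = of_real (2 * (\<Sum>l\<in>UNIV. \<kappa> l * of_int (\<epsilon> j l)) + 2 * idot (a j + b) \<tau>) *s f j"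
   if "(\<Sum>h\<in>UNIV. m h *s k h) = a j + b" for j m
   unfolding assms(25) by (rule pt.B_f[OF that])
  show "K u y = - (\<Sum>i\<in>UNIV. pd (pd u (axis i 1)) (axis i 1) y) + B xb *v u y
    + of_real (\<Sum>l\<in>UNIV. (\<kappa> l)\<^sup>2 * (cmod (zc y l))\<^sup>2) *s u y" if "smooth_on UNIV u" for u y
   unfolding K pt.second_order_part[OF a2 that] pt.hessian_Z pt.norm_X' ..
 qed
 have "md.eig = eig" by (intro ext) (simp add: md.eig_def eig_def)
 moreover have "md.admissible = admissible" by (intro ext) (simp add: md.admissible_def admissible_def)
 ultimately show ?thesis using md.model_spectrum unfolding Kbar_def by simp
qed

end
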